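(* Let $\ell,h_0,\mathtt g>0$ and let $b$ be a smooth function on $[0,\ell]$ such that, with $h_b=h_0-b$, $$\inf_{(0,\ell)} h_b>0\qquad\text{and}\qquad \inf_{(0,\ell)}\Big(1+\tfrac14(\partial_x b)^2+\tfrac16 h_b\,\partial_x^2 b\Big)>0 .$$ Let $\mathcal U\subset\mathbb R^2$ be a non-empty connected open set with $(0,0)\in\mathcal U$, let $\xi_0^+,\xi_\ell^-:\mathcal U\to\mathbb R$ be smooth (the input functions), let $\xi_0^-,\xi_\ell^+:\mathcal U\to\mathbb R$ be two further functions (the output functions), let $\mathcal V_0,\mathcal V_\ell\subset\mathbb R^2$ be open sets containing respectively the ranges of the maps $\mathcal U\ni(\zeta,q)\mapsto(\xi_0^+(\zeta,q),\xi_0^-(\zeta,q))$ and $\mathcal U\ni(\zeta,q)\mapsto(\xi_\ell^+(\zeta,q),\xi_\ell^-(\zeta,q))$, and let $\mathcal H_0=(\mathcal H_{0,1},\mathcal H_{0,2})^{\rm T}:\mathcal V_0\to\mathbb R^2$ and $\mathcal H_\ell=(\mathcal H_{\ell,1},\mathcal H_{\ell,2})^{\rm T}:\mathcal V_\ell\to\mathbb R^2$ be smooth mappings (the reconstruction mappings) such that for all $(\zeta,q)\in\mathcal U$, $$\mathcal H_0(\xi_0^+(\zeta,q),\xi_0^-(\zeta,q))=(\zeta,q)^{\rm T}\quad\text{and}\quad \mathcal H_\ell(\xi_\ell^+(\zeta,q),\xi_\ell^-(\zeta,q))=(\zeta,q)^{\rm T}.$$ Assume moreover that: (A1) either $\partial_2\mathcal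 H_{0,1}\equiv0$ and $\partial_2\mathcal H_{0,2}$ does not vanish on $\mathcal V_0$, or $\partial_2\mathcal H_{0,1}$ does not vanish on $\mathcal V_0$; (A2) either $\partial_1\mathcal H_{\ell,1}\equiv0$ and $\partial_1\mathcal H_{\ell,2}$ does not vanish on $\mathcal V_\ell$, or $\partial_1\mathcal H_{\ell,1}$ does not vanish on $\mathcal V_\ell$; (A3) if $\partial_1\mathcal H_{0,1}$ vanishes at some point of $\mathcal V_0$, then $\xi_0^+(\zeta,q)$ depends only on $q$ on $\mathcal U$; (A4) if $\partial_2\mathcal H_{\ell,1}$ vanishes at some point of $\mathcal V_\ell$, then $\xi_\ell^-(\zeta,q)$ depends only on $q$ on $\mathcal U$. Let $g_0,g_\ell\in C^\infty(\mathbb R^+)$. Let $n\in\mathbb N\setminus\{0\}$ and let $(\zeta^{\rm in},q^{\rm in})\in H^n(0,\ell)\times H^{n+1}(0,\ell)$ be such that $\inf_{[0,\ell]}(h_0-b+\zeta^{\rm in})>0$, with boundary values $(\zeta^{\rm in}(0),q^{\rm in}(0))$ and $(\zeta^{\rm in}(\ell),q^{\rm in}(\ell))$ in $\mathcal U$, and assume the compatibility condition $$\xi_0^+(\zeta^{\rm in}(0),q^{\rm in}(0))=g_0(0)\quad\text{and}\quad \xi_\ell^-(\zeta^{\rm in}(\ell),q^{\rm in}(\ell))=g_\ell(0).$$ If $\partial_2\mathcal H_{0,1}\equiv0$, assume also that $$0=-\partial_xq^{\rm in}(0)-\partial_1\mathcal H_{0,1}\big(g_0(0),\xi_0^-(\zeta^{\rm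 in}(0),q^{\rm in}(0))\big)\,\dot g_0(0);$$ if $\partial_1\mathcal H_{\ell,1}\equiv0$, assume also that $$0=-\partial_xq^{\rm in}(\ell)-\partial_2\mathcal H_{\ell,1}\big(\xi_\ell^+(\zeta^{\rm in}(\ell),q^{\rm in}(\ell)),g_\ell(0)\big)\,\dot g_\ell(0).$$ Then there exist a maximal existence time $T^*>0$ and a unique solution $(\zeta,q)\in C^\infty([0,T^* );H^n(0,\ell)\times H^{n+1}(0,\ell))$ to the Boussinesq-Abbott system $$\begin{cases}\partial_t\zeta+\partial_xq=0,\\ (1+h_b\mathcal T_b)\partial_tq+\partial_xf_{\rm NSW}(\zeta,q)=-\mathtt g\,h\,\partial_xb\end{cases}\qquad\text{in }(0,\ell),$$ with initial condition $(\zeta,q)(0,\cdot)=(\zeta^{\rm in},q^{\rm in})$ and boundary conditions $$\xi_0^+(\zeta(t,0),q(t,0))=g_0(t),\qquad \xi_\ell^-(\zeta(t,\ell),q(t,\ell))=g_\ell(t);$$ moreover, for all $t\in(0,T^* )$, one has $\inf_{[0,\ell]}(h_0-b+\zeta(t,\cdot))>0$.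
   Context: The constants are $\ell>0$ (length of the interval), $h_0>0$ (characteristic depth), $\mathtt g>0$ (gravity). The unknowns are $\zeta(t,x)$ (surface elevation) and $q(t,x)$ (horizontal discharge), and $h=h_0+\zeta-b$ is the water depth, $h_b=h_0-b$ the depth at rest. The shallow water flux is $$f_{\rm NSW}(\zeta,q)=\tfrac12\mathtt g(h^2-h_0^2)+\tfrac1h q^2 .$$ The operator $\mathcal T_b$ is $$\mathcal T_b u=-\frac1{3h_b}\partial_x\Big(h_b^3\,\partial_x\frac{u}{h_b}\Big)+\frac12(\partial_x^2b)\,u .$$ $\partial_1,\partial_2$ denote partial derivatives of a function of two variables with respect to its first and second variable; a dot denotes the time derivative. The arguments of both $\mathcal H_0$ and $\mathcal H_\ell$ are ordered as $(\xi^+,\xi^-)$. $H^k(0,\ell)$ is the usual $L^2$-based Sobolev space.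
   Formalization: The output functions ξ_0^- and ξ_ℓ^+ are assumed continuous on U; for arbitrary discontinuous output functions (with disconnected V_0) the claim fails, since the second compatibility condition can contradict the boundary condition. *)

theory Defs
  imports "HOL-Analysis.Analysis"
begin

text \<open>Differentiability is taken within \<open>S\<close>.  The definition is used for open sets \<open>S\<close>, and for the
  real intervals \<open>{0..l}\<close> and \<open>{0..}\<close>, where it means smoothness up to the boundary (one-sided
  derivatives at the end points).\<close>

primrec Ck_on :: "nat \<Rightarrow> ('a::real_normed_vector \<Rightarrow> 'b::real_normed_vector) \<Rightarrow> 'a set \<Rightarrow> bool" where
  "Ck_on 0 f S \<longleftrightarrow> continuous_on S f"
| "Ck_on (Suc k) f S \<longleftrightarrow>
     (\<forall>x\<in>S. f differentiable (at x within S)) \<and>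
     (\<forall>v. Ck_on k (\<lambda>x. frechet_derivative f (at x within S) v) S)"

definition smooth_on :: "('a::real_normed_vector \<Rightarrow> 'b::real_normed_vector) \<Rightarrow> 'a set \<Rightarrow> bool" where
  "smooth_on f S \<longleftrightarrow> (\<forall>k. Ck_on k f S)"

definition partial1 :: "(real \<times> real \<Rightarrow> real) \<Rightarrow> real \<times> real \<Rightarrow> real" where
  "partial1 F p = deriv (\<lambda>s. F (s, snd p)) (fst p)"

definition partial2 :: "(real \<times> real \<Rightarrow> real) \<Rightarrow> real \<times> real \<Rightarrow> real" where
  "partial2 F p = deriv (\<lambda>s. F (fst p, s)) (snd p)"

subsection \<open>Sobolev spaces on \<open>(0, l)\<close>\<close>

definition test_function :: "real \<Rightarrow> (real \<Rightarrow> real) \<Rightarrow> bool" where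
  "test_function l \<phi> \<longleftrightarrow>
     smooth_on \<phi> UNIV \<and> (\<exists>c d. 0 < c \<and> d < l \<and> (\<forall>x. x \<notin> {c..d} \<longrightarrow> \<phi> x = 0))"

definition locally_integrable :: "real \<Rightarrow> (real \<Rightarrow> real) \<Rightarrow> bool" where
  "locally_integrable l u \<longleftrightarrow> (\<forall>c d. 0 < c \<and> d < l \<longrightarrow> set_integrable lebesgue {c..d} u)"

definition has_weak_deriv :: "real \<Rightarrow> nat \<Rightarrow> (real \<Rightarrow> real) \<Rightarrow> (real \<Rightarrow> real) \<Rightarrow> bool" where
  "has_weak_deriv l j u v \<longleftrightarrow>
     locally_integrable l u \<and> locally_integrable l v \<and>
     (\<forall>\<phi>. test_function l \<phi> \<longrightarrow>
        (LINT x:{0<..<l}|lebesgue. u x * (deriv ^^ j) \<phi> x) =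
        (-1) ^ j * (LINT x:{0<..<l}|lebesgue. v x * \<phi> x))"

text \<open>Only meaningful up to null sets, and only if a weak derivative exists.\<close>

definition weak_deriv :: "real \<Rightarrow> nat \<Rightarrow> (real \<Rightarrow> real) \<Rightarrow> real \<Rightarrow> real" where
  "weak_deriv l j u = (SOME v. has_weak_deriv l j u v)"

definition square_integrable :: "real \<Rightarrow> (real \<Rightarrow> real) \<Rightarrow> bool" where
  "square_integrable l u \<longleftrightarrow>
     u \<in> borel_measurable (lebesgue_on {0<..<l}) \<and>
     integrable (lebesgue_on {0<..<l}) (\<lambda>x. (u x)\<^sup>2)"

definition sobolev :: "nat \<Rightarrow> real \<Rightarrow> (real \<Rightarrow> real) set" where
  "sobolev k l = {u. square_integrable l u \<and>
     (\<forall>j\<le>k. \<exists>v. has_weak_deriv l j u v \<and> square_integrable l v)}"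

definition sobolev_norm :: "nat \<Rightarrow> real \<Rightarrow> (real \<Rightarrow> real) \<Rightarrow> real" where
  "sobolev_norm k l u =
     sqrt (\<Sum>j\<le>k. integral\<^sup>L (lebesgue_on {0<..<l}) (\<lambda>x. (weak_deriv l j u x)\<^sup>2))"

text \<open>For \<open>k \<ge> 1\<close> every class in \<open>H\<^sup>k(0,l)\<close> has exactly one representative that is continuous on
  \<open>[0,l]\<close>.  Elements of \<open>H\<^sup>k(0,l)\<close> are represented by it, so that boundary values make sense;
  values outside \<open>[0,l]\<close> are irrelevant.\<close>

definition sobolev_cont :: "nat \<Rightarrow> real \<Rightarrow> (real \<Rightarrow> real) set" where
  "sobolev_cont k l = {u \<in> sobolev k l. continuous_on {0..l} u}"

subsection \<open>Smooth functions of time with values in \<open>H\<^sup>k(0,l)\<close>\<close>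

text \<open>\<open>v\<close> is the derivative at time \<open>t\<close>, in the norm of \<open>H\<^sup>k(0,l)\<close>, of the map
  \<open>u : J \<rightarrow> H\<^sup>k(0,l)\<close>.  It is determined on \<open>[0,l]\<close> if \<open>k \<ge> 1\<close>.\<close>

definition has_time_deriv ::
  "nat \<Rightarrow> real \<Rightarrow> real set \<Rightarrow> (real \<Rightarrow> real \<Rightarrow> real) \<Rightarrow> (real \<Rightarrow> real) \<Rightarrow> real \<Rightarrow> bool" where
  "has_time_deriv k l J u v t \<longleftrightarrow>
     (\<forall>s\<in>J. u s \<in> sobolev_cont k l) \<and> v \<in> sobolev_cont k l \<and>
     ((\<lambda>s. sobolev_norm k l (\<lambda>x. (u s x - u t x) / (s - t) - v x)) \<longlongrightarrow> 0) (at t within J)"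

definition time_deriv ::
  "nat \<Rightarrow> real \<Rightarrow> real set \<Rightarrow> (real \<Rightarrow> real \<Rightarrow> real) \<Rightarrow> real \<Rightarrow> real \<Rightarrow> real" where
  "time_deriv k l J u t = (SOME v. has_time_deriv k l J u v t)"

definition smooth_in_time :: "nat \<Rightarrow> real \<Rightarrow> real set \<Rightarrow> (real \<Rightarrow> real \<Rightarrow> real) \<Rightarrow> bool" where
  "smooth_in_time k l J u \<longleftrightarrow>
     (\<forall>j. \<forall>t\<in>J. \<exists>v. has_time_deriv k l J ((time_deriv k l J ^^ j) u) v t)"

subsection \<open>The Boussinesq-Abbott system\<close>

definition f_NSW :: "real \<Rightarrow> real \<Rightarrow> (real \<Rightarrow> real) \<Rightarrow> (real \<Rightarrow> real) \<Rightarrow> (real \<Rightarrow> real) \<Rightarrow> real \<Rightarrow> real" where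
  "f_NSW g h0 b \<zeta> q x =
     (let h = h0 + \<zeta> x - b x in 1/2 * g * (h\<^sup>2 - h0\<^sup>2) + 1/h * (q x)\<^sup>2)"

definition T_op :: "real \<Rightarrow> real \<Rightarrow> (real \<Rightarrow> real) \<Rightarrow> (real \<Rightarrow> real) \<Rightarrow> real \<Rightarrow> real" where
  "T_op l h0 b u x =
     (let hb = (\<lambda>y. h0 - b y) in
      - (1 / (3 * hb x)) * weak_deriv l 1 (\<lambda>y. hb y ^ 3 * weak_deriv l 1 (\<lambda>z. u z / hb z) y) x
      + 1/2 * deriv (deriv b) x * u x)"

definition time_interval :: "ereal \<Rightarrow> real set" where
  "time_interval T = {t. 0 \<le> t \<and> ereal t < T}"

text \<open>Solutions on \<open>[0,T)\<close>, with \<open>T\<close> possibly infinite.  The clause \<open>h \<noteq> 0\<close> gives a meaning to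
  \<open>1/h\<close> in the flux, and the two clauses on \<open>U\<close> give a meaning to the boundary conditions, as
  \<open>\<xi>0p\<close> and \<open>\<xi>lm\<close> are only given on \<open>U\<close>.  The equations are equalities in \<open>L\<^sup>2(0,l)\<close>.\<close>

definition BA_solution ::
  "nat \<Rightarrow> real \<Rightarrow> real \<Rightarrow> real \<Rightarrow> (real \<Rightarrow> real) \<Rightarrow> (real \<times> real) set \<Rightarrow>
   (real \<times> real \<Rightarrow> real) \<Rightarrow> (real \<times> real \<Rightarrow> real) \<Rightarrow> (real \<Rightarrow> real) \<Rightarrow> (real \<Rightarrow> real) \<Rightarrow>
   (real \<Rightarrow> real) \<Rightarrow> (real \<Rightarrow> real) \<Rightarrow> ereal \<Rightarrow>
   (real \<Rightarrow> real \<Rightarrow> real) \<Rightarrow> (real \<Rightarrow> real \<Rightarrow> real) \<Rightarrow> bool" where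
  "BA_solution n l h0 g b U \<xi>0p \<xi>lm g0 gl \<zeta>in qin T \<zeta> q \<longleftrightarrow>
     (let J = time_interval T in
      smooth_in_time n l J \<zeta> \<and> smooth_in_time (n + 1) l J q \<and>
      (\<forall>t\<in>J. \<forall>x\<in>{0..l}. h0 + \<zeta> t x - b x \<noteq> 0) \<and>
      (\<forall>t\<in>J. (\<zeta> t 0, q t 0) \<in> U \<and> (\<zeta> t l, q t l) \<in> U) \<and>
      (\<forall>t\<in>J. AE x in lebesgue_on {0<..<l}.
         time_deriv n l J \<zeta> t x + weak_deriv l 1 (q t) x = 0) \<and>
      (\<forall>t\<in>J. AE x in lebesgue_on {0<..<l}.
         time_deriv (n + 1) l J q t x
           + (h0 - b x) * T_op l h0 b (time_deriv (n + 1) l J q t) x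
           + weak_deriv l 1 (f_NSW g h0 b (\<zeta> t) (q t)) x
         = - g * (h0 + \<zeta> t x - b x) * deriv b x) \<and>
      (\<forall>x\<in>{0..l}. \<zeta> 0 x = \<zeta>in x \<and> q 0 x = qin x) \<and>
      (\<forall>t\<in>J. \<xi>0p (\<zeta> t 0, q t 0) = g0 t \<and> \<xi>lm (\<zeta> t l, q t l) = gl t))"

end

theory Submission
  imports Defs
begin

text \<open>With \<open>w = \<partial>\<^sub>x q\<close> and \<open>p = h\<^sub>b \<partial>\<^sub>x u - 3 f / h\<^sub>b\<close> for \<open>u = \<partial>\<^sub>t q\<close>, the momentum equation is a
  first order linear system for \<open>(u, p)\<close> in \<open>x\<close> that contains no derivative of the flux \<open>f\<close>.  By (A1) and
  (A2), each boundary condition, differentiated once or twice in time, prescribes \<open>u\<close> or \<open>\<partial>\<^sub>x u\<close> at its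
  end point, and the two compatibility conditions are the constants of integration.  The coercivity
  hypothesis makes this two-point problem uniquely solvable, so that
  \<open>\<partial>\<^sub>t \<zeta> = - w\<close>, \<open>\<partial>\<^sub>t w = \<partial>\<^sub>x u\<close>, \<open>\<partial>\<^sub>t q = u\<close> is an ordinary differential equation for continuous
  functions, with a locally Lipschitz right-hand side: this gives local existence, uniqueness and
  smoothness in time.  Higher regularity in \<open>x\<close> persists because the formally differentiated equation is
  linear in the highest derivatives, with coefficients of lower order, and Gronwall's inequality
  identifies its solution with the derivative.  The maximal time is the supremum of the existence
  times of all solutions.\<close>

text \<open>Read as an equation for zeta and q alone, the first line of the system loses a
  derivative, since it takes \<open>\<partial>\<^sub>x q\<close>. With w as a third unknown nothing
  is lost: the elliptic problem returns u together with \<open>\<partial>\<^sub>x u\<close>, equal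
  to p / h_b + 3 f / h_b^2, as continuous functions of x even when zeta, w, q are merely continuous.
  That w stays the x-derivative of q is then inherited from the data. The obstacle is the top order:
  the highest derivative of data in H^n is only square integrable and does not fit into a space of
  continuous functions. But \<open>\<partial>\<^sub>t w\<close> depends on zeta in two ways only:
  locally, through f at the same point, and through the nonlocal p, which is smoother by one
  derivative and enters as a known term. Sobolev norms appear only when results are translated back.
  Until then a weak derivative is always a density of an absolutely continuous function, so that
  integration takes the place of differentiation. Estimates live on closed time intervals; half-open
  ones are reached because time derivatives are local.\<close>

section \<open>Primitives of integrable functions\<close>

text \<open>u is absolutely continuous on [0,l] and v is a density of it, determined only up to null
  sets. This relation plays the part of the weak derivative throughout; a pointwise derivative is
  read off only when v is continuous.\<close>

definition primitive :: "real \<Rightarrow> (real \<Rightarrow> real) \<Rightarrow> (real \<Rightarrow> real) \<Rightarrow> bool" where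
  "primitive l u v \<longleftrightarrow>
     v absolutely_integrable_on {0..l} \<and> (\<forall>x\<in>{0..l}. u x = u 0 + integral {0..x} v)"

lemma primitive_integrable: "primitive l u v \<Longrightarrow> v absolutely_integrable_on {0..l}"
  and primitive_eq: "primitive l u v \<Longrightarrow> x \<in> {0..l} \<Longrightarrow> u x = u 0 + integral {0..x} v"
  unfolding primitive_def by blast+

lemma primitiveI:
  "v absolutely_integrable_on {0..l} \<Longrightarrow> (\<And>x. x \<in> {0..l} \<Longrightarrow> u x = u 0 + integral {0..x} v)
    \<Longrightarrow> primitive l u v"
  unfolding primitive_def by blast

lemma abs_integral_le:
  fixes v :: "real \<Rightarrow> real"
  assumes "v absolutely_integrable_on S"
  shows "\<bar>integral S v\<bar> \<le> integral S (\<lambda>y. \<bar>v y\<bar>)"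
  using integral_norm_bound_integral[of v S "\<lambda>y. \<bar>v y\<bar>"] assms
  by (simp add: absolutely_integrable_on_def)

lemma absolutely_integrable_initial:
  fixes v :: "real \<Rightarrow> real"
  assumes "v absolutely_integrable_on {0..l}" "x \<le> l"
  shows "v absolutely_integrable_on {0..x}" "v integrable_on {0..x}"
proof -
  show "v absolutely_integrable_on {0..x}"
    using assms set_integrable_subset[of lebesgue "{0..l}" v "{0..x}"] by auto
  then show "v integrable_on {0..x}" by (simp add: absolutely_integrable_on_def)
qed

lemma integral_initial_abs_le:
  fixes v :: "real \<Rightarrow> real"
  assumes "v absolutely_integrable_on {0..l}" "x \<le> l"
  shows "\<bar>integral {0..x} v\<bar> \<le> integral {0..l} (\<lambda>y. \<bar>v y\<bar>)"
proof -
  have a: "v absolutely_integrable_on {0..x}" using absolutely_integrable_initial(1)[OF assms] .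
  have "\<bar>integral {0..x} v\<bar> \<le> integral {0..x} (\<lambda>y. \<bar>v y\<bar>)"
    by (rule abs_integral_le[OF a])
  also have "\<dots> \<le> integral {0..l} (\<lambda>y. \<bar>v y\<bar>)"
    using a assms by (intro integral_subset_le) (auto simp: absolutely_integrable_on_def)
  finally show ?thesis .
qed

lemma absolutely_integrable_continuous_mult:
  fixes v a :: "real \<Rightarrow> real"
  assumes "v absolutely_integrable_on {0..l}" "continuous_on {0..l} a"
  shows "(\<lambda>x. a x * v x) absolutely_integrable_on {0..l}"
  using assms
  by (intro absolutely_integrable_bounded_measurable_product_real)
     (auto intro: continuous_imp_measurable_on_sets_lebesgue compact_imp_bounded compact_continuous_image)

lemma continuous_absolutely_integrable:
  fixes a :: "real \<Rightarrow> real"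
  assumes "continuous_on {0..l} a"
  shows "a absolutely_integrable_on {0..l}"
  using absolutely_integrable_continuous_real[OF assms] .

lemma primitive_continuous:
  assumes "primitive l u v"
  shows "continuous_on {0..l} u"
proof -
  have "continuous_on {0..l} (\<lambda>x. u 0 + integral {0..x} v)"
    using indefinite_integral_continuous_1[of v 0 l] primitive_integrable[OF assms]
    by (intro continuous_on_add continuous_on_const) (simp add: absolutely_integrable_on_def)
  moreover have "u x = u 0 + integral {0..x} v" if "x \<in> {0..l}" for x
    using primitive_eq[OF assms that] .
  ultimately show ?thesis by (subst continuous_on_cong[OF refl]) assumption+
qed

lemma primitive_cong:
  assumes "\<And>x. x \<in> {0..l} \<Longrightarrow> u x = u' x" "\<And>x. x \<in> {0..l} \<Longrightarrow> v x = v' x" "0 \<le> l"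
  shows "primitive l u v \<longleftrightarrow> primitive l u' v'"
proof -
  have "integral {0..x} v = integral {0..x} v'" if "x \<in> {0..l}" for x
    using that assms by (intro integral_cong) auto
  moreover have "v absolutely_integrable_on {0..l} \<longleftrightarrow> v' absolutely_integrable_on {0..l}"
    using assms by (intro set_integrable_cong) auto
  moreover have "u 0 = u' 0" if "x \<in> {0..l}" for x using assms that by simp
  ultimately show ?thesis unfolding primitive_def by (smt (verit) assms(1))
qed

lemma primitive_const: "primitive l (\<lambda>x. k) (\<lambda>x. 0)"
  unfolding primitive_def by simp

lemma primitive_add:
  assumes "primitive l u v" "primitive l u' v'"
  shows "primitive l (\<lambda>x. u x + u' x) (\<lambda>x. v x + v' x)"
proof (rule primitiveI)
  show "(\<lambda>x. v x + v' x) absolutely_integrable_on {0..l}"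
    using assms[THEN primitive_integrable] by (rule set_integral_add)
  fix x assume x: "x \<in> {0..l}"
  have "integral {0..x} (\<lambda>x. v x + v' x) = integral {0..x} v + integral {0..x} v'"
    using x by (intro integral_add absolutely_integrable_initial(2)[OF assms(1)[THEN primitive_integrable]]
        absolutely_integrable_initial(2)[OF assms(2)[THEN primitive_integrable]]) auto
  moreover have "u x = u 0 + integral {0..x} v" "u' x = u' 0 + integral {0..x} v'"
    using primitive_eq[OF assms(1) x] primitive_eq[OF assms(2) x] .
  ultimately show "u x + u' x = u 0 + u' 0 + integral {0..x} (\<lambda>x. v x + v' x)"
    by simp
qed

lemma primitive_cmult:
  assumes "primitive l u v"
  shows "primitive l (\<lambda>x. k * u x) (\<lambda>x. k * v x)"
proof (rule primitiveI)
  show "(\<lambda>x. k * v x) absolutely_integrable_on {0..l}"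
    using primitive_integrable[OF assms] by simp
  fix x assume x: "x \<in> {0..l}"
  have "integral {0..x} (\<lambda>x. k * v x) = k * integral {0..x} v" by simp
  moreover have "u x = u 0 + integral {0..x} v"
    using primitive_eq[OF assms x] .
  ultimately show "k * u x = k * u 0 + integral {0..x} (\<lambda>x. k * v x)"
    by (simp add: algebra_simps)
qed

lemma primitive_diff:
  assumes "primitive l u v" "primitive l u' v'"
  shows "primitive l (\<lambda>x. u x - u' x) (\<lambda>x. v x - v' x)"
  using primitive_add[OF assms(1) primitive_cmult[OF assms(2), of "-1"]] by simp

lemma primitive_integral:
  assumes "v absolutely_integrable_on {0..l}"
  shows "primitive l (\<lambda>x. k + integral {0..x} v) v"
  using assms by (intro primitiveI) auto

lemma primitive_C1:
  assumes "\<And>x. x \<in> {0..l} \<Longrightarrow> (u has_real_derivative v x) (at x within {0..l})"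
    and "continuous_on {0..l} v"
  shows "primitive l u v"
proof (rule primitiveI)
  show "v absolutely_integrable_on {0..l}" using continuous_absolutely_integrable[OF assms(2)] .
  fix x assume x: "x \<in> {0..l}"
  have "(v has_integral (u x - u 0)) {0..x}"
  proof (rule fundamental_theorem_of_calculus)
    fix y assume "y \<in> {0..x}"
    then have "(u has_real_derivative v y) (at y within {0..x})"
      using x DERIV_subset[OF assms(1), of y "{0..x}"] by auto
    then show "(u has_vector_derivative v y) (at y within {0..x})"
      by (simp add: has_real_derivative_iff_has_vector_derivative)
  qed (use x in auto)
  then show "u x = u 0 + integral {0..x} v" by (simp add: integral_unique)
qed

lemma primitive_has_derivative:
  assumes "primitive l u v" "continuous_on {0..l} v" "x \<in> {0..l}"
  shows "(u has_real_derivative v x) (at x within {0..l})"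
proof -
  have "((\<lambda>x. integral {0..x} v) has_real_derivative v x) (at x within {0..l})"
    using integral_has_real_derivative[OF assms(2,3)] .
  then have d: "((\<lambda>x. u 0 + integral {0..x} v) has_real_derivative v x) (at x within {0..l})"
    using DERIV_add[OF DERIV_const] by fastforce
  show ?thesis
    by (rule has_field_derivative_transform_within[OF d zero_less_one assms(3)])
       (use primitive_eq[OF assms(1)] in metis)
qed

lemma set_integrable_lebesgue_measurable:
  fixes f :: "real \<Rightarrow> real"
  assumes "f absolutely_integrable_on {a..b}"
  shows "f \<in> borel_measurable (lebesgue_on {a..b})"
  using assms absolutely_integrable_measurable[of "{a..b}" f] by simp

lemma absolutely_integrable_abs_diff:
  fixes f g :: "real \<Rightarrow> real"
  assumes "f absolutely_integrable_on S" "g absolutely_integrable_on S"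
  shows "(\<lambda>x. \<bar>f x - g x\<bar>) absolutely_integrable_on S" "(\<lambda>x. \<bar>f x - g x\<bar>) integrable_on S"
proof -
  show "(\<lambda>x. \<bar>f x - g x\<bar>) absolutely_integrable_on S"
    using absolutely_integrable_norm[OF set_integral_diff(1)[OF assms]] by (simp add: o_def)
  then show "(\<lambda>x. \<bar>f x - g x\<bar>) integrable_on S" by (simp add: absolutely_integrable_on_def)
qed

lemma continuous_on_compact_bound_abs:
  fixes u :: "'a::topological_space \<Rightarrow> real"
  assumes "continuous_on S u" "compact S"
  obtains M where "0 \<le> M" "\<And>x. x \<in> S \<Longrightarrow> \<bar>u x\<bar> \<le> M"
proof -
  obtain a where "\<forall>z\<in>u ` S. norm z \<le> a"
    using compact_imp_bounded[OF compact_continuous_image[OF assms]] bounded_iff by metis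
  then have "\<bar>u x\<bar> \<le> max a 0" if "x \<in> S" for x using that by (simp add: le_max_iff_disj)
  then show ?thesis using that[of "max a 0"] by simp
qed

text \<open>Since u need not be differentiable, increments are compared. On [a,c] the mean value
  theorem for F, with the intermediate value theorem for u, gives F(u c) - F(u a) = F'(u s) (u c - u
  a) for some s in [a,c]. Replacing F'(u s) by F'(u y) under the integral costs at most e times the
  integral of |v| once c - a < d. This error is additive over intervals, so it sums to e times
  \<open>W x\<close>, and e is arbitrary.\<close>

lemma primitive_chain:
  assumes u: "primitive l u v" and "0 \<le> l"
    and F: "\<And>z. (F has_real_derivative F' z) (at z)" and F': "continuous_on UNIV F'"
  shows "primitive l (\<lambda>x. F (u x)) (\<lambda>x. F' (u x) * v x)"
proof -
  note v = primitive_integrable[OF u]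
  have cu: "continuous_on {0..l} u" using primitive_continuous[OF u] .
  have ch: "continuous_on {0..l} (\<lambda>x. F' (u x))" by (rule continuous_on_compose2[OF F' cu]) auto
  have ai: "(\<lambda>x. F' (u x) * v x) absolutely_integrable_on {0..l}" by (rule absolutely_integrable_continuous_mult[OF v ch])
  have av: "(\<lambda>x. \<bar>v x\<bar>) absolutely_integrable_on {0..l}" using absolutely_integrable_norm[OF v] by (simp add: o_def)
  have sub: "f integrable_on {a..c}" if "f absolutely_integrable_on {0..l}" "0 \<le> a" "c \<le> l" for f :: "real \<Rightarrow> real" and a c
    using set_integrable_subset[OF that(1), of "{a..c}"] that by (auto simp: absolutely_integrable_on_def)
  have split: "integral {0..c} f - integral {0..a} f = integral {a..c} f"
    if "f absolutely_integrable_on {0..l}" "0 \<le> a" "a \<le> c" "c \<le> l" for f :: "real \<Rightarrow> real" and a c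
    using Henstock_Kurzweil_Integration.integral_combine[OF that(2,3) sub[OF that(1) order_refl that(4)]] by simp
  define W where "W x = integral {0..x} (\<lambda>y. \<bar>v y\<bar>)" for x
  define \<Phi> where "\<Phi> x = F (u x) - integral {0..x} (\<lambda>y. F' (u y) * v y)" for x
  have small: "\<bar>\<Phi> x - \<Phi> 0\<bar> \<le> e * W x" if e: "0 < e" and x: "x \<in> {0..l}" for e x
  proof -
    obtain d where d: "0 < d" "\<And>y s. y \<in> {0..l} \<Longrightarrow> s \<in> {0..l} \<Longrightarrow> \<bar>y - s\<bar> < d \<Longrightarrow> \<bar>F' (u y) - F' (u s)\<bar> < e"
      using compact_uniformly_continuous[OF ch compact_Icc] e unfolding uniformly_continuous_on_def dist_real_def by metis
    have loc: "\<bar>\<Phi> c - \<Phi> a\<bar> \<le> e * (W c - W a)" if ac: "0 \<le> a" "a \<le> c" "c \<le> l" "c - a < d" for a c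
    proof -
      have "\<exists>\<xi>. \<xi> \<in> u ` {a..c} \<and> F (u c) - F (u a) = F' \<xi> * (u c - u a)"
      proof -
        have con: "connected (u ` {a..c})" using ac by (intro connected_continuous_image continuous_on_subset[OF cu]) auto
        have mem: "{u a..u c} \<subseteq> u ` {a..c}" "{u c..u a} \<subseteq> u ` {a..c}" using connected_contains_Icc[OF con, of "u a" "u c"] connected_contains_Icc[OF con, of "u c" "u a"] ac by simp_all
        consider "u a < u c" | "u c < u a" | "u a = u c" by linarith
        then show ?thesis
        proof cases
          case 1
          obtain \<xi> where "u a < \<xi>" "\<xi> < u c" "F (u c) - F (u a) = (u c - u a) * F' \<xi>" using MVT2[OF 1 F] by blast
          then show ?thesis using mem(1) by (intro exI[of _ \<xi>]) (auto simp: algebra_simps)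
        next
          case 2
          obtain \<xi> where "u c < \<xi>" "\<xi> < u a" "F (u a) - F (u c) = (u a - u c) * F' \<xi>" using MVT2[OF 2 F] by blast
          then show ?thesis using mem(2) by (intro exI[of _ \<xi>]) (auto simp: algebra_simps)
        qed (use ac in auto)
      qed
      then obtain s where s: "s \<in> {a..c}" "F (u c) - F (u a) = F' (u s) * (u c - u a)" by blast
      let ?w = "\<lambda>y. F' (u s) * v y - F' (u y) * v y"
      have "(\<lambda>y. F' (u s) * v y) absolutely_integrable_on {0..l}" using v by (rule set_integrable_mult_right)
      from set_integral_diff(1)[OF this ai] have wi: "?w absolutely_integrable_on {0..l}" .
      have "u c - u a = integral {a..c} v"
        using split[OF v ac(1-3)] primitive_eq[OF u, of c] primitive_eq[OF u, of a] ac by simp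
      then have "\<Phi> c - \<Phi> a = integral {a..c} (\<lambda>y. F' (u s) * v y) - integral {a..c} (\<lambda>y. F' (u y) * v y)"
        unfolding \<Phi>_def using s(2) split[OF ai ac(1-3)] by simp
      also have "\<dots> = integral {a..c} ?w"
        by (intro integral_diff[symmetric] sub[OF ai] integrable_on_mult_right sub[OF v] ac)
      also have "\<bar>\<dots>\<bar> \<le> integral {a..c} (\<lambda>y. e * \<bar>v y\<bar>)"
      proof (rule integral_norm_bound_integral[of ?w "{a..c}" "\<lambda>y. e * \<bar>v y\<bar>", unfolded real_norm_def])
        show "?w integrable_on {a..c}" "(\<lambda>y. e * \<bar>v y\<bar>) integrable_on {a..c}"
          using ac by (intro integrable_on_mult_right sub[OF wi] sub[OF av]; simp)+
        fix y assume y: "y \<in> {a..c}"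
        have "\<bar>F' (u s) - F' (u y)\<bar> \<le> e" using d(2)[of s y] s(1) y ac by force
        then have "\<bar>F' (u s) - F' (u y)\<bar> * \<bar>v y\<bar> \<le> e * \<bar>v y\<bar>" by (rule mult_right_mono) simp
        then show "\<bar>?w y\<bar> \<le> e * \<bar>v y\<bar>" by (simp add: abs_mult[symmetric] left_diff_distrib)
      qed
      also have "\<dots> = e * (W c - W a)" unfolding W_def split[OF av ac(1-3)] by simp
      finally show ?thesis .
    qed
    \<comment> \<open>[0,x] is cut into N equal pieces of length x / N < d, and \<open>loc\<close>
      is summed along the grid points.\<close>
    obtain N :: nat where N: "x / d < real N" using reals_Archimedean2 by blast
    then have N0: "0 < real N" using x d(1) by (metis atLeastAtMost_iff divide_nonneg_pos le_less_trans)
    have "\<bar>\<Phi> (real k * x / N) - \<Phi> 0\<bar> \<le> e * W (real k * x / N)" if "k \<le> N" for k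
      using that
    proof (induction k)
      case (Suc k)
      let ?a = "real k * x / N" and ?c = "real (Suc k) * x / N"
      have "?c - ?a = x / N" by (simp add: add_divide_distrib distrib_right)
      moreover have "x / N < d" using N N0 d(1) by (simp add: field_simps)
      moreover have "0 \<le> ?a" "?a \<le> ?c" using x by (auto intro!: divide_right_mono mult_right_mono)
      moreover have "?c \<le> l"
      proof -
        have "?c \<le> real N * x / N" using Suc.prems x by (intro divide_right_mono mult_right_mono) auto
        then show ?thesis using N0 x by simp
      qed
      ultimately have "\<bar>\<Phi> ?c - \<Phi> ?a\<bar> \<le> e * (W ?c - W ?a)" by (intro loc) auto
      then show ?case using Suc by (simp add: right_diff_distrib)
    qed (simp add: W_def)
    from this[of N] show ?thesis using N0 by simp
  qed
  show ?thesis
  proof (intro primitiveI ai)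
    fix x assume x: "x \<in> {0..l}"
    have "0 \<le> W x" unfolding W_def using sub[OF av, of 0 x] x by (intro integral_nonneg) auto
    have "\<bar>\<Phi> x - \<Phi> 0\<bar> \<le> 0 + r" if r: "0 < r" for r
    proof -
      have "\<bar>\<Phi> x - \<Phi> 0\<bar> \<le> r / (W x + 1) * W x" using r \<open>0 \<le> W x\<close> by (intro small x) auto
      also have "\<dots> \<le> r" using r \<open>0 \<le> W x\<close> by (simp add: field_simps)
      finally show ?thesis by simp
    qed
    then have "\<bar>\<Phi> x - \<Phi> 0\<bar> \<le> 0" by (rule field_le_epsilon)
    then show "F (u x) = F (u 0) + integral {0..x} (\<lambda>y. F' (u y) * v y)" unfolding \<Phi>_def by simp
  qed
qed

text \<open>Polarisation: the product is a quarter of the difference of the squares of sum and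
  difference, and squares are covered by the chain rule.\<close>

lemma primitive_mult:
  assumes u: "primitive l u v" "primitive l u' v'" and "0 \<le> l"
  shows "primitive l (\<lambda>x. u x * u' x) (\<lambda>x. v x * u' x + u x * v' x)"
proof -
  have sq: "primitive l (\<lambda>x. (a x)\<^sup>2) (\<lambda>x. (2 * a x) * a' x)" if "primitive l a a'" for a a'
    by (rule primitive_chain[OF that \<open>0 \<le> l\<close>, where F="\<lambda>z. z\<^sup>2" and F'="\<lambda>z. 2 * z"])
       (auto intro!: derivative_eq_intros continuous_intros)
  have "primitive l (\<lambda>x. (1/4) * ((u x + u' x)\<^sup>2 - (u x - u' x)\<^sup>2))
      (\<lambda>x. (1/4) * (2 * (u x + u' x) * (v x + v' x) - 2 * (u x - u' x) * (v x - v' x)))"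
    by (intro primitive_cmult primitive_diff sq primitive_add u)
  moreover have "(1/4) * ((u x + u' x)\<^sup>2 - (u x - u' x)\<^sup>2) = u x * u' x" for x
    by (simp add: power2_eq_square algebra_simps)
  moreover have "(1/4) * (2 * (u x + u' x) * (v x + v' x) - 2 * (u x - u' x) * (v x - v' x)) = v x * u' x + u x * v' x" for x
    by (simp add: algebra_simps)
  ultimately show ?thesis by (simp only:)
qed

text \<open>A \<open>C\<^sup>1\<close> extension of the reciprocal to the line, to which the chain rule for primitives applies.\<close>

definition ext_inverse :: "real \<Rightarrow> real \<Rightarrow> real" where
  "ext_inverse d z = (if d \<le> z then 1 / z else 2 / d - z / d\<^sup>2)"

lemma ext_inverse_eq: "d \<le> z \<Longrightarrow> ext_inverse d z = 1 / z"
  by (simp add: ext_inverse_def)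

lemma ext_inverse_derivative:
  assumes "0 < d"
  shows "(ext_inverse d has_real_derivative - (1 / (max z d)\<^sup>2)) (at z)"
proof -
  have r: "((\<lambda>z. 1 / z) has_real_derivative - (1 / z\<^sup>2)) (at z within A)" if "d \<le> z" for A z
    using that assms by (auto intro!: derivative_eq_intros simp: power2_eq_square divide_simps)
  have s: "((\<lambda>z. 2 / d - z / d\<^sup>2) has_real_derivative - (1 / d\<^sup>2)) (at z within A)" for A z
    using assms by (auto intro!: derivative_eq_intros simp: power2_eq_square)
  consider "z < d" | "d < z" | "z = d" by linarith
  then show ?thesis
  proof cases
    case 1
    have "(ext_inverse d has_real_derivative - (1 / d\<^sup>2)) (at z)"
      by (rule has_field_derivative_transform_within_open[OF s, of "{..<d}"])
         (use 1 in \<open>auto simp: ext_inverse_def\<close>)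
    then show ?thesis using 1 by (simp add: max_def)
  next
    case 2
    have "(ext_inverse d has_real_derivative - (1 / z\<^sup>2)) (at z)"
      by (rule has_field_derivative_transform_within_open[OF r, of z "{d<..}"])
         (use 2 in \<open>auto simp: ext_inverse_def\<close>)
    then show ?thesis using 2 by (simp add: max_def)
  next
    case 3
    have "(ext_inverse d has_real_derivative - (1 / d\<^sup>2)) (at d within {d..})"
      by (rule has_field_derivative_transform_within[OF r[of d], of 1])
         (auto simp: ext_inverse_def)
    moreover have "(ext_inverse d has_real_derivative - (1 / d\<^sup>2)) (at d within {..d})"
    proof (rule has_field_derivative_transform_within[OF s, of 1])
      show "2 / d - x' / d\<^sup>2 = ext_inverse d x'" if "x' \<in> {..d}" for x'
        using that assms by (cases "x' = d") (auto simp: ext_inverse_def power2_eq_square field_simps)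
    qed auto
    ultimately have "(ext_inverse d has_real_derivative - (1 / d\<^sup>2)) (at d within {..d} \<union> {d..})"
      unfolding has_field_derivative_iff by (simp add: Lim_within_Un)
    moreover have "{..d} \<union> {d..} = (UNIV :: real set)" by auto
    ultimately show ?thesis using 3 by simp
  qed
qed

lemma ext_inverse_deriv_continuous:
  "0 < d \<Longrightarrow> continuous_on UNIV (\<lambda>z::real. - (1 / (max z d)\<^sup>2))"
  by (intro continuous_intros) auto

lemma primitive_inverse:
  assumes u: "primitive l u v" and "0 \<le> l" "0 < d" and ge: "\<And>x. x \<in> {0..l} \<Longrightarrow> d \<le> u x"
  shows "primitive l (\<lambda>x. 1 / u x) (\<lambda>x. - (v x * (1 / u x) * (1 / u x)))"
proof -
  have p: "primitive l (\<lambda>x. ext_inverse d (u x)) (\<lambda>x. - (1 / (max (u x) d)\<^sup>2) * v x)"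
    by (rule primitive_chain[OF u \<open>0 \<le> l\<close> ext_inverse_derivative[OF \<open>0 < d\<close>] ext_inverse_deriv_continuous[OF \<open>0 < d\<close>]])
  show ?thesis
  proof (subst primitive_cong)
    fix x assume x: "x \<in> {0..l}"
    show "1 / u x = ext_inverse d (u x)" using ge[OF x] by (simp add: ext_inverse_eq)
    show "- (v x * (1 / u x) * (1 / u x)) = - (1 / (max (u x) d)\<^sup>2) * v x"
      using ge[OF x] by (simp add: max_def power2_eq_square)
  qed (use p \<open>0 \<le> l\<close> in auto)
qed

section \<open>Densities of the zero function\<close>

lemma negligible_support_if_integral_zero:
  fixes f :: "real \<Rightarrow> real"
  assumes f: "f absolutely_integrable_on S" and i0: "integral S f = 0" and nn: "\<And>x. 0 \<le> f x"
  shows "negligible {x \<in> S. f x \<noteq> 0}"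
proof -
  have "(LINT x|lebesgue. indicator S x *\<^sub>R f x) = 0"
    using set_lebesgue_integral_eq_integral(2)[OF f] i0 unfolding set_lebesgue_integral_def by simp
  moreover have "integrable lebesgue (\<lambda>x. indicator S x *\<^sub>R f x)"
    using f by (simp add: set_integrable_def)
  ultimately have "AE x in lebesgue. indicator S x *\<^sub>R f x = 0"
    using nn by (subst (asm) integral_nonneg_eq_0_iff_AE) (auto simp: indicator_def)
  then have "AE x in lebesgue. x \<notin> {x \<in> S. f x \<noteq> 0}"
    by (rule AE_mp) (auto simp: indicator_def)
  then show ?thesis
    by (simp add: negligible_iff_null_sets eventually_ae_filter) (metis (no_types, lifting) Collect_mono negligible_iff_null_sets negligible_subset mem_Collect_eq subsetI)
qed

text \<open>The zero function has density v, so the product rule with a polynomial p gives a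
  vanishing integral of v p, and Weierstrass extends this to every continuous factor. A sequence of
  continuous functions tending to v almost everywhere then yields a vanishing integral of v^2 / (|v|
  + 1), whose integrand is nonnegative.\<close>

lemma AE_zero_if_integrals_zero:
  fixes l :: real and v :: "real \<Rightarrow> real"
  assumes v: "v absolutely_integrable_on {0..l}" and "0 \<le> l"
    and z: "\<And>x. x \<in> {0..l} \<Longrightarrow> integral {0..x} v = 0"
  shows "negligible {x \<in> {0..l}. v x \<noteq> 0}"
proof -
  have p0: "primitive l (\<lambda>x. 0) v" using v z by (intro primitiveI) auto
  have int0: "integral {0..l} (\<lambda>x. g x * v x) = 0" if g: "continuous_on {0..l} g" for g
  proof -
    define V where "V = integral {0..l} (\<lambda>y. \<bar>v y\<bar>)"
    have ab: "(\<lambda>y. \<bar>v y\<bar>) integrable_on {0..l}"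
      using absolutely_integrable_abs[OF v] by (simp add: absolutely_integrable_on_def)
    have V0: "0 \<le> V" unfolding V_def by (rule integral_nonneg[OF ab]) auto
    have "\<bar>integral {0..l} (\<lambda>x. g x * v x)\<bar> \<le> 0 + e" if e: "0 < e" for e
    proof -
      have "0 < e / (V + 1)" using e V0 by simp
      then obtain p where p: "real_polynomial_function p" "\<And>x. x \<in> {0..l} \<Longrightarrow> \<bar>g x - p x\<bar> < e / (V + 1)"
        using Stone_Weierstrass_real_polynomial_function[OF compact_Icc g] by metis
      obtain p' where p': "real_polynomial_function p'" "\<And>x. (p has_real_derivative p' x) (at x)"
        using has_real_derivative_polynomial_function[of p] p(1)
        by (auto simp: real_polynomial_function_eq)
      have cp: "continuous_on {0..l} p" "continuous_on {0..l} p'"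
        using p(1) p'(1) continuous_on_polymonial_function real_polynomial_function_eq by blast+
      have "primitive l p p'"
        by (rule primitive_C1) (use p' cp in \<open>auto intro: has_field_derivative_at_within\<close>)
      from primitive_mult[OF p0 this \<open>0 \<le> l\<close>]
      have ip: "integral {0..l} (\<lambda>x. v x * p x) = 0"
        using \<open>0 \<le> l\<close> primitive_eq[of l _ _ l] by fastforce
      have ai1: "(\<lambda>x. g x * v x) absolutely_integrable_on {0..l}" "(\<lambda>x. p x * v x) absolutely_integrable_on {0..l}"
        by (intro absolutely_integrable_continuous_mult v g cp)+
      have "integral {0..l} (\<lambda>x. g x * v x) = integral {0..l} (\<lambda>x. g x * v x) - integral {0..l} (\<lambda>x. p x * v x)"
        using ip by (simp add: mult.commute)
      also have "\<dots> = integral {0..l} (\<lambda>x. g x * v x - p x * v x)"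
        using ai1 by (simp add: integral_diff absolutely_integrable_on_def)
      also have "\<bar>\<dots>\<bar> \<le> integral {0..l} (\<lambda>x. \<bar>g x * v x - p x * v x\<bar>)"
        by (rule abs_integral_le[OF set_integral_diff(1)[OF ai1]])
      also have "\<dots> \<le> integral {0..l} (\<lambda>x. e / (V+1) * \<bar>v x\<bar>)"
      proof (rule integral_le)
        show "(\<lambda>x. \<bar>g x * v x - p x * v x\<bar>) integrable_on {0..l}"
          using absolutely_integrable_abs[OF set_integral_diff(1)[OF ai1]] by (simp add: absolutely_integrable_on_def)
        show "(\<lambda>x. e / (V+1) * \<bar>v x\<bar>) integrable_on {0..l}" by (intro integrable_on_mult_right ab)
        fix x assume x: "x \<in> {0..l}"
        have "\<bar>g x * v x - p x * v x\<bar> = \<bar>g x - p x\<bar> * \<bar>v x\<bar>" by (simp add: abs_mult[symmetric] algebra_simps)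
        also have "\<dots> \<le> e / (V+1) * \<bar>v x\<bar>" using p(2)[OF x] by (intro mult_right_mono) auto
        finally show "\<bar>g x * v x - p x * v x\<bar> \<le> e / (V+1) * \<bar>v x\<bar>" .
      qed
      also have "\<dots> = e * (V / (V+1))" unfolding V_def by simp
      also have "\<dots> \<le> e" using V0 e by (simp add: field_simps)
      finally show ?thesis by simp
    qed
    then have "\<bar>integral {0..l} (\<lambda>x. g x * v x)\<bar> \<le> 0" by (rule field_le_epsilon)
    then show ?thesis by simp
  qed
  have "v measurable_on {0..l}" using set_integrable_lebesgue_measurable[OF v] by (simp add: measurable_on_iff_borel_measurable)
  then obtain N g where N: "negligible N" and g: "\<And>n. continuous_on UNIV (g n)"
    and lim: "\<And>x. x \<notin> N \<Longrightarrow> (\<lambda>n. g n x) \<longlonglongrightarrow> (if x \<in> {0..l} then v x else 0)"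
    unfolding measurable_on_def by metis
  \<comment> \<open>The quotient keeps the factor between -1 and 1, so that |v| dominates, while
    \<open>k n x * v x\<close> still tends to v^2 / (|v| + 1).\<close>
  define k where "k n x = g n x / (\<bar>g n x\<bar> + 1)" for n :: nat and x
  have kc: "continuous_on {0..l} (k n)" for n
    unfolding k_def by (intro continuous_intros continuous_on_subset[OF g]) auto
  have kB: "\<bar>k n x\<bar> \<le> 1" for n x unfolding k_def by (auto simp: abs_le_iff field_simps)
  have sp: "integral ({0..l} - N) h = integral {0..l} h" for h :: "real \<Rightarrow> real"
    by (rule integral_subset_negligible) (auto intro: negligible_subset[OF N])
  have isp: "h integrable_on ({0..l} - N)" if "h integrable_on {0..l}" for h :: "real \<Rightarrow> real"
    using integrable_spike_set[OF that, of "{0..l} - N"] N by (auto intro: negligible_subset[OF N])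
  have ab: "(\<lambda>y. \<bar>v y\<bar>) integrable_on {0..l}"
    using absolutely_integrable_abs[OF v] by (simp add: absolutely_integrable_on_def)
  let ?q = "\<lambda>x. v x / (\<bar>v x\<bar> + 1) * v x"
  have dc: "?q integrable_on ({0..l} - N)"
    "(\<lambda>n. integral ({0..l} - N) (\<lambda>x. k n x * v x)) \<longlonglongrightarrow> integral ({0..l} - N) ?q"
  proof -
    have a: "(\<lambda>x. k n x * v x) integrable_on {0..l} - N" for n
      using absolutely_integrable_continuous_mult[OF v kc[of n]] by (intro isp) (simp add: absolutely_integrable_on_def)
    have b: "norm (k n x * v x) \<le> \<bar>v x\<bar>" for n x
      using kB[of n x] by (auto simp: abs_mult intro: mult_left_le_one_le)
    have c: "(\<lambda>n. k n x * v x) \<longlonglongrightarrow> ?q x" if "x \<in> {0..l} - N" for x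
      unfolding k_def using lim[of x] that by (intro tendsto_intros) auto
    show "?q integrable_on ({0..l} - N)"
      "(\<lambda>n. integral ({0..l} - N) (\<lambda>x. k n x * v x)) \<longlonglongrightarrow> integral ({0..l} - N) ?q"
      using dominated_convergence[OF a isp[OF ab] b c] by auto
  qed
  then have "integral ({0..l} - N) ?q = 0"
    using int0[OF kc] LIMSEQ_unique[OF dc(2), of 0] by (simp add: sp)
  moreover have "?q absolutely_integrable_on ({0..l} - N)"
    using dc(1) by (intro nonnegative_absolutely_integrable_1) (auto simp: zero_le_divide_iff)
  moreover have "0 \<le> ?q x" for x by (auto simp: zero_le_mult_iff zero_le_divide_iff)
  ultimately have "negligible {x \<in> {0..l} - N. ?q x \<noteq> 0}"
    by (intro negligible_support_if_integral_zero)
  then have "negligible ({x \<in> {0..l} - N. ?q x \<noteq> 0} \<union> N)" using N by simp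
  then show ?thesis by (rule negligible_subset) auto
qed

section \<open>Functions of time and space that are smooth in time\<close>

lemma continuous_on_slice1:
  fixes u :: "real \<Rightarrow> real \<Rightarrow> 'a::topological_space"
  assumes "continuous_on ({0..T} \<times> {0..l}) (\<lambda>(t, x). u t x)" "x \<in> {0..l}"
  shows "continuous_on {0..T} (\<lambda>t. u t x)"
proof -
  have "continuous_on {0..T} (\<lambda>t. (t, x))" by (intro continuous_intros)
  from continuous_on_compose2[OF assms(1) this] assms(2) show ?thesis by (simp add: image_subset_iff)
qed

lemma continuous_on_slice2:
  fixes u :: "real \<Rightarrow> real \<Rightarrow> 'a::topological_space"
  assumes "continuous_on ({0..T} \<times> {0..l}) (\<lambda>(t, x). u t x)" "t \<in> {0..T}"
  shows "continuous_on {0..l} (\<lambda>x. u t x)"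
proof -
  have "continuous_on {0..l} (\<lambda>x. (t, x))" by (intro continuous_intros)
  from continuous_on_compose2[OF assms(1) this] assms(2) show ?thesis by (simp add: image_subset_iff)
qed

lemma has_real_derivative_unique_within:
  assumes "(f has_real_derivative a) (at t within S)" "(f has_real_derivative b) (at t within S)"
    "at t within S \<noteq> bot"
  shows "a = b"
  using assms tendsto_unique unfolding has_field_derivative_iff by blast

lemma has_real_derivative_frechet:
  fixes f :: "real \<Rightarrow> real"
  assumes "f differentiable (at t within A)"
  shows "(f has_real_derivative frechet_derivative f (at t within A) 1) (at t within A)"
proof -
  have hd: "(f has_derivative frechet_derivative f (at t within A)) (at t within A)"
    using assms frechet_derivative_works by blast
  have "frechet_derivative f (at t within A) h = frechet_derivative f (at t within A) 1 * h" for h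
    using linear_cmul[OF has_derivative_linear[OF hd], of h 1] by (metis mult.commute mult_1 real_scaleR_def)
  then show ?thesis unfolding has_field_derivative_def by (intro has_derivative_eq_rhs[OF hd] ext)
qed

lemma has_derivative_partials:
  fixes F :: "real \<times> real \<Rightarrow> real"
  assumes "F differentiable (at p within U)"
  shows "(F has_derivative (\<lambda>v. fst v * frechet_derivative F (at p within U) (1, 0)
           + snd v * frechet_derivative F (at p within U) (0, 1))) (at p within U)"
proof -
  have hd: "(F has_derivative frechet_derivative F (at p within U)) (at p within U)"
    using assms frechet_derivative_works by blast
  interpret linear "frechet_derivative F (at p within U)" using has_derivative_linear[OF hd] .
  have "frechet_derivative F (at p within U) v = fst v * frechet_derivative F (at p within U) (1, 0)
           + snd v * frechet_derivative F (at p within U) (0, 1)" for v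
  proof -
    have "v = fst v *\<^sub>R (1, 0) + snd v *\<^sub>R (0, 1)" by (simp add: prod_eq_iff)
    then have "frechet_derivative F (at p within U) v
        = frechet_derivative F (at p within U) (fst v *\<^sub>R (1, 0) + snd v *\<^sub>R (0, 1))" by (rule arg_cong)
    also have "\<dots> = fst v *\<^sub>R frechet_derivative F (at p within U) (1, 0)
           + snd v *\<^sub>R frechet_derivative F (at p within U) (0, 1)" unfolding add scale ..
    finally show ?thesis by simp
  qed
  then show ?thesis by (intro has_derivative_eq_rhs[OF hd] ext)
qed

lemma has_real_derivative_compose2:
  fixes F :: "real \<times> real \<Rightarrow> real" and a b :: "real \<Rightarrow> real"
  assumes F: "(F has_derivative (\<lambda>v. fst v * X1 + snd v * X2)) (at (a t, b t) within U)"
    and a: "(a has_real_derivative a') (at t within A)" and b: "(b has_real_derivative b') (at t within A)"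
    and im: "\<And>s. s \<in> A \<Longrightarrow> (a s, b s) \<in> U"
  shows "((\<lambda>s. F (a s, b s)) has_real_derivative (a' * X1 + b' * X2)) (at t within A)"
proof -
  have ab: "((\<lambda>s. (a s, b s)) has_derivative (\<lambda>h. (a' * h, b' * h))) (at t within A)"
    using a b unfolding has_field_derivative_def by (rule has_derivative_Pair)
  have "(F has_derivative (\<lambda>v. fst v * X1 + snd v * X2)) (at (a t, b t) within (\<lambda>s. (a s, b s)) ` A)"
    by (rule has_derivative_subset[OF F]) (use im in auto)
  from has_derivative_in_compose[OF ab this] show ?thesis
    unfolding has_field_derivative_def by (rule has_derivative_eq_rhs) (auto simp: algebra_simps)
qed

section \<open>Fields on a rectangle that are smooth in time and continuous in space\<close>

locale rect =
  fixes T l :: real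
  assumes T_pos: "0 < T" and l_pos: "0 < l"
begin

definition jcont :: "(real \<Rightarrow> real \<Rightarrow> real) \<Rightarrow> bool" where
  "jcont u \<longleftrightarrow> continuous_on ({0..T} \<times> {0..l}) (\<lambda>(t, x). u t x)"

definition tderiv :: "(real \<Rightarrow> real \<Rightarrow> real) \<Rightarrow> (real \<Rightarrow> real \<Rightarrow> real) \<Rightarrow> bool" where
  "tderiv u u' \<longleftrightarrow> (\<forall>t\<in>{0..T}. \<forall>x\<in>{0..l}. ((\<lambda>s. u s x) has_real_derivative u' t x) (at t within {0..T}))"

text \<open>C^k in t, one-sided at both ends of [0,T], with all derivatives jointly continuous in
  (t,x). Here x is a mere parameter: nothing beyond continuity is asked of it.\<close>

primrec SC :: "nat \<Rightarrow> (real \<Rightarrow> real \<Rightarrow> real) \<Rightarrow> bool" where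
  "SC 0 u \<longleftrightarrow> jcont u"
| "SC (Suc k) u \<longleftrightarrow> jcont u \<and> (\<exists>u'. tderiv u u' \<and> SC k u')"

definition S :: "(real \<Rightarrow> real \<Rightarrow> real) \<Rightarrow> bool" where
  "S u \<longleftrightarrow> (\<forall>k. SC k u)"

lemma jcont_cong:
  assumes "\<And>t x. t \<in> {0..T} \<Longrightarrow> x \<in> {0..l} \<Longrightarrow> u t x = v t x"
  shows "jcont u \<longleftrightarrow> jcont v"
  unfolding jcont_def using assms by (intro continuous_on_cong) auto

lemma tderiv_cong:
  assumes "\<And>t x. t \<in> {0..T} \<Longrightarrow> x \<in> {0..l} \<Longrightarrow> u t x = v t x"
    "\<And>t x. t \<in> {0..T} \<Longrightarrow> x \<in> {0..l} \<Longrightarrow> u' t x = v' t x"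
    "tderiv u u'"
  shows "tderiv v v'"
  unfolding tderiv_def
proof (intro ballI)
  fix t x assume t: "t \<in> {0..T}" and x: "x \<in> {0..l}"
  have "((\<lambda>s. u s x) has_real_derivative u' t x) (at t within {0..T})"
    using assms(3) t x unfolding tderiv_def by blast
  then have "((\<lambda>s. v s x) has_real_derivative u' t x) (at t within {0..T})"
    by (rule has_field_derivative_transform_within[OF _ zero_less_one t]) (use assms(1) x in auto)
  then show "((\<lambda>s. v s x) has_real_derivative v' t x) (at t within {0..T})"
    using assms(2) t x by simp
qed

lemma tderiv_unique:
  assumes "tderiv u u'" "tderiv u v'" "t \<in> {0..T}" "x \<in> {0..l}"
  shows "u' t x = v' t x"
proof (rule has_real_derivative_unique_within)
  show "at t within {0..T} \<noteq> bot"
    using assms(3) T_pos by (simp add: trivial_limit_within islimpt_Icc)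
  show "((\<lambda>s. u s x) has_real_derivative u' t x) (at t within {0..T})"
    "((\<lambda>s. u s x) has_real_derivative v' t x) (at t within {0..T})"
    using assms unfolding tderiv_def by blast+
qed

lemma SC_cong:
  assumes "\<And>t x. t \<in> {0..T} \<Longrightarrow> x \<in> {0..l} \<Longrightarrow> u t x = v t x"
  shows "SC k u \<longleftrightarrow> SC k v"
proof (cases k)
  case 0 then show ?thesis using jcont_cong[OF assms] by simp
next
  case (Suc n)
  have "tderiv u u' \<longleftrightarrow> tderiv v u'" for u'
  proof
    assume "tderiv u u'" then show "tderiv v u'" by (rule tderiv_cong[rotated 2]) (use assms in auto)
  next
    assume "tderiv v u'" then show "tderiv u u'" by (rule tderiv_cong[rotated 2]) (use assms in auto)
  qed
  then show ?thesis using jcont_cong[OF assms] by (simp add: Suc)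
qed

lemma S_cong:
  assumes "\<And>t x. t \<in> {0..T} \<Longrightarrow> x \<in> {0..l} \<Longrightarrow> u t x = v t x" "S u"
  shows "S v"
proof -
  have "SC k u \<longleftrightarrow> SC k v" for k by (rule SC_cong) (rule assms(1))
  then show ?thesis using assms(2) unfolding S_def by simp
qed

lemma SC_jcont: "SC k u \<Longrightarrow> jcont u" by (cases k) auto

lemma SC_mono: "SC (Suc k) u \<Longrightarrow> SC k u"
proof (induction k arbitrary: u)
  case (Suc k)
  then obtain u' where "tderiv u u'" "SC (Suc k) u'" "jcont u" using SC.simps(2) by blast
  then show ?case using Suc.IH SC.simps(2) by blast
qed simp

lemma S_jcont: "S u \<Longrightarrow> jcont u" unfolding S_def using SC.simps(1) by blast

text \<open>\<open>SC (Suc k)\<close> supplies a derivative for each k separately; uniqueness on the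
  rectangle makes a single one serve for all orders.\<close>

lemma S_tderiv:
  assumes "S u"
  obtains u' where "tderiv u u'" "S u'"
proof -
  obtain u' where u': "tderiv u u'" using assms SC.simps(2)[of 0 u] unfolding S_def by blast
  have "SC k u'" for k
  proof -
    obtain v where v: "tderiv u v" "SC k v" using assms SC.simps(2)[of k u] unfolding S_def by blast
    show ?thesis using SC_cong[of u' v k] tderiv_unique[OF u' v(1)] v(2) by blast
  qed
  then show ?thesis using that u' unfolding S_def by blast
qed

lemma S_tderivD: "S u \<Longrightarrow> tderiv u u' \<Longrightarrow> S u'"
  by (metis S_tderiv S_cong tderiv_unique)

lemma SC_SucI: "tderiv u u' \<Longrightarrow> SC k u' \<Longrightarrow> jcont u \<Longrightarrow> SC (Suc k) u" by auto

lemma tderiv_static: "tderiv (\<lambda>t. a) (\<lambda>t x. 0)"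
  unfolding tderiv_def by auto

lemma SC_const: "SC k (\<lambda>t x. c)"
proof (induction k arbitrary: c)
  case 0 then show ?case by (simp add: jcont_def)
next
  case (Suc k)
  have "tderiv (\<lambda>t x. c) (\<lambda>t x. 0)" by (rule tderiv_static)
  then show ?case using Suc[of 0] by (auto simp: jcont_def)
qed

lemma jcont_static: "continuous_on {0..l} a \<Longrightarrow> jcont (\<lambda>t. a)"
  unfolding jcont_def case_prod_unfold
  by (rule continuous_on_compose2[of "{0..l}" a]) (auto intro!: continuous_intros)

lemma SC_static: "continuous_on {0..l} a \<Longrightarrow> SC k (\<lambda>t. a)"
  using SC_SucI[OF tderiv_static SC_const] jcont_static SC.simps(1) by (cases k) blast+

lemma jcont_add: "jcont u \<Longrightarrow> jcont v \<Longrightarrow> jcont (\<lambda>t x. u t x + v t x)"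
  unfolding jcont_def case_prod_unfold by (intro continuous_intros)

lemma jcont_mult: "jcont u \<Longrightarrow> jcont v \<Longrightarrow> jcont (\<lambda>t x. u t x * v t x)"
  unfolding jcont_def case_prod_unfold by (intro continuous_intros)

lemma tderiv_add: "tderiv u u' \<Longrightarrow> tderiv v v' \<Longrightarrow> tderiv (\<lambda>t x. u t x + v t x) (\<lambda>t x. u' t x + v' t x)"
  unfolding tderiv_def by (auto intro: DERIV_add)

lemma tderiv_mult: "tderiv u u' \<Longrightarrow> tderiv v v' \<Longrightarrow> tderiv (\<lambda>t x. u t x * v t x) (\<lambda>t x. u' t x * v t x + u t x * v' t x)"
  unfolding tderiv_def by (auto intro!: derivative_eq_intros)

lemma SC_add: "SC k u \<Longrightarrow> SC k v \<Longrightarrow> SC k (\<lambda>t x. u t x + v t x)"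
proof (induction k arbitrary: u v)
  case 0 then show ?case by (simp add: jcont_add)
next
  case (Suc k)
  then obtain u' v' where "tderiv u u'" "SC k u'" "tderiv v v'" "SC k v'" "jcont u" "jcont v" by auto
  then show ?case using Suc.IH[of u' v'] by (intro SC_SucI[OF tderiv_add]) (auto intro: jcont_add)
qed

lemma SC_mult: "SC k u \<Longrightarrow> SC k v \<Longrightarrow> SC k (\<lambda>t x. u t x * v t x)"
proof (induction k arbitrary: u v)
  case 0 then show ?case by (simp add: jcont_mult)
next
  case (Suc k)
  then obtain u' v' where a: "tderiv u u'" "SC k u'" "tderiv v v'" "SC k v'" "jcont u" "jcont v" by auto
  have "SC k u" "SC k v" using Suc.prems SC_mono by blast+
  then show ?case using a Suc.IH
    by (intro SC_SucI[OF tderiv_mult[OF a(1,3)]] SC_add) (auto intro: jcont_mult)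
qed

lemma SC_inverse: "SC k u \<Longrightarrow> (\<And>t x. t \<in> {0..T} \<Longrightarrow> x \<in> {0..l} \<Longrightarrow> u t x \<noteq> 0) \<Longrightarrow> SC k (\<lambda>t x. 1 / u t x)"
proof (induction k)
  case 0 then show ?case by (auto simp: jcont_def case_prod_unfold intro!: continuous_intros)
next
  case (Suc k)
  then obtain u' where u': "tderiv u u'" "SC k u'" "jcont u" by auto
  have i: "SC k (\<lambda>t x. 1 / u t x)" using Suc SC_mono by blast
  have d: "tderiv (\<lambda>t x. 1 / u t x) (\<lambda>t x. -1 * (u' t x * ((1 / u t x) * (1 / u t x))))"
    using u'(1) Suc.prems(2) unfolding tderiv_def by (auto intro!: derivative_eq_intros simp: divide_simps)
  show ?case
  proof (rule SC_SucI[OF d])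
    show "SC k (\<lambda>t x. -1 * (u' t x * ((1 / u t x) * (1 / u t x))))"
      by (intro SC_mult SC_const i u')
    show "jcont (\<lambda>t x. 1 / u t x)" using SC_jcont[OF i] .
  qed
qed

lemma jcont_trace:
  assumes "jcont u" "x0 \<in> {0..l}"
  shows "jcont (\<lambda>t x. u t x0)"
proof -
  have "continuous_on {0..T} (\<lambda>t. u t x0)"
    using continuous_on_slice1 assms unfolding jcont_def by blast
  then show ?thesis unfolding jcont_def case_prod_unfold
    by (rule continuous_on_compose2) (auto intro!: continuous_intros)
qed

lemma SC_trace: "SC k u \<Longrightarrow> x0 \<in> {0..l} \<Longrightarrow> SC k (\<lambda>t x. u t x0)"
proof (induction k arbitrary: u)
  case 0 then show ?case by (simp add: jcont_trace)
next
  case (Suc k)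
  then obtain u' where u': "tderiv u u'" "SC k u'" "jcont u" by auto
  have "tderiv (\<lambda>t x. u t x0) (\<lambda>t x. u' t x0)" using u'(1) Suc.prems(2) unfolding tderiv_def by blast
  then show ?case using u' Suc.IH[OF u'(2) Suc.prems(2)] jcont_trace[OF u'(3) Suc.prems(2)] by auto
qed

lemma jcont_slice: "jcont u \<Longrightarrow> t \<in> {0..T} \<Longrightarrow> continuous_on {0..l} (u t)"
  unfolding jcont_def using continuous_on_slice2 by blast

lemma jcont_bound:
  assumes "jcont u"
  obtains M where "0 \<le> M" "\<And>t x. t \<in> {0..T} \<Longrightarrow> x \<in> {0..l} \<Longrightarrow> \<bar>u t x\<bar> \<le> M"
proof -
  have "compact ({0..T} \<times> {0..l})" by (intro compact_Times) auto
  then obtain M where "0 \<le> M" "\<And>p. p \<in> {0..T} \<times> {0..l} \<Longrightarrow> \<bar>case_prod u p\<bar> \<le> M"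
    using continuous_on_compact_bound_abs[of "{0..T} \<times> {0..l}" "case_prod u"] assms unfolding jcont_def by metis
  then show ?thesis using that[of M] by fastforce
qed

lemma jcont_unif:
  assumes "jcont u" "0 < e"
  obtains d where "0 < d" "\<And>t s x y. t \<in> {0..T} \<Longrightarrow> s \<in> {0..T} \<Longrightarrow> x \<in> {0..l} \<Longrightarrow> y \<in> {0..l} \<Longrightarrow>
     \<bar>s - t\<bar> < d \<Longrightarrow> \<bar>y - x\<bar> < d \<Longrightarrow> \<bar>u s y - u t x\<bar> < e"
proof -
  have "compact ({0..T} \<times> {0..l})" by (intro compact_Times) auto
  then have "uniformly_continuous_on ({0..T} \<times> {0..l}) (\<lambda>(t, x). u t x)"
    using assms compact_uniformly_continuous unfolding jcont_def by blast
  then obtain d where d: "0 < d" "\<And>p q. p \<in> {0..T} \<times> {0..l} \<Longrightarrow> q \<in> {0..T} \<times> {0..l} \<Longrightarrow> dist q p < d \<Longrightarrow>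
     dist (case_prod u q) (case_prod u p) < e"
    unfolding uniformly_continuous_on_def using assms(2) by metis
  show ?thesis
  proof (rule that[of "d/2"])
    fix t s x y assume a: "t \<in> {0..T}" "s \<in> {0..T}" "x \<in> {0..l}" "y \<in> {0..l}" "\<bar>s - t\<bar> < d/2" "\<bar>y - x\<bar> < d/2"
    have "dist (s, y) (t, x) \<le> \<bar>s - t\<bar> + \<bar>y - x\<bar>"
      using sqrt_sum_squares_le_sum_abs[of "s - t" "y - x"] by (simp add: dist_Pair_Pair dist_real_def)
    then show "\<bar>u s y - u t x\<bar> < e" using d(2)[of "(t,x)" "(s,y)"] a by (simp add: dist_real_def)
  qed (use d in simp)
qed

text \<open>The mean value estimate is applied to \<open>u s x - s * u' t x\<close>, whose
  s-derivative is small near t uniformly in x, by uniform continuity of u' on the compact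
  rectangle.\<close>

lemma tderiv_uniform:
  assumes "tderiv u u'" "jcont u'" "t \<in> {0..T}" "0 < e"
  obtains d where "0 < d" "\<And>s x. s \<in> {0..T} \<Longrightarrow> s \<noteq> t \<Longrightarrow> \<bar>s - t\<bar> < d \<Longrightarrow> x \<in> {0..l} \<Longrightarrow>
     \<bar>(u s x - u t x) / (s - t) - u' t x\<bar> \<le> e"
proof -
  obtain d where d: "0 < d" "\<And>s x. s \<in> {0..T} \<Longrightarrow> x \<in> {0..l} \<Longrightarrow> \<bar>s - t\<bar> < d \<Longrightarrow> \<bar>u' s x - u' t x\<bar> < e"
  proof -
    obtain d where "0 < d" "\<And>t s x y. t \<in> {0..T} \<Longrightarrow> s \<in> {0..T} \<Longrightarrow> x \<in> {0..l} \<Longrightarrow> y \<in> {0..l} \<Longrightarrow>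
     \<bar>s - t\<bar> < d \<Longrightarrow> \<bar>y - x\<bar> < d \<Longrightarrow> \<bar>u' s y - u' t x\<bar> < e" using jcont_unif[OF assms(2,4)] by metis
    then show ?thesis using that[of d] assms(3) by auto
  qed
  show ?thesis
  proof (rule that[OF d(1)])
    fix s x assume s: "s \<in> {0..T}" "s \<noteq> t" "\<bar>s - t\<bar> < d" and x: "x \<in> {0..l}"
    define I where "I = {min s t..max s t}"
    have I: "I \<subseteq> {0..T}" "\<And>r. r \<in> I \<Longrightarrow> \<bar>r - t\<bar> < d" "s \<in> I" "t \<in> I" "convex I"
      using s assms(3) unfolding I_def by auto
    have "norm ((u s x - s * u' t x) - (u t x - t * u' t x)) \<le> e * norm (s - t)"
    proof (rule field_differentiable_bound[where S=I and f'="\<lambda>r. u' r x - u' t x"])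
      fix r assume r: "r \<in> I"
      have "((\<lambda>s. u s x) has_real_derivative u' r x) (at r within I)"
        using assms(1) r I(1) x unfolding tderiv_def by (meson DERIV_subset subsetD)
      then show "((\<lambda>s. u s x - s * u' t x) has_real_derivative u' r x - u' t x) (at r within I)"
        by (auto intro!: derivative_eq_intros)
      show "norm (u' r x - u' t x) \<le> e" using d(2)[of r x] r I(1,2) x by (auto intro: less_imp_le)
    qed (use I in auto)
    then have "\<bar>(u s x - u t x) - (s - t) * u' t x\<bar> \<le> e * \<bar>s - t\<bar>" by (simp add: algebra_simps)
    moreover have "(u s x - u t x) / (s - t) - u' t x = ((u s x - u t x) - (s - t) * u' t x) / (s - t)"
      using s(2) by (simp add: field_simps)
    ultimately show "\<bar>(u s x - u t x) / (s - t) - u' t x\<bar> \<le> e"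
      using s(2) by (simp add: abs_divide divide_le_eq)
  qed
qed

lemma jcontI_uniform:
  assumes c: "\<And>t. t \<in> {0..T} \<Longrightarrow> continuous_on {0..l} (u t)"
    and t: "\<And>t e. t \<in> {0..T} \<Longrightarrow> 0 < e \<Longrightarrow> \<exists>d>0. \<forall>s\<in>{0..T}. \<bar>s - t\<bar> < d \<longrightarrow> (\<forall>x\<in>{0..l}. \<bar>u s x - u t x\<bar> < e)"
  shows "jcont u"
  unfolding jcont_def case_prod_unfold continuous_on_iff
proof (intro ballI allI impI)
  fix p :: "real \<times> real" and e :: real assume p: "p \<in> {0..T} \<times> {0..l}" and e: "0 < e"
  obtain tt x where px: "p = (tt, x)" by fastforce
  have tx: "tt \<in> {0..T}" "x \<in> {0..l}" using p px by auto
  obtain d1 where d1: "0 < d1" "\<forall>s\<in>{0..T}. \<bar>s - tt\<bar> < d1 \<longrightarrow> (\<forall>x\<in>{0..l}. \<bar>u s x - u tt x\<bar> < e / 2)" using t[OF tx(1), of "e / 2"] e by auto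
  obtain d2 where d2: "0 < d2" "\<forall>y\<in>{0..l}. dist y x < d2 \<longrightarrow> dist (u tt y) (u tt x) < e / 2"
    using c[OF tx(1)] tx(2) e unfolding continuous_on_iff by (metis half_gt_zero)
  have "dist (u (fst q) (snd q)) (u (fst p) (snd p)) < e" if q: "q \<in> {0..T} \<times> {0..l}" "dist q p < min d1 d2" for q
  proof -
    have "dist (fst q) tt < d1" "dist (snd q) x < d2" using dist_fst_le[of q p] dist_snd_le[of q p] q(2) px by auto
    then have "\<bar>u (fst q) (snd q) - u tt (snd q)\<bar> < e / 2" "\<bar>u tt (snd q) - u tt x\<bar> < e / 2"
      using d1 d2 q(1) unfolding dist_real_def by (auto simp: mem_Times_iff)
    then show ?thesis unfolding px dist_real_def fst_conv snd_conv by linarith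
  qed
  then show "\<exists>d>0. \<forall>q\<in>{0..T} \<times> {0..l}. dist q p < d \<longrightarrow> dist (u (fst q) (snd q)) (u (fst p) (snd p)) < e"
    using d1(1) d2(1) by (intro exI[of _ "min d1 d2"]) auto
qed

text \<open>The weight r is only integrable; in the application it is a highest derivative of the
  data. The integrand is then not continuous in x, but the uniform distance of \<open>u s\<close>
  and \<open>u t\<close> times the integral of |r| controls the primitive.\<close>

lemma jcont_weighted_integral:
  assumes u: "jcont u" and r: "r absolutely_integrable_on {0..l}"
  shows "jcont (\<lambda>t x. integral {0..x} (\<lambda>y. u t y * r y))"
proof -
  define V where "V = integral {0..l} (\<lambda>y. \<bar>r y\<bar>)"
  have ab: "(\<lambda>y. \<bar>r y\<bar>) integrable_on {0..l}"
    using absolutely_integrable_abs[OF r] by (simp add: absolutely_integrable_on_def)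
  have V0: "0 \<le> V" unfolding V_def by (rule integral_nonneg[OF ab]) auto
  have ai: "(\<lambda>y. u t y * r y) absolutely_integrable_on {0..l}" if "t \<in> {0..T}" for t
    by (rule absolutely_integrable_continuous_mult[OF r jcont_slice[OF u that]])
  define w where "w t x = integral {0..x} (\<lambda>y. u t y * r y)" for t x
  have wc: "continuous_on {0..l} (w t)" if "t \<in> {0..T}" for t
    unfolding w_def using primitive_continuous[OF primitive_integral[OF ai[OF that], of 0]] by simp
  have wl: "\<bar>w s x - w t x\<bar> \<le> c * V" if st: "s \<in> {0..T}" "t \<in> {0..T}" and x: "x \<in> {0..l}"
    and c: "\<And>y. y \<in> {0..l} \<Longrightarrow> \<bar>u s y - u t y\<bar> \<le> c" for s t x c
  proof -
    have "w s x - w t x = integral {0..x} (\<lambda>y. u s y * r y - u t y * r y)"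
      unfolding w_def using x st by (subst integral_diff) (auto intro!: absolutely_integrable_initial(2)[OF ai])
    also have "\<bar>\<dots>\<bar> \<le> integral {0..l} (\<lambda>y. \<bar>u s y * r y - u t y * r y\<bar>)"
      using x st by (intro integral_initial_abs_le set_integral_diff ai) auto
    also have "\<dots> \<le> integral {0..l} (\<lambda>y. c * \<bar>r y\<bar>)"
    proof (rule integral_le)
      show "(\<lambda>y. \<bar>u s y * r y - u t y * r y\<bar>) integrable_on {0..l}"
        by (rule absolutely_integrable_abs_diff(2)[OF ai[OF st(1)] ai[OF st(2)]])
      show "(\<lambda>y. c * \<bar>r y\<bar>) integrable_on {0..l}" by (intro integrable_on_mult_right ab)
      fix y assume y: "y \<in> {0..l}"
      have "\<bar>u s y * r y - u t y * r y\<bar> = \<bar>u s y - u t y\<bar> * \<bar>r y\<bar>" by (simp add: abs_mult[symmetric] algebra_simps)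
      also have "\<dots> \<le> c * \<bar>r y\<bar>" using c[OF y] by (intro mult_right_mono) auto
      finally show "\<bar>u s y * r y - u t y * r y\<bar> \<le> c * \<bar>r y\<bar>" .
    qed
    also have "\<dots> = c * V" unfolding V_def by simp
    finally show ?thesis .
  qed
  have "jcont w"
  proof (rule jcontI_uniform[OF wc])
    fix t e :: real assume t: "t \<in> {0..T}" and e: "0 < e"
    have "0 < e / (V + 1)" using e V0 by simp
    then obtain d where d: "0 < d" "\<And>t s x y. t \<in> {0..T} \<Longrightarrow> s \<in> {0..T} \<Longrightarrow> x \<in> {0..l} \<Longrightarrow> y \<in> {0..l} \<Longrightarrow>
     \<bar>s - t\<bar> < d \<Longrightarrow> \<bar>y - x\<bar> < d \<Longrightarrow> \<bar>u s y - u t x\<bar> < e / (V + 1)"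
      using jcont_unif[OF u] by metis
    have "\<bar>w s x - w t x\<bar> < e" if "s \<in> {0..T}" "\<bar>s - t\<bar> < d" "x \<in> {0..l}" for s x
    proof -
      have "\<bar>w s x - w t x\<bar> \<le> e / (V + 1) * V" by (rule wl) (use that t d in \<open>auto intro!: less_imp_le\<close>)
      also have "\<dots> < e" using V0 e by (simp add: field_simps)
      finally show ?thesis .
    qed
    then show "\<exists>d>0. \<forall>s\<in>{0..T}. \<bar>s - t\<bar> < d \<longrightarrow> (\<forall>x\<in>{0..l}. \<bar>w s x - w t x\<bar> < e)" using d(1) by blast
  qed
  then show ?thesis unfolding w_def .
qed

text \<open>Uniform convergence of the difference quotients of u, integrated against |r|:
  differentiation under the integral sign with an unbounded weight.\<close>

lemma tderiv_weighted_integral: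
  assumes d: "tderiv u u'" and u: "jcont u" and u': "jcont u'" and r: "r absolutely_integrable_on {0..l}"
  shows "tderiv (\<lambda>t x. integral {0..x} (\<lambda>y. u t y * r y)) (\<lambda>t x. integral {0..x} (\<lambda>y. u' t y * r y))"
  unfolding tderiv_def
proof (intro ballI)
  fix t x assume t: "t \<in> {0..T}" and x: "x \<in> {0..l}"
  define V where "V = integral {0..l} (\<lambda>y. \<bar>r y\<bar>)"
  have ab: "(\<lambda>y. \<bar>r y\<bar>) integrable_on {0..l}"
    using absolutely_integrable_abs[OF r] by (simp add: absolutely_integrable_on_def)
  have V0: "0 \<le> V" unfolding V_def by (rule integral_nonneg[OF ab]) auto
  have ai: "(\<lambda>y. u t y * r y) absolutely_integrable_on {0..l}" if "t \<in> {0..T}" for t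
    by (rule absolutely_integrable_continuous_mult[OF r jcont_slice[OF u that]])
  have ai': "(\<lambda>y. u' t y * r y) absolutely_integrable_on {0..l}"
    by (rule absolutely_integrable_continuous_mult[OF r jcont_slice[OF u' t]])
  let ?w = "\<lambda>t. integral {0..x} (\<lambda>y. u t y * r y)"
  let ?w' = "integral {0..x} (\<lambda>y. u' t y * r y)"
  have "((\<lambda>s. (?w s - ?w t) / (s - t)) \<longlongrightarrow> ?w') (at t within {0..T})"
    unfolding Lim_within
  proof (intro allI impI)
    fix e :: real assume e: "0 < e"
    have "0 < e / (V + 1)" using e V0 by simp
    then obtain d where d: "0 < d" "\<And>s x. s \<in> {0..T} \<Longrightarrow> s \<noteq> t \<Longrightarrow> \<bar>s - t\<bar> < d \<Longrightarrow> x \<in> {0..l} \<Longrightarrow>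
     \<bar>(u s x - u t x) / (s - t) - u' t x\<bar> \<le> e / (V + 1)" using tderiv_uniform[OF d u' t] by metis
    show "\<exists>d>0. \<forall>s\<in>{0..T}. 0 < dist s t \<and> dist s t < d \<longrightarrow> dist ((?w s - ?w t) / (s - t)) ?w' < e"
    proof (intro exI[of _ d] conjI ballI impI d(1))
      fix s assume s: "s \<in> {0..T}" and "0 < dist s t \<and> dist s t < d"
      then have sd: "s \<noteq> t" "\<bar>s - t\<bar> < d" by (auto simp: dist_real_def)
      let ?g = "\<lambda>y. (1 / (s - t)) * (u s y * r y - u t y * r y) - u' t y * r y"
      have gi: "?g absolutely_integrable_on {0..l}"
        by (intro set_integral_diff(1) set_integrable_mult_right ai ai' s t)
      have eq: "(?w s - ?w t) / (s - t) - ?w' = integral {0..x} ?g"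
      proof -
        have i: "(\<lambda>y. u s y * r y) integrable_on {0..x}" "(\<lambda>y. u t y * r y) integrable_on {0..x}" "(\<lambda>y. u' t y * r y) integrable_on {0..x}"
          using x by (auto intro!: absolutely_integrable_initial(2)[OF ai[OF s]] absolutely_integrable_initial(2)[OF ai[OF t]] absolutely_integrable_initial(2)[OF ai'])
        have e1: "integral {0..x} ?g = integral {0..x} (\<lambda>y. (1 / (s - t)) * (u s y * r y - u t y * r y)) - ?w'"
          by (rule integral_diff[OF integrable_on_mult_right[OF integrable_diff[OF i(1,2)]] i(3)])
        have e2: "integral {0..x} (\<lambda>y. (1 / (s - t)) * (u s y * r y - u t y * r y)) = (1 / (s - t)) * (?w s - ?w t)"
          unfolding integral_mult_right by (simp only: integral_diff[OF i(1,2)])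
        show ?thesis unfolding e1 e2 by simp
      qed
      have "\<bar>(?w s - ?w t) / (s - t) - ?w'\<bar> \<le> integral {0..l} (\<lambda>y. \<bar>?g y\<bar>)"
        unfolding eq using integral_initial_abs_le[OF gi] x by simp
      also have "\<dots> \<le> integral {0..l} (\<lambda>y. e / (V + 1) * \<bar>r y\<bar>)"
      proof (rule integral_le)
        show "(\<lambda>y. \<bar>?g y\<bar>) integrable_on {0..l}"
          using absolutely_integrable_norm[OF gi] by (simp add: o_def absolutely_integrable_on_def)
        show "(\<lambda>y. e / (V + 1) * \<bar>r y\<bar>) integrable_on {0..l}" by (intro integrable_on_mult_right ab)
        fix y assume y: "y \<in> {0..l}"
        have "?g y = ((u s y - u t y) / (s - t) - u' t y) * r y" using sd by (simp add: field_simps)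
        then have "\<bar>?g y\<bar> = \<bar>(u s y - u t y) / (s - t) - u' t y\<bar> * \<bar>r y\<bar>" by (simp add: abs_mult)
        also have "\<dots> \<le> e / (V + 1) * \<bar>r y\<bar>" using d(2)[OF s sd y] by (intro mult_right_mono) auto
        finally show "\<bar>?g y\<bar> \<le> e / (V + 1) * \<bar>r y\<bar>" .
      qed
      also have "\<dots> < e" using V0 e unfolding V_def[symmetric] by (simp add: V_def[symmetric] field_simps)
      finally show "dist ((?w s - ?w t) / (s - t)) ?w' < e" by (simp add: dist_real_def)
    qed
  qed
  then show "(?w has_real_derivative ?w') (at t within {0..T})" by (simp add: has_field_derivative_iff)
qed

lemma SC_weighted_integral:
  "SC k u \<Longrightarrow> r absolutely_integrable_on {0..l} \<Longrightarrow> SC k (\<lambda>t x. integral {0..x} (\<lambda>y. u t y * r y))"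
proof (induction k arbitrary: u)
  case 0 then show ?case by (simp add: jcont_weighted_integral)
next
  case (Suc k)
  then obtain u' where u': "tderiv u u'" "SC k u'" "jcont u" by auto
  show ?case
    by (rule SC_SucI[OF tderiv_weighted_integral[OF u'(1,3) SC_jcont[OF u'(2)] Suc.prems(2)] Suc.IH[OF u'(2) Suc.prems(2)]
          jcont_weighted_integral[OF u'(3) Suc.prems(2)]])
qed

lemma SC_integral: "SC k u \<Longrightarrow> SC k (\<lambda>t x. integral {0..x} (u t))"
  using SC_weighted_integral[of k u "\<lambda>_. 1"] continuous_absolutely_integrable[of l "\<lambda>_. 1"] by simp

lemma S_intros:
  "S (\<lambda>t x. c)" "continuous_on {0..l} a \<Longrightarrow> S (\<lambda>t. a)"
  "S u \<Longrightarrow> S v \<Longrightarrow> S (\<lambda>t x. u t x + v t x)" "S u \<Longrightarrow> S v \<Longrightarrow> S (\<lambda>t x. u t x * v t x)"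
  "S u \<Longrightarrow> x0 \<in> {0..l} \<Longrightarrow> S (\<lambda>t x. u t x0)" "S u \<Longrightarrow> S (\<lambda>t x. integral {0..x} (u t))"
  "S u \<Longrightarrow> r absolutely_integrable_on {0..l} \<Longrightarrow> S (\<lambda>t x. integral {0..x} (\<lambda>y. u t y * r y))"
  unfolding S_def using SC_const SC_static SC_add SC_mult SC_trace SC_integral SC_weighted_integral by auto

lemma SC_compose_time:
  "Ck_on k g0 A \<Longrightarrow> {0..T} \<subseteq> A \<Longrightarrow> SC k (\<lambda>t x. g0 t)"
proof (induction k arbitrary: g0)
  case 0
  then have "continuous_on {0..T} g0" by (auto intro: continuous_on_subset)
  then show ?case by (auto simp: jcont_def case_prod_unfold intro!: continuous_on_compose2[of "{0..T}" g0] continuous_intros)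
next
  case (Suc k)
  define g' where "g' t = frechet_derivative g0 (at t within A) 1" for t
  have d: "(g0 has_real_derivative g' t) (at t within {0..T})" if "t \<in> {0..T}" for t
  proof -
    have "g0 differentiable (at t within A)" using Suc.prems that by auto
    then have "(g0 has_real_derivative g' t) (at t within A)"
      unfolding g'_def by (rule has_real_derivative_frechet)
    then show ?thesis by (rule DERIV_subset) (rule Suc.prems)
  qed
  have "SC k (\<lambda>t x. g' t)" unfolding g'_def by (rule Suc.IH[OF _ Suc.prems(2)]) (use Suc.prems(1) in simp)
  moreover have "tderiv (\<lambda>t x. g0 t) (\<lambda>t x. g' t)" unfolding tderiv_def using d by auto
  moreover have "continuous_on {0..T} g0" using d by (meson DERIV_continuous continuous_on_eq_continuous_within)
  then have "jcont (\<lambda>t x. g0 t)"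
    by (auto simp: jcont_def case_prod_unfold intro!: continuous_on_compose2[of "{0..T}" g0] continuous_intros)
  ultimately show ?case by (rule_tac SC_SucI)
qed

lemma tderiv_compose2:
  assumes F: "\<And>p. p \<in> U \<Longrightarrow> F differentiable (at p within U)"
    and uv: "tderiv u u'" "tderiv v v'"
    and im: "\<And>t x. t \<in> {0..T} \<Longrightarrow> x \<in> {0..l} \<Longrightarrow> (u t x, v t x) \<in> U"
  shows "tderiv (\<lambda>t x. F (u t x, v t x))
     (\<lambda>t x. u' t x * frechet_derivative F (at (u t x, v t x) within U) (1, 0)
          + v' t x * frechet_derivative F (at (u t x, v t x) within U) (0, 1))"
  unfolding tderiv_def
proof (intro ballI)
  fix t x assume t: "t \<in> {0..T}" and x: "x \<in> {0..l}"
  show "((\<lambda>s. F (u s x, v s x)) has_real_derivative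
      (u' t x * frechet_derivative F (at (u t x, v t x) within U) (1, 0)
          + v' t x * frechet_derivative F (at (u t x, v t x) within U) (0, 1))) (at t within {0..T})"
    by (rule has_real_derivative_compose2[OF has_derivative_partials[OF F]])
       (use uv im t x in \<open>auto simp: tderiv_def\<close>)
qed

lemma SC_compose2:
  "Ck_on k F U \<Longrightarrow> SC k u \<Longrightarrow> SC k v \<Longrightarrow>
   (\<And>t x. t \<in> {0..T} \<Longrightarrow> x \<in> {0..l} \<Longrightarrow> (u t x, v t x) \<in> U) \<Longrightarrow> SC k (\<lambda>t x. F (u t x, v t x))"
proof (induction k arbitrary: F)
  case 0
  have "continuous_on ({0..T} \<times> {0..l}) (\<lambda>p. (u (fst p) (snd p), v (fst p) (snd p)))"
    using 0 unfolding jcont_def case_prod_unfold SC.simps by (intro continuous_on_Pair) auto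
  then have "continuous_on ({0..T} \<times> {0..l}) (\<lambda>p. F (u (fst p) (snd p), v (fst p) (snd p)))"
    by (rule continuous_on_compose2[rotated]) (use 0 in auto)
  then show ?case by (simp add: jcont_def case_prod_unfold)
next
  case (Suc k)
  obtain u' v' where d: "tderiv u u'" "SC k u'" "tderiv v v'" "SC k v'" using Suc.prems by auto
  have uv: "SC k u" "SC k v" using Suc.prems SC_mono by blast+
  have diff: "\<And>p. p \<in> U \<Longrightarrow> F differentiable (at p within U)" using Suc.prems by simp
  have Fd: "SC k (\<lambda>t x. frechet_derivative F (at (u t x, v t x) within U) e)" for e
    by (rule Suc.IH[OF _ uv Suc.prems(4)]) (use Suc.prems(1) in \<open>simp_all only: Ck_on.simps\<close>)
  have c: "continuous_on U F"
    using diff differentiable_imp_continuous_within continuous_on_eq_continuous_within by blast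
  have "continuous_on ({0..T} \<times> {0..l}) (\<lambda>p. (u (fst p) (snd p), v (fst p) (snd p)))"
    using SC_jcont[OF uv(1)] SC_jcont[OF uv(2)] unfolding jcont_def case_prod_unfold by (intro continuous_on_Pair) auto
  then have "continuous_on ({0..T} \<times> {0..l}) (\<lambda>p. F (u (fst p) (snd p), v (fst p) (snd p)))"
    by (rule continuous_on_compose2[OF c]) (use Suc.prems(4) in auto)
  then have j: "jcont (\<lambda>t x. F (u t x, v t x))" by (simp add: jcont_def case_prod_unfold)
  show ?case
    by (rule SC_SucI[OF tderiv_compose2[OF diff d(1,3) Suc.prems(4)] _ j])
       (assumption | intro SC_add SC_mult Fd d)+
qed

end

section \<open>Square-integrable functions on the interval\<close>

definition SI :: "real \<Rightarrow> (real \<Rightarrow> real) \<Rightarrow> bool" where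
  "SI l u \<longleftrightarrow> u \<in> borel_measurable (lebesgue_on {0..l}) \<and> (\<lambda>x. (u x)\<^sup>2) integrable_on {0..l}"

lemma measurable_nonneg_bounded_integrable:
  fixes f g :: "real \<Rightarrow> real"
  assumes "f \<in> borel_measurable (lebesgue_on {0..l})" "g integrable_on {0..l}"
    "\<And>x. x \<in> {0..l} \<Longrightarrow> \<bar>f x\<bar> \<le> g x"
  shows "f absolutely_integrable_on {0..l}"
  by (rule measurable_bounded_by_integrable_imp_absolutely_integrable[OF assms(1) _ assms(2)]) (use assms(3) in auto)

lemma SI_sq_integrable: "SI l u \<Longrightarrow> (\<lambda>x. (u x)\<^sup>2) integrable_on {0..l}"
  unfolding SI_def by blast

lemma SI_absolutely_integrable:
  assumes "SI l u"
  shows "u absolutely_integrable_on {0..l}"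
proof (rule measurable_nonneg_bounded_integrable)
  show "(\<lambda>x. 1 + (u x)\<^sup>2) integrable_on {0..l}"
    using assms unfolding SI_def by (intro integrable_add integrable_const_ivl) auto
  show "\<bar>u x\<bar> \<le> 1 + (u x)\<^sup>2" for x
    using sum_squares_ge_zero[of "\<bar>u x\<bar> - 1" 0] zero_le_power2[of "u x"]
    by (simp add: power2_eq_square algebra_simps abs_mult_self_eq)
qed (use assms in \<open>simp add: SI_def\<close>)

lemma SI_bounded_mult:
  assumes "SI l u" "a \<in> borel_measurable (lebesgue_on {0..l})" "\<And>x. x \<in> {0..l} \<Longrightarrow> \<bar>a x\<bar> \<le> M"
  shows "SI l (\<lambda>x. a x * u x)"
proof -
  have m: "(\<lambda>x. a x * u x) \<in> borel_measurable (lebesgue_on {0..l})"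
    using assms unfolding SI_def by (intro borel_measurable_times) auto
  have "(\<lambda>x. (a x * u x)\<^sup>2) absolutely_integrable_on {0..l}"
  proof (rule measurable_nonneg_bounded_integrable)
    show "(\<lambda>x. (a x * u x)\<^sup>2) \<in> borel_measurable (lebesgue_on {0..l})" using m by (rule borel_measurable_power)
    show "(\<lambda>x. M\<^sup>2 * (u x)\<^sup>2) integrable_on {0..l}" using assms unfolding SI_def by (intro integrable_on_mult_right) auto
    fix x assume "x \<in> {0..l}"
    then have "(a x)\<^sup>2 \<le> M\<^sup>2" using assms(3) by (metis abs_ge_zero order_trans power2_abs power_mono)
    then show "\<bar>(a x * u x)\<^sup>2\<bar> \<le> M\<^sup>2 * (u x)\<^sup>2" by (simp add: power_mult_distrib mult_right_mono)
  qed
  then show ?thesis using m unfolding SI_def absolutely_integrable_on_def by blast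
qed

lemma continuous_measurable:
  fixes a :: "real \<Rightarrow> real"
  shows "continuous_on {0..l} a \<Longrightarrow> a \<in> borel_measurable (lebesgue_on {0..l})"
  by (rule continuous_imp_measurable_on_sets_lebesgue) auto

lemma SI_continuous_mult:
  assumes "SI l u" "continuous_on {0..l} a"
  shows "SI l (\<lambda>x. a x * u x)"
proof -
  obtain M where "\<And>x. x \<in> {0..l} \<Longrightarrow> \<bar>a x\<bar> \<le> M"
    using continuous_on_compact_bound_abs[OF assms(2) compact_Icc] by metis
  then show ?thesis using SI_bounded_mult[OF assms(1) continuous_measurable[OF assms(2)]] by blast
qed

lemma SI_add:
  assumes "SI l u" "SI l v"
  shows "SI l (\<lambda>x. u x + v x)"
proof -
  have m: "(\<lambda>x. u x + v x) \<in> borel_measurable (lebesgue_on {0..l})"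
    using assms unfolding SI_def by (intro borel_measurable_add) auto
  have "(\<lambda>x. (u x + v x)\<^sup>2) absolutely_integrable_on {0..l}"
  proof (rule measurable_nonneg_bounded_integrable)
    show "(\<lambda>x. (u x + v x)\<^sup>2) \<in> borel_measurable (lebesgue_on {0..l})" using m by (rule borel_measurable_power)
    show "(\<lambda>x. 2 * (u x)\<^sup>2 + 2 * (v x)\<^sup>2) integrable_on {0..l}"
      using assms unfolding SI_def by (intro integrable_add integrable_on_mult_right) auto
    show "\<bar>(u x + v x)\<^sup>2\<bar> \<le> 2 * (u x)\<^sup>2 + 2 * (v x)\<^sup>2" for x
    proof -
      have "(u x + v x)\<^sup>2 + (u x - v x)\<^sup>2 = 2 * (u x)\<^sup>2 + 2 * (v x)\<^sup>2"
        by (simp add: power2_eq_square algebra_simps)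
      then show ?thesis using zero_le_power2[of "u x - v x"] unfolding abs_power2 by linarith
    qed
  qed
  then show ?thesis using m unfolding SI_def absolutely_integrable_on_def by blast
qed

lemma SI_continuous: "continuous_on {0..l} a \<Longrightarrow> SI l a"
  unfolding SI_def
  by (auto intro!: continuous_measurable integrable_continuous_interval continuous_intros)

lemma SI_cmult: "SI l u \<Longrightarrow> SI l (\<lambda>x. k * u x)"
  using SI_continuous_mult[of l u "\<lambda>_. k"] by simp

lemma SI_diff: "SI l u \<Longrightarrow> SI l v \<Longrightarrow> SI l (\<lambda>x. u x - v x)"
  using SI_add[of l u "\<lambda>x. -1 * v x"] SI_cmult[of l v "-1"] by simp

lemma SI_cong: "(\<And>x. x \<in> {0..l} \<Longrightarrow> u x = v x) \<Longrightarrow> SI l u \<Longrightarrow> SI l v"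
  unfolding SI_def using measurable_cong[of "lebesgue_on {0..l}" u v borel]
    integrable_cong[of "{0..l}" "\<lambda>x. (u x)\<^sup>2" "\<lambda>x. (v x)\<^sup>2"] by (auto simp: space_restrict_space)

text \<open>Young's inequality 2 s |u| <= u^2 + s^2, integrated. With s chosen in proportion to the
  size of u it does the work of the Cauchy-Schwarz inequality.\<close>

lemma SI_integral_abs_le:
  assumes "SI l u" "0 < s" "0 \<le> l"
  shows "integral {0..l} (\<lambda>x. \<bar>u x\<bar>) \<le> integral {0..l} (\<lambda>x. (u x)\<^sup>2) / (2 * s) + s * l / 2"
proof -
  have ab: "(\<lambda>x. \<bar>u x\<bar>) integrable_on {0..l}"
    using absolutely_integrable_norm[OF SI_absolutely_integrable[OF assms(1)]] by (simp add: o_def absolutely_integrable_on_def)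
  have sq: "(\<lambda>x. 1 / (2 * s) * (u x)\<^sup>2) integrable_on {0..l}" using assms(1) unfolding SI_def by (intro integrable_on_mult_right) auto
  have "integral {0..l} (\<lambda>x. \<bar>u x\<bar>) \<le> integral {0..l} (\<lambda>x. 1 / (2 * s) * (u x)\<^sup>2 + s / 2)"
  proof (rule integral_le[OF ab])
    show "(\<lambda>x. 1 / (2 * s) * (u x)\<^sup>2 + s / 2) integrable_on {0..l}"
      by (intro integrable_add sq integrable_const_ivl)
    show "\<bar>u x\<bar> \<le> 1 / (2 * s) * (u x)\<^sup>2 + s / 2" for x
    proof -
      have "0 \<le> (\<bar>u x\<bar> - s)\<^sup>2" by simp
      then have "2 * s * \<bar>u x\<bar> \<le> (u x)\<^sup>2 + s\<^sup>2" by (simp add: power2_diff algebra_simps)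
      then show ?thesis using assms(2) by (simp add: field_simps power2_eq_square)
    qed
  qed
  also have "\<dots> = 1 / (2 * s) * integral {0..l} (\<lambda>x. (u x)\<^sup>2) + s / 2 * l"
    using assms(3) by (subst integral_add[OF sq integrable_const_ivl]) simp
  finally show ?thesis by simp
qed

section \<open>Fields that are smooth in time with values in Sobolev spaces\<close>

locale rect_rho = rect +
  fixes r1 r2 :: "real \<Rightarrow> real"
  assumes r1: "SI l r1" and r2: "SI l r2"
begin

lemmas r_ai = SI_absolutely_integrable[OF r1] SI_absolutely_integrable[OF r2]

text \<open>\<open>R m\<close> models \<open>C\<^sup>\<infinity>([0,T]; H\<^sup>m(0,l))\<close>.  The only \<open>L\<^sup>2\<close> functions that occur as
  highest derivatives are combinations of \<open>1\<close>, \<open>r1\<close>, \<open>r2\<close> (in the application the highest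
  derivatives of the data) with coefficients that are continuous in space; this reduces evolution
  in \<open>L\<^sup>2\<close> to evolution of the coefficients.\<close>

primrec R :: "nat \<Rightarrow> (real \<Rightarrow> real \<Rightarrow> real) \<Rightarrow> bool" where
  "R 0 u \<longleftrightarrow> (\<exists>M0 M1 M2. S M0 \<and> S M1 \<and> S M2 \<and>
     (\<forall>t\<in>{0..T}. \<forall>x\<in>{0..l}. u t x = M0 t x + M1 t x * r1 x + M2 t x * r2 x))"
| "R (Suc m) u \<longleftrightarrow> S u \<and> (\<exists>v. R m v \<and> (\<forall>t\<in>{0..T}. primitive l (u t) (v t)))"

text \<open>For m > 0 membership in \<open>R m\<close> already implies \<open>S\<close>; the second
  conjunct matters for m = 0, where it removes the square-integrable parts. \<open>R 0\<close> is
  not closed under products but is a module over \<open>RS 0\<close>, and in general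
  \<open>R m\<close> is one over \<open>RS m\<close>, which is an algebra.\<close>

definition RS :: "nat \<Rightarrow> (real \<Rightarrow> real \<Rightarrow> real) \<Rightarrow> bool" where
  "RS m u \<longleftrightarrow> R m u \<and> S u"

lemma R_cong:
  assumes "\<And>t x. t \<in> {0..T} \<Longrightarrow> x \<in> {0..l} \<Longrightarrow> u t x = v t x" "R m u"
  shows "R m v"
proof (cases m)
  case 0 then show ?thesis using assms by (metis R.simps(1))
next
  case (Suc n)
  then obtain w where w: "S u" "R n w" "\<And>t. t\<in>{0..T} \<Longrightarrow> primitive l (u t) (w t)" using assms(2) by auto
  have "primitive l (v t) (w t)" if "t \<in> {0..T}" for t
    using w(3)[OF that] primitive_cong[of l "u t" "v t" "w t" "w t"] assms(1) that l_pos by simp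
  then show ?thesis using S_cong[OF assms(1) w(1)] w(2) Suc by auto
qed

lemma S_R0: "S u \<Longrightarrow> R 0 u"
  unfolding R.simps by (rule exI[of _ u], rule exI[of _ "\<lambda>t x. 0"], rule exI[of _ "\<lambda>t x. 0"]) (auto intro: S_intros)

lemma R_Suc_S: "R (Suc m) u \<Longrightarrow> S u" by simp

lemma R_mono: "R (Suc m) u \<Longrightarrow> R m u"
proof (induction m arbitrary: u)
  case 0 then show ?case using S_R0 R_Suc_S by blast
next
  case (Suc m) then show ?case by (metis R.simps(2))
qed

lemma RS_Suc: "RS (Suc m) u \<longleftrightarrow> R (Suc m) u" unfolding RS_def by auto

lemma RS_mono: "RS (Suc m) u \<Longrightarrow> RS m u" unfolding RS_def using R_mono by blast

lemma RS_0: "RS 0 u \<longleftrightarrow> S u" unfolding RS_def using S_R0 by blast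

lemma RS_SucE:
  assumes "RS (Suc m) u"
  obtains v where "R m v" "\<And>t. t\<in>{0..T} \<Longrightarrow> primitive l (u t) (v t)" "RS m u"
  using assms RS_mono[OF assms] RS_Suc R.simps(2) by metis

lemma R_SucI: "S u \<Longrightarrow> R m v \<Longrightarrow> (\<And>t. t\<in>{0..T} \<Longrightarrow> primitive l (u t) (v t)) \<Longrightarrow> R (Suc m) u"
  by auto

lemma R0_SI:
  assumes "R 0 u" "t \<in> {0..T}"
  shows "SI l (u t)"
proof -
  obtain M0 M1 M2 where M: "S M0" "S M1" "S M2"
    "\<And>x. x\<in>{0..l} \<Longrightarrow> u t x = M0 t x + M1 t x * r1 x + M2 t x * r2 x" using assms by auto
  have "SI l (\<lambda>x. M0 t x + M1 t x * r1 x + M2 t x * r2 x)"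
    by (intro SI_add SI_continuous SI_continuous_mult r1 r2 jcont_slice[OF S_jcont] M assms)
  then show ?thesis by (rule SI_cong[rotated]) (simp add: M)
qed

lemma R_SI: "R m u \<Longrightarrow> t \<in> {0..T} \<Longrightarrow> SI l (u t)"
  by (cases m) (blast intro: R0_SI SI_continuous jcont_slice[OF S_jcont] R_Suc_S)+

lemma R_ai: "R m u \<Longrightarrow> t \<in> {0..T} \<Longrightarrow> u t absolutely_integrable_on {0..l}"
  using R_SI SI_absolutely_integrable by blast

lemma R0E:
  assumes "R 0 u"
  obtains M0 M1 M2 where "S M0" "S M1" "S M2"
    "\<And>t x. t \<in> {0..T} \<Longrightarrow> x \<in> {0..l} \<Longrightarrow> u t x = M0 t x + M1 t x * r1 x + M2 t x * r2 x"
  using assms by auto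

lemma R0I:
  assumes "S M0" "S M1" "S M2"
    "\<And>t x. t \<in> {0..T} \<Longrightarrow> x \<in> {0..l} \<Longrightarrow> u t x = M0 t x + M1 t x * r1 x + M2 t x * r2 x"
  shows "R 0 u"
  using assms by auto

lemma R_add: "R m u \<Longrightarrow> R m v \<Longrightarrow> R m (\<lambda>t x. u t x + v t x)"
proof (induction m arbitrary: u v)
  case 0
  obtain M0 M1 M2 where M: "S M0" "S M1" "S M2"
    "\<And>t x. t \<in> {0..T} \<Longrightarrow> x \<in> {0..l} \<Longrightarrow> u t x = M0 t x + M1 t x * r1 x + M2 t x * r2 x"
    using R0E[OF 0(1)] by blast
  obtain N0 N1 N2 where N: "S N0" "S N1" "S N2"
    "\<And>t x. t \<in> {0..T} \<Longrightarrow> x \<in> {0..l} \<Longrightarrow> v t x = N0 t x + N1 t x * r1 x + N2 t x * r2 x"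
    using R0E[OF 0(2)] by blast
  show ?case
    by (rule R0I[OF S_intros(3)[OF M(1) N(1)] S_intros(3)[OF M(2) N(2)] S_intros(3)[OF M(3) N(3)]])
       (simp add: M(4) N(4) distrib_right)
next
  case (Suc m)
  then obtain u' v' where a: "S u" "S v" "R m u'" "R m v'"
    "\<And>t. t\<in>{0..T} \<Longrightarrow> primitive l (u t) (u' t)" "\<And>t. t\<in>{0..T} \<Longrightarrow> primitive l (v t) (v' t)" by auto
  show ?case by (rule R_SucI[OF S_intros(3)[OF a(1,2)] Suc.IH[OF a(3,4)]]) (intro primitive_add a)
qed

lemma R_mult: "R m u \<Longrightarrow> RS m v \<Longrightarrow> R m (\<lambda>t x. u t x * v t x)"
proof (induction m arbitrary: u v)
  case 0
  obtain M0 M1 M2 where M: "S M0" "S M1" "S M2"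
    "\<And>t x. t \<in> {0..T} \<Longrightarrow> x \<in> {0..l} \<Longrightarrow> u t x = M0 t x + M1 t x * r1 x + M2 t x * r2 x"
    using R0E[OF 0(1)] by blast
  have v: "S v" using 0(2) by (simp only: RS_0)
  show ?case
    by (rule R0I[OF S_intros(4)[OF M(1) v] S_intros(4)[OF M(2) v] S_intros(4)[OF M(3) v]])
       (simp add: M(4) algebra_simps)
next
  case (Suc m)
  have "RS (Suc m) u" using Suc.prems RS_Suc by blast
  then obtain u' where u: "R m u'" "\<And>t. t\<in>{0..T} \<Longrightarrow> primitive l (u t) (u' t)" "RS m u" by (rule RS_SucE) blast
  obtain v' where v: "R m v'" "\<And>t. t\<in>{0..T} \<Longrightarrow> primitive l (v t) (v' t)" "RS m v" using Suc.prems(2) by (rule RS_SucE) blast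
  have a: "R m (\<lambda>t x. u' t x * v t x)" by (rule Suc.IH[OF u(1) v(3)])
  have "R m (\<lambda>t x. v' t x * u t x)" by (rule Suc.IH[OF v(1) u(3)])
  then have b: "R m (\<lambda>t x. u t x * v' t x)" by (simp add: mult.commute)
  show ?case
  proof (rule R_SucI[OF _ R_add[OF a b]])
    show "S (\<lambda>t x. u t x * v t x)" using u(3) v(3) S_intros(4) unfolding RS_def by blast
  qed (intro primitive_mult u v less_imp_le[OF l_pos])
qed

lemma RS_add: "RS m u \<Longrightarrow> RS m v \<Longrightarrow> RS m (\<lambda>t x. u t x + v t x)"
  unfolding RS_def using R_add S_intros(3) by blast

lemma RS_mult: "RS m u \<Longrightarrow> RS m v \<Longrightarrow> RS m (\<lambda>t x. u t x * v t x)"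
  using R_mult[of m u v] S_intros(4) unfolding RS_def by blast

lemma R_integral: "R m u \<Longrightarrow> R (Suc m) (\<lambda>t x. integral {0..x} (u t))"
proof (rule R_SucI)
  assume u: "R m u"
  show "primitive l (\<lambda>x. integral {0..x} (u t)) (u t)" if "t \<in> {0..T}" for t
    using primitive_integral[OF R_ai[OF u that], of 0] by simp
  show "S (\<lambda>t x. integral {0..x} (u t))"
  proof (cases m)
    case 0
    then obtain M0 M1 M2 where M: "S M0" "S M1" "S M2"
      "\<And>t x. t\<in>{0..T} \<Longrightarrow> x\<in>{0..l} \<Longrightarrow> u t x = M0 t x + M1 t x * r1 x + M2 t x * r2 x" using u by auto
    have "S (\<lambda>t x. integral {0..x} (M0 t) + integral {0..x} (\<lambda>x. M1 t x * r1 x) + integral {0..x} (\<lambda>x. M2 t x * r2 x))"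
      by (intro S_intros M r_ai)
    then show ?thesis
    proof (rule S_cong[rotated])
      fix t x assume t: "t \<in> {0..T}" and x: "x \<in> {0..l}"
      have i: "M0 t integrable_on {0..x}" "(\<lambda>x. M1 t x * r1 x) integrable_on {0..x}" "(\<lambda>x. M2 t x * r2 x) integrable_on {0..x}"
        using x absolutely_integrable_initial(2)[OF continuous_absolutely_integrable[OF jcont_slice[OF S_jcont[OF M(1)] t]], of x]
          absolutely_integrable_initial(2)[OF absolutely_integrable_continuous_mult[OF r_ai(1) jcont_slice[OF S_jcont[OF M(2)] t]], of x]
          absolutely_integrable_initial(2)[OF absolutely_integrable_continuous_mult[OF r_ai(2) jcont_slice[OF S_jcont[OF M(3)] t]], of x]
        by auto
      have "integral {0..x} (u t) = integral {0..x} (\<lambda>x. M0 t x + M1 t x * r1 x + M2 t x * r2 x)"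
        by (rule integral_cong) (use M(4)[OF t] x in auto)
      also have "\<dots> = integral {0..x} (M0 t) + integral {0..x} (\<lambda>x. M1 t x * r1 x) + integral {0..x} (\<lambda>x. M2 t x * r2 x)"
        by (simp only: integral_add[OF integrable_add[OF i(1,2)] i(3)] integral_add[OF i(1,2)])
      finally show "integral {0..x} (M0 t) + integral {0..x} (\<lambda>x. M1 t x * r1 x) + integral {0..x} (\<lambda>x. M2 t x * r2 x) = integral {0..x} (u t)" by simp
    qed
  next
    case (Suc n) then show ?thesis using u S_intros(6) by auto
  qed
qed

lemma RS_integral: "RS m u \<Longrightarrow> RS m (\<lambda>t x. integral {0..x} (u t))"
  using R_integral[of m u] R_mono unfolding RS_def by (auto simp del: R.simps(2) intro: S_intros)

lemma R_time_only: "S (\<lambda>t x. a t) \<Longrightarrow> R m (\<lambda>t x. a t)"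
proof (induction m arbitrary: a)
  case 0 then show ?case using S_R0 by blast
next
  case (Suc m)
  have "R m (\<lambda>t x. 0)" using Suc.IH[of "\<lambda>_. 0"] S_intros(1) by blast
  then show ?case using R_SucI[OF Suc.prems] primitive_const by blast
qed

lemma RS_time_only: "S (\<lambda>t x. a t) \<Longrightarrow> RS m (\<lambda>t x. a t)"
  unfolding RS_def using R_time_only by blast

lemma RS_const: "RS m (\<lambda>t x. c)" by (rule RS_time_only[OF S_intros(1)])

lemma RS_trace: "RS m u \<Longrightarrow> x0 \<in> {0..l} \<Longrightarrow> RS m (\<lambda>t x. u t x0)"
  by (rule RS_time_only) (auto simp: RS_def intro: S_intros)

lemma RS_inverse:
  assumes "0 < d" "\<And>t x. t \<in> {0..T} \<Longrightarrow> x \<in> {0..l} \<Longrightarrow> d \<le> u t x" "RS m u"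
  shows "RS m (\<lambda>t x. 1 / u t x)"
  using assms(3)
proof (induction m)
  case 0
  have "u t x \<noteq> 0" if "t \<in> {0..T}" "x \<in> {0..l}" for t x using assms(1,2) that by force
  then show ?case using 0 SC_inverse unfolding RS_0 S_def by blast
next
  case (Suc m)
  obtain u' where u: "R m u'" "\<And>t. t\<in>{0..T} \<Longrightarrow> primitive l (u t) (u' t)" "RS m u" using Suc.prems by (rule RS_SucE) blast
  have i: "RS m (\<lambda>t x. 1 / u t x)" using Suc.IH u(3) by blast
  have r: "R m (\<lambda>t x. u' t x * (-1 * ((1 / u t x) * (1 / u t x))))"
    by (intro R_mult u(1) RS_mult i RS_const)
  have "R (Suc m) (\<lambda>t x. 1 / u t x)"
  proof (rule R_SucI[OF _ r])
    show "S (\<lambda>t x. 1 / u t x)" using i unfolding RS_def by blast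
    fix t assume t: "t \<in> {0..T}"
    have "primitive l (\<lambda>x. 1 / u t x) (\<lambda>x. - (u' t x * (1 / u t x) * (1 / u t x)))"
      using primitive_inverse[OF u(2)[OF t] _ assms(1)] assms(2) t l_pos by simp
    then show "primitive l (\<lambda>x. 1 / u t x) (\<lambda>x. u' t x * (-1 * ((1 / u t x) * (1 / u t x))))" by simp
  qed
  then show ?case by (simp only: RS_Suc)
qed

text \<open>The difference quotients of c at time t converge to c' in the mean square on (0,l). This
  is the contribution of one space derivative to differentiability in a Sobolev norm.\<close>

definition hconv :: "(real \<Rightarrow> real \<Rightarrow> real) \<Rightarrow> (real \<Rightarrow> real \<Rightarrow> real) \<Rightarrow> real \<Rightarrow> bool" where
  "hconv c c' t \<longleftrightarrow>
    ((\<lambda>s. integral {0..l} (\<lambda>x. ((c s x - c t x) / (s - t) - c' t x)\<^sup>2)) \<longlongrightarrow> 0) (at t within {0..T})"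

lemma hconv_R0:
  assumes M: "\<And>i. i < 3 \<Longrightarrow> S (M i)" "\<And>i. i < 3 \<Longrightarrow> S (M' i)" "\<And>i. i < 3 \<Longrightarrow> tderiv (M i) (M' i)"
    and u: "\<And>t x. t\<in>{0..T} \<Longrightarrow> x\<in>{0..l} \<Longrightarrow> u t x = M 0 t x + M 1 t x * r1 x + M (2::nat) t x * r2 x"
    and u': "\<And>t x. t\<in>{0..T} \<Longrightarrow> x\<in>{0..l} \<Longrightarrow> u' t x = M' 0 t x + M' 1 t x * r1 x + M' (2::nat) t x * r2 x"
    and t: "t \<in> {0..T}"
  shows "hconv u u' t"
  unfolding hconv_def Lim_within
proof (intro allI impI)
  fix e :: real assume e: "0 < e"
  \<comment> \<open>Once the three coefficient quotients are within e1 of their limits, (a + b +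
    c)^2 <= 3 (a^2 + b^2 + c^2) bounds the integral by e1^2 K. The value of e1 below is chosen so
    that e1^2 K < e.\<close>
  define K where "K = integral {0..l} (\<lambda>x. 3 * (1 + (r1 x)\<^sup>2 + (r2 x)\<^sup>2))"
  have iK: "(\<lambda>x. 3 * (1 + (r1 x)\<^sup>2 + (r2 x)\<^sup>2)) integrable_on {0..l}"
    by (intro integrable_on_mult_right integrable_add integrable_const_ivl SI_sq_integrable r1 r2)
  have K0: "0 \<le> K" unfolding K_def by (rule integral_nonneg[OF iK]) auto
  define e1 where "e1 = sqrt (e / (2 * (K + 1)))"
  have e1: "0 < e1" "e1\<^sup>2 = e / (2 * (K + 1))" unfolding e1_def using e K0 by auto
  have "\<exists>d>0. \<forall>s x. s \<in> {0..T} \<longrightarrow> s \<noteq> t \<longrightarrow> \<bar>s - t\<bar> < d \<longrightarrow> x \<in> {0..l} \<longrightarrow>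
     \<bar>(M i s x - M i t x) / (s - t) - M' i t x\<bar> \<le> e1" if "i < 3" for i
    using tderiv_uniform[OF M(3)[OF that] S_jcont[OF M(2)[OF that]] t e1(1)] by metis
  then obtain d where d: "\<And>i. i < 3 \<Longrightarrow> 0 < d i" "\<And>i s x. i < 3 \<Longrightarrow> s \<in> {0..T} \<Longrightarrow> s \<noteq> t \<Longrightarrow> \<bar>s - t\<bar> < d i \<Longrightarrow> x \<in> {0..l} \<Longrightarrow>
     \<bar>(M i s x - M i t x) / (s - t) - M' i t x\<bar> \<le> e1" by metis
  define d0 where "d0 = min (d 0) (min (d 1) (d 2))"
  show "\<exists>d>0. \<forall>s\<in>{0..T}. 0 < dist s t \<and> dist s t < d \<longrightarrow>
     dist (integral {0..l} (\<lambda>x. ((u s x - u t x) / (s - t) - u' t x)\<^sup>2)) 0 < e"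
  proof (intro exI[of _ d0] conjI ballI impI)
    show "0 < d0" unfolding d0_def using d(1) by simp
    fix s assume s: "s \<in> {0..T}" and "0 < dist s t \<and> dist s t < d0"
    then have sd: "s \<noteq> t" "\<bar>s - t\<bar> < d 0" "\<bar>s - t\<bar> < d 1" "\<bar>s - t\<bar> < d 2" by (auto simp: dist_real_def d0_def)
    define Q where "Q i x = (M i s x - M i t x) / (s - t) - M' i t x" for i x
    have Qc: "continuous_on {0..l} (Q i)" if "i < 3" for i
      unfolding Q_def using sd(1) jcont_slice[OF S_jcont[OF M(1)[OF that]]] jcont_slice[OF S_jcont[OF M(2)[OF that]]] s t
      by (intro continuous_intros) auto
    have Qb: "\<bar>Q i x\<bar> \<le> e1" if "i < 3" "x \<in> {0..l}" for i x
    proof -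
      have "\<bar>s - t\<bar> < d i" using sd that(1) by (auto simp: less_Suc_eq numeral_3_eq_3 numeral_2_eq_2)
      then show ?thesis unfolding Q_def using d(2) that s sd(1) by blast
    qed
    have eq: "(u s x - u t x) / (s - t) - u' t x = Q 0 x + Q 1 x * r1 x + Q 2 x * r2 x" if "x \<in> {0..l}" for x
      unfolding Q_def u[OF s that] u[OF t that] u'[OF t that]
      by (simp add: add_divide_distrib diff_divide_distrib algebra_simps)
    have SIQ: "SI l (\<lambda>x. Q 0 x + Q 1 x * r1 x + Q 2 x * r2 x)"
      by (intro SI_add SI_continuous SI_continuous_mult r1 r2 Qc) auto
    have le: "(Q 0 x + Q 1 x * r1 x + Q 2 x * r2 x)\<^sup>2 \<le> e1\<^sup>2 * (3 * (1 + (r1 x)\<^sup>2 + (r2 x)\<^sup>2))" if x: "x \<in> {0..l}" for x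
    proof -
      have sq: "(Q i x)\<^sup>2 \<le> e1\<^sup>2" if "i < 3" for i using Qb[OF that x] by (metis abs_ge_zero power2_abs power_mono)
      have three: "(a + b + c)\<^sup>2 \<le> 3 * (a\<^sup>2 + b\<^sup>2 + c\<^sup>2)" for a b c :: real
        using zero_le_power2[of "a - b"] zero_le_power2[of "a - c"] zero_le_power2[of "b - c"]
        by (simp add: power2_eq_square algebra_simps)
      have "(Q 0 x + Q 1 x * r1 x + Q 2 x * r2 x)\<^sup>2 \<le> 3 * ((Q 0 x)\<^sup>2 + (Q 1 x)\<^sup>2 * (r1 x)\<^sup>2 + (Q 2 x)\<^sup>2 * (r2 x)\<^sup>2)"
        using three[of "Q 0 x" "Q 1 x * r1 x" "Q 2 x * r2 x"] by (simp add: power_mult_distrib)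
      also have "\<dots> \<le> 3 * (e1\<^sup>2 + e1\<^sup>2 * (r1 x)\<^sup>2 + e1\<^sup>2 * (r2 x)\<^sup>2)"
        by (intro mult_left_mono add_mono mult_right_mono sq) auto
      finally show ?thesis by (simp add: algebra_simps)
    qed
    have "integral {0..l} (\<lambda>x. ((u s x - u t x) / (s - t) - u' t x)\<^sup>2) = integral {0..l} (\<lambda>x. (Q 0 x + Q 1 x * r1 x + Q 2 x * r2 x)\<^sup>2)"
      by (rule integral_cong) (simp only: eq)
    moreover have "\<dots> \<le> integral {0..l} (\<lambda>x. e1\<^sup>2 * (3 * (1 + (r1 x)\<^sup>2 + (r2 x)\<^sup>2)))"
      by (rule integral_le[OF SI_sq_integrable[OF SIQ] integrable_on_mult_right[OF iK] le])
    moreover have "\<dots> = e1\<^sup>2 * K" unfolding K_def by (rule integral_mult_right)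
    moreover have "\<dots> < e"
    proof -
      have "e * K < e * (2 * (K + 1))" using e K0 by (intro mult_strict_left_mono) auto
      then show ?thesis unfolding e1(2) using K0 by (simp add: divide_less_eq)
    qed
    moreover have "0 \<le> integral {0..l} (\<lambda>x. (Q 0 x + Q 1 x * r1 x + Q 2 x * r2 x)\<^sup>2)"
      by (rule integral_nonneg[OF SI_sq_integrable[OF SIQ]]) auto
    ultimately show "dist (integral {0..l} (\<lambda>x. ((u s x - u t x) / (s - t) - u' t x)\<^sup>2)) 0 < e"
      unfolding dist_real_def diff_0_right by linarith
  qed
qed

lemma hconv_S:
  assumes "S u" "tderiv u u'" "t \<in> {0..T}"
  shows "hconv u u' t"
  by (rule hconv_R0[where M="\<lambda>i. if i = 0 then u else (\<lambda>t x. 0)" and M'="\<lambda>i. if i = 0 then u' else (\<lambda>t x. 0)"])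
     (use assms S_tderivD[OF assms(1,2)] in \<open>auto intro: S_intros tderiv_static\<close>)

lemma hconv_integral:
  assumes h: "hconv c c' t" and SIc: "\<And>t. t \<in> {0..T} \<Longrightarrow> SI l (c t)" "SI l (c' t)" and t: "t \<in> {0..T}" and x: "x \<in> {0..l}"
  shows "((\<lambda>s. integral {0..x} (c s)) has_real_derivative integral {0..x} (c' t)) (at t within {0..T})"
  unfolding has_field_derivative_iff Lim_within
proof (intro allI impI)
  fix e :: real assume e: "0 < e"
  \<comment> \<open>With this parameter in \<open>SI_integral_abs_le\<close> and the mean square
    below \<open>e * s0\<close>, each of the two summands of the bound is at most e / 2.\<close>
  define s0 where "s0 = e / (l + 1)"
  have s0: "0 < s0" unfolding s0_def using e l_pos by simp
  obtain d where d: "0 < d" "\<And>s. s\<in>{0..T} \<Longrightarrow> 0 < dist s t \<Longrightarrow> dist s t < d \<Longrightarrow>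
     dist (integral {0..l} (\<lambda>x. ((c s x - c t x) / (s - t) - c' t x)\<^sup>2)) 0 < e * s0"
  proof -
    have "0 < e * s0" using e s0 by simp
    then show ?thesis using h that unfolding hconv_def Lim_within by blast
  qed
  let ?w = "\<lambda>s. integral {0..x} (c s)" and ?w' = "integral {0..x} (c' t)"
  show "\<exists>d>0. \<forall>s\<in>{0..T}. 0 < dist s t \<and> dist s t < d \<longrightarrow> dist ((?w s - ?w t) / (s - t)) ?w' < e"
  proof (intro exI[of _ d] conjI ballI impI d(1))
    fix s assume s: "s \<in> {0..T}" and sd: "0 < dist s t \<and> dist s t < d"
    let ?Q = "\<lambda>x. (1 / (s - t)) * (c s x - c t x) - c' t x"
    have SIQ: "SI l ?Q" by (intro SI_diff SI_cmult SIc s t)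
    have i: "c s integrable_on {0..x}" "c t integrable_on {0..x}" "c' t integrable_on {0..x}"
      using x by (auto intro!: absolutely_integrable_initial(2)[where l=l] SI_absolutely_integrable SIc s t)
    have e1: "integral {0..x} ?Q = integral {0..x} (\<lambda>y. (1 / (s - t)) * (c s y - c t y)) - ?w'"
      by (rule integral_diff[OF integrable_on_mult_right[OF integrable_diff[OF i(1,2)]] i(3)])
    have e2: "integral {0..x} (\<lambda>y. (1 / (s - t)) * (c s y - c t y)) = (1 / (s - t)) * (?w s - ?w t)"
      unfolding integral_mult_right by (simp only: integral_diff[OF i(1,2)])
    have "\<bar>(?w s - ?w t) / (s - t) - ?w'\<bar> = \<bar>integral {0..x} ?Q\<bar>" unfolding e1 e2 by simp
    moreover have "\<dots> \<le> integral {0..l} (\<lambda>y. \<bar>?Q y\<bar>)"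
      using integral_initial_abs_le[OF SI_absolutely_integrable[OF SIQ]] x by simp
    moreover have "\<dots> \<le> integral {0..l} (\<lambda>x. (?Q x)\<^sup>2) / (2 * s0) + s0 * l / 2"
      by (rule SI_integral_abs_le[OF SIQ s0]) (use l_pos in simp)
    moreover have "integral {0..l} (\<lambda>x. (?Q x)\<^sup>2) < e * s0" using d(2)[OF s] sd by (simp add: dist_real_def)
    then have "integral {0..l} (\<lambda>x. (?Q x)\<^sup>2) / (2 * s0) < e / 2" using s0 by (simp add: field_simps)
    moreover have "s0 * l / 2 \<le> e / 2" unfolding s0_def using e l_pos by (simp add: field_simps)
    ultimately show "dist ((?w s - ?w t) / (s - t)) ?w' < e" by (simp add: dist_real_def)
  qed
qed

text \<open>\<open>c j\<close> is the j-th space derivative of u and \<open>c' j\<close> that of its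
  time derivative. In the induction u is \<open>u t 0\<close> plus the integral of
  \<open>c 0\<close>; differentiating this identity in time, with \<open>hconv_integral\<close>
  under the integral sign, shows that the two kinds of derivative commute. The last member of the
  chain need not be continuous in x, hence the mean square notion \<open>hconv\<close>.\<close>

lemma R_time_chain:
  "R m u \<Longrightarrow> \<exists>c c'. (\<forall>t\<in>{0..T}. \<forall>x\<in>{0..l}. c 0 t x = u t x) \<and> tderiv u (c' 0) \<and>
     (\<forall>j\<le>m. R (m - j) (c j) \<and> R (m - j) (c' j) \<and> (\<forall>t\<in>{0..T}. hconv (c j) (c' j) t)) \<and>
     (\<forall>j<m. \<forall>t\<in>{0..T}. primitive l (c j t) (c (Suc j) t) \<and> primitive l (c' j t) (c' (Suc j) t))"
proof (induction m arbitrary: u)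
  case 0
  obtain M0 M1 M2 where M: "S M0" "S M1" "S M2"
      "\<And>t x. t\<in>{0..T} \<Longrightarrow> x\<in>{0..l} \<Longrightarrow> u t x = M0 t x + M1 t x * r1 x + M2 t x * r2 x"
    using R0E[OF 0] by blast
  obtain N0 where N0: "tderiv M0 N0" "S N0" using S_tderiv[OF M(1)] .
  obtain N1 where N1: "tderiv M1 N1" "S N1" using S_tderiv[OF M(2)] .
  obtain N2 where N2: "tderiv M2 N2" "S N2" using S_tderiv[OF M(3)] .
  let ?u' = "\<lambda>t x. N0 t x + N1 t x * r1 x + N2 t x * r2 x"
  have "R 0 ?u'" by (rule R0I[OF N0(2) N1(2) N2(2)]) simp
  moreover have "tderiv u ?u'"
  proof (rule tderiv_cong)
    show "tderiv (\<lambda>t x. M0 t x + M1 t x * r1 x + M2 t x * r2 x) (\<lambda>t x. N0 t x + (N1 t x * r1 x + M1 t x * 0) + (N2 t x * r2 x + M2 t x * 0))"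
      by (intro tderiv_add tderiv_mult N0 N1 N2 tderiv_static)
  qed (use M in auto)
  moreover have "hconv u ?u' t" if "t \<in> {0..T}" for t
    by (rule hconv_R0[where M="\<lambda>i. if i = 0 then M0 else if i = 1 then M1 else M2" and M'="\<lambda>i. if i = 0 then N0 else if i = 1 then N1 else N2"])
       (use M N0 N1 N2 that in auto)
  ultimately show ?case using 0 by (intro exI[of _ "\<lambda>j. u"] exI[of _ "\<lambda>j. ?u'"]) (auto simp del: R.simps)
next
  case (Suc m)
  then obtain v where v: "S u" "R m v" "\<And>t. t\<in>{0..T} \<Longrightarrow> primitive l (u t) (v t)" by auto
  obtain u' where u': "tderiv u u'" "S u'" using S_tderiv[OF v(1)] .
  obtain c c' where cc: "(\<forall>t\<in>{0..T}. \<forall>x\<in>{0..l}. c 0 t x = v t x) \<and> tderiv v (c' 0) \<and>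
     (\<forall>j\<le>m. R (m - j) (c j) \<and> R (m - j) (c' j) \<and> (\<forall>t\<in>{0..T}. hconv (c j) (c' j) t)) \<and>
     (\<forall>j<m. \<forall>t\<in>{0..T}. primitive l (c j t) (c (Suc j) t) \<and> primitive l (c' j t) (c' (Suc j) t))"
    using Suc.IH[OF v(2)] by (elim exE) (rule that)
  have c: "\<And>t x. t\<in>{0..T} \<Longrightarrow> x\<in>{0..l} \<Longrightarrow> c 0 t x = v t x"
    "\<And>j. j\<le>m \<Longrightarrow> R (m - j) (c j)" "\<And>j. j\<le>m \<Longrightarrow> R (m - j) (c' j)" "\<And>j t. j\<le>m \<Longrightarrow> t\<in>{0..T} \<Longrightarrow> hconv (c j) (c' j) t"
    "\<And>j t. j<m \<Longrightarrow> t\<in>{0..T} \<Longrightarrow> primitive l (c j t) (c (Suc j) t)" "\<And>j t. j<m \<Longrightarrow> t\<in>{0..T} \<Longrightarrow> primitive l (c' j t) (c' (Suc j) t)"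
    using cc by blast+
  have c0: "R m (c 0)" "R m (c' 0)" using c(2)[of 0] c(3)[of 0] by auto
  have pu: "primitive l (u t) (c 0 t)" if "t \<in> {0..T}" for t
    using v(3)[OF that] primitive_cong[of l "u t" "u t" "v t" "c 0 t"] c(1)[OF that] l_pos by simp
  have pu': "primitive l (u' t) (c' 0 t)" if t: "t \<in> {0..T}" for t
  proof (rule primitiveI[OF R_ai[OF c0(2) t]])
    fix x assume x: "x \<in> {0..l}"
    have "((\<lambda>s. u s 0 + integral {0..x} (c 0 s)) has_real_derivative u' t 0 + integral {0..x} (c' 0 t)) (at t within {0..T})"
    proof (rule DERIV_add)
      show "((\<lambda>s. u s 0) has_real_derivative u' t 0) (at t within {0..T})"
        using u'(1) t l_pos unfolding tderiv_def by auto
      show "((\<lambda>s. integral {0..x} (c 0 s)) has_real_derivative integral {0..x} (c' 0 t)) (at t within {0..T})"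
        by (rule hconv_integral[OF c(4)[OF _ t] R_SI[OF c0(1)] R_SI[OF c0(2) t] t x]) auto
    qed
    then have "((\<lambda>s. u s x) has_real_derivative u' t 0 + integral {0..x} (c' 0 t)) (at t within {0..T})"
      by (rule has_field_derivative_transform_within[OF _ zero_less_one t]) (use primitive_eq[OF pu x] in auto)
    moreover have "((\<lambda>s. u s x) has_real_derivative u' t x) (at t within {0..T})"
      using u'(1) t x unfolding tderiv_def by blast
    moreover have "at t within {0..T} \<noteq> bot" using t T_pos by (simp add: trivial_limit_within islimpt_Icc)
    ultimately show "u' t x = u' t 0 + integral {0..x} (c' 0 t)"
      using has_real_derivative_unique_within by blast
  qed
  have Ru': "R (Suc m) u'" by (rule R_SucI[OF u'(2) c0(2) pu'])
  let ?c = "\<lambda>j. case j of 0 \<Rightarrow> u | Suc j \<Rightarrow> c j" and ?c' = "\<lambda>j. case j of 0 \<Rightarrow> u' | Suc j \<Rightarrow> c' j"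
  show ?case
  proof (rule exI[of _ ?c], rule exI[of _ ?c'], intro conjI allI impI)
    show "\<forall>t\<in>{0..T}. \<forall>x\<in>{0..l}. ?c 0 t x = u t x" by simp
    show "tderiv u (?c' 0)" using u' by simp
  next
    fix j assume j: "j \<le> Suc m"
    show "R (Suc m - j) (?c j)" "R (Suc m - j) (?c' j)" "\<forall>t\<in>{0..T}. hconv (?c j) (?c' j) t"
      using j Suc.prems Ru' c(2,3,4) hconv_S[OF v(1) u'(1)] by (auto split: nat.split simp del: R.simps)
  next
    fix j assume j: "j < Suc m"
    show "\<forall>t\<in>{0..T}. primitive l (?c j t) (?c (Suc j) t) \<and> primitive l (?c' j t) (?c' (Suc j) t)"
      using j pu pu' c(5,6) by (auto split: nat.split)
  qed
qed

end

section \<open>Differential equations in time with space as a parameter\<close>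

context rect
begin

abbreviation D :: "(real \<times> real) set" where "D \<equiv> {0..T} \<times> {0..l}"

lemma continuous_time_integral:
  fixes H :: "real \<Rightarrow> real \<Rightarrow> 'v::euclidean_space"
  assumes H: "continuous_on D (\<lambda>p. H (fst p) (snd p))"
  shows "continuous_on D (\<lambda>p. integral {0..fst p} (\<lambda>s. H s (snd p)))"
proof (subst continuous_on_componentwise, intro ballI)
  fix i :: 'v assume i: "i \<in> Basis"
  \<comment> \<open>The same rectangle with the variables exchanged: the lemma on primitives in the
    second variable then speaks of integrals in time.\<close>
  interpret sw: rect l T using T_pos l_pos by unfold_locales
  have sw: "continuous_on ({0..l} \<times> {0..T}) (\<lambda>p. (snd p, fst p))" by (intro continuous_intros)
  have "continuous_on ({0..l} \<times> {0..T}) (\<lambda>p. H (snd p) (fst p) \<bullet> i)"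
    using continuous_on_compose2[OF H sw] by (intro continuous_intros) (auto simp: image_subset_iff)
  then have "sw.jcont (\<lambda>x t. H t x \<bullet> i)" unfolding sw.jcont_def case_prod_unfold .
  then have "sw.jcont (\<lambda>x t. integral {0..t} (\<lambda>s. (H s x \<bullet> i) * 1))"
    by (rule sw.jcont_weighted_integral) (rule continuous_absolutely_integrable, simp)
  then have c: "continuous_on ({0..l} \<times> {0..T}) (\<lambda>p. integral {0..snd p} (\<lambda>s. H s (fst p) \<bullet> i))"
    unfolding sw.jcont_def case_prod_unfold by simp
  have sw2: "continuous_on D (\<lambda>p. (snd p, fst p))" by (intro continuous_intros)
  have "continuous_on D (\<lambda>p. integral {0..fst p} (\<lambda>s. H s (snd p) \<bullet> i))"
    using continuous_on_compose2[OF c sw2] by (auto simp: image_subset_iff)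
  moreover have "integral {0..fst p} (\<lambda>s. H s (snd p)) \<bullet> i = integral {0..fst p} (\<lambda>s. H s (snd p) \<bullet> i)" if "p \<in> D" for p
  proof -
    have "continuous_on {0..fst p} (\<lambda>s. (s, snd p))" by (intro continuous_intros)
    from continuous_on_compose2[OF H this] that have "continuous_on {0..fst p} (\<lambda>s. H s (snd p))"
      by (auto simp: image_subset_iff)
    then show ?thesis by (intro integral_component_eq[symmetric] integrable_continuous_interval)
  qed
  ultimately show "continuous_on D (\<lambda>p. integral {0..fst p} (\<lambda>s. H s (snd p)) \<bullet> i)"
    by (simp cong: continuous_on_cong)
qed

text \<open>The retraction of the plane onto the rectangle. Composing with it extends a continuous
  function on \<open>D\<close> to a bounded continuous function on the whole plane, a member of the
  complete space in which the contraction principle is applied.\<close>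

definition cl :: "real \<times> real \<Rightarrow> real \<times> real" where
  "cl p = (max 0 (min T (fst p)), max 0 (min l (snd p)))"

lemma cl_in: "cl p \<in> D" unfolding cl_def using T_pos l_pos by auto

lemma cl_id: "p \<in> D \<Longrightarrow> cl p = p" unfolding cl_def by (auto simp: max_def min_def)

lemma cl_continuous: "continuous_on UNIV cl" unfolding cl_def by (intro continuous_intros)

lemma bcontfun_cl:
  fixes F :: "real \<times> real \<Rightarrow> 'v::real_normed_vector"
  assumes "continuous_on D F"
  shows "(\<lambda>p. F (cl p)) \<in> bcontfun"
proof -
  have "compact D" by (intro compact_Times) auto
  then have "bounded (F ` D)" using compact_imp_bounded compact_continuous_image[OF assms] by blast
  then obtain B where "\<And>p. p \<in> D \<Longrightarrow> norm (F p) \<le> B" unfolding bounded_iff by blast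
  then show ?thesis
    using cl_in continuous_on_compose2[OF assms cl_continuous]
    by (intro bcontfun_normI[of _ B]) (simp_all add: image_subset_iff)
qed

text \<open>The weight \<open>exp (- 2 L t)\<close> makes the Picard operator a contraction on the whole interval.\<close>

lemma volterra:
  fixes G :: "real \<Rightarrow> (real \<Rightarrow> 'v::euclidean_space) \<Rightarrow> real \<Rightarrow> 'v"
  assumes cont: "\<And>Y. continuous_on D (\<lambda>p. Y (fst p) (snd p)) \<Longrightarrow> continuous_on D (\<lambda>p. G (fst p) (Y (fst p)) (snd p))"
    and lip: "\<And>t Y Z d x. t \<in> {0..T} \<Longrightarrow> continuous_on {0..l} Y \<Longrightarrow> continuous_on {0..l} Z \<Longrightarrow>
       (\<And>y. y \<in> {0..l} \<Longrightarrow> norm (Y y - Z y) \<le> d) \<Longrightarrow> x \<in> {0..l} \<Longrightarrow> norm (G t Y x - G t Z x) \<le> L * d"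
    and L: "0 < L" and Y0: "continuous_on {0..l} Y0"
  shows "\<exists>Y. continuous_on D (\<lambda>p. Y (fst p) (snd p)) \<and> (\<forall>x\<in>{0..l}. Y 0 x = Y0 x) \<and>
     (\<forall>t\<in>{0..T}. \<forall>x\<in>{0..l}. ((\<lambda>t. Y t x) has_vector_derivative G t (Y t) x) (at t within {0..T}))"
proof -
  define W where "W y t x = exp (2 * L * t) *\<^sub>R apply_bcontfun y (t, x)" for y :: "(real \<times> real) \<Rightarrow>\<^sub>C 'v" and t x
  define F where "F y p = exp (- (2 * L * fst p)) *\<^sub>R (Y0 (snd p) + integral {0..fst p} (\<lambda>s. G s (W y s) (snd p)))"
    for y :: "(real \<times> real) \<Rightarrow>\<^sub>C 'v" and p
  have Wc: "continuous_on D (\<lambda>p. W y (fst p) (snd p))" for y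
    unfolding W_def
    by (intro continuous_on_scaleR continuous_on_exp continuous_on_mult continuous_on_const continuous_on_fst continuous_on_id)
       simp
  have GW: "continuous_on D (\<lambda>p. G (fst p) (W y (fst p)) (snd p))" for y by (rule cont[OF Wc])
  have Ws: "continuous_on {0..l} (W y t)" for y t
  proof -
    have "continuous_on {0..l} (\<lambda>x. (t, x))" by (intro continuous_intros)
    from continuous_on_compose2[OF continuous_on_apply_bcontfun this, of UNIV y]
    have "continuous_on {0..l} (\<lambda>x. apply_bcontfun y (t, x))" by simp
    then show ?thesis unfolding W_def by (rule continuous_on_scaleR[OF continuous_on_const])
  qed
  have GWs: "continuous_on {0..T} (\<lambda>s. G s (W y s) x)" if "x \<in> {0..l}" for x y
  proof -
    have "continuous_on {0..T} (\<lambda>s. (s, x))" by (intro continuous_intros)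
    from continuous_on_compose2[OF GW this] that show ?thesis by (auto simp: image_subset_iff)
  qed
  have Fc: "continuous_on D (F y)" for y
  proof -
    have "continuous_on D (\<lambda>p. Y0 (snd p))"
      by (rule continuous_on_compose2[OF Y0]) (auto intro!: continuous_intros)
    then show ?thesis unfolding F_def by (intro continuous_intros continuous_time_integral GW)
  qed
  define \<Psi> where "\<Psi> y = Bcontfun (\<lambda>p. F y (cl p))" for y
  have \<Psi>: "apply_bcontfun (\<Psi> y) p = F y (cl p)" for y p
    unfolding \<Psi>_def by (simp add: Bcontfun_inverse[OF bcontfun_cl[OF Fc]])
  have contr: "dist (\<Psi> y) (\<Psi> z) \<le> 1/2 * dist y z" for y z
  proof (rule dist_bound)
    fix p
    obtain t x where p: "cl p = (t, x)" "t \<in> {0..T}" "x \<in> {0..l}" using cl_in[of p] by (cases "cl p") auto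
    define d where "d = dist y z"
    have i: "(\<lambda>s. G s (W y s) x) integrable_on {0..t}" for y
      using GWs[OF p(3), of y] p(2) by (intro integrable_continuous_interval) (auto elim: continuous_on_subset)
    have "norm (integral {0..t} (\<lambda>s. G s (W y s) x) - integral {0..t} (\<lambda>s. G s (W z s) x))
      = norm (integral {0..t} (\<lambda>s. G s (W y s) x - G s (W z s) x))" by (simp add: integral_diff i)
    \<comment> \<open>This integral is at most d / 2 times exp (2 L t): an exponent of twice the
      Lipschitz constant is what leaves the contraction factor 1/2.\<close>
    also have "\<dots> \<le> integral {0..t} (\<lambda>s. L * d * exp (2 * L * s))"
    proof (rule integral_norm_bound_integral)
      show "(\<lambda>s. G s (W y s) x - G s (W z s) x) integrable_on {0..t}" by (intro integrable_diff i)
      show "(\<lambda>s. L * d * exp (2 * L * s)) integrable_on {0..t}"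
        by (intro integrable_continuous_interval continuous_intros)
      fix s assume s: "s \<in> {0..t}"
      have "norm (W y s v - W z s v) \<le> exp (2 * L * s) * d" for v
      proof -
        have "W y s v - W z s v = exp (2 * L * s) *\<^sub>R (apply_bcontfun y (s, v) - apply_bcontfun z (s, v))"
          unfolding W_def by (simp add: scaleR_diff_right)
        then have "norm (W y s v - W z s v) = exp (2 * L * s) * dist (apply_bcontfun y (s, v)) (apply_bcontfun z (s, v))"
          by (simp add: dist_norm)
        also have "\<dots> \<le> exp (2 * L * s) * d" unfolding d_def by (intro mult_left_mono dist_bounded) auto
        finally show ?thesis .
      qed
      then have "norm (G s (W y s) x - G s (W z s) x) \<le> L * (exp (2 * L * s) * d)"
        using s p by (intro lip Ws) auto
      then show "norm (G s (W y s) x - G s (W z s) x) \<le> L * d * exp (2 * L * s)" by (simp add: algebra_simps)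
    qed
    also have "\<dots> = d / 2 * (exp (2 * L * t) - 1)"
    proof -
      have "((\<lambda>s. L * d * exp (2 * L * s)) has_integral (d / 2 * exp (2 * L * t) - d / 2 * exp (2 * L * 0))) {0..t}"
      proof (rule fundamental_theorem_of_calculus)
        fix s
        have "((\<lambda>s. d / 2 * exp (2 * L * s)) has_real_derivative L * d * exp (2 * L * s)) (at s within {0..t})"
          by (auto intro!: derivative_eq_intros)
        then show "((\<lambda>s. d / 2 * exp (2 * L * s)) has_vector_derivative L * d * exp (2 * L * s)) (at s within {0..t})"
          by (simp only: has_real_derivative_iff_has_vector_derivative)
      qed (use p(2) in simp)
      from integral_unique[OF this] show ?thesis by (simp add: right_diff_distrib)
    qed
    also have "\<dots> \<le> d / 2 * exp (2 * L * t)" unfolding d_def by (simp add: mult_left_mono)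
    finally have b: "norm (integral {0..t} (\<lambda>s. G s (W y s) x) - integral {0..t} (\<lambda>s. G s (W z s) x)) \<le> d / 2 * exp (2 * L * t)" .
    have "dist (F y (cl p)) (F z (cl p)) = exp (- (2 * L * t)) * norm (integral {0..t} (\<lambda>s. G s (W y s) x) - integral {0..t} (\<lambda>s. G s (W z s) x))"
      unfolding dist_norm F_def p by (simp flip: scaleR_diff_right)
    also have "\<dots> \<le> exp (- (2 * L * t)) * (d / 2 * exp (2 * L * t))" by (intro mult_left_mono b) auto
    also have "\<dots> = d / 2" by (simp add: exp_minus)
    finally show "dist (apply_bcontfun (\<Psi> y) p) (apply_bcontfun (\<Psi> z) p) \<le> 1/2 * dist y z"
      by (simp add: \<Psi> d_def)
  qed
  have "\<exists>!y. \<Psi> y = y" by (rule banach_fix_type[of "1/2"]) (use contr in auto)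
  then obtain y where y: "\<Psi> y = y" by blast
  have eq: "W y t x = Y0 x + integral {0..t} (\<lambda>s. G s (W y s) x)" if "t \<in> {0..T}" "x \<in> {0..l}" for t x
  proof -
    have "apply_bcontfun y (t, x) = F y (t, x)" using \<Psi>[of y "(t, x)"] y cl_id[of "(t, x)"] that by simp
    then show ?thesis unfolding W_def F_def by (simp add: exp_minus)
  qed
  show ?thesis
  proof (intro exI[of _ "W y"] conjI ballI)
    show "continuous_on D (\<lambda>p. W y (fst p) (snd p))" by (rule Wc)
    show "W y 0 x = Y0 x" if "x \<in> {0..l}" for x using eq[of 0 x] that T_pos by simp
    fix t x assume t: "t \<in> {0..T}" and x: "x \<in> {0..l}"
    have "((\<lambda>t. integral {0..t} (\<lambda>s. G s (W y s) x)) has_vector_derivative G t (W y t) x) (at t within {0..T})"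
      by (rule integral_has_vector_derivative[OF GWs[OF x] t])
    then have "((\<lambda>t. Y0 x + integral {0..t} (\<lambda>s. G s (W y s) x)) has_vector_derivative G t (W y t) x) (at t within {0..T})"
      using has_vector_derivative_add[OF has_vector_derivative_const] by fastforce
    then show "((\<lambda>t. W y t x) has_vector_derivative G t (W y t) x) (at t within {0..T})"
      by (rule has_vector_derivative_transform[OF t, rotated]) (use eq x in auto)
  qed
qed

text \<open>The bound on E' is nonlocal in x, so the maximum K of exp (- 2 L t) |E| over the whole
  rectangle is taken. Integrating the bound L K exp (2 L s) in time gives |E| <= K / 2 exp (2 L t),
  that is K <= K / 2, and hence K = 0.\<close>

lemma gronwall_zero:
  fixes E :: "real \<Rightarrow> real \<Rightarrow> 'v::euclidean_space"
  assumes cont: "continuous_on D (\<lambda>p. E (fst p) (snd p))" and L: "0 < L"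
    and der: "\<And>t x. t \<in> {0..T} \<Longrightarrow> x \<in> {0..l} \<Longrightarrow> ((\<lambda>t. E t x) has_vector_derivative E' t x) (at t within {0..T})"
    and bound: "\<And>t x d. t \<in> {0..T} \<Longrightarrow> (\<And>y. y \<in> {0..l} \<Longrightarrow> norm (E t y) \<le> d) \<Longrightarrow> x \<in> {0..l} \<Longrightarrow> norm (E' t x) \<le> L * d"
    and init: "\<And>x. x \<in> {0..l} \<Longrightarrow> E 0 x = 0"
    and tx: "t \<in> {0..T}" "x \<in> {0..l}"
  shows "E t x = 0"
proof -
  let ?m = "\<lambda>p. exp (- (2 * L * fst p)) * norm (E (fst p) (snd p))"
  have "compact D" by (intro compact_Times) auto
  moreover have "continuous_on D ?m" by (intro continuous_intros cont)
  moreover have "D \<noteq> {}" using tx by auto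
  ultimately obtain q where q: "q \<in> D" "\<And>p. p \<in> D \<Longrightarrow> ?m p \<le> ?m q"
    using continuous_attains_sup[of D ?m] by blast
  define K where "K = ?m q"
  have K: "norm (E s y) \<le> K * exp (2 * L * s)" if "s \<in> {0..T}" "y \<in> {0..l}" for s y
    using q(2)[of "(s, y)"] that unfolding K_def[symmetric] by (simp add: exp_minus field_simps)
  have half: "norm (E s y) \<le> K / 2 * exp (2 * L * s)" if s: "s \<in> {0..T}" and y: "y \<in> {0..l}" for s y
  proof (cases "s = 0")
    case True
    have "0 \<le> K" unfolding K_def by simp
    then show ?thesis using True init[OF y] by simp
  next
    case False
    then have s0: "0 < s" using s by simp
    have K0: "0 \<le> K" unfolding K_def by simp
    have sub: "{0..s} \<subseteq> {0..T}" using s by auto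
    have d: "((\<lambda>t. E t y) has_vector_derivative E' r y) (at r within {0..s})" if "r \<in> {0..s}" for r
      using der[of r y] that sub y by (meson has_vector_derivative_within_subset subsetD)
    have "norm (E s y - E 0 y) \<le> K / 2 * exp (2 * L * s) - K / 2 * exp (2 * L * 0)"
    proof (rule differentiable_bound_general[OF s0, where f'="\<lambda>r. E' r y" and \<phi>'="\<lambda>r. L * (K * exp (2 * L * r))"])
      show "continuous_on {0..s} (\<lambda>t. E t y)"
        using d has_vector_derivative_continuous continuous_on_eq_continuous_within by blast
      show "continuous_on {0..s} (\<lambda>r. K / 2 * exp (2 * L * r))" by (intro continuous_intros)
      fix r assume r: "0 < r" "r < s"
      show "((\<lambda>t. E t y) has_vector_derivative E' r y) (at r)"
        using d[of r] r at_within_Icc_at[of 0 r s] by simp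
      show "((\<lambda>r. K / 2 * exp (2 * L * r)) has_vector_derivative L * (K * exp (2 * L * r))) (at r)"
        unfolding has_real_derivative_iff_has_vector_derivative[symmetric] by (auto intro!: derivative_eq_intros)
      show "norm (E' r y) \<le> L * (K * exp (2 * L * r))"
        by (rule bound) (use r s y K in auto)
    qed
    then show ?thesis using init[OF y] K0 by simp
  qed
  have "K \<le> K / 2"
  proof -
    obtain s y where sy: "q = (s, y)" "s \<in> {0..T}" "y \<in> {0..l}" using q(1) by auto
    have "K = exp (- (2 * L * s)) * norm (E s y)" unfolding K_def sy by simp
    also have "\<dots> \<le> exp (- (2 * L * s)) * (K / 2 * exp (2 * L * s))" by (intro mult_left_mono half sy) auto
    also have "\<dots> = K / 2" by (simp add: exp_minus)
    finally show ?thesis .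
  qed
  then have "K \<le> 0" by simp
  then have "norm (E t x) \<le> 0" using K[OF tx] by (meson exp_ge_zero mult_nonpos_nonneg order_trans)
  then show ?thesis by simp
qed

text \<open>B is left general because the lemma serves two purposes: with B = -1 it solves systems
  in time, and with B = 1 / h_b, and x in the place of time, it yields the fundamental solutions of
  the elliptic problem.\<close>

lemma linear_system_exists:
  assumes B: "jcont B" and A: "jcont A" and P: "jcont P" and ab: "continuous_on {0..l} a" "continuous_on {0..l} b"
  obtains u v where "jcont u" "jcont v" "tderiv u (\<lambda>t x. B t x * v t x)"
    "tderiv v (\<lambda>t x. A t x * u t x + P t x)" "\<And>x. x \<in> {0..l} \<Longrightarrow> u 0 x = a x \<and> v 0 x = b x"
proof -
  obtain MA where MA: "0 \<le> MA" "\<And>t x. t \<in> {0..T} \<Longrightarrow> x \<in> {0..l} \<Longrightarrow> \<bar>A t x\<bar> \<le> MA" using jcont_bound[OF A] by metis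
  obtain MB where MB: "0 \<le> MB" "\<And>t x. t \<in> {0..T} \<Longrightarrow> x \<in> {0..l} \<Longrightarrow> \<bar>B t x\<bar> \<le> MB" using jcont_bound[OF B] by metis
  let ?G = "\<lambda>t Y x. (B t x * snd (Y x), A t x * fst (Y x) + P t x) :: real \<times> real"
  have "\<exists>Y. continuous_on D (\<lambda>p. Y (fst p) (snd p)) \<and> (\<forall>x\<in>{0..l}. Y 0 x = (a x, b x)) \<and>
     (\<forall>t\<in>{0..T}. \<forall>x\<in>{0..l}. ((\<lambda>t. Y t x) has_vector_derivative ?G t (Y t) x) (at t within {0..T}))"
  proof (rule volterra[where L="MA + MB + 1"])
    fix Y :: "real \<Rightarrow> real \<Rightarrow> real \<times> real" assume "continuous_on D (\<lambda>p. Y (fst p) (snd p))"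
    then show "continuous_on D (\<lambda>p. ?G (fst p) (Y (fst p)) (snd p))"
      using A B P unfolding jcont_def case_prod_unfold by (intro continuous_intros)
  next
    fix t x d and Y Z :: "real \<Rightarrow> real \<times> real"
    assume t: "t \<in> {0..T}" and x: "x \<in> {0..l}" and d: "\<And>y. y \<in> {0..l} \<Longrightarrow> norm (Y y - Z y) \<le> d"
    have "norm (?G t Y x - ?G t Z x) = norm (B t x * snd (Y x - Z x), A t x * fst (Y x - Z x))"
      by (simp add: algebra_simps)
    also have "\<dots> \<le> \<bar>B t x * snd (Y x - Z x)\<bar> + \<bar>A t x * fst (Y x - Z x)\<bar>"
      unfolding norm_Pair real_norm_def power2_abs by (rule sqrt_sum_squares_le_sum_abs)
    also have "\<dots> \<le> MB * d + MA * d"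
    proof -
      have "\<bar>fst (Y x - Z x)\<bar> \<le> d" "\<bar>snd (Y x - Z x)\<bar> \<le> d"
        using d[OF x] norm_fst_le[of "fst (Y x - Z x)" "snd (Y x - Z x)"] norm_snd_le[of "snd (Y x - Z x)" "fst (Y x - Z x)"]
        unfolding prod.collapse real_norm_def by linarith+
      then show ?thesis unfolding abs_mult
        using MA(2)[OF t x] MB(2)[OF t x] MA(1) MB(1) by (intro add_mono mult_mono) auto
    qed
    also have "\<dots> \<le> (MA + MB + 1) * d" using order_trans[OF norm_ge_zero d[OF x]] by (simp add: algebra_simps)
    finally show "norm (?G t Y x - ?G t Z x) \<le> (MA + MB + 1) * d" .
  qed (use MA MB ab in \<open>auto intro!: continuous_intros\<close>)
  then obtain Y where Y: "continuous_on D (\<lambda>p. Y (fst p) (snd p))" "\<And>x. x\<in>{0..l} \<Longrightarrow> Y 0 x = (a x, b x)"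
    "\<And>t x. t\<in>{0..T} \<Longrightarrow> x\<in>{0..l} \<Longrightarrow> ((\<lambda>t. Y t x) has_vector_derivative ?G t (Y t) x) (at t within {0..T})" by blast
  show ?thesis
  proof (rule that[of "\<lambda>t x. fst (Y t x)" "\<lambda>t x. snd (Y t x)"])
    show "jcont (\<lambda>t x. fst (Y t x))" "jcont (\<lambda>t x. snd (Y t x))"
      using Y(1) unfolding jcont_def case_prod_unfold by (auto intro: continuous_intros)
    show "tderiv (\<lambda>t x. fst (Y t x)) (\<lambda>t x. B t x * snd (Y t x))"
      unfolding tderiv_def has_real_derivative_iff_has_vector_derivative
      using bounded_linear.has_vector_derivative[OF bounded_linear_fst Y(3)] by simp
    show "tderiv (\<lambda>t x. snd (Y t x)) (\<lambda>t x. A t x * fst (Y t x) + P t x)"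
      unfolding tderiv_def has_real_derivative_iff_has_vector_derivative
      using bounded_linear.has_vector_derivative[OF bounded_linear_snd Y(3)] by simp
  qed (use Y(2) in auto)
qed

lemma linear_system_S:
  assumes A: "S A" and P: "S P" and ab: "continuous_on {0..l} a" "continuous_on {0..l} b"
  obtains u v where "S u" "S v" "tderiv u (\<lambda>t x. - v t x)"
    "tderiv v (\<lambda>t x. A t x * u t x + P t x)" "\<And>x. x \<in> {0..l} \<Longrightarrow> u 0 x = a x \<and> v 0 x = b x"
proof -
  have "jcont (\<lambda>t x. -1)" by (simp add: jcont_def)
  then obtain u v where uv: "jcont u" "jcont v" "tderiv u (\<lambda>t x. -1 * v t x)"
    "tderiv v (\<lambda>t x. A t x * u t x + P t x)" "\<And>x. x \<in> {0..l} \<Longrightarrow> u 0 x = a x \<and> v 0 x = b x"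
    using linear_system_exists[OF _ S_jcont[OF A] S_jcont[OF P] ab] by blast
  have "SC k u \<and> SC k v" for k
  proof (induction k)
    case (Suc k)
    then show ?case
      using A P uv by (auto intro!: SC_SucI[OF uv(3)] SC_SucI[OF uv(4)] SC_mult SC_add SC_const simp del: SC.simps simp: S_def)
  qed (use uv in auto)
  then show ?thesis using uv that[of u v] unfolding S_def by simp
qed

end

section \<open>Linear systems and propagation of regularity in space\<close>

context rect_rho
begin

text \<open>The Gronwall estimate in the supremum norm meets the unbounded members of
  \<open>R 0\<close> only under an integral over x, so an L^1 bound that is uniform in time is what
  it needs.\<close>

lemma R_L1_bound:
  assumes "R m u"
  obtains K where "0 \<le> K" "\<And>t. t \<in> {0..T} \<Longrightarrow> integral {0..l} (\<lambda>x. \<bar>u t x\<bar>) \<le> K"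
proof -
  have R0: "R 0 u" using assms S_R0[OF R_Suc_S] by (cases m) blast+
  obtain M0 M1 M2 where M: "S M0" "S M1" "S M2"
    "\<And>t x. t \<in> {0..T} \<Longrightarrow> x \<in> {0..l} \<Longrightarrow> u t x = M0 t x + M1 t x * r1 x + M2 t x * r2 x"
    using R0E[OF R0] by blast
  obtain K0 where K0: "0 \<le> K0" "\<And>t x. t \<in> {0..T} \<Longrightarrow> x \<in> {0..l} \<Longrightarrow> \<bar>M0 t x\<bar> \<le> K0" using jcont_bound[OF S_jcont[OF M(1)]] by metis
  obtain K1 where K1: "0 \<le> K1" "\<And>t x. t \<in> {0..T} \<Longrightarrow> x \<in> {0..l} \<Longrightarrow> \<bar>M1 t x\<bar> \<le> K1" using jcont_bound[OF S_jcont[OF M(2)]] by metis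
  obtain K2 where K2: "0 \<le> K2" "\<And>t x. t \<in> {0..T} \<Longrightarrow> x \<in> {0..l} \<Longrightarrow> \<bar>M2 t x\<bar> \<le> K2" using jcont_bound[OF S_jcont[OF M(3)]] by metis
  have ir: "(\<lambda>x. \<bar>r1 x\<bar>) integrable_on {0..l}" "(\<lambda>x. \<bar>r2 x\<bar>) integrable_on {0..l}"
    using absolutely_integrable_norm[OF r_ai(1)] absolutely_integrable_norm[OF r_ai(2)] by (auto simp: o_def absolutely_integrable_on_def)
  have ib: "(\<lambda>x. K0 + K1 * \<bar>r1 x\<bar> + K2 * \<bar>r2 x\<bar>) integrable_on {0..l}"
    by (intro integrable_add integrable_const_ivl integrable_on_mult_right ir)
  show ?thesis
  proof (rule that)
    show "0 \<le> integral {0..l} (\<lambda>x. K0 + K1 * \<bar>r1 x\<bar> + K2 * \<bar>r2 x\<bar>)"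
      by (rule integral_nonneg[OF ib]) (use K0 K1 K2 in auto)
    fix t assume t: "t \<in> {0..T}"
    show "integral {0..l} (\<lambda>x. \<bar>u t x\<bar>) \<le> integral {0..l} (\<lambda>x. K0 + K1 * \<bar>r1 x\<bar> + K2 * \<bar>r2 x\<bar>)"
    proof (rule integral_le[OF _ ib])
      show "(\<lambda>x. \<bar>u t x\<bar>) integrable_on {0..l}"
        using absolutely_integrable_norm[OF R_ai[OF R0 t]] by (simp add: o_def absolutely_integrable_on_def)
      fix x assume x: "x \<in> {0..l}"
      have "\<bar>u t x\<bar> \<le> \<bar>M0 t x\<bar> + \<bar>M1 t x\<bar> * \<bar>r1 x\<bar> + \<bar>M2 t x\<bar> * \<bar>r2 x\<bar>"
        unfolding M(4)[OF t x] abs_mult[symmetric] by linarith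
      also have "\<dots> \<le> K0 + K1 * \<bar>r1 x\<bar> + K2 * \<bar>r2 x\<bar>"
        by (intro add_mono mult_right_mono K0 K1 K2 t x) auto
      finally show "\<bar>u t x\<bar> \<le> K0 + K1 * \<bar>r1 x\<bar> + K2 * \<bar>r2 x\<bar>" .
    qed
  qed
qed

lemma R_integral_tderiv:
  assumes "R m s" "tderiv s s'"
  shows "tderiv (\<lambda>t x. integral {0..x} (s t)) (\<lambda>t x. integral {0..x} (s' t))"
proof -
  obtain c c' where c: "(\<forall>t\<in>{0..T}. \<forall>x\<in>{0..l}. c 0 t x = s t x)" "tderiv s (c' 0)"
     "(\<forall>j\<le>m. R (m - j) (c j) \<and> R (m - j) (c' j) \<and> (\<forall>t\<in>{0..T}. hconv (c j) (c' j) t))"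
    using R_time_chain[OF assms(1)] by blast
  have c0: "R m (c 0)" "R m (c' 0)" "\<And>t. t\<in>{0..T} \<Longrightarrow> hconv (c 0) (c' 0) t" using c(3)[rule_format, of 0] by auto
  have "tderiv (\<lambda>t x. integral {0..x} (c 0 t)) (\<lambda>t x. integral {0..x} (c' 0 t))"
    unfolding tderiv_def using hconv_integral[OF c0(3) R_SI[OF c0(1)] R_SI[OF c0(2)]] by blast
  then show ?thesis
  proof (rule tderiv_cong[rotated 2])
    fix t x assume t: "t \<in> {0..T}" and x: "x \<in> {0..l}"
    show "integral {0..x} (c 0 t) = integral {0..x} (s t)" using c(1) t x by (intro integral_cong) auto
    show "integral {0..x} (c' 0 t) = integral {0..x} (s' t)"
      using tderiv_unique[OF c(2) assms(2) t] x by (intro integral_cong) auto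
  qed
qed

text \<open>The difference between \<open>y1, y2\<close> and the primitives of \<open>s1, s2\<close> satisfies a Gronwall
  inequality, since \<open>\<Phi>z\<close> and \<open>\<Phi>x\<close> are evaluated at \<open>y1\<close> and not at the primitive of \<open>s1\<close>.\<close>

lemma persistence:
  assumes y: "jcont y1" "jcont y2" "tderiv y1 (\<lambda>t x. - y2 t x)" "tderiv y2 (\<lambda>t x. \<Phi> t x (y1 t x))"
    and s: "R m s1" "R m s2" "tderiv s1 (\<lambda>t x. - s2 t x)"
       "tderiv s2 (\<lambda>t x. \<Phi>z t x (y1 t x) * s1 t x + \<Phi>x t x (y1 t x))"
    and init: "primitive l (y1 0) (s1 0)" "primitive l (y2 0) (s2 0)"
    and chain: "\<And>t Y. t \<in> {0..T} \<Longrightarrow> primitive l Y (s1 t) \<Longrightarrow>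
        primitive l (\<lambda>x. \<Phi> t x (Y x)) (\<lambda>x. \<Phi>z t x (Y x) * s1 t x + \<Phi>x t x (Y x))"
    and rhs: "\<And>t. t \<in> {0..T} \<Longrightarrow> (\<lambda>x. \<Phi>z t x (y1 t x) * s1 t x + \<Phi>x t x (y1 t x)) absolutely_integrable_on {0..l}"
    and k: "R i k"
    and lip: "\<And>M. \<exists>K\<ge>0. \<forall>t\<in>{0..T}. \<forall>x\<in>{0..l}. \<forall>a b. \<bar>a\<bar> \<le> M \<longrightarrow> \<bar>b\<bar> \<le> M \<longrightarrow>
        \<bar>\<Phi> t x a - \<Phi> t x b\<bar> \<le> K * \<bar>a - b\<bar> \<and> \<bar>\<Phi>z t x a - \<Phi>z t x b\<bar> \<le> K * \<bar>a - b\<bar> \<and>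
        \<bar>\<Phi>x t x a - \<Phi>x t x b\<bar> \<le> (K + \<bar>k t x\<bar>) * \<bar>a - b\<bar>"
    and t: "t \<in> {0..T}"
  shows "primitive l (y1 t) (s1 t)" "primitive l (y2 t) (s2 t)"
proof -
  let ?g = "\<lambda>t x. \<Phi>z t x (y1 t x) * s1 t x + \<Phi>x t x (y1 t x)"
  define Y1 where "Y1 t x = y1 t 0 + integral {0..x} (s1 t)" for t x
  define Y2 where "Y2 t x = y2 t 0 + integral {0..x} (s2 t)" for t x
  have l0: "0 \<in> {0..l}" using l_pos by auto
  have Yj: "jcont Y1" "jcont Y2" unfolding Y1_def Y2_def
    by (intro jcont_add jcont_trace y l0 S_jcont[OF R_Suc_S[OF R_integral[OF s(1)]]] S_jcont[OF R_Suc_S[OF R_integral[OF s(2)]]])+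
  have Y1d: "tderiv Y1 (\<lambda>t x. - y2 t 0 + integral {0..x} (\<lambda>x. - s2 t x))" unfolding Y1_def
    by (rule tderiv_add[OF _ R_integral_tderiv[OF s(1,3)]]) (use y(3) l0 in \<open>auto simp: tderiv_def\<close>)
  have Y2d: "tderiv Y2 (\<lambda>t x. \<Phi> t 0 (y1 t 0) + integral {0..x} (?g t))" unfolding Y2_def
    by (rule tderiv_add[OF _ R_integral_tderiv[OF s(2,4)]]) (use y(4) l0 in \<open>auto simp: tderiv_def\<close>)
  have Y1p: "primitive l (Y1 t) (s1 t)" if "t \<in> {0..T}" for t
    unfolding Y1_def by (rule primitive_integral[OF R_ai[OF s(1) that]])
  have Y2p: "primitive l (Y2 t) (s2 t)" if "t \<in> {0..T}" for t
    unfolding Y2_def by (rule primitive_integral[OF R_ai[OF s(2) that]])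
  obtain M1 where M1: "\<And>t x. t \<in> {0..T} \<Longrightarrow> x \<in> {0..l} \<Longrightarrow> \<bar>y1 t x\<bar> \<le> M1" using jcont_bound[OF y(1)] by metis
  obtain M2 where M2: "\<And>t x. t \<in> {0..T} \<Longrightarrow> x \<in> {0..l} \<Longrightarrow> \<bar>Y1 t x\<bar> \<le> M2" using jcont_bound[OF Yj(1)] by metis
  define M where "M = max M1 M2"
  have MM: "\<bar>y1 t x\<bar> \<le> M" "\<bar>Y1 t x\<bar> \<le> M" if "t \<in> {0..T}" "x \<in> {0..l}" for t x
    using M1[OF that] M2[OF that] unfolding M_def by auto
  obtain K where K: "0 \<le> K" "\<And>t x a b. t \<in> {0..T} \<Longrightarrow> x \<in> {0..l} \<Longrightarrow> \<bar>a\<bar> \<le> M \<Longrightarrow> \<bar>b\<bar> \<le> M \<Longrightarrow>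
        \<bar>\<Phi> t x a - \<Phi> t x b\<bar> \<le> K * \<bar>a - b\<bar> \<and> \<bar>\<Phi>z t x a - \<Phi>z t x b\<bar> \<le> K * \<bar>a - b\<bar> \<and>
        \<bar>\<Phi>x t x a - \<Phi>x t x b\<bar> \<le> (K + \<bar>k t x\<bar>) * \<bar>a - b\<bar>" using lip[of M] by blast
  obtain Ks where Ks: "0 \<le> Ks" "\<And>t. t \<in> {0..T} \<Longrightarrow> integral {0..l} (\<lambda>x. \<bar>s1 t x\<bar>) \<le> Ks" using R_L1_bound[OF s(1)] by metis
  obtain Kk where Kk: "0 \<le> Kk" "\<And>t. t \<in> {0..T} \<Longrightarrow> integral {0..l} (\<lambda>x. \<bar>k t x\<bar>) \<le> Kk" using R_L1_bound[OF k] by metis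
  \<comment> \<open>The summands are: 1 for the equation of \<open>y1\<close>, K for \<Phi>,
    \<open>K * Ks\<close> for \<Phi>z against \<open>s1\<close>, and \<open>K * l + Kk\<close> for
    \<Phi>x with its Lipschitz constant K + |k|.\<close>
  define L where "L = 1 + K + K * Ks + K * l + Kk"
  have L: "0 < L" unfolding L_def using K(1) Ks(1) Kk(1) l_pos by (simp add: add_pos_nonneg)
  define E where "E t x = (y1 t x - Y1 t x, y2 t x - Y2 t x)" for t x
  define E' where "E' t x = (- (y2 t x - Y2 t x), \<Phi> t x (y1 t x) - (\<Phi> t 0 (y1 t 0) + integral {0..x} (?g t)))" for t x
  have E0: "E t x = 0" if tx: "t \<in> {0..T}" "x \<in> {0..l}" for t x
  proof (rule gronwall_zero[OF _ L _ _ _ tx, where E'=E'])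
    show "continuous_on D (\<lambda>p. E (fst p) (snd p))"
      using y(1,2) Yj unfolding E_def jcont_def case_prod_unfold by (intro continuous_intros)
    show "E 0 x = 0" if "x \<in> {0..l}" for x
      unfolding E_def Y1_def Y2_def using primitive_eq[OF init(1) that] primitive_eq[OF init(2) that] by (simp add: zero_prod_def)
  next
    fix t x assume t: "t \<in> {0..T}" and x: "x \<in> {0..l}"
    have e: "- y2 t 0 + integral {0..x} (\<lambda>x. - s2 t x) = - Y2 t x" unfolding Y2_def by simp
    have d: "((\<lambda>t. y1 t x) has_vector_derivative - y2 t x) (at t within {0..T})"
      "((\<lambda>t. Y1 t x) has_vector_derivative - Y2 t x) (at t within {0..T})"
      "((\<lambda>t. y2 t x) has_vector_derivative \<Phi> t x (y1 t x)) (at t within {0..T})"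
      "((\<lambda>t. Y2 t x) has_vector_derivative \<Phi> t 0 (y1 t 0) + integral {0..x} (?g t)) (at t within {0..T})"
      using y(3,4) Y1d Y2d t x unfolding tderiv_def e[symmetric] has_real_derivative_iff_has_vector_derivative by blast+
    have "((\<lambda>t. E t x) has_vector_derivative (- y2 t x - (- Y2 t x), \<Phi> t x (y1 t x) - (\<Phi> t 0 (y1 t 0) + integral {0..x} (?g t)))) (at t within {0..T})"
      unfolding E_def by (intro has_vector_derivative_Pair has_vector_derivative_diff d)
    then show "((\<lambda>t. E t x) has_vector_derivative E' t x) (at t within {0..T})" unfolding E'_def by simp
  next
    fix t x d assume t: "t \<in> {0..T}" and x: "x \<in> {0..l}" and d: "\<And>y. y \<in> {0..l} \<Longrightarrow> norm (E t y) \<le> d"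
    have d1: "\<bar>y1 t y - Y1 t y\<bar> \<le> d" "\<bar>y2 t y - Y2 t y\<bar> \<le> d" if "y \<in> {0..l}" for y
      using d[OF that] norm_fst_le[of "y1 t y - Y1 t y" "y2 t y - Y2 t y"] norm_snd_le[of "y2 t y - Y2 t y" "y1 t y - Y1 t y"]
      unfolding E_def real_norm_def by linarith+
    have d0: "0 \<le> d" using d1(1)[OF x] by linarith
    let ?G = "\<lambda>x. \<Phi>z t x (Y1 t x) * s1 t x + \<Phi>x t x (Y1 t x)"
    \<comment> \<open>\<open>chain\<close> asks for a function known to have density
      \<open>s1 t\<close>. This holds for \<open>Y1 t\<close> by construction; for
      \<open>y1 t\<close> it is the claim. The cost of passing from one to the other is Lipschitz in
      \<open>Y1 - y1\<close>, a component of E.\<close>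
    have cp: "primitive l (\<lambda>x. \<Phi> t x (Y1 t x)) ?G" by (rule chain[OF t Y1p[OF t]])
    have Gi: "?G absolutely_integrable_on {0..l}" by (rule primitive_integrable[OF cp])
    have e1: "\<Phi> t x (Y1 t x) = \<Phi> t 0 (y1 t 0) + integral {0..x} ?G"
      using primitive_eq[OF cp x] unfolding Y1_def by simp
    have e2: "integral {0..x} ?G - integral {0..x} (?g t) = integral {0..x} (\<lambda>x. ?G x - ?g t x)"
      using x by (intro integral_diff[symmetric] absolutely_integrable_initial(2)[OF Gi] absolutely_integrable_initial(2)[OF rhs[OF t]]) auto
    have si: "(\<lambda>x. \<bar>s1 t x\<bar>) integrable_on {0..l}" "(\<lambda>x. \<bar>k t x\<bar>) integrable_on {0..l}"
      using absolutely_integrable_norm[OF R_ai[OF s(1) t]] absolutely_integrable_norm[OF R_ai[OF k t]] by (auto simp: o_def absolutely_integrable_on_def)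
    have "\<bar>integral {0..x} (\<lambda>x. ?G x - ?g t x)\<bar> \<le> integral {0..l} (\<lambda>x. \<bar>?G x - ?g t x\<bar>)"
      using x by (intro integral_initial_abs_le set_integral_diff(1) Gi rhs t) auto
    also have "\<dots> \<le> integral {0..l} (\<lambda>x. (K * d) * \<bar>s1 t x\<bar> + (K * d + d * \<bar>k t x\<bar>))"
    proof (rule integral_le)
      show "(\<lambda>x. \<bar>?G x - ?g t x\<bar>) integrable_on {0..l}" by (rule absolutely_integrable_abs_diff(2)[OF Gi rhs[OF t]])
      show "(\<lambda>x. (K * d) * \<bar>s1 t x\<bar> + (K * d + d * \<bar>k t x\<bar>)) integrable_on {0..l}"
        by (intro integrable_add integrable_on_mult_right si integrable_const_ivl)
      fix z assume z: "z \<in> {0..l}"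
      have kk: "\<bar>\<Phi>z t z (Y1 t z) - \<Phi>z t z (y1 t z)\<bar> \<le> K * \<bar>Y1 t z - y1 t z\<bar>"
        "\<bar>\<Phi>x t z (Y1 t z) - \<Phi>x t z (y1 t z)\<bar> \<le> (K + \<bar>k t z\<bar>) * \<bar>Y1 t z - y1 t z\<bar>"
        using K(2)[OF t z MM(2)[OF t z] MM(1)[OF t z]] by auto
      have dd: "\<bar>Y1 t z - y1 t z\<bar> \<le> d" using d1(1)[OF z] by linarith
      have a1: "\<bar>\<Phi>z t z (Y1 t z) - \<Phi>z t z (y1 t z)\<bar> \<le> K * d" using kk(1) dd K(1) by (meson mult_left_mono order_trans)
      have "(K + \<bar>k t z\<bar>) * \<bar>Y1 t z - y1 t z\<bar> \<le> (K + \<bar>k t z\<bar>) * d" using dd K(1) by (intro mult_left_mono) auto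
      then have a2: "\<bar>\<Phi>x t z (Y1 t z) - \<Phi>x t z (y1 t z)\<bar> \<le> K * d + d * \<bar>k t z\<bar>" using kk(2) by (simp add: algebra_simps)
      have "?G z - ?g t z = (\<Phi>z t z (Y1 t z) - \<Phi>z t z (y1 t z)) * s1 t z + (\<Phi>x t z (Y1 t z) - \<Phi>x t z (y1 t z))"
        by (simp add: algebra_simps)
      then have "\<bar>?G z - ?g t z\<bar> \<le> \<bar>\<Phi>z t z (Y1 t z) - \<Phi>z t z (y1 t z)\<bar> * \<bar>s1 t z\<bar> + \<bar>\<Phi>x t z (Y1 t z) - \<Phi>x t z (y1 t z)\<bar>"
        by (metis abs_mult abs_triangle_ineq)
      also have "\<dots> \<le> (K * d) * \<bar>s1 t z\<bar> + (K * d + d * \<bar>k t z\<bar>)" by (intro add_mono mult_right_mono a1 a2) auto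
      finally show "\<bar>?G z - ?g t z\<bar> \<le> (K * d) * \<bar>s1 t z\<bar> + (K * d + d * \<bar>k t z\<bar>)" .
    qed
    also have "\<dots> = (K * d) * integral {0..l} (\<lambda>x. \<bar>s1 t x\<bar>) + (K * d * l + d * integral {0..l} (\<lambda>x. \<bar>k t x\<bar>))"
      using l_pos by (simp add: integral_add integrable_add integrable_on_mult_right si integrable_const_ivl)
    also have "\<dots> \<le> (K * d) * Ks + (K * d * l + d * Kk)"
      by (intro add_mono mult_left_mono Ks Kk t) (use d0 K in auto)
    finally have b1: "\<bar>integral {0..x} (\<lambda>x. ?G x - ?g t x)\<bar> \<le> (K * d) * Ks + (K * d * l + d * Kk)" .
    have "\<bar>\<Phi> t x (y1 t x) - \<Phi> t x (Y1 t x)\<bar> \<le> K * \<bar>y1 t x - Y1 t x\<bar>"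
      using K(2)[OF t x MM(1)[OF t x] MM(2)[OF t x]] by auto
    also have "\<dots> \<le> K * d" using d1(1)[OF x] K(1) by (intro mult_left_mono) auto
    finally have b2: "\<bar>\<Phi> t x (y1 t x) - \<Phi> t x (Y1 t x)\<bar> \<le> K * d" .
    have "\<Phi> t x (y1 t x) - (\<Phi> t 0 (y1 t 0) + integral {0..x} (?g t)) = (\<Phi> t x (y1 t x) - \<Phi> t x (Y1 t x)) + integral {0..x} (\<lambda>x. ?G x - ?g t x)"
      using e1 e2 by linarith
    then have b3: "\<bar>\<Phi> t x (y1 t x) - (\<Phi> t 0 (y1 t 0) + integral {0..x} (?g t))\<bar> \<le> K * d + ((K * d) * Ks + (K * d * l + d * Kk))"
      using b1 b2 by linarith
    have "norm (E' t x) \<le> \<bar>- (y2 t x - Y2 t x)\<bar> + \<bar>\<Phi> t x (y1 t x) - (\<Phi> t 0 (y1 t 0) + integral {0..x} (?g t))\<bar>"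
      unfolding E'_def norm_Pair real_norm_def using sqrt_sum_squares_le_sum_abs[of "- (y2 t x - Y2 t x)"] by simp
    also have "\<dots> \<le> d + (K * d + ((K * d) * Ks + (K * d * l + d * Kk)))" using d1(2)[OF x] b3 by linarith
    also have "\<dots> = L * d" unfolding L_def by (simp add: algebra_simps)
    finally show "norm (E' t x) \<le> L * d" .
  qed
  have e: "y1 t x = Y1 t x" "y2 t x = Y2 t x" if "x \<in> {0..l}" for x using E0[OF t that] unfolding E_def by (auto simp: zero_prod_def)
  show "primitive l (y1 t) (s1 t)" using Y1p[OF t] primitive_cong[of l "y1 t" "Y1 t" "s1 t" "s1 t"] e l_pos by simp
  show "primitive l (y2 t) (s2 t)" using Y2p[OF t] primitive_cong[of l "y2 t" "Y2 t" "s2 t" "s2 t"] e l_pos by simp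
qed

lemma S_freeze: "S u \<Longrightarrow> S (\<lambda>t. u 0)"
  using S_intros(2)[OF jcont_slice[OF S_jcont, of u 0]] T_pos by simp

lemma R_freeze: "R m u \<Longrightarrow> R m (\<lambda>t. u 0)"
proof (induction m arbitrary: u)
  case 0
  have T0: "0 \<in> {0..T}" using T_pos by simp
  obtain M0 M1 M2 where M: "S M0" "S M1" "S M2"
    "\<And>t x. t \<in> {0..T} \<Longrightarrow> x \<in> {0..l} \<Longrightarrow> u t x = M0 t x + M1 t x * r1 x + M2 t x * r2 x"
    using R0E[OF 0] by blast
  show ?case by (rule R0I[OF S_freeze[OF M(1)] S_freeze[OF M(2)] S_freeze[OF M(3)]]) (rule M(4)[OF T0])
next
  case (Suc m)
  then obtain v where v: "S u" "R m v" "\<And>t. t\<in>{0..T} \<Longrightarrow> primitive l (u t) (v t)" by auto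
  have T0: "0 \<in> {0..T}" using T_pos by simp
  show ?case by (rule R_SucI[OF S_freeze[OF v(1)] Suc.IH[OF v(2)] v(3)[OF T0]])
qed

lemma R_static_SucE:
  assumes "R (Suc m) (\<lambda>t. a)"
  obtains a' where "R m (\<lambda>t. a')" "primitive l a a'" "S (\<lambda>t. a)"
proof -
  obtain v where v: "S (\<lambda>t. a)" "R m v" "\<And>t. t\<in>{0..T} \<Longrightarrow> primitive l a (v t)" using assms by auto
  show ?thesis by (rule that[OF R_freeze[OF v(2)] v(3) v(1)]) (use T_pos in simp)
qed

text \<open>For m = 0 linearity decouples the equation: the coefficients of 1, \<open>r1\<close> and
  \<open>r2\<close> solve three systems with the same A and continuous data. For larger m the
  formally differentiated system is solved first, and \<open>persistence\<close> identifies its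
  solution with the densities of u and v. The final implication feeds the induction: the source of
  the differentiated system contains the product of A' and u, which stays in \<open>R m\<close>
  because the u found at the lower level is also in \<open>S\<close>.\<close>

lemma linear_R:
  "RS m A \<Longrightarrow> R m P \<Longrightarrow> R m (\<lambda>t. a) \<Longrightarrow> R m (\<lambda>t. b) \<Longrightarrow>
   \<exists>u v. R m u \<and> R m v \<and> tderiv u (\<lambda>t x. - v t x) \<and> tderiv v (\<lambda>t x. A t x * u t x + P t x) \<and>
     (\<forall>x\<in>{0..l}. u 0 x = a x \<and> v 0 x = b x) \<and> (S P \<and> S (\<lambda>t. a) \<and> S (\<lambda>t. b) \<longrightarrow> S u \<and> S v)"
proof (induction m arbitrary: P a b)
  case 0
  have T0: "0 \<in> {0..T}" using T_pos by simp
  have A: "S A" using 0(1) by (simp only: RS_0)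
  show ?case
  proof (cases "S P \<and> S (\<lambda>t. a) \<and> S (\<lambda>t. b)")
    case True
    then have c: "continuous_on {0..l} a" "continuous_on {0..l} b" using jcont_slice[OF S_jcont T0] by blast+
    obtain u v where uv: "S u" "S v" "tderiv u (\<lambda>t x. - v t x)"
      "tderiv v (\<lambda>t x. A t x * u t x + P t x)" "\<And>x. x \<in> {0..l} \<Longrightarrow> u 0 x = a x \<and> v 0 x = b x"
      using linear_system_S[OF A conjunct1[OF True] c] by blast
    show ?thesis by (intro exI[of _ u] exI[of _ v] conjI S_R0 impI ballI) (use uv in auto)
  next
    case False
    obtain P0 P1 P2 where P: "S P0" "S P1" "S P2"
      "\<And>t x. t \<in> {0..T} \<Longrightarrow> x \<in> {0..l} \<Longrightarrow> P t x = P0 t x + P1 t x * r1 x + P2 t x * r2 x" using R0E[OF 0(2)] by blast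
    obtain a0 a1 a2 where a: "S a0" "S a1" "S a2"
      "\<And>t x. t \<in> {0..T} \<Longrightarrow> x \<in> {0..l} \<Longrightarrow> a x = a0 t x + a1 t x * r1 x + a2 t x * r2 x" using R0E[OF 0(3)] by blast
    obtain b0 b1 b2 where b: "S b0" "S b1" "S b2"
      "\<And>t x. t \<in> {0..T} \<Longrightarrow> x \<in> {0..l} \<Longrightarrow> b x = b0 t x + b1 t x * r1 x + b2 t x * r2 x" using R0E[OF 0(4)] by blast
    note sl = jcont_slice[OF S_jcont T0]
    obtain u0 v0 where u0: "S u0" "S v0" "tderiv u0 (\<lambda>t x. - v0 t x)"
      "tderiv v0 (\<lambda>t x. A t x * u0 t x + P0 t x)" "\<And>x. x \<in> {0..l} \<Longrightarrow> u0 0 x = a0 0 x \<and> v0 0 x = b0 0 x"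
      using linear_system_S[OF A P(1) sl[OF a(1)] sl[OF b(1)]] by blast
    obtain u1 v1 where u1: "S u1" "S v1" "tderiv u1 (\<lambda>t x. - v1 t x)"
      "tderiv v1 (\<lambda>t x. A t x * u1 t x + P1 t x)" "\<And>x. x \<in> {0..l} \<Longrightarrow> u1 0 x = a1 0 x \<and> v1 0 x = b1 0 x"
      using linear_system_S[OF A P(2) sl[OF a(2)] sl[OF b(2)]] by blast
    obtain u2 v2 where u2: "S u2" "S v2" "tderiv u2 (\<lambda>t x. - v2 t x)"
      "tderiv v2 (\<lambda>t x. A t x * u2 t x + P2 t x)" "\<And>x. x \<in> {0..l} \<Longrightarrow> u2 0 x = a2 0 x \<and> v2 0 x = b2 0 x"
      using linear_system_S[OF A P(3) sl[OF a(3)] sl[OF b(3)]] by blast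
    let ?u = "\<lambda>t x. u0 t x + u1 t x * r1 x + u2 t x * r2 x" and ?v = "\<lambda>t x. v0 t x + v1 t x * r1 x + v2 t x * r2 x"
    have Ru: "R 0 ?u" by (rule R0I[OF u0(1) u1(1) u2(1)]) simp
    have Rv: "R 0 ?v" by (rule R0I[OF u0(2) u1(2) u2(2)]) simp
    have "tderiv ?u (\<lambda>t x. - v0 t x + (- v1 t x * r1 x + u1 t x * 0) + (- v2 t x * r2 x + u2 t x * 0))"
      by (intro tderiv_add tderiv_mult tderiv_static u0 u1 u2)
    then have du: "tderiv ?u (\<lambda>t x. - ?v t x)" by (rule tderiv_cong[rotated 2]) auto
    have "tderiv ?v (\<lambda>t x. (A t x * u0 t x + P0 t x) + ((A t x * u1 t x + P1 t x) * r1 x + v1 t x * 0) + ((A t x * u2 t x + P2 t x) * r2 x + v2 t x * 0))"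
      by (intro tderiv_add tderiv_mult tderiv_static u0 u1 u2)
    then have dv: "tderiv ?v (\<lambda>t x. A t x * ?u t x + P t x)"
      by (rule tderiv_cong[rotated 2]) (auto simp: P(4) algebra_simps)
    have i: "\<forall>x\<in>{0..l}. ?u 0 x = a x \<and> ?v 0 x = b x" using u0(5) u1(5) u2(5) a(4)[OF T0] b(4)[OF T0] by simp
    show ?thesis using False by (intro exI[of _ ?u] exI[of _ ?v] conjI Ru Rv du dv i) blast
  qed
next
  case (Suc m)
  obtain A' where A': "R m A'" "\<And>t. t\<in>{0..T} \<Longrightarrow> primitive l (A t) (A' t)" "RS m A" using Suc.prems(1) by (rule RS_SucE) blast
  obtain P' where P': "S P" "R m P'" "\<And>t. t\<in>{0..T} \<Longrightarrow> primitive l (P t) (P' t)" using Suc.prems(2) by auto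
  obtain a' where a': "R m (\<lambda>t. a')" "primitive l a a'" "S (\<lambda>t. a)" using R_static_SucE[OF Suc.prems(3)] by blast
  obtain b' where b': "R m (\<lambda>t. b')" "primitive l b b'" "S (\<lambda>t. b)" using R_static_SucE[OF Suc.prems(4)] by blast
  obtain u v where uv: "R m u" "R m v" "tderiv u (\<lambda>t x. - v t x)" "tderiv v (\<lambda>t x. A t x * u t x + P t x)"
     "\<forall>x\<in>{0..l}. u 0 x = a x \<and> v 0 x = b x" "S u" "S v"
    using Suc.IH[OF A'(3) R_mono[OF Suc.prems(2)] R_mono[OF Suc.prems(3)] R_mono[OF Suc.prems(4)]] P'(1) a'(3) b'(3) by blast
  have RSu: "RS m u" using uv unfolding RS_def by blast
  have f: "R m (\<lambda>t x. A' t x * u t x + P' t x)" by (intro R_add R_mult A' RSu P')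
  obtain s1 s2 where s: "R m s1" "R m s2" "tderiv s1 (\<lambda>t x. - s2 t x)" "tderiv s2 (\<lambda>t x. A t x * s1 t x + (A' t x * u t x + P' t x))"
     "\<forall>x\<in>{0..l}. s1 0 x = a' x \<and> s2 0 x = b' x"
    using Suc.IH[OF A'(3) f a'(1) b'(1)] by blast
  have l0: "0 \<le> l" using l_pos by simp
  obtain KA where KA: "0 \<le> KA" "\<And>t x. t \<in> {0..T} \<Longrightarrow> x \<in> {0..l} \<Longrightarrow> \<bar>A t x\<bar> \<le> KA"
    using jcont_bound[OF S_jcont] A'(3) unfolding RS_def by metis
  have i: "primitive l (u 0) (s1 0)" "primitive l (v 0) (s2 0)"
    using a'(2) b'(2) primitive_cong[of l "u 0" a "s1 0" a'] primitive_cong[of l "v 0" b "s2 0" b'] uv(5) s(5) l0 by auto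
  have As: "R m (\<lambda>t x. A t x * s1 t x)" using R_mult[OF s(1) A'(3)] by (simp add: mult.commute)
  have "primitive l (u t) (s1 t) \<and> primitive l (v t) (s2 t)" if t: "t \<in> {0..T}" for t
  proof (rule conjI)
    have chain: "primitive l (\<lambda>x. A t x * Y x + P t x) (\<lambda>x. A t x * s1 t x + (A' t x * Y x + P' t x))"
      if t: "t \<in> {0..T}" and Y: "primitive l Y (s1 t)" for t Y
    proof -
      have "primitive l (\<lambda>x. A t x * Y x + P t x) (\<lambda>x. (A' t x * Y x + A t x * s1 t x) + P' t x)"
        by (intro primitive_add primitive_mult A' P' Y t l0)
      then show ?thesis by (simp add: ac_simps)
    qed
    have rhs: "(\<lambda>x. A t x * s1 t x + (A' t x * u t x + P' t x)) absolutely_integrable_on {0..l}" if "t \<in> {0..T}" for t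
      by (rule R_ai[OF R_add[OF As f] that])
    have lip: "\<exists>K\<ge>0. \<forall>t\<in>{0..T}. \<forall>x\<in>{0..l}. \<forall>a b. \<bar>a\<bar> \<le> M \<longrightarrow> \<bar>b\<bar> \<le> M \<longrightarrow>
        \<bar>(A t x * a + P t x) - (A t x * b + P t x)\<bar> \<le> K * \<bar>a - b\<bar> \<and> \<bar>A t x - A t x\<bar> \<le> K * \<bar>a - b\<bar> \<and>
        \<bar>(A' t x * a + P' t x) - (A' t x * b + P' t x)\<bar> \<le> (K + \<bar>A' t x\<bar>) * \<bar>a - b\<bar>" for M
    proof (intro exI[of _ KA] conjI ballI allI impI KA(1))
      fix t x a b assume t: "t \<in> {0..T}" "x \<in> {0..l}"
      have e: "(A t x * a + P t x) - (A t x * b + P t x) = A t x * (a - b)" "(A' t x * a + P' t x) - (A' t x * b + P' t x) = A' t x * (a - b)"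
        by (simp_all add: algebra_simps)
      show "\<bar>(A t x * a + P t x) - (A t x * b + P t x)\<bar> \<le> KA * \<bar>a - b\<bar>" unfolding e abs_mult using KA(2)[OF t] by (intro mult_right_mono) auto
      show "\<bar>A t x - A t x\<bar> \<le> KA * \<bar>a - b\<bar>" using KA(1) by simp
      show "\<bar>(A' t x * a + P' t x) - (A' t x * b + P' t x)\<bar> \<le> (KA + \<bar>A' t x\<bar>) * \<bar>a - b\<bar>"
        unfolding e abs_mult using KA(1) by (intro mult_right_mono) auto
    qed
    note p = persistence[where \<Phi>="\<lambda>t x z. A t x * z + P t x" and \<Phi>z="\<lambda>t x z. A t x" and \<Phi>x="\<lambda>t x z. A' t x * z + P' t x",
        OF S_jcont[OF uv(6)] S_jcont[OF uv(7)] uv(3,4) s(1-4) i chain rhs A'(1) lip t]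
    show "primitive l (u t) (s1 t)" by (rule p(1))
    show "primitive l (v t) (s2 t)" by (rule p(2))
  qed
  then have "R (Suc m) u" "R (Suc m) v" using R_SucI[OF uv(6) s(1)] R_SucI[OF uv(7) s(2)] by blast+
  then show ?case using uv by blast
qed

end

section \<open>Weak derivatives and Sobolev norms\<close>

text \<open>Iterated ordinary derivatives in place of the directional ones of \<open>Ck_on\<close>.
  Closure under products and affine changes of variable becomes a plain induction, and
  \<open>Ck_on_UNIV_iff_sm\<close> transfers it.\<close>

primrec sm :: "nat \<Rightarrow> (real \<Rightarrow> real) \<Rightarrow> bool" where
  "sm 0 f \<longleftrightarrow> continuous_on UNIV f"
| "sm (Suc k) f \<longleftrightarrow> (\<exists>f'. (\<forall>x. (f has_real_derivative f' x) (at x)) \<and> sm k f')"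

lemma frechet_real_derivative:
  assumes "(f has_real_derivative d) (at x)"
  shows "frechet_derivative f (at x) v = d * v"
  using frechet_derivative_at[of f "(*) d" x] assms unfolding has_field_derivative_def by metis

lemma sm_SucI: "(\<And>x. (f has_real_derivative f' x) (at x)) \<Longrightarrow> sm k f' \<Longrightarrow> sm (Suc k) f"
  by auto

lemma sm_cmult: "sm k f \<Longrightarrow> sm k (\<lambda>x. c * f x)"
proof (induction k arbitrary: f)
  case 0 then show ?case by (auto intro: continuous_intros)
next
  case (Suc k)
  then obtain f' where f': "\<And>x. (f has_real_derivative f' x) (at x)" "sm k f'" by auto
  have "((\<lambda>x. c * f x) has_real_derivative c * f' x) (at x)" for x by (rule DERIV_cmult[OF f'(1)])
  then show ?case by (rule sm_SucI) (rule Suc.IH[OF f'(2)])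
qed

lemma sm_add: "sm k f \<Longrightarrow> sm k g \<Longrightarrow> sm k (\<lambda>x. f x + g x)"
proof (induction k arbitrary: f g)
  case 0 then show ?case by (auto intro: continuous_intros)
next
  case (Suc k)
  then obtain f' g' where f': "\<And>x. (f has_real_derivative f' x) (at x)" "sm k f'"
    "\<And>x. (g has_real_derivative g' x) (at x)" "sm k g'" by auto
  have "((\<lambda>x. f x + g x) has_real_derivative f' x + g' x) (at x)" for x by (rule DERIV_add[OF f'(1,3)])
  then show ?case by (rule sm_SucI) (rule Suc.IH[OF f'(2,4)])
qed

lemma sm_continuous: "sm k f \<Longrightarrow> continuous_on UNIV f"
proof (cases k)
  case (Suc n)
  assume "sm k f"
  then obtain f' where "\<And>x. (f has_real_derivative f' x) (at x)" using Suc by auto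
  then show ?thesis by (meson DERIV_isCont continuous_at_imp_continuous_on)
qed simp

lemma sm_mono: "sm (Suc k) f \<Longrightarrow> sm k f"
proof (induction k arbitrary: f)
  case 0 then show ?case using sm_continuous[of 1 f] by simp
next
  case (Suc k)
  then obtain f' where "\<And>x. (f has_real_derivative f' x) (at x)" "sm (Suc k) f'" using sm.simps(2)[of "Suc k" f] by blast
  then show ?case using Suc.IH[of f'] sm.simps(2)[of k f] by blast
qed

lemma sm_mult: "sm k f \<Longrightarrow> sm k g \<Longrightarrow> sm k (\<lambda>x. f x * g x)"
proof (induction k arbitrary: f g)
  case 0 then show ?case by (auto intro: continuous_intros)
next
  case (Suc k)
  then obtain f' g' where f': "\<And>x. (f has_real_derivative f' x) (at x)" "sm k f'"
    "\<And>x. (g has_real_derivative g' x) (at x)" "sm k g'" by auto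
  have "((\<lambda>x. f x * g x) has_real_derivative f' x * g x + g' x * f x) (at x)" for x by (rule DERIV_mult[OF f'(1,3)])
  moreover have "sm k (\<lambda>x. f' x * g x + g' x * f x)"
    by (intro sm_add Suc.IH f' sm_mono[OF Suc.prems(1)] sm_mono[OF Suc.prems(2)])
  ultimately show ?case by (rule sm_SucI)
qed

lemma sm_affine: "sm k f \<Longrightarrow> sm k (\<lambda>x. f (a * x + b))"
proof (induction k arbitrary: f)
  case 0 then show ?case by (auto intro!: continuous_intros continuous_on_compose2[of UNIV f])
next
  case (Suc k)
  then obtain f' where f': "\<And>x. (f has_real_derivative f' x) (at x)" "sm k f'" by auto
  have "((\<lambda>x. f (a * x + b)) has_real_derivative f' (a * x + b) * a) (at x)" for x
    by (rule DERIV_chain2[OF f'(1)]) (auto intro!: derivative_eq_intros)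
  moreover have "sm k (\<lambda>x. f' (a * x + b) * a)" using sm_cmult[OF Suc.IH[OF f'(2)], of a] by (simp add: mult.commute)
  ultimately show ?case by (rule sm_SucI)
qed

lemma Ck_on_UNIV_iff_sm: "Ck_on k f UNIV \<longleftrightarrow> sm k f"
proof (induction k arbitrary: f)
  case (Suc k)
  show ?case
  proof
    assume a: "Ck_on (Suc k) f UNIV"
    have "(f has_real_derivative frechet_derivative f (at x) 1) (at x)" for x
      using has_real_derivative_frechet[of f x UNIV] a by simp
    moreover have "sm k (\<lambda>x. frechet_derivative f (at x) 1)" using a Suc by simp
    ultimately show "sm (Suc k) f" unfolding sm.simps by (intro exI[of _ "\<lambda>x. frechet_derivative f (at x) 1"]) blast
  next
    assume "sm (Suc k) f"
    then obtain f' where f': "\<And>x. (f has_real_derivative f' x) (at x)" "sm k f'" by auto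
    have "f differentiable (at x)" for x using f'(1) real_differentiable_def by blast
    moreover have "Ck_on k (\<lambda>x. frechet_derivative f (at x) v) UNIV" for v
      unfolding frechet_real_derivative[OF f'(1)] Suc using sm_cmult[OF f'(2), of v] by (simp add: mult.commute)
    ultimately show "Ck_on (Suc k) f UNIV" by simp
  qed
qed simp

lemma smooth_on_UNIV_iff_sm: "smooth_on f UNIV \<longleftrightarrow> (\<forall>k. sm k f)"
  unfolding smooth_on_def Ck_on_UNIV_iff_sm ..

lemma smooth_UNIV_deriv:
  assumes "smooth_on f UNIV"
  shows "(f has_real_derivative deriv f x) (at x)" "smooth_on (deriv f) UNIV"
proof -
  have d: "(f has_real_derivative deriv f x) (at x)" for x
  proof -
    have "sm 1 f" using assms smooth_on_UNIV_iff_sm by blast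
    then obtain f' where "\<And>x. (f has_real_derivative f' x) (at x)" by auto
    then show ?thesis by (metis DERIV_imp_deriv)
  qed
  show "(f has_real_derivative deriv f x) (at x)" by (rule d)
  have "sm k (deriv f)" for k
  proof -
    have "sm (Suc k) f" using assms smooth_on_UNIV_iff_sm by blast
    then obtain f' where f': "\<And>x. (f has_real_derivative f' x) (at x)" "sm k f'" by auto
    have "deriv f = f'" using DERIV_imp_deriv[OF f'(1)] by auto
    then show ?thesis using f'(2) by simp
  qed
  then show "smooth_on (deriv f) UNIV" by (simp add: smooth_on_UNIV_iff_sm)
qed

text \<open>\<open>x\<^sup>-\<^sup>n exp(-1/x)\<close>: a family closed under differentiation.\<close>

definition flat :: "nat \<Rightarrow> real \<Rightarrow> real" where
  "flat n x = (if 0 < x then (1 / x) ^ n * exp (- (1 / x)) else 0)"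

lemma flat_tendsto_0: "(flat n \<longlongrightarrow> 0) (at 0)"
proof -
  have "((\<lambda>x::real. inverse x ^ n / exp (inverse x)) \<longlongrightarrow> 0) (at_right 0)"
    by (rule filterlim_compose[OF tendsto_power_div_exp_0 filterlim_inverse_at_top_right])
  then have "(flat n \<longlongrightarrow> 0) (at_right 0)"
    by (rule Lim_transform_eventually) (auto simp: flat_def exp_minus field_simps eventually_at_right_field intro!: exI[of _ 1])
  moreover have "(flat n \<longlongrightarrow> 0) (at_left 0)"
    by (rule tendsto_eventually) (auto simp: flat_def eventually_at_left_field intro!: exI[of _ "-1"])
  ultimately show ?thesis by (simp add: filterlim_at_split)
qed

lemma flat_derivative: "(flat n has_real_derivative flat (n + 2) x - real n * flat (n + 1) x) (at x)"
proof -
  consider "x < 0" | "0 < x" | "x = 0" by linarith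
  then show ?thesis
  proof cases
    case 1
    have "((\<lambda>x. 0) has_real_derivative 0) (at x)" by simp
    then have "(flat n has_real_derivative 0) (at x)"
      by (rule has_field_derivative_transform_within_open[of _ _ _ "{..<0}"]) (use 1 in \<open>auto simp: flat_def\<close>)
    then show ?thesis using 1 by (simp add: flat_def)
  next
    case 2
    have i: "((\<lambda>x. 1 / x) has_real_derivative - ((1 / x) * (1 / x))) (at x)"
      using 2 by (auto intro!: derivative_eq_intros simp: field_simps)
    have p: "((\<lambda>x. (1 / x) ^ n) has_real_derivative real n * (- ((1 / x) * (1 / x)) * (1 / x) ^ (n - Suc 0))) (at x)"
      by (rule DERIV_power[OF i, of n])
    have e: "((\<lambda>x. exp (- (1 / x))) has_real_derivative exp (- (1 / x)) * - (- ((1 / x) * (1 / x)))) (at x)"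
      by (rule DERIV_chain2[OF DERIV_exp DERIV_minus[OF i]])
    have eq: "real n * (- ((1 / x) * (1 / x)) * (1 / x) ^ (n - Suc 0)) * exp (- (1 / x)) + exp (- (1 / x)) * - (- ((1 / x) * (1 / x))) * (1 / x) ^ n
      = flat (n + 2) x - real n * flat (n + 1) x"
      using 2 by (cases n) (simp_all add: flat_def algebra_simps)
    from DERIV_mult[OF p e] have "((\<lambda>x. (1 / x) ^ n * exp (- (1 / x))) has_real_derivative flat (n + 2) x - real n * flat (n + 1) x) (at x)"
      unfolding eq .
    then show ?thesis
      by (rule has_field_derivative_transform_within_open[of _ _ _ "{0<..}"]) (use 2 in \<open>auto simp: flat_def\<close>)
  next
    case 3
    have "((\<lambda>h. (flat n (0 + h) - flat n 0) / h) \<longlongrightarrow> 0) (at 0)"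
      by (rule Lim_transform_eventually[OF flat_tendsto_0[of "n + 1"]]) (auto simp: flat_def)
    then have "(flat n has_real_derivative 0) (at 0)" by (simp add: DERIV_def)
    then show ?thesis using 3 by (simp add: flat_def)
  qed
qed

lemma sm_flat: "sm k (flat n)"
proof (induction k arbitrary: n)
  case 0
  show ?case using DERIV_isCont[OF flat_derivative] by (simp add: continuous_at_imp_continuous_on)
next
  case (Suc k)
  have "sm k (\<lambda>x. flat (n + 2) x + (- real n) * flat (n + 1) x)" by (intro sm_add sm_cmult Suc)
  then have "sm k (\<lambda>x. flat (n + 2) x - real n * flat (n + 1) x)" by simp
  with flat_derivative show ?case by (rule sm_SucI)
qed

text \<open>\<open>flat 0 y\<close> is exp (-1/y) for y > 0 and tends to 1 as y grows, so stretching
  by \<open>Suc k\<close> makes the products tend to the indicator of the open interval from a to b.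
  The arguments are written out in the affine form that \<open>sm_affine\<close> expects.\<close>

definition bump :: "nat \<Rightarrow> real \<Rightarrow> real \<Rightarrow> real \<Rightarrow> real" where
  "bump k a b x = flat 0 (real (Suc k) * x + - (real (Suc k) * a)) * flat 0 (- real (Suc k) * x + real (Suc k) * b)"

lemma bump_props:
  "smooth_on (bump k a b) UNIV" "0 \<le> bump k a b x" "bump k a b x \<le> 1"
  "x \<notin> {a<..<b} \<Longrightarrow> bump k a b x = 0" "x \<in> {a<..<b} \<Longrightarrow> 0 < bump k a b x"
  "(\<lambda>k. bump k a b x) \<longlonglongrightarrow> (if x \<in> {a<..<b} then 1 else 0)"
proof -
  show "smooth_on (bump k a b) UNIV"
    unfolding smooth_on_UNIV_iff_sm bump_def by (intro allI sm_mult sm_affine sm_flat)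
  have eq: "bump k a b x = flat 0 (real (Suc k) * (x - a)) * flat 0 (real (Suc k) * (b - x))" for k x
    unfolding bump_def by (simp add: algebra_simps)
  have f: "0 \<le> flat 0 y" "flat 0 y \<le> 1" "0 < y \<Longrightarrow> 0 < flat 0 y" "y \<le> 0 \<Longrightarrow> flat 0 y = 0" for y
    by (auto simp: flat_def)
  show "0 \<le> bump k a b x" "bump k a b x \<le> 1" unfolding eq using f by (auto intro: mult_le_one)
  show z: "bump k a b x = 0" if "x \<notin> {a<..<b}" for k
    using that f(4) unfolding eq by (auto simp: mult_nonneg_nonpos)
  show "0 < bump k a b x" if "x \<in> {a<..<b}" unfolding eq using that by (intro mult_pos_pos f(3)) auto
  show "(\<lambda>k. bump k a b x) \<longlonglongrightarrow> (if x \<in> {a<..<b} then 1 else 0)"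
  proof (cases "x \<in> {a<..<b}")
    case True
    have "(\<lambda>k. flat 0 (real (Suc k) * y)) \<longlonglongrightarrow> 1" if y: "0 < y" for y
    proof -
      have "(\<lambda>k. exp (- (inverse (real (Suc k)) * (1 / y)))) \<longlonglongrightarrow> exp (- (0 * (1 / y)))"
        by (intro tendsto_intros LIMSEQ_inverse_real_of_nat)
      moreover have "flat 0 (real (Suc k) * y) = exp (- (inverse (real (Suc k)) * (1 / y)))" for k
        using mult_pos_pos[OF _ y, of "real (Suc k)"] unfolding flat_def by (simp add: field_simps)
      ultimately show ?thesis by simp
    qed
    then have "(\<lambda>k. bump k a b x) \<longlonglongrightarrow> 1 * 1" unfolding eq using True by (intro tendsto_mult) auto
    then show ?thesis using True by simp
  next
    case False
    show ?thesis unfolding if_not_P[OF False] z[OF False] by simp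
  qed
qed

lemma test_function_bump: "0 < a \<Longrightarrow> b < l \<Longrightarrow> test_function l (bump k a b)"
proof -
  assume ab: "0 < a" "b < l"
  have "bump k a b x = 0" if "x \<notin> {a..b}" for x
    by (rule bump_props(4)) (use that in auto)
  then show ?thesis unfolding test_function_def using bump_props(1) ab by blast
qed

section \<open>Test functions and the fundamental lemma of the calculus of variations\<close>

lemma test_functionE:
  assumes "test_function l \<phi>"
  obtains c d where "0 < c" "d < l" "\<And>x. x \<notin> {c..d} \<Longrightarrow> \<phi> x = 0" "smooth_on \<phi> UNIV"
  using assms unfolding test_function_def by blast

lemma test_function_continuous: "test_function l \<phi> \<Longrightarrow> continuous_on A \<phi>"
  unfolding test_function_def smooth_on_UNIV_iff_sm using sm_continuous continuous_on_subset by blast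

lemma test_function_deriv:
  assumes "test_function l \<phi>"
  shows "test_function l (deriv \<phi>)" "(\<phi> has_real_derivative deriv \<phi> x) (at x)"
proof -
  obtain c d where c: "0 < c" "d < l" "\<And>x. x \<notin> {c..d} \<Longrightarrow> \<phi> x = 0" "smooth_on \<phi> UNIV"
    using test_functionE[OF assms] by metis
  show "(\<phi> has_real_derivative deriv \<phi> x) (at x)" by (rule smooth_UNIV_deriv[OF c(4)])
  have "deriv \<phi> x = 0" if x: "x \<notin> {c..d}" for x
  proof -
    have "((\<lambda>x. 0) has_real_derivative 0) (at x)" by simp
    then have "(\<phi> has_real_derivative 0) (at x)"
      by (rule has_field_derivative_transform_within_open[of _ _ _ "- {c..d}"]) (use x c(3) in auto)
    then show ?thesis by (rule DERIV_imp_deriv)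
  qed
  then show "test_function l (deriv \<phi>)" unfolding test_function_def using c smooth_UNIV_deriv[OF c(4)] by blast
qed

lemma test_function_derivs: "test_function l \<phi> \<Longrightarrow> test_function l ((deriv ^^ j) \<phi>)"
  by (induction j) (auto intro: test_function_deriv)

lemma test_function_zero:
  "test_function l \<phi> \<Longrightarrow> x \<le> 0 \<or> l \<le> x \<Longrightarrow> \<phi> x = 0"
  by (elim test_functionE) auto

lemma locally_integrable_test:
  assumes v: "locally_integrable l v" and t: "test_function l \<phi>"
  shows "set_integrable lebesgue {0<..<l} (\<lambda>x. v x * \<phi> x)"
    "(\<lambda>x. v x * \<phi> x) absolutely_integrable_on {0..l}"
    "(LINT x:{0<..<l}|lebesgue. v x * \<phi> x) = integral {0..l} (\<lambda>x. v x * \<phi> x)"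
proof -
  obtain c d where c: "0 < c" "d < l" "\<And>x. x \<notin> {c..d} \<Longrightarrow> \<phi> x = 0" using test_functionE[OF t] by metis
  have cont: "continuous_on {c..d} \<phi>" using test_function_continuous[OF t] .
  have vi: "v absolutely_integrable_on {c..d}" using v c unfolding locally_integrable_def by blast
  have "(\<lambda>x. \<phi> x * v x) absolutely_integrable_on {c..d}"
    by (rule absolutely_integrable_bounded_measurable_product_real[OF continuous_imp_measurable_on_sets_lebesgue[OF cont] _ _ vi])
       (auto intro: compact_imp_bounded compact_continuous_image cont)
  then have i: "integrable lebesgue (\<lambda>x. indicator {c..d} x *\<^sub>R (v x * \<phi> x))" unfolding set_integrable_def by (simp add: mult.commute)
  have e: "(\<lambda>x. indicator {0<..<l} x *\<^sub>R (v x * \<phi> x)) = (\<lambda>x. indicator {c..d} x *\<^sub>R (v x * \<phi> x))"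
    "(\<lambda>x. indicator {0..l} x *\<^sub>R (v x * \<phi> x)) = (\<lambda>x. indicator {c..d} x *\<^sub>R (v x * \<phi> x))"
    using c by (auto simp: indicator_def fun_eq_iff)
  show "set_integrable lebesgue {0<..<l} (\<lambda>x. v x * \<phi> x)" unfolding set_integrable_def e by (rule i)
  show a: "(\<lambda>x. v x * \<phi> x) absolutely_integrable_on {0..l}" unfolding set_integrable_def e by (rule i)
  show "(LINT x:{0<..<l}|lebesgue. v x * \<phi> x) = integral {0..l} (\<lambda>x. v x * \<phi> x)"
    unfolding set_lebesgue_integral_eq_integral(2)[OF a, symmetric] set_lebesgue_integral_def e ..
qed

lemma absolutely_integrable_imp_local:
  "v absolutely_integrable_on {0..l} \<Longrightarrow> locally_integrable l v"
  unfolding locally_integrable_def by (auto intro: set_integrable_subset)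

lemma locally_integrable_diff:
  "locally_integrable l u \<Longrightarrow> locally_integrable l v \<Longrightarrow> locally_integrable l (\<lambda>x. u x - v x)"
  unfolding locally_integrable_def by (auto intro: set_integral_diff)

text \<open>Bumps tending to the indicator of an interval show that v has integral zero over every
  subinterval of a compact part of (0,l), and \<open>AE_zero_if_integrals_zero\<close> concludes
  there. As v is only locally integrable, (0,l) is exhausted by compact parts afterwards.\<close>

lemma fundamental_lemma:
  assumes v: "locally_integrable l v" and "0 < l"
    and z: "\<And>\<phi>. test_function l \<phi> \<Longrightarrow> integral {0..l} (\<lambda>x. v x * \<phi> x) = 0"
  shows "negligible {x \<in> {0<..<l}. v x \<noteq> 0}"
proof -
  have loc: "negligible {x \<in> {c..d}. v x \<noteq> 0}" if cd: "0 < c" "c < d" "d < l" for c d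
  proof -
    have int0: "integral {a..b} v = 0" if ab: "c \<le> a" "a < b" "b \<le> d" for a b
    proof -
      define w where "w x = (if x \<in> {a..b} then v x else 0)" for x
      have va: "v absolutely_integrable_on {a..b}" using v ab cd unfolding locally_integrable_def by auto
      have wi: "w absolutely_integrable_on UNIV" unfolding w_def using va by (simp only: absolutely_integrable_restrict_UNIV)
      have "(\<lambda>k. integral UNIV (\<lambda>x. w x * bump k a b x)) \<longlonglongrightarrow> integral UNIV (\<lambda>x. w x * (if x \<in> {a<..<b} then 1 else 0))"
      proof (rule dominated_convergence(2)[where h="\<lambda>x. \<bar>w x\<bar>"])
        show "(\<lambda>x. w x * bump k a b x) integrable_on UNIV" for k
        proof -
          have "(\<lambda>x. bump k a b x * w x) absolutely_integrable_on UNIV"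
          proof (rule absolutely_integrable_bounded_measurable_product_real[OF _ _ _ wi])
            show "bump k a b \<in> borel_measurable (lebesgue_on UNIV)"
              using bump_props(1) sm_continuous unfolding smooth_on_UNIV_iff_sm by (intro continuous_imp_measurable_on_sets_lebesgue) auto
            show "bounded (bump k a b ` UNIV)" using bump_props(2,3) by (auto simp: bounded_iff intro!: exI[of _ 1])
          qed simp
          then show ?thesis by (simp add: absolutely_integrable_on_def mult.commute)
        qed
        show "(\<lambda>x. \<bar>w x\<bar>) integrable_on UNIV" using wi by (simp add: absolutely_integrable_on_def)
        show "norm (w x * bump k a b x) \<le> \<bar>w x\<bar>" for k x
          using bump_props(2,3)[of k a b x] by (simp add: abs_mult mult_left_le)
        show "(\<lambda>k. w x * bump k a b x) \<longlonglongrightarrow> w x * (if x \<in> {a<..<b} then 1 else 0)" for x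
          by (intro tendsto_mult tendsto_const bump_props(6))
      qed
      moreover have "integral UNIV (\<lambda>x. w x * bump k a b x) = 0" for k
      proof -
        have "integral UNIV (\<lambda>x. w x * bump k a b x) = integral UNIV (\<lambda>x. if x \<in> {0..l} then v x * bump k a b x else 0)"
          using ab cd bump_props(4)[of _ a b k] by (intro integral_cong) (auto simp: w_def)
        also have "\<dots> = integral {0..l} (\<lambda>x. v x * bump k a b x)" by (rule integral_restrict_UNIV)
        also have "\<dots> = 0" using ab cd by (intro z test_function_bump) auto
        finally show ?thesis .
      qed
      ultimately have "(\<lambda>k::nat. 0) \<longlonglongrightarrow> integral UNIV (\<lambda>x. w x * (if x \<in> {a<..<b} then 1 else 0))" by simp
      then have "integral UNIV (\<lambda>x. w x * (if x \<in> {a<..<b} then 1 else 0)) = 0"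
        by (rule LIMSEQ_unique[OF _ tendsto_const])
      moreover have "integral UNIV (\<lambda>x. w x * (if x \<in> {a<..<b} then 1 else 0)) = integral UNIV w"
        by (rule integral_spike[of "{a, b}"]) (auto simp: w_def)
      moreover have "integral UNIV w = integral {a..b} v" unfolding w_def by (rule integral_restrict_UNIV)
      ultimately show ?thesis by simp
    qed
    define w where "w x = (if x \<in> {c..d} then v x else 0)" for x
    have wa: "w absolutely_integrable_on {0..l}"
    proof -
      have "v absolutely_integrable_on {c..d}" using v cd unfolding locally_integrable_def by auto
      then have "w absolutely_integrable_on UNIV" unfolding w_def by (simp only: absolutely_integrable_restrict_UNIV)
      then show ?thesis by (rule set_integrable_subset) auto
    qed
    have "integral {0..x} w = 0" if x: "x \<in> {0..l}" for x
    proof (cases "x \<le> c")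
      case True
      have "integral {0..x} w = integral {0..x} (\<lambda>x. 0)"
        by (rule integral_spike[of "{c}"]) (use True in \<open>auto simp: w_def\<close>)
      then show ?thesis by simp
    next
      case False
      have "integral {0..x} w = integral ({c..d} \<inter> {0..x}) v" unfolding w_def by (rule integral_restrict_Int)
      also have "{c..d} \<inter> {0..x} = {c..min x d}" using cd by auto
      also have "integral \<dots> v = 0" using False cd by (intro int0) auto
      finally show ?thesis .
    qed
    then have "negligible {x \<in> {0..l}. w x \<noteq> 0}" using cd by (intro AE_zero_if_integrals_zero wa) auto
    then show ?thesis by (rule negligible_subset) (use cd in \<open>auto simp: w_def\<close>)
  qed
  \<comment> \<open>These intervals increase to (0,l). The summand 3 keeps l / (n + 3) below l / 2,
    so that each of them is nondegenerate.\<close>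
  have "negligible (\<Union>n. {x \<in> {l / (real n + 3) .. l - l / (real n + 3)}. v x \<noteq> 0})"
  proof (rule negligible_Union_nat)
    fix n :: nat
    have "l / (real n + 3) < l - l / (real n + 3)" using \<open>0 < l\<close> by (simp add: field_simps add_pos_nonneg)
    then show "negligible {x \<in> {l / (real n + 3) .. l - l / (real n + 3)}. v x \<noteq> 0}"
      using \<open>0 < l\<close> by (intro loc) auto
  qed
  moreover have "{x \<in> {0<..<l}. v x \<noteq> 0} \<subseteq> (\<Union>n. {x \<in> {l / (real n + 3) .. l - l / (real n + 3)}. v x \<noteq> 0})"
  proof clarsimp
    fix x assume x: "0 < x" "x < l"
    define m where "m = min x (l - x)"
    have m: "0 < m" "m \<le> x" "x \<le> l - m" unfolding m_def using x by auto
    obtain n where n: "l / m < real n" using reals_Archimedean2 by blast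
    then have "l < m * (real n + 3)" using m by (simp add: field_simps)
    then have "l / (real n + 3) \<le> m" by (simp add: divide_le_eq mult.commute)
    then show "\<exists>n. l / (real n + 3) \<le> x \<and> x \<le> l - l / (real n + 3)" using m by (intro exI[of _ n]) auto
  qed
  ultimately show ?thesis by (rule negligible_subset)
qed

section \<open>Sobolev functions as chains of iterated primitives\<close>

lemma primitive_test_parts:
  assumes "primitive l u v" "test_function l \<phi>" "0 < l"
  shows "integral {0..l} (\<lambda>x. u x * deriv \<phi> x) = - integral {0..l} (\<lambda>x. v x * \<phi> x)"
proof -
  have c: "continuous_on {0..l} (deriv \<phi>)" "continuous_on {0..l} \<phi>" "continuous_on {0..l} u"
    using test_function_continuous[OF test_function_deriv(1)[OF assms(2)]] test_function_continuous[OF assms(2)]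
      primitive_continuous[OF assms(1)] by auto
  have "primitive l \<phi> (deriv \<phi>)"
    by (rule primitive_C1) (auto intro: has_field_derivative_at_within test_function_deriv(2)[OF assms(2)] c)
  from primitive_eq[OF primitive_mult[OF assms(1) this], of l]
  have "0 = integral {0..l} (\<lambda>x. v x * \<phi> x + u x * deriv \<phi> x)"
    using assms(3) test_function_zero[OF assms(2), of 0] test_function_zero[OF assms(2), of l] by simp
  also have "\<dots> = integral {0..l} (\<lambda>x. v x * \<phi> x) + integral {0..l} (\<lambda>x. u x * deriv \<phi> x)"
  proof (rule integral_add)
    show "(\<lambda>x. v x * \<phi> x) integrable_on {0..l}"
      using absolutely_integrable_continuous_mult[OF primitive_integrable[OF assms(1)] c(2)] by (simp add: absolutely_integrable_on_def mult.commute)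
    show "(\<lambda>x. u x * deriv \<phi> x) integrable_on {0..l}" by (intro integrable_continuous_interval continuous_intros c)
  qed
  finally show ?thesis by simp
qed

text \<open>A function with its first k space derivatives, all square integrable: an explicit
  witness of membership in H^k, free of the arbitrary choice in \<open>weak_deriv\<close>. Every
  member before the last is absolutely continuous.\<close>

definition chain :: "real \<Rightarrow> nat \<Rightarrow> (nat \<Rightarrow> real \<Rightarrow> real) \<Rightarrow> bool" where
  "chain l k c \<longleftrightarrow> (\<forall>j<k. primitive l (c j) (c (Suc j))) \<and> (\<forall>j\<le>k. SI l (c j))"

lemma chain_parts:
  assumes "chain l k c" "0 < l"
  shows "j \<le> k \<Longrightarrow> test_function l \<phi> \<Longrightarrow>
    integral {0..l} (\<lambda>x. c 0 x * (deriv ^^ j) \<phi> x) = (-1) ^ j * integral {0..l} (\<lambda>x. c j x * \<phi> x)"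
proof (induction j arbitrary: \<phi>)
  case (Suc j)
  have "integral {0..l} (\<lambda>x. c 0 x * (deriv ^^ Suc j) \<phi> x) = integral {0..l} (\<lambda>x. c 0 x * (deriv ^^ j) (deriv \<phi>) x)"
    by (simp only: funpow_Suc_right o_apply)
  also have "\<dots> = (-1) ^ j * integral {0..l} (\<lambda>x. c j x * deriv \<phi> x)"
    using Suc test_function_deriv by (intro Suc.IH) auto
  also have "integral {0..l} (\<lambda>x. c j x * deriv \<phi> x) = - integral {0..l} (\<lambda>x. c (Suc j) x * \<phi> x)"
    using assms Suc unfolding chain_def by (intro primitive_test_parts) auto
  finally show ?case by simp
qed simp

lemma SI_local: "SI l u \<Longrightarrow> locally_integrable l u"
  using SI_absolutely_integrable absolutely_integrable_imp_local by blast

lemma chain_weak_deriv: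
  assumes "chain l k c" "0 < l" "j \<le> k"
  shows "has_weak_deriv l j (c 0) (c j)"
proof -
  have loc: "locally_integrable l (c 0)" "locally_integrable l (c j)" using assms SI_local unfolding chain_def by auto
  show ?thesis unfolding has_weak_deriv_def
  proof (intro conjI allI impI loc)
    fix \<phi> assume t: "test_function l \<phi>"
    show "(LINT x:{0<..<l}|lebesgue. c 0 x * (deriv ^^ j) \<phi> x) = (-1) ^ j * (LINT x:{0<..<l}|lebesgue. c j x * \<phi> x)"
      unfolding locally_integrable_test(3)[OF loc(1) test_function_derivs[OF t]] locally_integrable_test(3)[OF loc(2) t]
      by (rule chain_parts[OF assms t])
  qed
qed

lemma weak_deriv_unique:
  assumes "has_weak_deriv l j u v" "has_weak_deriv l j u w" "0 < l"
  shows "negligible {x \<in> {0<..<l}. v x \<noteq> w x}"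
proof -
  have loc: "locally_integrable l v" "locally_integrable l w" using assms unfolding has_weak_deriv_def by auto
  have "negligible {x \<in> {0<..<l}. v x - w x \<noteq> 0}"
  proof (rule fundamental_lemma[OF locally_integrable_diff[OF loc] \<open>0 < l\<close>])
    fix \<phi> assume t: "test_function l \<phi>"
    have "(-1) ^ j * (LINT x:{0<..<l}|lebesgue. v x * \<phi> x) = (-1) ^ j * (LINT x:{0<..<l}|lebesgue. w x * \<phi> x)"
    proof -
      have "(LINT x:{0<..<l}|lebesgue. u x * (deriv ^^ j) \<phi> x) = (-1) ^ j * (LINT x:{0<..<l}|lebesgue. v x * \<phi> x)"
        "(LINT x:{0<..<l}|lebesgue. u x * (deriv ^^ j) \<phi> x) = (-1) ^ j * (LINT x:{0<..<l}|lebesgue. w x * \<phi> x)"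
        using assms t unfolding has_weak_deriv_def by blast+
      then show ?thesis by (rule trans[OF sym])
    qed
    then have "integral {0..l} (\<lambda>x. v x * \<phi> x) = integral {0..l} (\<lambda>x. w x * \<phi> x)"
      using locally_integrable_test(3)[OF loc(1) t] locally_integrable_test(3)[OF loc(2) t] by simp
    moreover have "integral {0..l} (\<lambda>x. v x * \<phi> x - w x * \<phi> x) = integral {0..l} (\<lambda>x. v x * \<phi> x) - integral {0..l} (\<lambda>x. w x * \<phi> x)"
      using locally_integrable_test(2)[OF loc(1) t] locally_integrable_test(2)[OF loc(2) t]
      by (intro integral_diff) (auto simp: absolutely_integrable_on_def)
    ultimately show "integral {0..l} (\<lambda>x. (v x - w x) * \<phi> x) = 0" by (simp add: left_diff_distrib)
  qed
  then show ?thesis by simp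
qed

text \<open>\<open>weak_deriv\<close> is an arbitrary choice and hence known only up to a null set.
  This is enough for norms and for equations in L^2.\<close>

lemma chain_weak_deriv_eq:
  assumes "chain l k c" "0 < l" "j \<le> k"
  shows "negligible {x \<in> {0..l}. weak_deriv l j (c 0) x \<noteq> c j x}"
proof -
  have "has_weak_deriv l j (c 0) (weak_deriv l j (c 0))"
    unfolding weak_deriv_def by (rule someI[of "has_weak_deriv l j (c 0)", OF chain_weak_deriv[OF assms]])
  from weak_deriv_unique[OF this chain_weak_deriv[OF assms] assms(2)]
  have "negligible ({x \<in> {0<..<l}. weak_deriv l j (c 0) x \<noteq> c j x} \<union> {0, l})" by simp
  then show ?thesis by (rule negligible_subset) auto
qed

lemma absolutely_integrable_Ioo: "f absolutely_integrable_on {0<..<l} \<longleftrightarrow> f absolutely_integrable_on {0..l}" for f :: "real \<Rightarrow> real"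
  by (rule absolutely_integrable_spike_set_eq) (auto intro: negligible_subset[of "{0, l}"])

lemma integrable_lebesgue_on_iff: "integrable (lebesgue_on {0<..<l}) f \<longleftrightarrow> f absolutely_integrable_on {0..l}" for f :: "real \<Rightarrow> real"
  unfolding absolutely_integrable_Ioo[symmetric] unfolding set_integrable_def by (rule integrable_restrict_space) simp

lemma integral_lebesgue_on_eq:
  fixes f :: "real \<Rightarrow> real"
  assumes "f absolutely_integrable_on {0..l}"
  shows "integral\<^sup>L (lebesgue_on {0<..<l}) f = integral {0..l} f"
proof -
  have "integral\<^sup>L (lebesgue_on {0<..<l}) f = integral {0<..<l} f"
    using assms by (intro lebesgue_integral_eq_integral) (auto simp: integrable_lebesgue_on_iff)
  also have "\<dots> = integral {0..l} f" using integral_open_interval_real[of 0 l f] by simp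
  finally show ?thesis .
qed

lemma square_integrable_iff_SI: "square_integrable l u \<longleftrightarrow> SI l u"
proof -
  have s: "({0<..<l} - {0..l}) \<union> ({0..l} - {0<..<l}) \<subseteq> {0, l}" by auto
  have "u measurable_on {0<..<l} \<longleftrightarrow> u measurable_on {0..l}"
    using measurable_on_spike_set[of u "{0<..<l}" "{0..l}"] measurable_on_spike_set[of u "{0..l}" "{0<..<l}"]
      negligible_subset[OF _ s] by (auto simp: Un_commute)
  then have m: "u \<in> borel_measurable (lebesgue_on {0<..<l}) \<longleftrightarrow> u \<in> borel_measurable (lebesgue_on {0..l})"
    by (simp add: measurable_on_iff_borel_measurable)
  show ?thesis unfolding square_integrable_def SI_def m integrable_lebesgue_on_iff
    by (simp add: absolutely_integrable_on_iff_nonneg)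
qed

lemma chain_sobolev_norm:
  assumes "chain l k c" "0 < l"
  shows "sobolev_norm k l (c 0) = sqrt (\<Sum>j\<le>k. integral {0..l} (\<lambda>x. (c j x)\<^sup>2))"
proof -
  have "integral\<^sup>L (lebesgue_on {0<..<l}) (\<lambda>x. (weak_deriv l j (c 0) x)\<^sup>2) = integral {0..l} (\<lambda>x. (c j x)\<^sup>2)" if j: "j \<le> k" for j
  proof -
    have n: "negligible {x \<in> {0..l}. weak_deriv l j (c 0) x \<noteq> c j x}" by (rule chain_weak_deriv_eq[OF assms j])
    have "(\<lambda>x. (c j x)\<^sup>2) absolutely_integrable_on {0..l}"
      using assms(1) j unfolding chain_def SI_def by (auto simp: absolutely_integrable_on_iff_nonneg)
    then have "(\<lambda>x. (weak_deriv l j (c 0) x)\<^sup>2) absolutely_integrable_on {0..l}"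
      by (rule absolutely_integrable_spike[OF _ n]) auto
    then have "integral\<^sup>L (lebesgue_on {0<..<l}) (\<lambda>x. (weak_deriv l j (c 0) x)\<^sup>2) = integral {0..l} (\<lambda>x. (weak_deriv l j (c 0) x)\<^sup>2)"
      by (rule integral_lebesgue_on_eq)
    also have "\<dots> = integral {0..l} (\<lambda>x. (c j x)\<^sup>2)" by (rule integral_spike[OF n]) auto
    finally show ?thesis .
  qed
  then show ?thesis unfolding sobolev_norm_def by simp
qed

lemma chain_sobolev_cont:
  assumes "chain l (Suc k) c" "0 < l"
  shows "c 0 \<in> sobolev_cont (Suc k) l"
  unfolding sobolev_cont_def sobolev_def square_integrable_iff_SI
proof (intro CollectI conjI allI impI)
  show "SI l (c 0)" using assms unfolding chain_def by simp
  show "continuous_on {0..l} (c 0)" using assms primitive_continuous unfolding chain_def by blast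
  fix j assume "j \<le> Suc k"
  then show "\<exists>v. has_weak_deriv l j (c 0) v \<and> SI l v"
    using chain_weak_deriv[OF assms] assms unfolding chain_def by blast
qed

lemma test_function_primitive:
  assumes t: "test_function l \<eta>" and i: "integral {0..l} \<eta> = 0" and "0 < l"
  shows "test_function l (\<lambda>x. integral {0..x} \<eta>)" "deriv (\<lambda>x. integral {0..x} \<eta>) = \<eta>"
proof -
  obtain c d where c: "0 < c" "d < l" "\<And>x. x \<notin> {c..d} \<Longrightarrow> \<eta> x = 0" "smooth_on \<eta> UNIV" using test_functionE[OF t] by metis
  have cont: "continuous_on A \<eta>" for A using test_function_continuous[OF t] .
  have z: "integral {0..x} \<eta> = 0" if "x < c" for x
  proof -
    have "integral {0..x} \<eta> = integral {0..x} (\<lambda>x. 0)" using that c(3) by (intro integral_cong) auto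
    then show ?thesis by simp
  qed
  have d: "((\<lambda>x. integral {0..x} \<eta>) has_real_derivative \<eta> x) (at x)" for x
  proof (cases "x < c")
    case True
    have "((\<lambda>x. 0) has_real_derivative 0) (at x)" by simp
    then have "((\<lambda>x. integral {0..x} \<eta>) has_real_derivative 0) (at x)"
      by (rule has_field_derivative_transform_within_open[of _ _ _ "{..<c}"]) (use True z in auto)
    then show ?thesis using True c(3) by simp
  next
    case False
    have "((\<lambda>x. integral {0..x} \<eta>) has_real_derivative \<eta> x) (at x within {0..x+1})"
      using False c(1) by (intro integral_has_real_derivative cont) auto
    moreover have "at x within {0..x+1} = at x" using False c(1) by (intro at_within_Icc_at) auto
    ultimately show ?thesis by simp
  qed
  then show e: "deriv (\<lambda>x. integral {0..x} \<eta>) = \<eta>" using DERIV_imp_deriv by blast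
  have "sm k (\<lambda>x. integral {0..x} \<eta>)" for k
    using d c(4) sm_mono sm.simps(2)[of k "\<lambda>x. integral {0..x} \<eta>"] unfolding smooth_on_UNIV_iff_sm by blast
  moreover have "integral {0..x} \<eta> = 0" if "x \<notin> {c..max c d}" for x
  proof (cases "x < c")
    case False
    then have x: "c < x" "d < x" using that by auto
    have ii: "\<eta> integrable_on {0..r}" for r using cont by (rule integrable_continuous_interval)
    have tail: "integral {r..s} \<eta> = 0" if "d < r" for r s
    proof -
      have "integral {r..s} \<eta> = integral {r..s} (\<lambda>x. 0)" using that c(3) by (intro integral_cong) auto
      then show ?thesis by simp
    qed
    show ?thesis
    proof (cases "x \<le> l")
      case True
      have "integral {0..x} \<eta> + integral {x..l} \<eta> = integral {0..l} \<eta>"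
        by (rule Henstock_Kurzweil_Integration.integral_combine[OF _ _ ii]) (use True x c in auto)
      then show ?thesis using i tail[OF x(2)] by simp
    next
      case False
      have "integral {0..l} \<eta> + integral {l..x} \<eta> = integral {0..x} \<eta>"
        by (rule Henstock_Kurzweil_Integration.integral_combine[OF _ _ ii]) (use False assms(3) in auto)
      then show ?thesis using i tail[OF c(2)] by simp
    qed
  qed (use z in auto)
  ultimately have sz: "\<And>k. sm k (\<lambda>x. integral {0..x} \<eta>)" "\<And>x. x \<notin> {c..max c d} \<Longrightarrow> integral {0..x} \<eta> = 0" by blast+
  show "test_function l (\<lambda>x. integral {0..x} \<eta>)"
  proof (cases "c < l")
    case True
    then have "0 < c \<and> max c d < l \<and> (\<forall>x. x \<notin> {c..max c d} \<longrightarrow> integral {0..x} \<eta> = 0)" using c sz(2) by auto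
    then show ?thesis unfolding test_function_def smooth_on_UNIV_iff_sm using sz(1) by blast
  next
    \<comment> \<open>The bounds c and d of the support need not satisfy c <= d. If c >= l, then
      \<eta> vanishes everywhere, and the single point l/2 serves as the support of its
      primitive.\<close>
    case False
    have "\<eta> x = 0" for x using False c(2,3) by auto
    then have "\<eta> = (\<lambda>x. 0)" by auto
    then have "integral {0..x} \<eta> = 0" for x by simp
    then have "0 < l/2 \<and> l/2 < l \<and> (\<forall>x. x \<notin> {l/2..l/2} \<longrightarrow> integral {0..x} \<eta> = 0)" using assms(3) by auto
    then show ?thesis unfolding test_function_def smooth_on_UNIV_iff_sm using sz(1) by blast
  qed
qed

text \<open>By the hypothesis, w = v minus the primitive of v' is orthogonal to the derivative of
  every test function, that is, to every test function of mean zero. Subtracting from a test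
  function \<psi> the multiple of a fixed bump \<open>b0\<close> with the same mean makes it such a
  derivative. So w acts on \<psi> like the constant C, the mean of w with weight
  \<open>b0\<close>.\<close>

lemma du_Bois_Reymond:
  assumes v: "SI l v" and v': "SI l v'" and l: "0 < l"
    and parts: "\<And>\<phi>. test_function l \<phi> \<Longrightarrow> integral {0..l} (\<lambda>x. v x * deriv \<phi> x) = - integral {0..l} (\<lambda>x. v' x * \<phi> x)"
  obtains C where "negligible {x \<in> {0..l}. v x \<noteq> C + integral {0..x} v'}"
proof -
  define w where "w x = v x - integral {0..x} v'" for x
  have pV: "primitive l (\<lambda>x. integral {0..x} v') v'" using primitive_integral[OF SI_absolutely_integrable[OF v'], of 0] by simp
  have wSI: "SI l w" unfolding w_def by (intro SI_diff v SI_continuous primitive_continuous[OF pV])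
  have wt: "(\<lambda>x. w x * \<phi> x) integrable_on {0..l}" if "test_function l \<phi>" for \<phi>
    using locally_integrable_test(2)[OF SI_local[OF wSI] that] by (simp add: absolutely_integrable_on_def)
  have w0: "integral {0..l} (\<lambda>x. w x * deriv \<phi> x) = 0" if t: "test_function l \<phi>" for \<phi>
  proof -
    have "integral {0..l} (\<lambda>x. w x * deriv \<phi> x) = integral {0..l} (\<lambda>x. v x * deriv \<phi> x - integral {0..x} v' * deriv \<phi> x)"
      unfolding w_def by (simp add: left_diff_distrib)
    also have "\<dots> = integral {0..l} (\<lambda>x. v x * deriv \<phi> x) - integral {0..l} (\<lambda>x. integral {0..x} v' * deriv \<phi> x)"
      using locally_integrable_test(2)[OF SI_local[OF v] test_function_deriv(1)[OF t]]
        locally_integrable_test(2)[OF SI_local[OF SI_continuous[OF primitive_continuous[OF pV]]] test_function_deriv(1)[OF t]]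
      by (intro integral_diff) (auto simp: absolutely_integrable_on_def)
    also have "\<dots> = 0" unfolding parts[OF t] primitive_test_parts[OF pV t l] by simp
    finally show ?thesis .
  qed
  define b0 where "b0 = bump 0 (l/3) (2*l/3)"
  have b0: "test_function l b0" unfolding b0_def using l by (intro test_function_bump) auto
  have b0i: "b0 integrable_on {0..l}" using test_function_continuous[OF b0] by (rule integrable_continuous_interval)
  have "integral {0..l} b0 \<noteq> 0"
  proof
    assume "integral {0..l} b0 = 0"
    then have "\<forall>x\<in>{0..l}. b0 x = 0"
      using integral_eq_0_iff[of 0 l b0] test_function_continuous[OF b0] l bump_props(2) unfolding b0_def by blast
    then have "b0 (l/2) = 0" using l by auto
    then show False using bump_props(5)[of "l/2" "l/3" "2*l/3" 0] l unfolding b0_def by auto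
  qed
  define m where "m = integral {0..l} b0"
  have m: "m \<noteq> 0" unfolding m_def by fact
  define C where "C = integral {0..l} (\<lambda>x. w x * b0 x) / m"
  have "negligible {x \<in> {0<..<l}. w x - C \<noteq> 0}"
  proof (rule fundamental_lemma[OF _ l])
    show "locally_integrable l (\<lambda>x. w x - C)"
      using SI_local[OF SI_diff[OF wSI SI_continuous[of l "\<lambda>_. C"]]] by simp
    fix \<psi> assume t: "test_function l \<psi>"
    define s where "s = integral {0..l} \<psi>"
    define \<eta> where "\<eta> x = \<psi> x + (- (s / m)) * b0 x" for x
    have ti: "\<psi> integrable_on {0..l}" using test_function_continuous[OF t] by (rule integrable_continuous_interval)
    have te: "test_function l \<eta>"
    proof -
      obtain c d where c: "0 < c" "d < l" "\<And>x. x \<notin> {c..d} \<Longrightarrow> \<psi> x = 0" "smooth_on \<psi> UNIV" using test_functionE[OF t] by metis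
      obtain c' d' where c': "0 < c'" "d' < l" "\<And>x. x \<notin> {c'..d'} \<Longrightarrow> b0 x = 0" "smooth_on b0 UNIV" using test_functionE[OF b0] by metis
      have sm: "smooth_on \<eta> UNIV"
        using c(4) c'(4) unfolding smooth_on_UNIV_iff_sm \<eta>_def by (intro allI sm_add sm_cmult) auto
      have "\<eta> x = 0" if "x \<notin> {min c c'..max d d'}" for x
      proof -
        have "x \<notin> {c..d}" "x \<notin> {c'..d'}" using that by auto
        then show ?thesis unfolding \<eta>_def using c(3) c'(3) by simp
      qed
      moreover have "0 < min c c'" "max d d' < l" using c c' by auto
      ultimately show ?thesis unfolding test_function_def using sm by blast
    qed
    have "integral {0..l} \<eta> = s + (- (s / m)) * m"
      unfolding \<eta>_def s_def m_def using integral_add[OF ti integrable_on_mult_right[OF b0i, of "- (s / m)"]] unfolding s_def m_def by simp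
    then have "integral {0..l} \<eta> = 0" using m by simp
    from w0[OF test_function_primitive(1)[OF te this l]] test_function_primitive(2)[OF te this l]
    have "0 = integral {0..l} (\<lambda>x. w x * \<eta> x)" by simp
    also have "\<dots> = integral {0..l} (\<lambda>x. w x * \<psi> x + (- (s / m)) * (w x * b0 x))" unfolding \<eta>_def by (simp add: algebra_simps)
    also have "\<dots> = integral {0..l} (\<lambda>x. w x * \<psi> x) - s * C"
      by (simp only: integral_add[OF wt[OF t] integrable_on_mult_right[OF wt[OF b0]]] integral_mult_right) (simp add: C_def)
    finally have e: "integral {0..l} (\<lambda>x. w x * \<psi> x) = s * C" by simp
    have "integral {0..l} (\<lambda>x. (w x - C) * \<psi> x) = integral {0..l} (\<lambda>x. w x * \<psi> x - C * \<psi> x)" by (simp add: left_diff_distrib)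
    also have "\<dots> = integral {0..l} (\<lambda>x. w x * \<psi> x) - C * s"
      by (simp only: integral_diff[OF wt[OF t] integrable_on_mult_right[OF ti]] integral_mult_right s_def)
    finally show "integral {0..l} (\<lambda>x. (w x - C) * \<psi> x) = 0" using e by simp
  qed
  then have "negligible ({x \<in> {0<..<l}. w x - C \<noteq> 0} \<union> {0, l})" by simp
  then have "negligible {x \<in> {0..l}. v x \<noteq> C + integral {0..x} v'}"
    by (rule negligible_subset) (auto simp: w_def)
  then show ?thesis by (rule that)
qed

text \<open>The chain is built from the top: the highest weak derivative is kept, and each lower one
  is replaced by the primitive of the one above it, with the constant supplied by
  \<open>du_Bois_Reymond\<close>.\<close>

lemma weak_chain_exists:
  assumes l: "0 < l"
  shows "(\<And>j. j \<le> k \<Longrightarrow> SI l (v j)) \<Longrightarrow>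
    (\<And>j \<phi>. j < k \<Longrightarrow> test_function l \<phi> \<Longrightarrow> integral {0..l} (\<lambda>x. v j x * deriv \<phi> x) = - integral {0..l} (\<lambda>x. v (Suc j) x * \<phi> x)) \<Longrightarrow>
    \<exists>c. chain l k c \<and> (\<forall>j\<le>k. negligible {x \<in> {0..l}. c j x \<noteq> v j x})"
proof (induction k arbitrary: v)
  case 0
  then show ?case unfolding chain_def by (intro exI[of _ v]) auto
next
  case (Suc k)
  obtain c where c: "chain l k c" "\<And>j. j\<le>k \<Longrightarrow> negligible {x \<in> {0..l}. c j x \<noteq> v (Suc j) x}"
    using Suc.IH[of "\<lambda>j. v (Suc j)"] Suc.prems by auto
  have c0: "SI l (c 0)" using c(1) unfolding chain_def by simp
  have n0: "negligible {x \<in> {0..l}. c 0 x \<noteq> v 1 x}" using c(2)[of 0] by simp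
  obtain C where C: "negligible {x \<in> {0..l}. v 0 x \<noteq> C + integral {0..x} (c 0)}"
  proof (rule du_Bois_Reymond[OF Suc.prems(1)[of 0] c0 l])
    fix \<phi> assume t: "test_function l \<phi>"
    have "integral {0..l} (\<lambda>x. v 0 x * deriv \<phi> x) = - integral {0..l} (\<lambda>x. v 1 x * \<phi> x)" using Suc.prems(2)[of 0 \<phi>] t by simp
    also have "integral {0..l} (\<lambda>x. v 1 x * \<phi> x) = integral {0..l} (\<lambda>x. c 0 x * \<phi> x)"
      by (rule integral_spike[OF n0]) auto
    finally show "integral {0..l} (\<lambda>x. v 0 x * deriv \<phi> x) = - integral {0..l} (\<lambda>x. c 0 x * \<phi> x)" .
  qed auto
  let ?u = "\<lambda>x. C + integral {0..x} (c 0)"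
  have pu: "primitive l ?u (c 0)" by (rule primitive_integral[OF SI_absolutely_integrable[OF c0]])
  let ?c = "\<lambda>j. case j of 0 \<Rightarrow> ?u | Suc j \<Rightarrow> c j"
  have "chain l (Suc k) ?c"
    using c(1) pu SI_continuous[OF primitive_continuous[OF pu]] unfolding chain_def by (auto split: nat.split simp: less_Suc_eq_0_disj)
  moreover have "negligible {x \<in> {0..l}. ?c j x \<noteq> v j x}" if "j \<le> Suc k" for j
  proof (cases j)
    case 0
    have "{x \<in> {0..l}. ?c j x \<noteq> v j x} = {x \<in> {0..l}. v 0 x \<noteq> C + integral {0..x} (c 0)}" using 0 by auto
    then show ?thesis using C by (simp only:)
  next
    case (Suc i) then show ?thesis using c(2)[of i] that by simp
  qed
  ultimately show ?case by blast
qed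

lemma chain_cong0:
  assumes "chain l k c" "\<And>x. x \<in> {0..l} \<Longrightarrow> u x = c 0 x" "0 < l"
  shows "chain l k (c(0 := u))"
proof -
  have "SI l u" using SI_cong[of l "c 0" u] assms unfolding chain_def by simp
  moreover have "primitive l u (c (Suc 0))" if "0 < k"
    using assms that primitive_cong[of l u "c 0" "c 1" "c 1"] unfolding chain_def by simp
  ultimately show ?thesis using assms(1) unfolding chain_def by auto
qed

lemma continuous_eq_if_AE_eq:
  fixes f g :: "real \<Rightarrow> real"
  assumes "continuous_on {0..l} f" "continuous_on {0..l} g" "negligible {x \<in> {0..l}. f x \<noteq> g x}" "0 < l" "x \<in> {0..l}"
  shows "f x = g x"
proof -
  have "integral {0..l} (\<lambda>x. \<bar>f x - g x\<bar>) = integral {0..l} (\<lambda>x. 0)"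
    by (rule integral_spike[OF assms(3)]) auto
  then have "\<forall>x\<in>{0..l}. \<bar>f x - g x\<bar> = 0"
  proof (subst integral_eq_0_iff[symmetric])
    show "continuous_on {0..l} (\<lambda>x. \<bar>f x - g x\<bar>)" by (intro continuous_intros assms)
  qed (use assms(4) in auto)
  then show ?thesis using assms(5) by auto
qed

lemma sobolev_cont_chain:
  assumes u: "u \<in> sobolev_cont k l" and l: "0 < l"
  obtains c where "chain l k c" "c 0 = u"
proof -
  have s: "SI l u" "continuous_on {0..l} u" "\<And>j. j \<le> k \<Longrightarrow> \<exists>v. has_weak_deriv l j u v \<and> SI l v"
    using u unfolding sobolev_cont_def sobolev_def square_integrable_iff_SI by auto
  have "has_weak_deriv l 0 u u" unfolding has_weak_deriv_def using SI_local[OF s(1)] by simp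
  then have "\<forall>j\<le>k. \<exists>v. has_weak_deriv l j u v \<and> SI l v \<and> (j = 0 \<longrightarrow> v = u)" using s by (metis)
  then obtain v where v: "\<And>j. j \<le> k \<Longrightarrow> has_weak_deriv l j u (v j)" "\<And>j. j \<le> k \<Longrightarrow> SI l (v j)" "v 0 = u" by (metis le0)
  have p: "integral {0..l} (\<lambda>x. u x * (deriv ^^ j) \<phi> x) = (-1) ^ j * integral {0..l} (\<lambda>x. v j x * \<phi> x)" if "j \<le> k" "test_function l \<phi>" for j \<phi>
  proof -
    have "(LINT x:{0<..<l}|lebesgue. u x * (deriv ^^ j) \<phi> x) = (-1) ^ j * (LINT x:{0<..<l}|lebesgue. v j x * \<phi> x)"
      using v(1)[OF that(1)] that(2) unfolding has_weak_deriv_def by blast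
    then show ?thesis
      unfolding locally_integrable_test(3)[OF SI_local[OF s(1)] test_function_derivs[OF that(2)]]
        locally_integrable_test(3)[OF SI_local[OF v(2)[OF that(1)]] that(2)] .
  qed
  \<comment> \<open>The weak derivatives are given relative to u only. Testing order j with
    \<open>deriv \<phi>\<close> and order j + 1 with \<phi> produces the same integral of u, which
    links consecutive ones.\<close>
  have q: "integral {0..l} (\<lambda>x. v j x * deriv \<phi> x) = - integral {0..l} (\<lambda>x. v (Suc j) x * \<phi> x)" if j: "j < k" and t: "test_function l \<phi>" for j \<phi>
  proof -
    have "(-1) ^ j * integral {0..l} (\<lambda>x. v j x * deriv \<phi> x) = integral {0..l} (\<lambda>x. u x * (deriv ^^ j) (deriv \<phi>) x)"
      using p[of j "deriv \<phi>"] j test_function_deriv(1)[OF t] by simp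
    also have "\<dots> = integral {0..l} (\<lambda>x. u x * (deriv ^^ Suc j) \<phi> x)" by (simp only: funpow_Suc_right o_apply)
    also have "\<dots> = (-1) ^ Suc j * integral {0..l} (\<lambda>x. v (Suc j) x * \<phi> x)" using p[of "Suc j" \<phi>] j t by simp
    also have "\<dots> = (-1) ^ j * (- integral {0..l} (\<lambda>x. v (Suc j) x * \<phi> x))" by simp
    finally show ?thesis unfolding mult_cancel_left by simp
  qed
  obtain c where c: "chain l k c" "\<And>j. j \<le> k \<Longrightarrow> negligible {x \<in> {0..l}. c j x \<noteq> v j x}"
    using weak_chain_exists[where k=k and v=v, OF l v(2) q] by blast
  show ?thesis
  proof (cases k)
    case 0
    have "chain l k (\<lambda>j. u)" using s 0 unfolding chain_def by simp
    then show ?thesis by (rule that) simp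
  next
    case (Suc n)
    have "continuous_on {0..l} (c 0)" using c(1) Suc primitive_continuous unfolding chain_def by blast
    then have "u x = c 0 x" if "x \<in> {0..l}" for x
      using continuous_eq_if_AE_eq[OF _ s(2) _ l that] c(2)[of 0] v(3) by (metis le0)
    then show ?thesis using that[OF chain_cong0[OF c(1) _ l, of u]] by simp
  qed
qed

text \<open>The embedding of H^1 into the continuous functions. |c j x| exceeds |c j y| by at most
  twice the L^1 norm of the next derivative; averaging over y in [0,l] leaves only L^1 norms, each
  at most 1 + l times the Sobolev norm. The constant is not sharp.\<close>

lemma chain_sup_bound:
  assumes c: "chain l k c" and l: "0 < l" and j: "j < k" and x: "x \<in> {0..l}"
  shows "\<bar>c j x\<bar> \<le> (1 / l + 2) * (1 + l) * sobolev_norm k l (c 0)"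
proof -
  define N where "N = sobolev_norm k l (c 0)"
  have SI: "SI l (c i)" if "i \<le> k" for i using c that unfolding chain_def by blast
  have nn: "0 \<le> integral {0..l} (\<lambda>x. (c i x)\<^sup>2)" if "i \<le> k" for i
    using SI_sq_integrable[OF SI[OF that]] by (intro integral_nonneg) auto
  have N2: "N\<^sup>2 = (\<Sum>i\<le>k. integral {0..l} (\<lambda>x. (c i x)\<^sup>2))" "0 \<le> N"
    unfolding N_def chain_sobolev_norm[OF c l] using nn by (auto intro!: sum_nonneg)
  have sq: "integral {0..l} (\<lambda>x. (c i x)\<^sup>2) \<le> N\<^sup>2" if "i \<le> k" for i
    unfolding N2 by (rule member_le_sum) (use nn that in auto)
  have L1: "integral {0..l} (\<lambda>x. \<bar>c i x\<bar>) \<le> (1 + l) * N" if i: "i \<le> k" for i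
  proof (rule field_le_epsilon)
    fix e :: real assume e: "0 < e"
    \<comment> \<open>The Sobolev norm N may be 0, whereas Young's inequality needs a positive
      parameter. The added e / (1 + l) contributes exactly e in the last line.\<close>
    define s where "s = N + e / (1 + l)"
    have s: "0 < s" "N \<le> s" unfolding s_def using N2(2) e l by (auto intro: add_nonneg_pos)
    have "integral {0..l} (\<lambda>x. \<bar>c i x\<bar>) \<le> integral {0..l} (\<lambda>x. (c i x)\<^sup>2) / (2 * s) + s * l / 2"
      by (rule SI_integral_abs_le[OF SI[OF i] s(1)]) (use l in simp)
    also have "integral {0..l} (\<lambda>x. (c i x)\<^sup>2) / (2 * s) \<le> s * s / (2 * s)"
      using sq[OF i] s N2(2) by (intro divide_right_mono) (auto simp: power2_eq_square intro: order_trans mult_mono)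
    also have "s * s / (2 * s) + s * l / 2 = (1 + l) * s / 2" using s by (simp add: field_simps)
    also have "\<dots> \<le> (1 + l) * s" using s l by simp
    also have "\<dots> = (1 + l) * N + e" unfolding s_def using l by (simp add: field_simps)
    finally show "integral {0..l} (\<lambda>x. \<bar>c i x\<bar>) \<le> (1 + l) * N + e" by simp
  qed
  have p: "primitive l (c j) (c (Suc j))" using c j unfolding chain_def by blast
  define V where "V = integral {0..l} (\<lambda>x. \<bar>c (Suc j) x\<bar>)"
  have near: "\<bar>c j x\<bar> \<le> \<bar>c j y\<bar> + 2 * V" if y: "y \<in> {0..l}" for y
  proof -
    have "\<bar>integral {0..z} (c (Suc j))\<bar> \<le> V" if "z \<in> {0..l}" for z
      unfolding V_def using that by (intro integral_initial_abs_le primitive_integrable[OF p]) auto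
    from this[OF x] this[OF y] show ?thesis using primitive_eq[OF p x] primitive_eq[OF p y] by linarith
  qed
  have ab: "(\<lambda>y. \<bar>c j y\<bar>) integrable_on {0..l}"
    using primitive_continuous[OF p] by (intro integrable_continuous_interval continuous_intros)
  have "l * \<bar>c j x\<bar> = integral {0..l} (\<lambda>y. \<bar>c j x\<bar>)" using l by simp
  also have "\<dots> \<le> integral {0..l} (\<lambda>y. \<bar>c j y\<bar> + 2 * V)"
    by (rule integral_le[OF integrable_const_ivl integrable_add[OF ab integrable_const_ivl] near])
  also have "\<dots> = integral {0..l} (\<lambda>y. \<bar>c j y\<bar>) + 2 * V * l"
    using l by (subst integral_add[OF ab integrable_const_ivl]) simp
  also have "\<dots> \<le> (1 + l) * N + 2 * ((1 + l) * N) * l"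
    using L1[of j] L1[of "Suc j"] j l unfolding V_def by (intro add_mono mult_right_mono mult_left_mono) auto
  also have "\<dots> = l * ((1 / l + 2) * (1 + l) * N)" using l by (simp add: field_simps)
  finally show ?thesis using l unfolding N_def by simp
qed

section \<open>Time derivatives in the Sobolev norm and their locality\<close>

lemma chain_lin:
  assumes "chain l k c" "chain l k d"
  shows "chain l k (\<lambda>j x. a * c j x + b * d j x)"
  using assms unfolding chain_def by (auto intro!: primitive_add primitive_cmult SI_add SI_cmult)

lemma has_weak_deriv_cong:
  assumes "\<And>x. x \<in> {0..l} \<Longrightarrow> f x = g x"
  shows "has_weak_deriv l j f v \<longleftrightarrow> has_weak_deriv l j g v"
proof -
  have "set_integrable lebesgue {c..d} f \<longleftrightarrow> set_integrable lebesgue {c..d} g" if "0 < c" "d < l" for c d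
    using assms that by (intro set_integrable_cong) auto
  then have "locally_integrable l f \<longleftrightarrow> locally_integrable l g" unfolding locally_integrable_def by blast
  moreover have "(LINT x:{0<..<l}|lebesgue. f x * h x) = (LINT x:{0<..<l}|lebesgue. g x * h x)" for h
    unfolding set_lebesgue_integral_def using assms by (intro Bochner_Integration.integral_cong) (auto simp: indicator_def)
  ultimately show ?thesis unfolding has_weak_deriv_def by simp
qed

lemma weak_deriv_cong:
  assumes "\<And>x. x \<in> {0..l} \<Longrightarrow> f x = g x"
  shows "weak_deriv l j f = weak_deriv l j g"
proof -
  have "has_weak_deriv l j f = has_weak_deriv l j g" by (rule ext) (rule has_weak_deriv_cong[OF assms])
  then show ?thesis unfolding weak_deriv_def by simp
qed

lemma sobolev_norm_cong:
  "(\<And>x. x \<in> {0..l} \<Longrightarrow> f x = g x) \<Longrightarrow> sobolev_norm k l f = sobolev_norm k l g"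
  unfolding sobolev_norm_def using weak_deriv_cong[of l f g] by simp

lemma sobolev_cont_cong:
  assumes "\<And>x. x \<in> {0..l} \<Longrightarrow> f x = g x" "f \<in> sobolev_cont (Suc k) l" "0 < l"
  shows "g \<in> sobolev_cont (Suc k) l"
proof -
  obtain c where c: "chain l (Suc k) c" "c 0 = f" using sobolev_cont_chain[OF assms(2,3)] .
  have "chain l (Suc k) (c(0 := g))" by (rule chain_cong0[OF c(1) _ assms(3)]) (use assms(1) c(2) in auto)
  from chain_sobolev_cont[OF this assms(3)] show ?thesis by simp
qed

text \<open>By \<open>chain_sup_bound\<close>, applied to the difference quotient minus its limit,
  convergence in the norm of H^k is uniform convergence for the space derivatives of order below
  k.\<close>

lemma has_time_deriv_uniform:
  assumes h: "has_time_deriv k l J u v t" and l: "0 < l" and t: "t \<in> J"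
    and c: "\<And>s. s \<in> J \<Longrightarrow> chain l k (c s)" "\<And>s x. s \<in> J \<Longrightarrow> x \<in> {0..l} \<Longrightarrow> c s 0 x = u s x"
    and cv: "chain l k cv" "\<And>x. x \<in> {0..l} \<Longrightarrow> cv 0 x = v x" and j: "j < k" and e: "0 < e"
  obtains d where "0 < d" "\<And>s x. s \<in> J \<Longrightarrow> s \<noteq> t \<Longrightarrow> \<bar>s - t\<bar> < d \<Longrightarrow> x \<in> {0..l} \<Longrightarrow>
     \<bar>(c s j x - c t j x) / (s - t) - cv j x\<bar> < e"
proof -
  define K where "K = (1 / l + 2) * (1 + l)"
  have K: "0 < K" unfolding K_def using l by (intro mult_pos_pos add_pos_pos) auto
  let ?N = "\<lambda>s. sobolev_norm k l (\<lambda>x. (u s x - u t x) / (s - t) - v x)"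
  have "(?N \<longlongrightarrow> 0) (at t within J)" using h unfolding has_time_deriv_def by blast
  moreover have "0 < e / K" using e K by simp
  ultimately obtain d where d: "0 < d" "\<And>s. s \<in> J \<Longrightarrow> 0 < dist s t \<Longrightarrow> dist s t < d \<Longrightarrow> dist (?N s) 0 < e / K"
    unfolding Lim_within by blast
  show ?thesis
  proof (rule that[OF d(1)])
    fix s x assume s: "s \<in> J" "s \<noteq> t" "\<bar>s - t\<bar> < d" and x: "x \<in> {0..l}"
    let ?d = "\<lambda>j x. 1 * (1 / (s - t) * c s j x + (- (1 / (s - t))) * c t j x) + (-1) * cv j x"
    have ch: "chain l k ?d" by (intro chain_lin c cv s t)
    have "sobolev_norm k l (?d 0) = ?N s"
      by (rule sobolev_norm_cong) (use c(2) cv(2) s t in \<open>simp add: diff_divide_distrib\<close>)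
    moreover have "\<bar>?N s\<bar> < e / K" using d(2)[OF s(1)] s by (simp add: dist_real_def)
    ultimately have "K * sobolev_norm k l (?d 0) < K * (e / K)" using K by (intro mult_strict_left_mono) auto
    moreover have "\<bar>?d j x\<bar> \<le> K * sobolev_norm k l (?d 0)" using chain_sup_bound[OF ch l j x] unfolding K_def .
    ultimately have "\<bar>?d j x\<bar> < e" using K by simp
    moreover have "?d j x = (c s j x - c t j x) / (s - t) - cv j x" by (simp add: diff_divide_distrib)
    ultimately show "\<bar>(c s j x - c t j x) / (s - t) - cv j x\<bar> < e" by simp
  qed
qed

lemma has_time_deriv_chains:
  assumes h: "has_time_deriv k l J u v t" and l: "0 < l"
  obtains c cv where "\<And>s. s \<in> J \<Longrightarrow> chain l k (c s)" "\<And>s. s \<in> J \<Longrightarrow> c s 0 = u s" "chain l k cv" "cv 0 = v"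
proof -
  have "\<exists>c. chain l k c \<and> c 0 = u s" if "s \<in> J" for s
    using h that sobolev_cont_chain[OF _ l] unfolding has_time_deriv_def by metis
  then obtain c where "\<And>s. s \<in> J \<Longrightarrow> chain l k (c s) \<and> c s 0 = u s" by metis
  moreover have "v \<in> sobolev_cont k l" using h unfolding has_time_deriv_def by blast
  then obtain cv where "chain l k cv" "cv 0 = v" using sobolev_cont_chain[OF _ l] by metis
  ultimately show ?thesis using that by blast
qed

lemma has_time_deriv_pointwise:
  assumes h: "has_time_deriv (Suc k) l J u v t" and l: "0 < l" and t: "t \<in> J" and x: "x \<in> {0..l}"
  shows "((\<lambda>s. u s x) has_real_derivative v x) (at t within J)"
proof -
  obtain c cv where c: "\<And>s. s \<in> J \<Longrightarrow> chain l (Suc k) (c s)" "\<And>s. s \<in> J \<Longrightarrow> c s 0 = u s" "chain l (Suc k) cv" "cv 0 = v"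
    using has_time_deriv_chains[OF h l] by blast
  show ?thesis unfolding has_field_derivative_iff Lim_within
  proof (intro allI impI)
    fix e :: real assume e: "0 < e"
    obtain d where d: "0 < d" "\<And>s x. s \<in> J \<Longrightarrow> s \<noteq> t \<Longrightarrow> \<bar>s - t\<bar> < d \<Longrightarrow> x \<in> {0..l} \<Longrightarrow>
       \<bar>(c s 0 x - c t 0 x) / (s - t) - cv 0 x\<bar> < e"
    proof (rule has_time_deriv_uniform[OF h l t c(1) _ c(3) _ zero_less_Suc e])
      show "c s 0 x = u s x" if "s \<in> J" for s x using c(2)[OF that] by simp
      show "cv 0 x = v x" for x using c(4) by simp
    qed blast+
    show "\<exists>d>0. \<forall>s\<in>J. 0 < dist s t \<and> dist s t < d \<longrightarrow> dist ((u s x - u t x) / (s - t)) (v x) < e"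
      using d c(2,4) t x by (intro exI[of _ d]) (auto simp: dist_real_def)
  qed
qed

lemma has_time_deriv_unique:
  assumes "has_time_deriv (Suc k) l J u v t" "has_time_deriv (Suc k) l J u w t" "0 < l" "t \<in> J" "x \<in> {0..l}"
    "at t within J \<noteq> bot"
  shows "v x = w x"
  using has_real_derivative_unique_within has_time_deriv_pointwise assms by metis

text \<open>The families u on J and u' on J' coincide on the open set W of times. Derivatives in
  time see only such a neighbourhood, so smoothness passes from closed intervals to half-open ones
  and to families glued from pieces.\<close>

definition chart :: "real \<Rightarrow> real set \<Rightarrow> (real \<Rightarrow> real \<Rightarrow> real) \<Rightarrow> real set \<Rightarrow> (real \<Rightarrow> real \<Rightarrow> real) \<Rightarrow> real set \<Rightarrow> bool" where
  "chart l J u J' u' W \<longleftrightarrow> open W \<and> J \<inter> W = J' \<inter> W \<and> (\<forall>s\<in>J \<inter> W. \<forall>x\<in>{0..l}. u s x = u' s x)"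

lemma has_time_deriv_chart:
  assumes ch: "chart l J u J' u' W" and t: "t \<in> W" "t \<in> J"
    and mem: "\<And>s. s \<in> J' \<Longrightarrow> u' s \<in> sobolev_cont k l"
    and h: "has_time_deriv k l J u v t"
  shows "has_time_deriv k l J' u' v t"
proof -
  have W: "open W" "J \<inter> W = J' \<inter> W" "\<And>s x. s\<in>J \<inter> W \<Longrightarrow> x\<in>{0..l} \<Longrightarrow> u s x = u' s x"
    using ch unfolding chart_def by auto
  have at: "at t within J = at t within J'"
    by (rule at_within_nhd[OF t(1) W(1)]) (use W(2) in auto)
  have "((\<lambda>s. sobolev_norm k l (\<lambda>x. (u s x - u t x) / (s - t) - v x)) \<longlongrightarrow> 0) (at t within J)"
    using h unfolding has_time_deriv_def by blast
  moreover have "\<forall>\<^sub>F s in at t within J. sobolev_norm k l (\<lambda>x. (u s x - u t x) / (s - t) - v x)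
      = sobolev_norm k l (\<lambda>x. (u' s x - u' t x) / (s - t) - v x)"
    unfolding eventually_at_topological
    by (intro exI[of _ W] conjI W(1) t(1) ballI impI sobolev_norm_cong) (use W(3) t in auto)
  ultimately have "((\<lambda>s. sobolev_norm k l (\<lambda>x. (u' s x - u' t x) / (s - t) - v x)) \<longlongrightarrow> 0) (at t within J)"
    by (rule Lim_transform_eventually)
  then show ?thesis using mem h unfolding has_time_deriv_def at by blast
qed

lemma smooth_in_time_mem:
  assumes "smooth_in_time k l J u" "s \<in> J"
  shows "(time_deriv k l J ^^ j) u s \<in> sobolev_cont k l"
  using assms unfolding smooth_in_time_def has_time_deriv_def by blast

lemma chart_sym: "chart l J u J' u' W \<Longrightarrow> chart l J' u' J u W"
  unfolding chart_def by auto

lemma smooth_in_time_local: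
  assumes l: "0 < l"
    and charts: "\<And>t. t \<in> J' \<Longrightarrow> \<exists>J u W. chart l J u J' u' W \<and> t \<in> W \<and> smooth_in_time (Suc k) l J u"
  shows "smooth_in_time (Suc k) l J' u'"
    and "\<And>t J u W. t \<in> J' \<Longrightarrow> chart l J u J' u' W \<Longrightarrow> t \<in> W \<Longrightarrow> smooth_in_time (Suc k) l J u \<Longrightarrow>
      time_deriv (Suc k) l J' u' t = time_deriv (Suc k) l J u t"
proof -
  let ?d = "\<lambda>J u j. (time_deriv (Suc k) l J ^^ j) u"
  have eq: "\<forall>t J u W x. t \<in> J' \<longrightarrow> chart l J u J' u' W \<longrightarrow> t \<in> W \<longrightarrow> smooth_in_time (Suc k) l J u \<longrightarrow> x \<in> {0..l} \<longrightarrow>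
      ?d J' u' j t x = ?d J u j t x" for j
  proof (induction j)
    case 0
    then show ?case unfolding chart_def by auto
  next
    case (Suc j)
    have mem: "?d J' u' j s \<in> sobolev_cont (Suc k) l" if s: "s \<in> J'" for s
    proof -
      obtain J u W where c: "chart l J u J' u' W" "s \<in> W" "smooth_in_time (Suc k) l J u" using charts[OF s] by blast
      have "s \<in> J" using c s unfolding chart_def by blast
      from smooth_in_time_mem[OF c(3) this, of j]
      show ?thesis by (rule sobolev_cont_cong[OF _ _ l, rotated]) (use Suc s c in simp)
    qed
    show ?case
    proof (intro allI impI)
      fix t J u W x assume t: "t \<in> J'" and c: "chart l J u J' u' W" "t \<in> W" "smooth_in_time (Suc k) l J u" and x: "x \<in> {0..l}"
      have tJ: "t \<in> J" using c t unfolding chart_def by blast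
      have c': "chart l J (?d J u j) J' (?d J' u' j) W"
        using c Suc unfolding chart_def by (metis IntD1 IntD2 IntI)
      have "has_time_deriv (Suc k) l J (?d J u j) v t \<longleftrightarrow> has_time_deriv (Suc k) l J' (?d J' u' j) v t" for v
        using has_time_deriv_chart[OF c' c(2) tJ mem] has_time_deriv_chart[OF chart_sym[OF c'] c(2) t smooth_in_time_mem[OF c(3)]] by blast
      \<comment> \<open>The two predicates hold for the same functions v, so the choice operator
        picks the same one for both; no uniqueness of the derivative is involved.\<close>
      then show "?d J' u' (Suc j) t x = ?d J u (Suc j) t x"
        by (simp add: time_deriv_def[of _ _ _ "?d J u j"] time_deriv_def[of _ _ _ "?d J' u' j"])
    qed
  qed
  have mem: "?d J' u' j s \<in> sobolev_cont (Suc k) l" if s: "s \<in> J'" for s j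
  proof -
    obtain J u W where c: "chart l J u J' u' W" "s \<in> W" "smooth_in_time (Suc k) l J u" using charts[OF s] by blast
    have "s \<in> J" using c s unfolding chart_def by blast
    from smooth_in_time_mem[OF c(3) this, of j]
    show ?thesis by (rule sobolev_cont_cong[OF _ _ l, rotated]) (use eq s c in simp)
  qed
  have iff: "has_time_deriv (Suc k) l J (?d J u j) v t \<longleftrightarrow> has_time_deriv (Suc k) l J' (?d J' u' j) v t"
    if t: "t \<in> J'" and c: "chart l J u J' u' W" "t \<in> W" "smooth_in_time (Suc k) l J u" for t J u W v j
  proof -
    have tJ: "t \<in> J" using c t unfolding chart_def by blast
    have c': "chart l J (?d J u j) J' (?d J' u' j) W"
      using c eq unfolding chart_def by (metis IntD1 IntD2 IntI)
    show ?thesis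
      using has_time_deriv_chart[OF c' c(2) tJ mem] has_time_deriv_chart[OF chart_sym[OF c'] c(2) t smooth_in_time_mem[OF c(3)]] by blast
  qed
  show "smooth_in_time (Suc k) l J' u'" unfolding smooth_in_time_def
  proof (intro allI ballI)
    fix j t assume t: "t \<in> J'"
    obtain J u W where c: "chart l J u J' u' W" "t \<in> W" "smooth_in_time (Suc k) l J u" using charts[OF t] by blast
    have "t \<in> J" using c t unfolding chart_def by blast
    then obtain v where "has_time_deriv (Suc k) l J (?d J u j) v t" using c(3) unfolding smooth_in_time_def by blast
    then show "\<exists>v. has_time_deriv (Suc k) l J' (?d J' u' j) v t" using iff[OF t c] by blast
  qed
  show "time_deriv (Suc k) l J' u' t = time_deriv (Suc k) l J u t"
    if "t \<in> J'" "chart l J u J' u' W" "t \<in> W" "smooth_in_time (Suc k) l J u" for t J u W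
    using iff[OF that, of 0] by (simp add: time_deriv_def)
qed

section \<open>Members of the class \<open>R\<close> as smooth Sobolev-valued functions of
  time\<close>

context rect_rho
begin

lemma R_has_time_deriv:
  assumes "R (Suc m) u"
  obtains u' where "R (Suc m) u'" "tderiv u u'" "\<And>t. t \<in> {0..T} \<Longrightarrow> has_time_deriv (Suc m) l {0..T} u (u' t) t"
proof -
  obtain c c' where c: "\<forall>t\<in>{0..T}. \<forall>x\<in>{0..l}. c 0 t x = u t x" "tderiv u (c' 0)"
     "\<forall>j\<le>Suc m. R (Suc m - j) (c j) \<and> R (Suc m - j) (c' j) \<and> (\<forall>t\<in>{0..T}. hconv (c j) (c' j) t)"
     "\<forall>j<Suc m. \<forall>t\<in>{0..T}. primitive l (c j t) (c (Suc j) t) \<and> primitive l (c' j t) (c' (Suc j) t)"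
    using R_time_chain[OF assms] by blast
  have ch: "chain l (Suc m) (\<lambda>j. c j t)" "chain l (Suc m) (\<lambda>j. c' j t)" if "t \<in> {0..T}" for t
    using c(3,4) that R_SI unfolding chain_def by blast+
  have mem: "u t \<in> sobolev_cont (Suc m) l" if "t \<in> {0..T}" for t
    by (rule sobolev_cont_cong[OF _ chain_sobolev_cont[OF ch(1)[OF that] l_pos] l_pos]) (use c(1) that in auto)
  have "has_time_deriv (Suc m) l {0..T} u (c' 0 t) t" if t: "t \<in> {0..T}" for t
    unfolding has_time_deriv_def
  proof (intro conjI ballI mem)
    show "c' 0 t \<in> sobolev_cont (Suc m) l" by (rule chain_sobolev_cont[OF ch(2)[OF t] l_pos])
    let ?I = "\<lambda>j s. integral {0..l} (\<lambda>x. ((c j s x - c j t x) / (s - t) - c' j t x)\<^sup>2)"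
    have "((\<lambda>s. sqrt (\<Sum>j\<le>Suc m. ?I j s)) \<longlongrightarrow> sqrt (\<Sum>j\<le>Suc m. 0)) (at t within {0..T})"
      by (intro tendsto_real_sqrt tendsto_sum) (use c(3) t in \<open>auto simp: hconv_def\<close>)
    moreover have "\<forall>\<^sub>F s in at t within {0..T}. sqrt (\<Sum>j\<le>Suc m. ?I j s) = sobolev_norm (Suc m) l (\<lambda>x. (u s x - u t x) / (s - t) - c' 0 t x)"
      unfolding eventually_at_filter
    proof (intro always_eventually allI impI)
      fix s assume s: "s \<noteq> t" "s \<in> {0..T}"
      let ?d = "\<lambda>j x. 1 * (1 / (s - t) * c j s x + (- (1 / (s - t))) * c j t x) + (-1) * c' j t x"
      have "chain l (Suc m) ?d" by (intro chain_lin ch s t)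
      from chain_sobolev_norm[OF this l_pos]
      have "sobolev_norm (Suc m) l (?d 0) = sqrt (\<Sum>j\<le>Suc m. integral {0..l} (\<lambda>x. (?d j x)\<^sup>2))" .
      moreover have "?d j x = (c j s x - c j t x) / (s - t) - c' j t x" for j x by (simp add: diff_divide_distrib)
      moreover have "sobolev_norm (Suc m) l (\<lambda>x. (u s x - u t x) / (s - t) - c' 0 t x)
          = sobolev_norm (Suc m) l (\<lambda>x. (c 0 s x - c 0 t x) / (s - t) - c' 0 t x)"
        by (rule sobolev_norm_cong) (use c(1) s t in auto)
      ultimately show "sqrt (\<Sum>j\<le>Suc m. ?I j s) = sobolev_norm (Suc m) l (\<lambda>x. (u s x - u t x) / (s - t) - c' 0 t x)"
        by simp
    qed
    ultimately show "((\<lambda>s. sobolev_norm (Suc m) l (\<lambda>x. (u s x - u t x) / (s - t) - c' 0 t x)) \<longlongrightarrow> 0) (at t within {0..T})"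
      using Lim_transform_eventually by fastforce
  qed
  moreover have "R (Suc m) (c' 0)" using c(3)[rule_format, of 0] by (simp del: R.simps)
  ultimately show ?thesis using that c(2) by blast
qed

text \<open>The values chosen by \<open>time_deriv\<close> outside [0,l] are arbitrary, so an
  iterated time derivative agrees with a field of class \<open>R\<close> only on the rectangle. The
  separate function w allows for this when derivatives are iterated.\<close>

lemma R_time_deriv_eq:
  assumes "R (Suc m) u" and w: "\<And>t x. t \<in> {0..T} \<Longrightarrow> x \<in> {0..l} \<Longrightarrow> w t x = u t x"
    and "tderiv u u'" "t \<in> {0..T}"
  shows "\<exists>v. has_time_deriv (Suc m) l {0..T} w v t"
    and "\<And>x. x \<in> {0..l} \<Longrightarrow> time_deriv (Suc m) l {0..T} w t x = u' t x"
proof -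
  obtain v where v: "R (Suc m) v" "tderiv u v" "\<And>t. t \<in> {0..T} \<Longrightarrow> has_time_deriv (Suc m) l {0..T} u (v t) t"
    using R_has_time_deriv[OF assms(1)] by blast
  have ch: "chart l {0..T} u {0..T} w UNIV" unfolding chart_def using w by auto
  have mem: "w s \<in> sobolev_cont (Suc m) l" if "s \<in> {0..T}" for s
  proof -
    have "u s \<in> sobolev_cont (Suc m) l" using v(3)[OF that] that unfolding has_time_deriv_def by blast
    then show ?thesis using sobolev_cont_cong[of l "u s" "w s"] w[OF that] l_pos by simp
  qed
  have h: "has_time_deriv (Suc m) l {0..T} w (v t) t"
    by (rule has_time_deriv_chart[OF ch _ assms(4) mem v(3)[OF assms(4)]]) auto
  then show "\<exists>v. has_time_deriv (Suc m) l {0..T} w v t" by blast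
  have h2: "has_time_deriv (Suc m) l {0..T} w (time_deriv (Suc m) l {0..T} w t) t"
    unfolding time_deriv_def by (rule someI[of "\<lambda>v. has_time_deriv (Suc m) l {0..T} w v t", OF h])
  have nb: "at t within {0..T} \<noteq> bot" using assms(4) T_pos by (simp add: trivial_limit_within islimpt_Icc)
  show "time_deriv (Suc m) l {0..T} w t x = u' t x" if x: "x \<in> {0..l}" for x
    using has_time_deriv_unique[OF h2 h l_pos assms(4) x nb] tderiv_unique[OF assms(3) v(2) assms(4) x] by simp
qed

lemma R_smooth_in_time:
  assumes "R (Suc m) u"
  shows "smooth_in_time (Suc m) l {0..T} u"
    and "\<And>u' t x. tderiv u u' \<Longrightarrow> t \<in> {0..T} \<Longrightarrow> x \<in> {0..l} \<Longrightarrow> time_deriv (Suc m) l {0..T} u t x = u' t x"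
proof -
  have "\<exists>w. R (Suc m) w \<and> (\<forall>t\<in>{0..T}. \<forall>x\<in>{0..l}. (time_deriv (Suc m) l {0..T} ^^ j) u t x = w t x)" for j
  proof (induction j)
    case 0 then show ?case using assms by (intro exI[of _ u]) simp
  next
    case (Suc j)
    then obtain w where w: "R (Suc m) w" "\<And>t x. t\<in>{0..T} \<Longrightarrow> x\<in>{0..l} \<Longrightarrow> (time_deriv (Suc m) l {0..T} ^^ j) u t x = w t x" by blast
    obtain w' where w': "R (Suc m) w'" "tderiv w w'" using R_has_time_deriv[OF w(1)] by blast
    show ?case using w' R_time_deriv_eq(2)[OF w w'(2)] by (intro exI[of _ w']) simp
  qed
  then show "smooth_in_time (Suc m) l {0..T} u"
    unfolding smooth_in_time_def using R_time_deriv_eq(1) R_has_time_deriv by metis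
  show "time_deriv (Suc m) l {0..T} u t x = u' t x" if "tderiv u u'" "t \<in> {0..T}" "x \<in> {0..l}" for u' t x
    by (rule R_time_deriv_eq(2)[OF assms refl that])
qed

end

section \<open>The elliptic problem and the boundary conditions\<close>

lemma constant_if_zero_derivative:
  fixes f :: "real \<Rightarrow> real"
  assumes "\<And>x. x \<in> {0..r} \<Longrightarrow> (f has_real_derivative 0) (at x within {0..r})" "x \<in> {0..r}"
  shows "f x = f 0"
  using has_field_derivative_zero_constant[of "{0..r}" f] assms by (metis atLeastAtMost_iff convex_real_interval(5) order.trans order_refl)

lemma smooth_on_frechet: "smooth_on f A \<Longrightarrow> smooth_on (\<lambda>x. frechet_derivative f (at x within A) v) A"
  unfolding smooth_on_def using Ck_on.simps(2) by blast

lemma smooth_on_differentiable: "smooth_on f A \<Longrightarrow> x \<in> A \<Longrightarrow> f differentiable (at x within A)"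
  unfolding smooth_on_def using Ck_on.simps(2)[of 0 f A] by blast

section \<open>Coefficients of the elliptic operator and its fundamental solutions\<close>

locale bathymetry =
  fixes l h0 g :: real and b :: "real \<Rightarrow> real"
  assumes l_pos: "0 < l" and b_smooth: "smooth_on b {0..l}"
    and hb_inf: "0 < (INF x\<in>{0<..<l}. h0 - b x)"
    and c_inf: "0 < (INF x\<in>{0<..<l}. 1 + 1/4 * (deriv b x)\<^sup>2 + 1/6 * (h0 - b x) * deriv (deriv b) x)"
begin

sublocale X: rect l 1 using l_pos by unfold_locales auto

text \<open>Functions of \<open>x\<close> that are smooth up to the boundary, as functions on a rectangle that do
  not depend on the second variable.\<close>

definition St :: "(real \<Rightarrow> real) \<Rightarrow> bool" where
  "St a \<longleftrightarrow> X.S (\<lambda>x y. a x)"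

lemma St_continuous:
  assumes "St a" shows "continuous_on {0..l} a"
  using continuous_on_slice1[of l 1 "\<lambda>x y. a x" 0] X.S_jcont[OF assms[unfolded St_def]] unfolding X.jcont_def by simp

lemma St_intros:
  "St (\<lambda>x. k)" "St a \<Longrightarrow> St a' \<Longrightarrow> St (\<lambda>x. a x + a' x)" "St a \<Longrightarrow> St a' \<Longrightarrow> St (\<lambda>x. a x * a' x)"
  unfolding St_def by (auto intro: X.S_intros)

lemma St_diff: "St a \<Longrightarrow> St a' \<Longrightarrow> St (\<lambda>x. a x - a' x)"
  using St_intros(2)[OF _ St_intros(3)[OF St_intros(1)[of "-1"]], of a a'] by simp

lemma St_inverse: "St a \<Longrightarrow> (\<And>x. x \<in> {0..l} \<Longrightarrow> a x \<noteq> 0) \<Longrightarrow> St (\<lambda>x. 1 / a x)"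
  unfolding St_def X.S_def by (auto intro!: X.SC_inverse)

lemma St_deriv:
  assumes "St a"
  obtains a' where "St a'" "\<And>x. x \<in> {0..l} \<Longrightarrow> (a has_real_derivative a' x) (at x within {0..l})"
proof -
  obtain u' where u': "X.tderiv (\<lambda>x y. a x) u'" "X.S u'" using X.S_tderiv assms unfolding St_def by blast
  show ?thesis
  proof (rule that[of "\<lambda>x. u' x 0"])
    show "St (\<lambda>x. u' x 0)" unfolding St_def using X.S_intros(5)[OF u'(2), of 0] by simp
    show "(a has_real_derivative u' x 0) (at x within {0..l})" if "x \<in> {0..l}" for x
      using u'(1) that unfolding X.tderiv_def by auto
  qed
qed

lemma St_primitive:
  assumes "St a"
  obtains a' where "St a'" "primitive l a a'"
proof -
  obtain a' where a': "St a'" "\<And>x. x \<in> {0..l} \<Longrightarrow> (a has_real_derivative a' x) (at x within {0..l})" using St_deriv[OF assms] by blast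
  show ?thesis by (rule that[OF a'(1) primitive_C1[OF a'(2) St_continuous[OF a'(1)]]])
qed

lemma St_smooth: "smooth_on a {0..l} \<Longrightarrow> St a"
  unfolding St_def X.S_def smooth_on_def using X.SC_compose_time by blast

definition hb where "hb x = h0 - b x"
definition ihb where "ihb x = 1 / hb x"
text \<open>Derivatives within [0,l] are meaningful up to the end points, where
  \<open>deriv b\<close> also sees the values of b outside. The two agree on the open interval,
  which is enough for equations that hold almost everywhere.\<close>

definition b1 where "b1 x = frechet_derivative b (at x within {0..l}) 1"
definition b2 where "b2 x = frechet_derivative b1 (at x within {0..l}) 1"
text \<open>Expanding with h_b' = - b' gives (1 + h_b T_b) u = cc u - (h_b / 3) (h_b u')'. The
  coefficient 1/3 of (b')^2 exceeds the 1/4 of the coercivity hypothesis, so that hypothesis makes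
  \<open>cc\<close> positive.\<close>

definition cc where "cc x = 1 + 1/3 * (b1 x)\<^sup>2 + 1/6 * hb x * b2 x"

lemma b1_smooth: "smooth_on b1 {0..l}" unfolding b1_def by (rule smooth_on_frechet[OF b_smooth])

lemma b_deriv: "x \<in> {0..l} \<Longrightarrow> (b has_real_derivative b1 x) (at x within {0..l})"
  unfolding b1_def by (rule has_real_derivative_frechet[OF smooth_on_differentiable[OF b_smooth]])

lemma b1_deriv: "x \<in> {0..l} \<Longrightarrow> (b1 has_real_derivative b2 x) (at x within {0..l})"
  unfolding b2_def by (rule has_real_derivative_frechet[OF smooth_on_differentiable[OF b1_smooth]])

lemma St_b: "St b" "St b1" "St b2"
  using St_smooth[OF b_smooth] St_smooth[OF b1_smooth] St_smooth[OF smooth_on_frechet[OF b1_smooth, of 1]]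
  unfolding b2_def[abs_def] .

lemma St_hb: "St hb" unfolding hb_def by (intro St_diff St_intros St_b)

lemma deriv_b:
  assumes x: "x \<in> {0<..<l}"
  shows "deriv b x = b1 x" "deriv (deriv b) x = b2 x"
proof -
  have "(b has_real_derivative b1 x) (at x)" if "x \<in> {0<..<l}" for x
    using b_deriv[of x] that at_within_Icc_at[of 0 x l] by simp
  then have db: "deriv b x = b1 x" if "x \<in> {0<..<l}" for x using that DERIV_imp_deriv by blast
  then show "deriv b x = b1 x" using x by blast
  have "(b1 has_real_derivative b2 x) (at x)"
    using b1_deriv[of x] x at_within_Icc_at[of 0 x l] by simp
  then have "(deriv b has_real_derivative b2 x) (at x)"
    by (rule has_field_derivative_transform_within_open[of _ _ _ "{0<..<l}"]) (use x db in auto)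
  then show "deriv (deriv b) x = b2 x" by (rule DERIV_imp_deriv)
qed

lemma ge_INF_open:
  assumes "continuous_on {0..l} f" "x \<in> {0..l}"
  shows "(INF x\<in>{0<..<l}. f x) \<le> (f x :: real)"
proof -
  have "(INF x\<in>{0<..<l}. f x) \<le> f y" if "y \<in> {0<..<l}" for y
  proof (rule cINF_lower[OF _ that])
    have "bounded (f ` {0..l})" using assms(1) by (intro compact_imp_bounded compact_continuous_image) auto
    then have "bdd_below (f ` {0..l})" by (rule bounded_imp_bdd_below)
    then show "bdd_below (f ` {0<..<l})" by (rule bdd_below_mono) auto
  qed
  moreover have "closure {0<..<l} = {0..l}" using l_pos by simp
  ultimately show ?thesis using continuous_ge_on_closure[of "{0<..<l}" f x] assms by auto
qed

lemma hb_pos: obtains \<delta> where "0 < \<delta>" "\<And>x. x \<in> {0..l} \<Longrightarrow> \<delta> \<le> hb x"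
proof (rule that[OF hb_inf])
  show "(INF x\<in>{0<..<l}. h0 - b x) \<le> hb x" if "x \<in> {0..l}" for x
    using ge_INF_open[OF St_continuous[OF St_hb] that] unfolding hb_def .
qed

lemma hb_gt_0: "x \<in> {0..l} \<Longrightarrow> 0 < hb x"
  using hb_pos by (metis less_le_trans)

lemma St_ihb: "St ihb" unfolding ihb_def by (intro St_inverse St_hb) (use hb_gt_0 in force)

lemma St_cc: "St cc" unfolding cc_def power2_eq_square by (intro St_intros St_b St_hb)

lemma cc_pos: assumes "x \<in> {0..l}" shows "0 < cc x"
proof -
  let ?d = "\<lambda>x. 1 + 1/4 * (b1 x * b1 x) + 1/6 * hb x * b2 x"
  have "St ?d" by (intro St_intros St_b St_hb)
  then have "(INF x\<in>{0<..<l}. ?d x) \<le> ?d x" using ge_INF_open[OF St_continuous assms] by blast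
  moreover have "(INF x\<in>{0<..<l}. ?d x) = (INF x\<in>{0<..<l}. 1 + 1/4 * (deriv b x)\<^sup>2 + 1/6 * (h0 - b x) * deriv (deriv b) x)"
    by (intro INF_cong refl) (simp only: deriv_b hb_def power2_eq_square)
  ultimately have "0 < ?d x" using c_inf by linarith
  moreover have "0 \<le> b1 x * b1 x" by simp
  ultimately show ?thesis unfolding cc_def power2_eq_square by linarith
qed

lemma ihb_deriv: "x \<in> {0..l} \<Longrightarrow> (ihb has_real_derivative b1 x * (ihb x * ihb x)) (at x within {0..l})"
  unfolding ihb_def hb_def using hb_gt_0[of x] b_deriv[of x]
  by (auto intro!: derivative_eq_intros simp: hb_def divide_simps)

lemma ihb_primitive: "primitive l ihb (\<lambda>x. b1 x * (ihb x * ihb x))"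
  by (rule primitive_C1[OF ihb_deriv]) (auto intro!: St_continuous St_intros St_b St_ihb)

text \<open>With \<open>p = hb \<partial>\<^sub>x u\<close>, the homogeneous equation \<open>(1 + hb T\<^sub>b) u = 0\<close> is the system
  \<open>u' = p / hb\<close>, \<open>p' = (3 cc / hb) u\<close>.\<close>

definition fundamental :: "(real \<Rightarrow> real) \<Rightarrow> (real \<Rightarrow> real) \<Rightarrow> bool" where
  "fundamental u p \<longleftrightarrow> St u \<and> St p \<and>
     (\<forall>x\<in>{0..l}. (u has_real_derivative ihb x * p x) (at x within {0..l})) \<and>
     (\<forall>x\<in>{0..l}. (p has_real_derivative 3 * cc x * ihb x * u x) (at x within {0..l}))"

text \<open>\<open>linear_system_exists\<close> with x as time and a dummy space variable in [0,1].
  Smoothness follows by induction on the order, since the coefficients are smooth up to the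
  boundary.\<close>

lemma fundamental_exists: "\<exists>u p. fundamental u p \<and> u 0 = \<alpha> \<and> p 0 = \<beta>"
proof -
  let ?A = "\<lambda>x. 3 * cc x * ihb x"
  have AS: "X.S (\<lambda>x y. ?A x)" "X.S (\<lambda>x y. ihb x)" using St_intros St_cc St_ihb unfolding St_def[symmetric] by auto
  obtain u v where uv: "X.jcont u" "X.jcont v" "X.tderiv u (\<lambda>t x. ihb t * v t x)"
    "X.tderiv v (\<lambda>t x. ?A t * u t x + 0)" "\<And>x. x \<in> {0..1} \<Longrightarrow> u 0 x = \<alpha> \<and> v 0 x = \<beta>"
    using X.linear_system_exists[OF X.S_jcont[OF AS(2)] X.S_jcont[OF AS(1)] X.S_jcont[OF X.S_intros(1)[of 0]]
          continuous_on_const[of "{0..1}" \<alpha>] continuous_on_const[of "{0..1}" \<beta>]] by blast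
  have "X.SC k u \<and> X.SC k v" for k
  proof (induction k)
    case (Suc k)
    have c: "X.SC k (\<lambda>x y. ?A x)" "X.SC k (\<lambda>x y. ihb x)" using AS unfolding X.S_def by blast+
    have "X.SC k (\<lambda>t x. ihb t * v t x)" "X.SC k (\<lambda>t x. ?A t * u t x + 0)"
      using Suc c by (auto intro!: X.SC_mult X.SC_add X.SC_const)
    then show ?case using uv X.SC_SucI by blast
  qed (use uv in auto)
  then have "X.S u" "X.S v" unfolding X.S_def by auto
  then have "St (\<lambda>x. u x 0)" "St (\<lambda>x. v x 0)" unfolding St_def using X.S_intros(5) by auto
  moreover have "((\<lambda>x. u x 0) has_real_derivative ihb x * v x 0) (at x within {0..l})"
    "((\<lambda>x. v x 0) has_real_derivative ?A x * u x 0) (at x within {0..l})" if "x \<in> {0..l}" for x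
    using uv(3,4) that unfolding X.tderiv_def by auto
  ultimately have "fundamental (\<lambda>x. u x 0) (\<lambda>x. v x 0)" unfolding fundamental_def by blast
  moreover have "u 0 0 = \<alpha>" "v 0 0 = \<beta>" using uv(5)[of 0] by auto
  ultimately show ?thesis by blast
qed

text \<open>The coefficient matrix of the system has trace zero, so the Wronskian is
  constant.\<close>

lemma fundamental_wronskian:
  assumes "fundamental u1 p1" "fundamental u2 p2" "u1 0 = 1" "p1 0 = 0" "u2 0 = 0" "p2 0 = 1" "x \<in> {0..l}"
  shows "u1 x * p2 x - u2 x * p1 x = 1"
proof -
  have "((\<lambda>x. u1 x * p2 x - u2 x * p1 x) has_real_derivative 0) (at x within {0..l})" if "x \<in> {0..l}" for x
    using assms(1,2) that unfolding fundamental_def by (auto intro!: derivative_eq_intros simp: algebra_simps)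
  from constant_if_zero_derivative[OF this assms(7)] show ?thesis using assms(3-6) by simp
qed

text \<open>\<open>(u p)' = p\<^sup>2 / hb + (3 cc / hb) u\<^sup>2 > 0\<close>; here the positivity of \<open>cc\<close> excludes nontrivial
  solutions of the homogeneous problem, for every choice of boundary conditions.\<close>

lemma fundamental_nonzero:
  assumes f: "fundamental u p" and nz: "\<And>x. x \<in> {0..l} \<Longrightarrow> u x \<noteq> 0 \<or> p x \<noteq> 0" and i: "u 0 * p 0 = 0"
  shows "u l \<noteq> 0" "p l \<noteq> 0"
proof -
  let ?f' = "\<lambda>x. ihb x * p x * p x + 3 * cc x * ihb x * u x * u x"
  have d: "((\<lambda>x. u x * p x) has_real_derivative ?f' x) (at x within {0..l})" if "x \<in> {0..l}" for x
    using f that unfolding fundamental_def by (auto intro!: derivative_eq_intros simp: algebra_simps)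
  have pos: "0 < ?f' x" if x: "x \<in> {0..l}" for x
  proof -
    have ih: "0 < ihb x" using hb_gt_0[OF x] unfolding ihb_def by simp
    have "0 < cc x" by (rule cc_pos[OF x])
    consider "u x \<noteq> 0" | "p x \<noteq> 0" using nz[OF x] by blast
    then show ?thesis
    proof cases
      case 1
      have "0 < u x * u x" using 1 not_real_square_gt_zero by blast
      moreover have "0 < 3 * cc x * ihb x" using ih \<open>0 < cc x\<close> by simp
      ultimately have "0 < 3 * cc x * ihb x * (u x * u x)" by (rule mult_pos_pos[rotated])
      moreover have "0 \<le> ihb x * (p x * p x)" using ih by simp
      ultimately show ?thesis by (simp add: ac_simps)
    next
      case 2
      have "0 < p x * p x" using 2 not_real_square_gt_zero by blast
      with ih have "0 < ihb x * (p x * p x)" by (rule mult_pos_pos)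
      moreover have "0 \<le> 3 * cc x * ihb x * (u x * u x)" using ih \<open>0 < cc x\<close> by simp
      ultimately show ?thesis by (simp add: ac_simps)
    qed
  qed
  have c: "continuous_on {0..l} (\<lambda>x. u x * p x)" using d DERIV_continuous continuous_on_eq_continuous_within by blast
  obtain z where z: "0 < z" "z < l" "u l * p l - u 0 * p 0 = ?f' z * (l - 0)"
  proof -
    have "((\<lambda>x. u x * p x) has_derivative (\<lambda>h. ?f' x * h)) (at x)" if "0 < x" "x < l" for x
      using d[of x] that at_within_Icc_at[of 0 x l] unfolding has_field_derivative_def by (simp add: mult_commute_abs)
    then show ?thesis using mvt[OF l_pos c, of "\<lambda>x h. ?f' x * h"] that by blast
  qed
  have "0 < ?f' z * (l - 0)" using pos[of z] z l_pos by (intro mult_pos_pos) auto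
  then have "0 < u l * p l" using z(3) i by simp
  then show "u l \<noteq> 0" "p l \<noteq> 0" by auto
qed

end

text \<open>Families of functions of \<open>x\<close>, indexed by time or by states, that are closed under the
  operations from which the right-hand side of the evolution equation is built.\<close>

locale opclass = bathymetry +
  fixes C :: "('i \<Rightarrow> real \<Rightarrow> real) \<Rightarrow> bool"
  assumes C_static: "St a \<Longrightarrow> C (\<lambda>i. a)"
    and C_add: "C u \<Longrightarrow> C v \<Longrightarrow> C (\<lambda>i x. u i x + v i x)"
    and C_mult: "C u \<Longrightarrow> C v \<Longrightarrow> C (\<lambda>i x. u i x * v i x)"
    and C_integral: "C u \<Longrightarrow> C (\<lambda>i x. integral {0..x} (u i))"
    and C_trace: "C u \<Longrightarrow> x0 \<in> {0..l} \<Longrightarrow> C (\<lambda>i x. u i x0)"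
begin

lemma C_const: "C (\<lambda>i x. k)" by (rule C_static[OF St_intros(1)])

lemma C_if: "C u \<Longrightarrow> C v \<Longrightarrow> C (\<lambda>i x. if Q then u i x else v i x)"
  by (cases Q) auto

lemma C_minus: "C u \<Longrightarrow> C (\<lambda>i x. - u i x)"
  using C_mult[OF C_const[of "-1"], of u] by simp

lemma C_diff: "C u \<Longrightarrow> C v \<Longrightarrow> C (\<lambda>i x. u i x - v i x)"
  using C_add[OF _ C_minus, of u v] by simp

end

text \<open>The inhomogeneous problem \<open>(1 + hb T\<^sub>b) u = - \<partial>\<^sub>x f - g h \<partial>\<^sub>x b\<close>, as the system
  \<open>u' = p / hb + F1\<close>, \<open>p' = (3 cc / hb) u + F2\<close> for \<open>p = hb \<partial>\<^sub>x u - 3 f / hb\<close>, which does not involve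
  derivatives of \<open>f\<close>.  The flags \<open>N0\<close>, \<open>Nl\<close> select the condition on \<open>\<partial>\<^sub>x u\<close> (true) or on
  \<open>u\<close> (false) at the two end points.\<close>

lemma if_weak_intro: "(Q \<Longrightarrow> A) \<Longrightarrow> (\<not> Q \<Longrightarrow> B) \<Longrightarrow> (if Q then A else B)"
  by simp

section \<open>Variation of constants for the two-point problem\<close>

locale elliptic = bathymetry +
  fixes \<phi>1 \<pi>1 \<phi>2 \<pi>2 :: "real \<Rightarrow> real" and N0 Nl :: bool
  assumes fund: "fundamental \<phi>1 \<pi>1" "fundamental \<phi>2 \<pi>2"
    and fund0: "\<phi>1 0 = 1" "\<pi>1 0 = 0" "\<phi>2 0 = 0" "\<pi>2 0 = 1"
begin

lemma wronskian: "x \<in> {0..l} \<Longrightarrow> \<phi>1 x * \<pi>2 x - \<phi>2 x * \<pi>1 x = 1"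
  using fundamental_wronskian[OF fund fund0] .

lemma fund_l: "\<phi>1 l \<noteq> 0" "\<pi>1 l \<noteq> 0" "\<phi>2 l \<noteq> 0" "\<pi>2 l \<noteq> 0"
proof -
  have "\<phi>1 x \<noteq> 0 \<or> \<pi>1 x \<noteq> 0" "\<phi>2 x \<noteq> 0 \<or> \<pi>2 x \<noteq> 0" if "x \<in> {0..l}" for x
    using wronskian[OF that] by auto
  then show "\<phi>1 l \<noteq> 0" "\<pi>1 l \<noteq> 0" "\<phi>2 l \<noteq> 0" "\<pi>2 l \<noteq> 0"
    using fundamental_nonzero[OF fund(1)] fundamental_nonzero[OF fund(2)] fund0 by auto
qed

lemma fund_St: "St \<phi>1" "St \<pi>1" "St \<phi>2" "St \<pi>2"
  using fund unfolding fundamental_def by auto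

lemma fund_d:
  assumes "x \<in> {0..l}"
  shows "(\<phi>1 has_real_derivative ihb x * \<pi>1 x) (at x within {0..l})"
    "(\<pi>1 has_real_derivative 3 * cc x * ihb x * \<phi>1 x) (at x within {0..l})"
    "(\<phi>2 has_real_derivative ihb x * \<pi>2 x) (at x within {0..l})"
    "(\<pi>2 has_real_derivative 3 * cc x * ihb x * \<phi>2 x) (at x within {0..l})"
  using fund assms unfolding fundamental_def by auto

definition F1 where "F1 f x = 3 * (ihb x * ihb x) * f x"
text \<open>The terms 3 f' / h_b in (h_b u')' and in (3 f / h_b)' cancel; the latter leaves behind -
  3 b' f / h_b^2.\<close>

definition F2 where "F2 h f x = 3 * (b1 x * ihb x) * (g * h x - ihb x * f x)"
text \<open>Variation of constants: as the Wronskian is 1, \<open>I1\<close> and \<open>I2\<close>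
  are the integrated coordinates of (F1, F2) in the basis (\<phi>1, \<pi>1), (\<phi>2,
  \<pi>2).\<close>

definition I1 where "I1 h f x = integral {0..x} (\<lambda>y. \<pi>2 y * F1 f y - \<phi>2 y * F2 h f y)"
definition I2 where "I2 h f x = integral {0..x} (\<lambda>y. \<phi>1 y * F2 h f y - \<pi>1 y * F1 f y)"
definition rr0 where "rr0 f d = (if N0 then hb 0 * d - 3 * ihb 0 * f 0 else d)"
definition rrl where "rrl f d = (if Nl then hb l * d - 3 * ihb l * f l else d)"
definition X1 where "X1 = (if Nl then \<pi>1 l else \<phi>1 l)"
definition X2 where "X2 = (if Nl then \<pi>2 l else \<phi>2 l)"
text \<open>The boundary conditions form a triangular system for the coefficients \<open>al\<close>
  and \<open>be\<close> of the fundamental solutions. These take the values (1, 0) and (0, 1) at x =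
  0, so the condition on the left fixes one coefficient and the condition on the right then fixes
  the other, after division by \<open>X1\<close> or \<open>X2\<close>, which do not vanish because
  \<open>cc\<close> is positive.\<close>

definition al where "al h f d0 dl =
  (if N0 then (rrl f dl - (rr0 f d0 + I2 h f l) * X2) * (1 / X1) - I1 h f l else rr0 f d0)"
definition be where "be h f d0 dl =
  (if N0 then rr0 f d0 else (rrl f dl - (rr0 f d0 + I1 h f l) * X1) * (1 / X2) - I2 h f l)"
definition Ue where "Ue h f d0 dl x = (al h f d0 dl + I1 h f x) * \<phi>1 x + (be h f d0 dl + I2 h f x) * \<phi>2 x"
definition Pe where "Pe h f d0 dl x = (al h f d0 dl + I1 h f x) * \<pi>1 x + (be h f d0 dl + I2 h f x) * \<pi>2 x"
definition Ux where "Ux h f d0 dl x = ihb x * Pe h f d0 dl x + F1 f x"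

lemma X_nz: "X1 \<noteq> 0" "X2 \<noteq> 0" unfolding X1_def X2_def using fund_l by auto

lemma St_cont: "continuous_on {0..l} ihb" "continuous_on {0..l} hb" "continuous_on {0..l} b1" "continuous_on {0..l} cc"
  "continuous_on {0..l} \<phi>1" "continuous_on {0..l} \<pi>1" "continuous_on {0..l} \<phi>2" "continuous_on {0..l} \<pi>2"
  using St_continuous St_ihb St_hb St_b St_cc fund_St by auto

lemma F_cont:
  assumes "continuous_on {0..l} h" "continuous_on {0..l} f"
  shows "continuous_on {0..l} (F1 f)" "continuous_on {0..l} (F2 h f)"
  unfolding F1_def F2_def by (intro continuous_intros St_cont assms)+

lemma Ue_deriv:
  assumes hf: "continuous_on {0..l} h" "continuous_on {0..l} f" and x: "x \<in> {0..l}"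
  shows "(Ue h f d0 dl has_real_derivative Ux h f d0 dl x) (at x within {0..l})"
    "(Pe h f d0 dl has_real_derivative 3 * cc x * ihb x * Ue h f d0 dl x + F2 h f x) (at x within {0..l})"
proof -
  have c: "continuous_on {0..l} (\<lambda>y. \<pi>2 y * F1 f y - \<phi>2 y * F2 h f y)" "continuous_on {0..l} (\<lambda>y. \<phi>1 y * F2 h f y - \<pi>1 y * F1 f y)"
    by (intro continuous_intros St_cont F_cont[OF hf])+
  have dI: "(I1 h f has_real_derivative \<pi>2 x * F1 f x - \<phi>2 x * F2 h f x) (at x within {0..l})"
    "(I2 h f has_real_derivative \<phi>1 x * F2 h f x - \<pi>1 x * F1 f x) (at x within {0..l})"
    unfolding I1_def[abs_def] I2_def[abs_def] by (rule integral_has_real_derivative[OF c(1) x] integral_has_real_derivative[OF c(2) x])+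
  note w = wronskian[OF x]
  have "(Ue h f d0 dl has_real_derivative ihb x * Pe h f d0 dl x + (\<phi>1 x * \<pi>2 x - \<phi>2 x * \<pi>1 x) * F1 f x) (at x within {0..l})"
    unfolding Ue_def[abs_def] Pe_def
    by (rule derivative_eq_intros dI fund_d[OF x] refl)+ (simp add: algebra_simps)
  then show "(Ue h f d0 dl has_real_derivative Ux h f d0 dl x) (at x within {0..l})" unfolding w Ux_def by simp
  have "(Pe h f d0 dl has_real_derivative 3 * cc x * ihb x * Ue h f d0 dl x + (\<phi>1 x * \<pi>2 x - \<phi>2 x * \<pi>1 x) * F2 h f x) (at x within {0..l})"
    unfolding Ue_def Pe_def[abs_def]
    by (rule derivative_eq_intros dI fund_d[OF x] refl)+ (simp add: algebra_simps)
  then show "(Pe h f d0 dl has_real_derivative 3 * cc x * ihb x * Ue h f d0 dl x + F2 h f x) (at x within {0..l})" unfolding w by simp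
qed

lemma bc0_iff: "(if N0 then ihb 0 * P + F1 f 0 = d0 else u = d0) \<longleftrightarrow> (if N0 then P = rr0 f d0 else u = rr0 f d0)"
proof -
  have "hb 0 > 0" using hb_gt_0[of 0] l_pos by simp
  then show ?thesis unfolding rr0_def F1_def ihb_def by (auto simp: field_simps)
qed

lemma bcl_iff: "(if Nl then ihb l * P + F1 f l = d0 else u = d0) \<longleftrightarrow> (if Nl then P = rrl f d0 else u = rrl f d0)"
proof -
  have "hb l > 0" using hb_gt_0[of l] l_pos by simp
  then show ?thesis unfolding rrl_def F1_def ihb_def by (auto simp: field_simps)
qed

lemma coefficients_unique:
  assumes "if N0 then \<beta> = rr0 f d0 else \<alpha> = rr0 f d0"
    and "(\<alpha> + I1 h f l) * X1 + (\<beta> + I2 h f l) * X2 = rrl f dl"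
  shows "\<alpha> = al h f d0 dl" "\<beta> = be h f d0 dl"
  using assms X_nz unfolding al_def be_def by (auto simp: field_simps split: if_splits)

lemma coefficients_solve:
  "if N0 then be h f d0 dl = rr0 f d0 else al h f d0 dl = rr0 f d0"
  "(al h f d0 dl + I1 h f l) * X1 + (be h f d0 dl + I2 h f l) * X2 = rrl f dl"
  using X_nz unfolding al_def be_def by (auto simp: field_simps)

lemma Ue_bc:
  "if N0 then Ux h f d0 dl 0 = d0 else Ue h f d0 dl 0 = d0"
  "if Nl then Ux h f d0 dl l = dl else Ue h f d0 dl l = dl"
proof -
  have "I1 h f 0 = 0" "I2 h f 0 = 0" unfolding I1_def I2_def by auto
  then have "Ue h f d0 dl 0 = al h f d0 dl" "Pe h f d0 dl 0 = be h f d0 dl" unfolding Ue_def Pe_def fund0 by auto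
  then show "if N0 then Ux h f d0 dl 0 = d0 else Ue h f d0 dl 0 = d0"
    using coefficients_solve(1)[of h f d0 dl] unfolding Ux_def bc0_iff by (simp only:)
  note sl = coefficients_solve(2)[of h f d0 dl, unfolded X1_def X2_def]
  show "if Nl then Ux h f d0 dl l = dl else Ue h f d0 dl l = dl"
    unfolding Ux_def bcl_iff
  proof (rule if_weak_intro)
    assume Nl
    then show "Pe h f d0 dl l = rrl f dl" using sl unfolding Pe_def by (simp only: if_True)
  next
    assume "\<not> Nl"
    then show "Ue h f d0 dl l = rrl f dl" using sl unfolding Ue_def by (simp only: if_False)
  qed
qed

text \<open>\<pi>2 u - \<phi>2 p and \<phi>1 p - \<pi>1 u are the coordinates of (u, p) in the
  fundamental basis. Their densities contain only F1 and F2, so they equal \<open>u 0\<close> plus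
  \<open>I1\<close> and \<open>p 0\<close> plus \<open>I2\<close>; the boundary conditions determine
  \<open>u 0\<close> and \<open>p 0\<close>. The argument uses densities throughout, because p is
  only known to be absolutely continuous when it comes from a weak solution.\<close>

lemma elliptic_unique:
  assumes hf: "continuous_on {0..l} h" "continuous_on {0..l} f"
    and u: "primitive l u (\<lambda>x. ihb x * p x + F1 f x)" and p: "primitive l p (\<lambda>x. 3 * cc x * ihb x * u x + F2 h f x)"
    and bc0: "if N0 then ihb 0 * p 0 + F1 f 0 = d0 else u 0 = d0"
    and bcl: "if Nl then ihb l * p l + F1 f l = dl else u l = dl"
    and x: "x \<in> {0..l}"
  shows "u x = Ue h f d0 dl x" "p x = Pe h f d0 dl x"
proof -
  have l0: "0 \<le> l" using l_pos by simp
  have St1: "primitive l \<phi>1 (\<lambda>x. ihb x * \<pi>1 x)" "primitive l \<pi>1 (\<lambda>x. 3 * cc x * ihb x * \<phi>1 x)"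
    "primitive l \<phi>2 (\<lambda>x. ihb x * \<pi>2 x)" "primitive l \<pi>2 (\<lambda>x. 3 * cc x * ihb x * \<phi>2 x)"
    by (rule primitive_C1[OF fund_d(1)] primitive_C1[OF fund_d(2)] primitive_C1[OF fund_d(3)] primitive_C1[OF fund_d(4)];
        (intro continuous_intros St_cont | assumption))+
  have e1: "\<pi>2 x * u x - \<phi>2 x * p x = u 0 + I1 h f x" if x: "x \<in> {0..l}" for x
  proof -
    have "primitive l (\<lambda>x. \<pi>2 x * u x - \<phi>2 x * p x)
       (\<lambda>x. (3 * cc x * ihb x * \<phi>2 x * u x + \<pi>2 x * (ihb x * p x + F1 f x)) - (ihb x * \<pi>2 x * p x + \<phi>2 x * (3 * cc x * ihb x * u x + F2 h f x)))"
      by (intro primitive_diff primitive_mult St1 u p l0)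
    then have "primitive l (\<lambda>x. \<pi>2 x * u x - \<phi>2 x * p x) (\<lambda>y. \<pi>2 y * F1 f y - \<phi>2 y * F2 h f y)"
      by (simp add: algebra_simps)
    from primitive_eq[OF this x] show ?thesis unfolding I1_def fund0 by simp
  qed
  have e2: "\<phi>1 x * p x - \<pi>1 x * u x = p 0 + I2 h f x" if x: "x \<in> {0..l}" for x
  proof -
    have "primitive l (\<lambda>x. \<phi>1 x * p x - \<pi>1 x * u x)
       (\<lambda>x. (ihb x * \<pi>1 x * p x + \<phi>1 x * (3 * cc x * ihb x * u x + F2 h f x)) - (3 * cc x * ihb x * \<phi>1 x * u x + \<pi>1 x * (ihb x * p x + F1 f x)))"
      by (intro primitive_diff primitive_mult St1 u p l0)
    then have "primitive l (\<lambda>x. \<phi>1 x * p x - \<pi>1 x * u x) (\<lambda>y. \<phi>1 y * F2 h f y - \<pi>1 y * F1 f y)"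
      by (simp add: algebra_simps)
    from primitive_eq[OF this x] show ?thesis unfolding I2_def fund0 by simp
  qed
  have repr: "u x = (u 0 + I1 h f x) * \<phi>1 x + (p 0 + I2 h f x) * \<phi>2 x" "p x = (u 0 + I1 h f x) * \<pi>1 x + (p 0 + I2 h f x) * \<pi>2 x"
    if x: "x \<in> {0..l}" for x
  proof -
    have "(\<phi>1 x * \<pi>2 x - \<phi>2 x * \<pi>1 x) * u x = (u 0 + I1 h f x) * \<phi>1 x + (p 0 + I2 h f x) * \<phi>2 x"
      "(\<phi>1 x * \<pi>2 x - \<phi>2 x * \<pi>1 x) * p x = (u 0 + I1 h f x) * \<pi>1 x + (p 0 + I2 h f x) * \<pi>2 x"
      unfolding e1[OF x, symmetric] e2[OF x, symmetric] by (simp_all add: algebra_simps)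
    then show "u x = (u 0 + I1 h f x) * \<phi>1 x + (p 0 + I2 h f x) * \<phi>2 x" "p x = (u 0 + I1 h f x) * \<pi>1 x + (p 0 + I2 h f x) * \<pi>2 x"
      unfolding wronskian[OF x] by auto
  qed
  have ll: "l \<in> {0..l}" using l_pos by simp
  have b0: "if N0 then p 0 = rr0 f d0 else u 0 = rr0 f d0" using bc0 unfolding bc0_iff .
  have bl: "(u 0 + I1 h f l) * X1 + (p 0 + I2 h f l) * X2 = rrl f dl"
    using bcl unfolding bcl_iff X1_def X2_def using repr[OF ll] by (simp split: if_splits)
  show "u x = Ue h f d0 dl x" "p x = Pe h f d0 dl x"
    unfolding Ue_def Pe_def coefficients_unique[OF b0 bl, symmetric] using repr[OF x] by auto
qed

end

locale elliptic_opclass = elliptic + opclass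
begin

lemma C_elliptic:
  assumes h: "C h" and f: "C f" and d: "C (\<lambda>i x. d0 i)" "C (\<lambda>i x. dl i)"
  shows "C (\<lambda>i. Ue (h i) (f i) (d0 i) (dl i))" "C (\<lambda>i. Pe (h i) (f i) (d0 i) (dl i))"
    "C (\<lambda>i. Ux (h i) (f i) (d0 i) (dl i))" "C (\<lambda>i. F1 (f i))" "C (\<lambda>i. F2 (h i) (f i))"
proof -
  note st = C_static[OF St_ihb] C_static[OF St_hb] C_static[OF St_b(2)] C_static[OF fund_St(1)] C_static[OF fund_St(2)]
    C_static[OF fund_St(3)] C_static[OF fund_St(4)] C_const
  have e0: "0 \<in> {0..l}" "l \<in> {0..l}" using l_pos by auto
  show F: "C (\<lambda>i. F1 (f i))" "C (\<lambda>i. F2 (h i) (f i))"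
    unfolding F1_def[abs_def] F2_def[abs_def] by (intro C_mult C_diff st h f)+
  have I: "C (\<lambda>i. I1 (h i) (f i))" "C (\<lambda>i. I2 (h i) (f i))"
    unfolding I1_def[abs_def] I2_def[abs_def] by (intro C_integral C_diff C_mult st F)+
  have Il: "C (\<lambda>i x. I1 (h i) (f i) l)" "C (\<lambda>i x. I2 (h i) (f i) l)" using C_trace[OF I(1) e0(2)] C_trace[OF I(2) e0(2)] .
  have fl: "C (\<lambda>i x. f i 0)" "C (\<lambda>i x. f i l)" using C_trace[OF f e0(1)] C_trace[OF f e0(2)] .
  have r: "C (\<lambda>i x. rr0 (f i) (d0 i))" "C (\<lambda>i x. rrl (f i) (dl i))"
    unfolding rr0_def rrl_def by (intro C_if C_diff C_mult st fl d C_const)+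
  have ab: "C (\<lambda>i x. al (h i) (f i) (d0 i) (dl i))" "C (\<lambda>i x. be (h i) (f i) (d0 i) (dl i))"
    unfolding al_def be_def by (intro C_if C_diff C_mult C_add C_const r Il)+
  show U: "C (\<lambda>i. Ue (h i) (f i) (d0 i) (dl i))" "C (\<lambda>i. Pe (h i) (f i) (d0 i) (dl i))"
    unfolding Ue_def[abs_def] Pe_def[abs_def] by (intro C_add C_mult st ab I)+
  show "C (\<lambda>i. Ux (h i) (f i) (d0 i) (dl i))" unfolding Ux_def[abs_def] by (intro C_add C_mult st U F)
qed

end

section \<open>Lipschitz dependence on the state\<close>

lemma compact_lipschitz:
  fixes F :: "real \<times> real \<Rightarrow> real"
  assumes U: "open U" and F: "smooth_on F U" and K: "compact K" "K \<subseteq> U"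
  obtains L where "0 \<le> L" "\<And>p q. p \<in> K \<Longrightarrow> q \<in> K \<Longrightarrow> \<bar>F p - F q\<bar> \<le> L * norm (p - q)"
proof -
  have CF: "Ck_on 1 F U" using F unfolding smooth_on_def by blast
  have diff: "F differentiable (at p within U)" if "p \<in> U" for p using CF that by simp
  let ?F1 = "\<lambda>p. frechet_derivative F (at p within U) (1, 0)" and ?F2 = "\<lambda>p. frechet_derivative F (at p within U) (0, 1)"
  have c: "continuous_on U ?F1" "continuous_on U ?F2" using CF by auto
  \<comment> \<open>K need not be convex, so the derivative bound is used on small balls only;
    compactness turns the local Lipschitz property into a global one on K.\<close>
  have "local_lipschitz {0::real} U (\<lambda>t. F)"
  proof (rule local_lipschitzI)
    fix t :: real and p assume "t \<in> {0}" and p: "p \<in> U"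
    obtain u where u: "0 < u" "cball p u \<subseteq> U" using U p open_contains_cball by blast
    obtain M1 where M1: "0 \<le> M1" "\<And>q. q \<in> cball p u \<Longrightarrow> \<bar>?F1 q\<bar> \<le> M1"
      using continuous_on_compact_bound_abs[OF continuous_on_subset[OF c(1) u(2)] compact_cball] by metis
    obtain M2 where M2: "0 \<le> M2" "\<And>q. q \<in> cball p u \<Longrightarrow> \<bar>?F2 q\<bar> \<le> M2"
      using continuous_on_compact_bound_abs[OF continuous_on_subset[OF c(2) u(2)] compact_cball] by metis
    have "(M1 + M2)-lipschitz_on (cball p u \<inter> U) F"
    proof (rule lipschitz_onI)
      fix q r assume q: "q \<in> cball p u \<inter> U" and r: "r \<in> cball p u \<inter> U"
      have "norm (F q - F r) \<le> (M1 + M2) * norm (q - r)"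
      proof (rule differentiable_bound[of "cball p u" F "\<lambda>s v. fst v * ?F1 s + snd v * ?F2 s"])
        fix s assume s: "s \<in> cball p u"
        show "(F has_derivative (\<lambda>v. fst v * ?F1 s + snd v * ?F2 s)) (at s within cball p u)"
          using has_derivative_partials[OF diff] s u(2) by (meson has_derivative_subset subsetD)
        show "onorm (\<lambda>v. fst v * ?F1 s + snd v * ?F2 s) \<le> M1 + M2"
        proof (rule onorm_le)
          fix v :: "real \<times> real"
          have "norm (fst v * ?F1 s + snd v * ?F2 s) \<le> \<bar>fst v\<bar> * \<bar>?F1 s\<bar> + \<bar>snd v\<bar> * \<bar>?F2 s\<bar>"
            unfolding abs_mult[symmetric] by simp
          also have "\<dots> \<le> norm v * M1 + norm v * M2"
            using norm_fst_le[of "fst v" "snd v"] norm_snd_le[of "snd v" "fst v"] M1(2)[OF s] M2(2)[OF s]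
            by (intro add_mono mult_mono) auto
          finally show "norm (fst v * ?F1 s + snd v * ?F2 s) \<le> (M1 + M2) * norm v" by (simp add: algebra_simps)
        qed
      qed (use q r in auto)
      then show "dist (F q) (F r) \<le> (M1 + M2) * dist q r" by (simp add: dist_norm)
    qed (use M1 M2 in auto)
    then show "\<exists>u>0. \<exists>L. \<forall>t\<in>cball t u \<inter> {0}. L-lipschitz_on (cball p u \<inter> U) F" using u(1) by blast
  qed
  from local_lipschitz_subset[OF this subset_refl K(2)]
  obtain L where L: "\<And>t. t \<in> {0::real} \<Longrightarrow> L-lipschitz_on K F"
    by (rule local_lipschitz_compact_implies_lipschitz[OF _ K(1)]) auto
  then have "L-lipschitz_on K F" by simp
  then show ?thesis using that[of L] unfolding lipschitz_on_def dist_norm by (simp add: lipschitz_on_def)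
qed

text \<open>Here \<open>rel i j d\<close> says that the states \<open>i\<close> and \<open>j\<close> have distance at most \<open>d\<close>.\<close>

locale lipschitz_class = bathymetry +
  fixes Gd :: "'i set" and rel :: "'i \<Rightarrow> 'i \<Rightarrow> real \<Rightarrow> bool"
  assumes rel_nonneg: "rel i j d \<Longrightarrow> 0 \<le> d"
begin

text \<open>Uniform bounds are carried along with the Lipschitz constants, because the constant of a
  product involves both.\<close>

definition LB :: "('i \<Rightarrow> real \<Rightarrow> real) \<Rightarrow> bool" where
  "LB \<Theta> \<longleftrightarrow> (\<forall>i\<in>Gd. continuous_on {0..l} (\<Theta> i)) \<and>
    (\<exists>L M. 0 \<le> L \<and> 0 \<le> M \<and> (\<forall>i\<in>Gd. \<forall>x\<in>{0..l}. \<bar>\<Theta> i x\<bar> \<le> M) \<and>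
      (\<forall>i\<in>Gd. \<forall>j\<in>Gd. \<forall>d. rel i j d \<longrightarrow> (\<forall>x\<in>{0..l}. \<bar>\<Theta> i x - \<Theta> j x\<bar> \<le> L * d)))"

lemma LBE:
  assumes "LB \<Theta>"
  obtains L M where "0 \<le> L" "0 \<le> M" "\<And>i. i \<in> Gd \<Longrightarrow> continuous_on {0..l} (\<Theta> i)"
    "\<And>i x. i \<in> Gd \<Longrightarrow> x \<in> {0..l} \<Longrightarrow> \<bar>\<Theta> i x\<bar> \<le> M"
    "\<And>i j d x. i \<in> Gd \<Longrightarrow> j \<in> Gd \<Longrightarrow> rel i j d \<Longrightarrow> x \<in> {0..l} \<Longrightarrow> \<bar>\<Theta> i x - \<Theta> j x\<bar> \<le> L * d"
proof -
  from assms obtain L M where c: "\<forall>i\<in>Gd. continuous_on {0..l} (\<Theta> i)" "0 \<le> L" "0 \<le> M"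
      "\<forall>i\<in>Gd. \<forall>x\<in>{0..l}. \<bar>\<Theta> i x\<bar> \<le> M"
      "\<forall>i\<in>Gd. \<forall>j\<in>Gd. \<forall>d. rel i j d \<longrightarrow> (\<forall>x\<in>{0..l}. \<bar>\<Theta> i x - \<Theta> j x\<bar> \<le> L * d)"
    unfolding LB_def by (elim conjE exE)
  show ?thesis
    by (rule that[OF c(2,3) c(1)[rule_format] c(4)[rule_format] c(5)[rule_format]])
qed

lemma LBI:
  assumes "0 \<le> L" "0 \<le> M" "\<And>i. i \<in> Gd \<Longrightarrow> continuous_on {0..l} (\<Theta> i)"
    "\<And>i x. i \<in> Gd \<Longrightarrow> x \<in> {0..l} \<Longrightarrow> \<bar>\<Theta> i x\<bar> \<le> M"
    "\<And>i j d x. i \<in> Gd \<Longrightarrow> j \<in> Gd \<Longrightarrow> rel i j d \<Longrightarrow> x \<in> {0..l} \<Longrightarrow> \<bar>\<Theta> i x - \<Theta> j x\<bar> \<le> L * d"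
  shows "LB \<Theta>"
  using assms unfolding LB_def by blast

lemma LB_opclass: "opclass l h0 b LB"
proof unfold_locales
  fix a assume "St a"
  then have c: "continuous_on {0..l} a" by (rule St_continuous)
  obtain M where "0 \<le> M" "\<And>x. x \<in> {0..l} \<Longrightarrow> \<bar>a x\<bar> \<le> M" using continuous_on_compact_bound_abs[OF c compact_Icc] by metis
  then show "LB (\<lambda>i. a)" using c by (intro LBI[of 0 M]) auto
next
  fix u v assume u: "LB u" and v: "LB v"
  obtain L M where a: "0 \<le> L" "0 \<le> M" "\<And>i. i \<in> Gd \<Longrightarrow> continuous_on {0..l} (u i)"
    "\<And>i x. i \<in> Gd \<Longrightarrow> x \<in> {0..l} \<Longrightarrow> \<bar>u i x\<bar> \<le> M"
    "\<And>i j d x. i \<in> Gd \<Longrightarrow> j \<in> Gd \<Longrightarrow> rel i j d \<Longrightarrow> x \<in> {0..l} \<Longrightarrow> \<bar>u i x - u j x\<bar> \<le> L * d" by (rule LBE[OF u]) blast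
  obtain L' M' where a': "0 \<le> L'" "0 \<le> M'" "\<And>i. i \<in> Gd \<Longrightarrow> continuous_on {0..l} (v i)"
    "\<And>i x. i \<in> Gd \<Longrightarrow> x \<in> {0..l} \<Longrightarrow> \<bar>v i x\<bar> \<le> M'"
    "\<And>i j d x. i \<in> Gd \<Longrightarrow> j \<in> Gd \<Longrightarrow> rel i j d \<Longrightarrow> x \<in> {0..l} \<Longrightarrow> \<bar>v i x - v j x\<bar> \<le> L' * d" by (rule LBE[OF v]) blast
  show "LB (\<lambda>i x. u i x + v i x)"
  proof (rule LBI[of "L + L'" "M + M'"])
    show "\<bar>u i x + v i x\<bar> \<le> M + M'" if "i \<in> Gd" "x \<in> {0..l}" for i x
      using a(4)[OF that] a'(4)[OF that] by linarith
    show "\<bar>u i x + v i x - (u j x + v j x)\<bar> \<le> (L + L') * d" if "i \<in> Gd" "j \<in> Gd" "rel i j d" "x \<in> {0..l}" for i j d x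
      using a(5)[OF that] a'(5)[OF that] unfolding distrib_right by linarith
  qed (use a a' in \<open>auto intro: continuous_intros\<close>)
  show "LB (\<lambda>i x. u i x * v i x)"
  proof (rule LBI[of "L * M' + M * L'" "M * M'"])
    show "\<bar>u i x * v i x\<bar> \<le> M * M'" if "i \<in> Gd" "x \<in> {0..l}" for i x
      unfolding abs_mult using a(2) a(4)[OF that] a'(4)[OF that] by (intro mult_mono) auto
    show "\<bar>u i x * v i x - u j x * v j x\<bar> \<le> (L * M' + M * L') * d" if r: "i \<in> Gd" "j \<in> Gd" "rel i j d" "x \<in> {0..l}" for i j d x
    proof -
      have "u i x * v i x - u j x * v j x = (u i x - u j x) * v i x + u j x * (v i x - v j x)" by (simp add: algebra_simps)
      then have "\<bar>u i x * v i x - u j x * v j x\<bar> \<le> \<bar>u i x - u j x\<bar> * \<bar>v i x\<bar> + \<bar>u j x\<bar> * \<bar>v i x - v j x\<bar>"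
        by (metis abs_mult abs_triangle_ineq)
      also have "\<dots> \<le> (L * d) * M' + M * (L' * d)"
        using a(1,2) rel_nonneg[OF r(3)] a(5)[OF r] a'(5)[OF r] a(4)[OF r(2,4)] a'(4)[OF r(1,4)] by (intro add_mono mult_mono) auto
      finally show ?thesis by (simp add: algebra_simps)
    qed
  qed (use a a' in \<open>auto intro: continuous_intros\<close>)
next
  fix u assume u: "LB u"
  obtain L M where a: "0 \<le> L" "0 \<le> M" "\<And>i. i \<in> Gd \<Longrightarrow> continuous_on {0..l} (u i)"
    "\<And>i x. i \<in> Gd \<Longrightarrow> x \<in> {0..l} \<Longrightarrow> \<bar>u i x\<bar> \<le> M"
    "\<And>i j d x. i \<in> Gd \<Longrightarrow> j \<in> Gd \<Longrightarrow> rel i j d \<Longrightarrow> x \<in> {0..l} \<Longrightarrow> \<bar>u i x - u j x\<bar> \<le> L * d" by (rule LBE[OF u]) blast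
  have ii: "u i integrable_on {0..x}" if "i \<in> Gd" "x \<in> {0..l}" for i x
    using a(3)[OF that(1)] that(2) by (intro integrable_continuous_interval) (auto elim: continuous_on_subset)
  show "LB (\<lambda>i x. integral {0..x} (u i))"
  proof (rule LBI[of "L * l" "M * l"])
    show "continuous_on {0..l} (\<lambda>x. integral {0..x} (u i))" if "i \<in> Gd" for i
      by (rule indefinite_integral_continuous_1) (rule ii[OF that], use l_pos in simp)
    show "\<bar>integral {0..x} (u i)\<bar> \<le> M * l" if i: "i \<in> Gd" and x: "x \<in> {0..l}" for i x
    proof -
      have "\<bar>integral {0..x} (u i)\<bar> \<le> integral {0..x} (\<lambda>y. M)"
        using integral_norm_bound_integral[OF ii[OF i x] integrable_const_ivl, of M] a(4)[OF i] x by auto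
      also have "\<dots> \<le> M * l" using x a(2) by (simp add: mult.commute mult_left_mono)
      finally show ?thesis .
    qed
    show "\<bar>integral {0..x} (u i) - integral {0..x} (u j)\<bar> \<le> L * l * d" if r: "i \<in> Gd" "j \<in> Gd" "rel i j d" "x \<in> {0..l}" for i j d x
    proof -
      have "\<bar>integral {0..x} (u i) - integral {0..x} (u j)\<bar> = \<bar>integral {0..x} (\<lambda>y. u i y - u j y)\<bar>"
        by (simp only: integral_diff[OF ii[OF r(1,4)] ii[OF r(2,4)]])
      also have "\<dots> \<le> integral {0..x} (\<lambda>y. L * d)"
        using integral_norm_bound_integral[OF integrable_diff[OF ii[OF r(1,4)] ii[OF r(2,4)]] integrable_const_ivl, of "L * d"] a(5)[OF r(1-3)] r(4) by auto
      also have "\<dots> = (L * d) * x" using r(4) by simp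
      also have "\<dots> \<le> (L * d) * l" using r(4) a(1) rel_nonneg[OF r(3)] by (intro mult_left_mono) auto
      finally show ?thesis by (simp add: ac_simps)
    qed
  qed (use a l_pos in auto)
  fix x0 assume x0: "x0 \<in> {0..l}"
  show "LB (\<lambda>i x. u i x0)" by (rule LBI[of L M]) (use a x0 in auto)
qed

sublocale opclass l h0 g b LB by (rule LB_opclass)

lemma LB_inverse:
  assumes u: "LB u" and d: "0 < \<delta>" "\<And>i x. i \<in> Gd \<Longrightarrow> x \<in> {0..l} \<Longrightarrow> \<delta> \<le> u i x"
  shows "LB (\<lambda>i x. 1 / u i x)"
proof -
  obtain L M where a: "0 \<le> L" "0 \<le> M" "\<And>i. i \<in> Gd \<Longrightarrow> continuous_on {0..l} (u i)"
    "\<And>i x. i \<in> Gd \<Longrightarrow> x \<in> {0..l} \<Longrightarrow> \<bar>u i x\<bar> \<le> M"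
    "\<And>i j d x. i \<in> Gd \<Longrightarrow> j \<in> Gd \<Longrightarrow> rel i j d \<Longrightarrow> x \<in> {0..l} \<Longrightarrow> \<bar>u i x - u j x\<bar> \<le> L * d" by (rule LBE[OF u]) blast
  show ?thesis
  proof (rule LBI[of "(1/\<delta>) * (1/\<delta>) * L" "1 / \<delta>"])
    have le: "\<bar>1 / u i x\<bar> \<le> 1 / \<delta>" if "i \<in> Gd" "x \<in> {0..l}" for i x
      using d(1) d(2)[OF that] by (simp add: frac_le)
    then show "\<bar>1 / u i x\<bar> \<le> 1 / \<delta>" if "i \<in> Gd" "x \<in> {0..l}" for i x using that .
    show "continuous_on {0..l} (\<lambda>x. 1 / u i x)" if "i \<in> Gd" for i
      using a(3)[OF that] d(1) d(2)[OF that] by (intro continuous_intros) force+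
    show "\<bar>1 / u i x - 1 / u j x\<bar> \<le> (1/\<delta>) * (1/\<delta>) * L * d" if r: "i \<in> Gd" "j \<in> Gd" "rel i j d" "x \<in> {0..l}" for i j d x
    proof -
      have nz: "u i x \<noteq> 0" "u j x \<noteq> 0" using d(1) d(2)[OF r(1,4)] d(2)[OF r(2,4)] by auto
      have "1 / u i x - 1 / u j x = (1 / u i x) * (1 / u j x) * (u j x - u i x)" using nz by (simp add: field_simps)
      then have "\<bar>1 / u i x - 1 / u j x\<bar> = \<bar>1 / u i x\<bar> * \<bar>1 / u j x\<bar> * \<bar>u i x - u j x\<bar>"
        by (simp only: abs_mult abs_minus_commute)
      also have "\<dots> \<le> (1/\<delta>) * (1/\<delta>) * (L * d)"
        using le[OF r(1,4)] le[OF r(2,4)] a(5)[OF r] d(1) by (intro mult_mono) auto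
      finally show ?thesis by (simp add: ac_simps)
    qed
  qed (use a d in auto)
qed

lemma LB_compose:
  assumes F: "open U" "smooth_on F U" and K: "compact K" "K \<subseteq> U"
    and u: "LB u" "LB v" and im: "\<And>i x. i \<in> Gd \<Longrightarrow> x \<in> {0..l} \<Longrightarrow> (u i x, v i x) \<in> K"
  shows "LB (\<lambda>i x. F (u i x, v i x))"
proof -
  obtain L M where a: "0 \<le> L" "0 \<le> M" "\<And>i. i \<in> Gd \<Longrightarrow> continuous_on {0..l} (u i)"
    "\<And>i x. i \<in> Gd \<Longrightarrow> x \<in> {0..l} \<Longrightarrow> \<bar>u i x\<bar> \<le> M"
    "\<And>i j d x. i \<in> Gd \<Longrightarrow> j \<in> Gd \<Longrightarrow> rel i j d \<Longrightarrow> x \<in> {0..l} \<Longrightarrow> \<bar>u i x - u j x\<bar> \<le> L * d" by (rule LBE[OF u(1)]) blast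
  obtain L' M' where a': "0 \<le> L'" "0 \<le> M'" "\<And>i. i \<in> Gd \<Longrightarrow> continuous_on {0..l} (v i)"
    "\<And>i x. i \<in> Gd \<Longrightarrow> x \<in> {0..l} \<Longrightarrow> \<bar>v i x\<bar> \<le> M'"
    "\<And>i j d x. i \<in> Gd \<Longrightarrow> j \<in> Gd \<Longrightarrow> rel i j d \<Longrightarrow> x \<in> {0..l} \<Longrightarrow> \<bar>v i x - v j x\<bar> \<le> L' * d" by (rule LBE[OF u(2)]) blast
  have "Ck_on 0 F U" using F(2) unfolding smooth_on_def by blast
  then have c: "continuous_on U F" by simp
  obtain LF where LF: "0 \<le> LF" "\<And>p q. p \<in> K \<Longrightarrow> q \<in> K \<Longrightarrow> \<bar>F p - F q\<bar> \<le> LF * norm (p - q)"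
    using compact_lipschitz[OF F K] by blast
  obtain MF where MF: "0 \<le> MF" "\<And>p. p \<in> K \<Longrightarrow> \<bar>F p\<bar> \<le> MF"
    using continuous_on_compact_bound_abs[OF continuous_on_subset[OF c K(2)] K(1)] by metis
  show ?thesis
  proof (rule LBI[of "LF * (L + L')" MF])
    show "continuous_on {0..l} (\<lambda>x. F (u i x, v i x))" if "i \<in> Gd" for i
      by (rule continuous_on_compose2[OF c]) (use a(3)[OF that] a'(3)[OF that] im[OF that] K(2) in \<open>auto intro: continuous_intros\<close>)
    show "\<bar>F (u i x, v i x) - F (u j x, v j x)\<bar> \<le> LF * (L + L') * d" if r: "i \<in> Gd" "j \<in> Gd" "rel i j d" "x \<in> {0..l}" for i j d x
    proof -
      have "\<bar>F (u i x, v i x) - F (u j x, v j x)\<bar> \<le> LF * norm ((u i x, v i x) - (u j x, v j x))" by (rule LF(2)[OF im[OF r(1,4)] im[OF r(2,4)]])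
      also have "LF * norm ((u i x, v i x) - (u j x, v j x)) \<le> LF * ((L + L') * d)"
      proof (rule mult_left_mono[OF _ LF(1)])
        have "norm ((u i x, v i x) - (u j x, v j x)) \<le> \<bar>u i x - u j x\<bar> + \<bar>v i x - v j x\<bar>"
          unfolding diff_Pair norm_Pair real_norm_def power2_abs by (rule sqrt_sum_squares_le_sum_abs)
        then show "norm ((u i x, v i x) - (u j x, v j x)) \<le> (L + L') * d"
          using a(5)[OF r] a'(5)[OF r] unfolding distrib_right by linarith
      qed
      finally show ?thesis by (simp only: mult.assoc)
    qed
  qed (use LF MF a a' im in auto)
qed

end

section \<open>Boundary conditions differentiated in time\<close>

text \<open>A boundary condition \<open>\<xi>(\<zeta>, q) = \<gamma>(t)\<close>.  If \<open>\<partial>\<xi>/\<partial>q\<close> does not vanish, it determines \<open>\<partial>\<^sub>t q\<close>;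
  otherwise (flag \<open>N\<close>) it determines \<open>\<partial>\<^sub>x q = - \<partial>\<^sub>t \<zeta>\<close> and hence \<open>\<partial>\<^sub>x \<partial>\<^sub>t q\<close>.\<close>

locale boundary =
  fixes U :: "(real \<times> real) set" and \<xi> :: "real \<times> real \<Rightarrow> real" and \<gamma> :: "real \<Rightarrow> real" and N :: bool
  assumes U: "open U" and \<xi>: "smooth_on \<xi> U" and \<gamma>: "smooth_on \<gamma> {0..}"
    and kind: "\<And>p. p \<in> U \<Longrightarrow> if N then frechet_derivative \<xi> (at p within U) (0, 1) = 0 \<and>
        frechet_derivative \<xi> (at p within U) (1, 0) \<noteq> 0
      else frechet_derivative \<xi> (at p within U) (0, 1) \<noteq> 0"
begin

definition xz where "xz p = frechet_derivative \<xi> (at p within U) (1, 0)"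
definition xq where "xq p = frechet_derivative \<xi> (at p within U) (0, 1)"
definition xzz where "xzz p = frechet_derivative xz (at p within U) (1, 0)"
definition g1 where "g1 t = frechet_derivative \<gamma> (at t within {0..}) 1"
definition g2 where "g2 t = frechet_derivative g1 (at t within {0..}) 1"

text \<open>The derivative of the condition is - \<xi>_z w + \<xi>_q \<partial>t q = \<gamma>'. If
  \<xi>_q is nonzero this is solved for \<partial>t q. If \<open>N\<close> holds it reads w = -
  \<gamma>' / \<xi>_z, and one more derivative, with \<partial>t z = - w, gives \<partial>t w = -
  (\<gamma>'' / \<xi>_z + \<gamma>' \<xi>_zz w / \<xi>_z^2).\<close>

definition dval where
  "dval t z k w = (if N then - (g2 t * (1 / xz (z, k)) + g1 t * xzz (z, k) * w * ((1 / xz (z, k)) * (1 / xz (z, k))))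
     else (g1 t + xz (z, k) * w) * (1 / xq (z, k)))"

lemma smooth_parts: "smooth_on xz U" "smooth_on xq U" "smooth_on xzz U" "smooth_on g1 {0..}" "smooth_on g2 {0..}"
proof -
  show 1: "smooth_on xz U" "smooth_on xq U" unfolding xz_def[abs_def] xq_def[abs_def] by (intro smooth_on_frechet \<xi>)+
  show 2: "smooth_on g1 {0..}" unfolding g1_def[abs_def] by (intro smooth_on_frechet \<gamma>)
  show "smooth_on xzz U" "smooth_on g2 {0..}" unfolding xzz_def[abs_def] g2_def[abs_def] by (intro smooth_on_frechet 1 2)+
qed

lemma kind_N: "N \<Longrightarrow> p \<in> U \<Longrightarrow> xq p = 0" "N \<Longrightarrow> p \<in> U \<Longrightarrow> xz p \<noteq> 0" "\<not> N \<Longrightarrow> p \<in> U \<Longrightarrow> xq p \<noteq> 0"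
  using kind unfolding xq_def xz_def by (auto split: if_splits)

lemma \<gamma>_deriv: "0 \<le> t \<Longrightarrow> {0..T} \<subseteq> {0..} \<Longrightarrow> (\<gamma> has_real_derivative g1 t) (at t within {0..T})"
  "0 \<le> t \<Longrightarrow> {0..T} \<subseteq> {0..} \<Longrightarrow> (g1 has_real_derivative g2 t) (at t within {0..T})"
  unfolding g1_def g2_def
  by (rule DERIV_subset[OF has_real_derivative_frechet[OF smooth_on_differentiable[OF \<gamma>]]] DERIV_subset[OF has_real_derivative_frechet[OF smooth_on_differentiable[OF smooth_parts(4)[unfolded g1_def[abs_def]]]]]; simp)+

lemma \<xi>_deriv: "p \<in> U \<Longrightarrow> (\<xi> has_derivative (\<lambda>v. fst v * xz p + snd v * xq p)) (at p within U)"
  unfolding xz_def xq_def by (rule has_derivative_partials[OF smooth_on_differentiable[OF \<xi>]])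

text \<open>If \<open>N\<close> holds, \<xi> has zero q-derivative on U and is therefore independent
  of q on a small square around p, and so is its z-derivative. The argument is local because U need
  not contain the segments joining points with equal z. It ensures that the second differentiation
  of the boundary condition produces no term in \<partial>t q.\<close>

lemma xz_q_zero:
  assumes N and p: "p \<in> U"
  shows "frechet_derivative xz (at p within U) (0, 1) = 0"
proof -
  obtain a b where p': "p = (a, b)" by (cases p)
  obtain e where e: "0 < e" "ball p e \<subseteq> U" using U p open_contains_ball by blast
  have loc: "\<xi> (z, k) = \<xi> (z, b)" if z: "\<bar>z - a\<bar> < e/2" and k: "\<bar>k - b\<bar> < e/2" for z k
  proof -
    define I where "I = {min k b..max k b}"
    have I: "(z, s) \<in> U" if "s \<in> I" for s
    proof -
      have "\<bar>s - b\<bar> < e/2"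
        using that k unfolding I_def by (auto simp: min_def max_def abs_if split: if_splits)
      then have "dist (z, s) p < e"
        using z sqrt_sum_squares_le_sum_abs[of "z - a" "s - b"] unfolding p' dist_Pair_Pair dist_real_def by simp
      then show ?thesis using e(2) by (auto simp: dist_commute)
    qed
    have d: "((\<lambda>s. \<xi> (z, s)) has_real_derivative 0) (at s within I)" if "s \<in> I" for s
    proof -
      have "((\<lambda>s. \<xi> (z, s)) has_real_derivative (0 * xz (z, s) + 1 * xq (z, s))) (at s within I)"
        by (rule has_real_derivative_compose2[where a="\<lambda>_. z" and b="\<lambda>s. s", OF \<xi>_deriv[OF I[OF that]]]) (use I in auto)
      then show ?thesis using kind_N(1)[OF assms(1) I[OF that]] by simp
    qed
    have "k \<in> I" "b \<in> I" "convex I" unfolding I_def by auto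
    then show ?thesis using has_field_derivative_zero_constant[OF \<open>convex I\<close> d] by metis
  qed
  then have xzeq: "xz (a, k) = xz (a, b)" if k: "\<bar>k - b\<bar> < e/2" for k
  proof -
    have inU: "(a, s) \<in> U" if "\<bar>s - b\<bar> < e/2" for s
    proof -
      have "dist (a, s) p < e"
        using that sqrt_sum_squares_le_sum_abs[of "a - a" "s - b"] e(1) unfolding p' dist_Pair_Pair dist_real_def by simp
      then show ?thesis using e(2) by (auto simp: dist_commute)
    qed
    have der: "((\<lambda>z. \<xi> (z, s)) has_real_derivative xz (a, s)) (at a)" if s: "\<bar>s - b\<bar> < e/2" for s
    proof -
      have at: "at (a, s) within U = at (a, s)" by (rule at_within_open[OF inU[OF s] U])
      have F: "(\<xi> has_derivative (\<lambda>v. fst v * xz (a, s) + snd v * xq (a, s))) (at (a, s) within UNIV)"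
        using \<xi>_deriv[OF inU[OF s]] unfolding at by simp
      have "((\<lambda>z. \<xi> (z, s)) has_real_derivative (1 * xz (a, s) + 0 * xq (a, s))) (at a within UNIV)"
        by (rule has_real_derivative_compose2[where a="\<lambda>z. z" and b="\<lambda>_. s", OF F]) auto
      then show ?thesis by simp
    qed
    have "((\<lambda>z. \<xi> (z, b)) has_real_derivative xz (a, k)) (at a)"
      by (rule has_field_derivative_transform_within_open[OF der[OF k], of "{a - e/2<..<a + e/2}"])
         (use e(1) in \<open>auto intro!: loc[OF _ k] simp: abs_if\<close>)
    then show ?thesis using DERIV_unique der[of b] e(1) by simp
  qed
  have at: "at p within U = at p" by (rule at_within_open[OF p U])
  have F: "(xz has_derivative (\<lambda>v. fst v * frechet_derivative xz (at p within U) (1, 0) + snd v * frechet_derivative xz (at p within U) (0, 1))) (at (a, b) within UNIV)"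
    using has_derivative_partials[OF smooth_on_differentiable[OF smooth_parts(1) p]] unfolding p' by (simp add: at[unfolded p'])
  have "((\<lambda>k. xz (a, k)) has_real_derivative (0 * frechet_derivative xz (at p within U) (1, 0) + 1 * frechet_derivative xz (at p within U) (0, 1))) (at b within UNIV)"
    by (rule has_real_derivative_compose2[where a="\<lambda>_. a" and b="\<lambda>k. k", OF F]) auto
  moreover have "((\<lambda>k. xz (a, k)) has_real_derivative 0) (at b)"
  proof -
    have "((\<lambda>k. xz (a, b)) has_real_derivative 0) (at b)" by simp
    then show ?thesis
      by (rule has_field_derivative_transform_within_open[of _ _ _ "{b - e/2<..<b + e/2}"])
         (use e(1) in \<open>auto intro!: xzeq[symmetric] simp: abs_if\<close>)
  qed
  ultimately have "0 * frechet_derivative xz (at p within U) (1, 0) + 1 * frechet_derivative xz (at p within U) (0, 1) = 0"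
    by (rule DERIV_unique)
  then show ?thesis by simp
qed

lemma xz_deriv:
  assumes N "p \<in> U"
  shows "(xz has_derivative (\<lambda>v. fst v * xzz p + snd v * 0)) (at p within U)"
  using has_derivative_partials[OF smooth_on_differentiable[OF smooth_parts(1) assms(2)]] xz_q_zero[OF assms] unfolding xzz_def by simp

text \<open>Forwards, the condition is differentiated once, and under \<open>N\<close> the resulting
  formula for w once more. Backwards, the rates are integrated, and the conditions at time 0 are the
  constants. The forward direction serves uniqueness, the backward one existence.\<close>

lemma boundary_rate:
  assumes T: "0 < T" and U: "\<And>t. t \<in> {0..T} \<Longrightarrow> (z t, k t) \<in> U"
    and z: "\<And>t. t \<in> {0..T} \<Longrightarrow> (z has_real_derivative - w t) (at t within {0..T})"
    and k: "\<And>t. t \<in> {0..T} \<Longrightarrow> (k has_real_derivative k' t) (at t within {0..T})"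
    and w: "\<And>t. t \<in> {0..T} \<Longrightarrow> (w has_real_derivative w' t) (at t within {0..T})"
  shows "(\<forall>t\<in>{0..T}. \<xi> (z t, k t) = \<gamma> t) \<longleftrightarrow>
     \<xi> (z 0, k 0) = \<gamma> 0 \<and> (N \<longrightarrow> w 0 = - g1 0 / xz (z 0, k 0)) \<and>
     (\<forall>t\<in>{0..T}. if N then w' t = dval t (z t) (k t) (w t) else k' t = dval t (z t) (k t) (w t))" (is "?L \<longleftrightarrow> ?R")
proof -
  have nb: "at t within {0..T} \<noteq> bot" if "t \<in> {0..T}" for t using that T by (simp add: trivial_limit_within islimpt_Icc)
  have T0: "0 \<in> {0..T}" using T by simp
  have \<gamma>d: "(\<gamma> has_real_derivative g1 t) (at t within {0..T})" "(g1 has_real_derivative g2 t) (at t within {0..T})" if "t \<in> {0..T}" for t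
    using \<gamma>_deriv[of t T] that by auto
  have \<xi>d: "((\<lambda>t. \<xi> (z t, k t)) has_real_derivative (- w t * xz (z t, k t) + k' t * xq (z t, k t))) (at t within {0..T})" if "t \<in> {0..T}" for t
    by (rule has_real_derivative_compose2[OF \<xi>_deriv z k]) (use that U in auto)
  have xzd: "((\<lambda>t. xz (z t, k t)) has_real_derivative (- w t * xzz (z t, k t) + k' t * 0)) (at t within {0..T})" if "t \<in> {0..T}" N for t
    by (rule has_real_derivative_compose2[OF xz_deriv z k]) (use that U in auto)
  let ?r = "\<lambda>t. - g1 t / xz (z t, k t)"
  have rd: "(?r has_real_derivative dval t (z t) (k t) (w t) + g1 t * xzz (z t, k t) * (w t - w t) ) (at t within {0..T})" if t: "t \<in> {0..T}" and N for t
  proof -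
    have nz: "xz (z t, k t) \<noteq> 0" using kind_N(2)[OF \<open>N\<close> U[OF t]] .
    have "(?r has_real_derivative ((- g2 t) * xz (z t, k t) - (- g1 t) * (- w t * xzz (z t, k t) + k' t * 0)) / (xz (z t, k t) * xz (z t, k t))) (at t within {0..T})"
      by (rule DERIV_divide[OF DERIV_minus[OF \<gamma>d(2)[OF t]] xzd[OF t \<open>N\<close>] nz])
    moreover have "((- g2 t) * xz (z t, k t) - (- g1 t) * (- w t * xzz (z t, k t) + k' t * 0)) / (xz (z t, k t) * xz (z t, k t))
       = dval t (z t) (k t) (w t) + g1 t * xzz (z t, k t) * (w t - w t)"
      using \<open>N\<close> nz unfolding dval_def by (simp add: field_simps)
    ultimately show ?thesis by simp
  qed
  show ?thesis
  proof
    assume L: ?L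
    have e: "- w t * xz (z t, k t) + k' t * xq (z t, k t) = g1 t" if t: "t \<in> {0..T}" for t
    proof (rule has_real_derivative_unique_within[OF \<xi>d[OF t] _ nb[OF t]])
      show "((\<lambda>t. \<xi> (z t, k t)) has_real_derivative g1 t) (at t within {0..T})"
        by (rule has_field_derivative_transform_within[OF \<gamma>d(1)[OF t] zero_less_one t]) (use L in auto)
    qed
    show ?R
    proof (cases N)
      case True
      have w: "w t = ?r t" if t: "t \<in> {0..T}" for t
        using e[OF t] kind_N(1,2)[OF True U[OF t]] by (simp add: field_simps)
      have "w' t = dval t (z t) (k t) (w t)" if t: "t \<in> {0..T}" for t
      proof (rule has_real_derivative_unique_within[OF assms(5)[OF t] _ nb[OF t]])
        have "(?r has_real_derivative dval t (z t) (k t) (w t)) (at t within {0..T})" using rd[OF t True] by simp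
        then show "(w has_real_derivative dval t (z t) (k t) (w t)) (at t within {0..T})"
          by (rule has_field_derivative_transform_within[OF _ zero_less_one t]) (use w in auto)
      qed
      then show ?thesis using True L w T0 by simp
    next
      case False
      have "k' t = dval t (z t) (k t) (w t)" if t: "t \<in> {0..T}" for t
        using e[OF t] kind_N(3)[OF False U[OF t]] False unfolding dval_def by (simp add: field_simps)
      then show ?thesis using False L T0 by simp
    qed
  next
    assume R: ?R
    have "- w t * xz (z t, k t) + k' t * xq (z t, k t) = g1 t" if t: "t \<in> {0..T}" for t
    proof (cases N)
      case True
      have d0: "((\<lambda>t. w t - ?r t) has_real_derivative 0) (at s within {0..T})" if s: "s \<in> {0..T}" for s
        using DERIV_diff[OF w[OF s] rd[OF s True]] R True s by simp
      have "w t - ?r t = w 0 - ?r 0"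
        by (rule constant_if_zero_derivative[OF d0 t])
      then have "w t = ?r t" using R True by simp
      then show ?thesis using kind_N(1,2)[OF True U[OF t]] by simp
    next
      case False
      then show ?thesis using R t kind_N(3)[OF False U[OF t]] unfolding dval_def by (simp add: field_simps)
    qed
    then have d0: "((\<lambda>t. \<xi> (z t, k t) - \<gamma> t) has_real_derivative 0) (at s within {0..T})" if s: "s \<in> {0..T}" for s
      using DERIV_diff[OF \<xi>d[OF s] \<gamma>d(1)[OF s]] s by simp
    show ?L
    proof
      fix t assume t: "t \<in> {0..T}"
      have "\<xi> (z t, k t) - \<gamma> t = \<xi> (z 0, k 0) - \<gamma> 0"
        by (rule constant_if_zero_derivative[OF d0 t])
      then show "\<xi> (z t, k t) = \<gamma> t" using R by simp
    qed
  qed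
qed

end

section \<open>The evolution equation\<close>

locale boundary_opclass = opclass + boundary
begin

lemma C_dval:
  assumes w: "C (\<lambda>i x. w i)" and t: "C (\<lambda>i x. g1 (\<tau> i))" "C (\<lambda>i x. g2 (\<tau> i))"
    and F: "\<And>F. smooth_on F U \<Longrightarrow> C (\<lambda>i x. F (z i, k i))"
    and Fi: "\<And>F. smooth_on F U \<Longrightarrow> (\<And>p. p \<in> U \<Longrightarrow> F p \<noteq> 0) \<Longrightarrow> C (\<lambda>i x. 1 / F (z i, k i))"
  shows "C (\<lambda>i x. dval (\<tau> i) (z i) (k i) (w i))"
proof (cases N)
  case True
  have i: "C (\<lambda>i x. 1 / xz (z i, k i))" by (rule Fi[OF smooth_parts(1)]) (rule kind_N(2)[OF True])
  have "C (\<lambda>i x. - (g2 (\<tau> i) * (1 / xz (z i, k i)) + g1 (\<tau> i) * xzz (z i, k i) * w i * ((1 / xz (z i, k i)) * (1 / xz (z i, k i)))))"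
    by (intro C_minus C_add C_mult t w i F smooth_parts)
  then show ?thesis unfolding dval_def using True by simp
next
  case False
  have i: "C (\<lambda>i x. 1 / xq (z i, k i))" by (rule Fi[OF smooth_parts(2)]) (rule kind_N(3)[OF False])
  have "C (\<lambda>i x. (g1 (\<tau> i) + xz (z i, k i) * w i) * (1 / xq (z i, k i)))"
    by (intro C_add C_mult t w i F smooth_parts)
  then show ?thesis unfolding dval_def using False by simp
qed

end

section \<open>The right-hand side of the evolution equation\<close>

locale problem = elliptic l h0 g b \<phi>1 \<pi>1 \<phi>2 \<pi>2 N0 Nl + B0: boundary U \<xi>0 \<gamma>0 N0 + Bl: boundary U \<xi>l \<gamma>l Nl
  for l h0 g b \<phi>1 \<pi>1 \<phi>2 \<pi>2 N0 Nl U \<xi>0 \<gamma>0 \<xi>l \<gamma>l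
begin

definition hs where "hs z x = h0 + z x - b x"
definition fs where "fs z k x = 1/2 * g * (hs z x * hs z x - h0 * h0) + 1 / hs z x * (k x * k x)"
definition D0 where "D0 t z w k = B0.dval t (z 0) (k 0) (w 0)" for t :: real and z w k :: "real \<Rightarrow> real"
definition Dl where "Dl t z w k = Bl.dval t (z l) (k l) (w l)" for t :: real and z w k :: "real \<Rightarrow> real"
definition GU where "GU t z w k = Ue (hs z) (fs z k) (D0 t z w k) (Dl t z w k)"
definition GP where "GP t z w k = Pe (hs z) (fs z k) (D0 t z w k) (Dl t z w k)"
definition GX where "GX t z w k = Ux (hs z) (fs z k) (D0 t z w k) (Dl t z w k)"

lemma fs_NSW: "fs z k x = f_NSW g h0 b z k x"
  unfolding fs_def f_NSW_def Let_def hs_def power2_eq_square by simp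

lemma ends: "0 \<in> {0..l}" "l \<in> {0..l}" using l_pos by auto

text \<open>Proved once for an arbitrary closed class, then used for Lipschitz dependence
  (\<open>LB\<close>), smoothness in time (\<open>SC n\<close>) and regularity in space
  (\<open>RS m\<close>). The reciprocal of the depth and the boundary rates are left as hypotheses,
  since they need lower bounds and compositions that each class treats in its own way.\<close>

lemma C_field:
  assumes "opclass l h0 b C" and z: "C z" and w: "C w" and k: "C k" and ih: "C (\<lambda>i x. 1 / hs (z i) x)"
    and d: "C (\<lambda>i x. D0 (\<tau> i) (z i) (w i) (k i))" "C (\<lambda>i x. Dl (\<tau> i) (z i) (w i) (k i))"
  shows "C (\<lambda>i. hs (z i))" "C (\<lambda>i. fs (z i) (k i))" "C (\<lambda>i. GU (\<tau> i) (z i) (w i) (k i))"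
    "C (\<lambda>i. GP (\<tau> i) (z i) (w i) (k i))" "C (\<lambda>i. GX (\<tau> i) (z i) (w i) (k i))"
    "C (\<lambda>i. F2 (hs (z i)) (fs (z i) (k i)))" "C (\<lambda>i. F1 (fs (z i) (k i)))"
proof -
  interpret c: elliptic_opclass l h0 g b \<phi>1 \<pi>1 \<phi>2 \<pi>2 N0 Nl C
    using assms(1) elliptic_axioms unfolding elliptic_opclass_def by blast
  show h: "C (\<lambda>i. hs (z i))" unfolding hs_def[abs_def] by (intro c.C_add c.C_diff c.C_const z c.C_static St_b)
  show f: "C (\<lambda>i. fs (z i) (k i))" unfolding fs_def[abs_def]
    by (intro c.C_add c.C_diff c.C_mult c.C_const h ih k)
  show "C (\<lambda>i. GU (\<tau> i) (z i) (w i) (k i))" "C (\<lambda>i. GP (\<tau> i) (z i) (w i) (k i))" "C (\<lambda>i. GX (\<tau> i) (z i) (w i) (k i))"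
    "C (\<lambda>i. F2 (hs (z i)) (fs (z i) (k i)))" "C (\<lambda>i. F1 (fs (z i) (k i)))"
    unfolding GU_def GP_def GX_def by (rule c.C_elliptic[OF h f d])+
qed

lemma LB_field:
  assumes "lipschitz_class l h0 b rel"
    and rel_t: "\<And>i j d. rel i j d \<Longrightarrow> \<tau> i = \<tau> j"
    and LB: "lipschitz_class.LB l Gd rel z" "lipschitz_class.LB l Gd rel w" "lipschitz_class.LB l Gd rel k"
    and \<delta>: "0 < \<delta>" "\<And>i x. i \<in> Gd \<Longrightarrow> x \<in> {0..l} \<Longrightarrow> \<delta> \<le> hs (z i) x"
    and K: "compact K0" "K0 \<subseteq> U" "\<And>i. i \<in> Gd \<Longrightarrow> (z i 0, k i 0) \<in> K0"
           "compact Kl" "Kl \<subseteq> U" "\<And>i. i \<in> Gd \<Longrightarrow> (z i l, k i l) \<in> Kl"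
    and T: "\<And>i. i \<in> Gd \<Longrightarrow> \<tau> i \<in> {0..T}"
  shows "lipschitz_class.LB l Gd rel (\<lambda>i. GU (\<tau> i) (z i) (w i) (k i))"
    "lipschitz_class.LB l Gd rel (\<lambda>i. GX (\<tau> i) (z i) (w i) (k i))"
proof -
  interpret L: lipschitz_class l h0 g b Gd rel by fact
  have t: "L.LB (\<lambda>i x. a (\<tau> i))" if "smooth_on a {0..}" for a
  proof -
    have "Ck_on 0 a {0..}" using that unfolding smooth_on_def by blast
    then have "continuous_on {0..T} a" by (auto elim: continuous_on_subset)
    then obtain M where "0 \<le> M" "\<And>t. t \<in> {0..T} \<Longrightarrow> \<bar>a t\<bar> \<le> M" using continuous_on_compact_bound_abs[OF _ compact_Icc] by metis
    then show ?thesis using T rel_t by (intro L.LBI[of 0 M]) fastforce+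
  qed
  have ih: "L.LB (\<lambda>i x. 1 / hs (z i) x)"
  proof (rule L.LB_inverse[OF _ \<delta>])
    show "L.LB (\<lambda>i. hs (z i))" unfolding hs_def[abs_def] by (intro L.C_add L.C_diff L.C_const LB L.C_static St_b)
  qed
  have inv: "L.LB (\<lambda>i x. 1 / F (a i, c i))" if F: "smooth_on F U" "\<And>p. p \<in> U \<Longrightarrow> F p \<noteq> 0"
    and K: "compact K" "K \<subseteq> U" "\<And>i. i \<in> Gd \<Longrightarrow> (a i, c i) \<in> K" and LF: "L.LB (\<lambda>i x. F (a i, c i))" for F K a c
  proof (cases "K = {}")
    case True then show ?thesis using K(3) by (intro L.LBI[of 0 0]) auto
  next
    case False
    have "Ck_on 0 F U" using F(1) unfolding smooth_on_def by blast
    then have "continuous_on K (\<lambda>p. F p * F p)" using continuous_on_subset[OF _ K(2)] by (intro continuous_intros) auto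
    then obtain q where q: "q \<in> K" "\<And>p. p \<in> K \<Longrightarrow> F q * F q \<le> F p * F p"
      using continuous_attains_inf[OF K(1) False] by blast
    have "F q \<noteq> 0" using q(1) K(2) F(2) by blast
    then have "0 < F q * F q" using not_real_square_gt_zero by blast
    \<comment> \<open>F need not have a constant sign on K, while \<open>LB_inverse\<close> asks for
      a positive lower bound. So the reciprocal is taken of the square, which has a positive minimum
      on K, and multiplied by F.\<close>
    then have "L.LB (\<lambda>i x. 1 / (F (a i, c i) * F (a i, c i)))"
      by (rule L.LB_inverse[OF L.C_mult[OF LF LF]]) (use q(2) K(3) in auto)
    then have "L.LB (\<lambda>i x. F (a i, c i) * (1 / (F (a i, c i) * F (a i, c i))))" by (rule L.C_mult[OF LF])
    moreover have "x * (1 / (x * x)) = 1 / x" for x :: real by (cases "x = 0") auto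
    ultimately show ?thesis by (simp only:)
  qed
  have comp: "L.LB (\<lambda>i x. F (z i 0, k i 0))" "L.LB (\<lambda>i x. F (z i l, k i l))" if "smooth_on F U" for F
    using L.LB_compose[OF B0.U that K(1,2) L.C_trace[OF LB(1) ends(1)] L.C_trace[OF LB(3) ends(1)]]
      L.LB_compose[OF B0.U that K(4,5) L.C_trace[OF LB(1) ends(2)] L.C_trace[OF LB(3) ends(2)]] K(3,6) by auto
  interpret b0: boundary_opclass l h0 g b L.LB U \<xi>0 \<gamma>0 N0
    using L.opclass_axioms B0.boundary_axioms unfolding boundary_opclass_def by blast
  interpret bl: boundary_opclass l h0 g b L.LB U \<xi>l \<gamma>l Nl
    using L.opclass_axioms Bl.boundary_axioms unfolding boundary_opclass_def by blast
  have d0: "L.LB (\<lambda>i x. D0 (\<tau> i) (z i) (w i) (k i))" unfolding D0_def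
    by (rule b0.C_dval[where z="\<lambda>i. z i 0" and k="\<lambda>i. k i 0" and w="\<lambda>i. w i 0" and \<tau>=\<tau>, OF L.C_trace[OF LB(2) ends(1)] t[OF B0.smooth_parts(4)] t[OF B0.smooth_parts(5)] comp(1)])
       (auto intro: inv[OF _ _ K(1-3)] comp)
  have dl: "L.LB (\<lambda>i x. Dl (\<tau> i) (z i) (w i) (k i))" unfolding Dl_def
    by (rule bl.C_dval[where z="\<lambda>i. z i l" and k="\<lambda>i. k i l" and w="\<lambda>i. w i l" and \<tau>=\<tau>, OF L.C_trace[OF LB(2) ends(2)] t[OF Bl.smooth_parts(4)] t[OF Bl.smooth_parts(5)] comp(2)])
       (auto intro: inv[OF _ _ K(4-6)] comp)
  note c = C_field[OF L.LB_opclass LB ih d0 dl]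
  show "L.LB (\<lambda>i. GU (\<tau> i) (z i) (w i) (k i))" "L.LB (\<lambda>i. GX (\<tau> i) (z i) (w i) (k i))"
    by (rule c(3), rule c(5))
qed

end

section \<open>Solutions of the evolution equation in continuous functions\<close>

locale evolution = problem + rect T l for T
begin

lemma SC_opclass: "opclass l h0 b (SC n)"
proof unfold_locales
  show "SC n (\<lambda>t. a)" if "St a" for a by (rule SC_static[OF St_continuous[OF that]])
qed (auto intro: SC_add SC_mult SC_integral SC_trace)

lemma SC_field:
  assumes S: "SC n z" "SC n w" "SC n k"
    and hs: "\<And>t x. t \<in> {0..T} \<Longrightarrow> x \<in> {0..l} \<Longrightarrow> hs (z t) x \<noteq> 0"
    and tr: "\<And>t. t \<in> {0..T} \<Longrightarrow> (z t 0, k t 0) \<in> U" "\<And>t. t \<in> {0..T} \<Longrightarrow> (z t l, k t l) \<in> U"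
  shows "SC n (\<lambda>t. hs (z t))" "SC n (\<lambda>t. fs (z t) (k t))" "SC n (\<lambda>t. GU t (z t) (w t) (k t))"
    "SC n (\<lambda>t. GP t (z t) (w t) (k t))" "SC n (\<lambda>t. GX t (z t) (w t) (k t))"
    "SC n (\<lambda>t. F2 (hs (z t)) (fs (z t) (k t)))" "SC n (\<lambda>t. F1 (fs (z t) (k t)))"
    "SC n (\<lambda>t x. D0 t (z t) (w t) (k t))" "SC n (\<lambda>t x. Dl t (z t) (w t) (k t))"
proof -
  interpret c: opclass l h0 g b "SC n" by (rule SC_opclass)
  have ih: "SC n (\<lambda>t x. 1 / hs (z t) x)"
    by (rule SC_inverse[OF _ hs]) (unfold hs_def[abs_def], intro c.C_add c.C_diff c.C_const S c.C_static St_b)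
  have t: "SC n (\<lambda>t x. a t)" if "smooth_on a {0..}" for a
    using SC_compose_time[of n a "{0..}"] that unfolding smooth_on_def by auto
  have comp: "SC n (\<lambda>t x. F (z t 0, k t 0))" "SC n (\<lambda>t x. F (z t l, k t l))" if "smooth_on F U" for F
    by (rule SC_compose2[where U=U and F=F, OF _ SC_trace[OF S(1) ends(1)] SC_trace[OF S(3) ends(1)]],
        use that[unfolded smooth_on_def] tr in auto)
      (rule SC_compose2[where U=U and F=F, OF _ SC_trace[OF S(1) ends(2)] SC_trace[OF S(3) ends(2)]],
        use that[unfolded smooth_on_def] tr in auto)
  have inv: "SC n (\<lambda>t x. 1 / F (z t 0, k t 0))" "SC n (\<lambda>t x. 1 / F (z t l, k t l))" if "smooth_on F U" "\<And>p. p \<in> U \<Longrightarrow> F p \<noteq> 0" for F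
    using SC_inverse[OF comp(1)[OF that(1)]] SC_inverse[OF comp(2)[OF that(1)]] that(2) tr by auto
  interpret b0: boundary_opclass l h0 g b "SC n" U \<xi>0 \<gamma>0 N0
    using c.opclass_axioms B0.boundary_axioms unfolding boundary_opclass_def by blast
  interpret bl: boundary_opclass l h0 g b "SC n" U \<xi>l \<gamma>l Nl
    using c.opclass_axioms Bl.boundary_axioms unfolding boundary_opclass_def by blast
  show d0: "SC n (\<lambda>t x. D0 t (z t) (w t) (k t))" unfolding D0_def
    by (rule b0.C_dval[where z="\<lambda>t. z t 0" and k="\<lambda>t. k t 0" and w="\<lambda>t. w t 0" and \<tau>="\<lambda>t. t", OF SC_trace[OF S(2) ends(1)] t[OF B0.smooth_parts(4)] t[OF B0.smooth_parts(5)] comp(1) inv(1)]) auto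
  show dl: "SC n (\<lambda>t x. Dl t (z t) (w t) (k t))" unfolding Dl_def
    by (rule bl.C_dval[where z="\<lambda>t. z t l" and k="\<lambda>t. k t l" and w="\<lambda>t. w t l" and \<tau>="\<lambda>t. t", OF SC_trace[OF S(2) ends(2)] t[OF Bl.smooth_parts(4)] t[OF Bl.smooth_parts(5)] comp(2) inv(2)]) auto
  note c = C_field[OF SC_opclass S ih d0 dl]
  show "SC n (\<lambda>t. hs (z t))" "SC n (\<lambda>t. fs (z t) (k t))" "SC n (\<lambda>t. GU t (z t) (w t) (k t))"
    "SC n (\<lambda>t. GP t (z t) (w t) (k t))" "SC n (\<lambda>t. GX t (z t) (w t) (k t))"
    "SC n (\<lambda>t. F2 (hs (z t)) (fs (z t) (k t)))" "SC n (\<lambda>t. F1 (fs (z t) (k t)))"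
    by (rule c)+
qed

text \<open>The initial boundary value problem for \<open>(\<zeta>, w, q)\<close> with \<open>w = \<partial>\<^sub>x q\<close>: an ordinary differential
  equation, pointwise in \<open>x\<close> up to the nonlocal quantities \<open>GU\<close> and \<open>GX = \<partial>\<^sub>x GU\<close>.\<close>

definition base_solution where
  "base_solution z w k \<longleftrightarrow> jcont z \<and> jcont w \<and> jcont k \<and> tderiv z (\<lambda>t x. - w t x) \<and>
     tderiv w (\<lambda>t. GX t (z t) (w t) (k t)) \<and> tderiv k (\<lambda>t. GU t (z t) (w t) (k t)) \<and>
     (\<forall>t\<in>{0..T}. \<forall>x\<in>{0..l}. 0 < hs (z t) x) \<and>
     (\<forall>t\<in>{0..T}. (z t 0, k t 0) \<in> U \<and> (z t l, k t l) \<in> U)"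

lemma base_solutionD:
  assumes b: "base_solution z w k"
  shows "SC 0 z" "SC 0 w" "SC 0 k" "t \<in> {0..T} \<Longrightarrow> x \<in> {0..l} \<Longrightarrow> hs (z t) x \<noteq> 0"
    "t \<in> {0..T} \<Longrightarrow> (z t 0, k t 0) \<in> U" "t \<in> {0..T} \<Longrightarrow> (z t l, k t l) \<in> U"
  using b unfolding base_solution_def by force+

lemma base_solution_lower:
  assumes b: "base_solution z w k"
  obtains \<delta> where "0 < \<delta>" "\<And>t x. t \<in> {0..T} \<Longrightarrow> x \<in> {0..l} \<Longrightarrow> \<delta> \<le> hs (z t) x"
proof -
  have "continuous_on ({0..T} \<times> {0..l}) (\<lambda>p. hs (z (fst p)) (snd p))"
    using SC_field(1)[OF base_solutionD[OF b]] unfolding SC.simps jcont_def case_prod_unfold .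
  moreover have "compact ({0..T} \<times> {0..l})" by (intro compact_Times compact_Icc)
  moreover have "{0..T} \<times> {0..l} \<noteq> {}" using T_pos l_pos by auto
  ultimately obtain p where p: "p \<in> {0..T} \<times> {0..l}" "\<forall>q\<in>{0..T} \<times> {0..l}. hs (z (fst p)) (snd p) \<le> hs (z (fst q)) (snd q)"
    using continuous_attains_inf by blast
  show ?thesis
  proof (rule that)
    show "0 < hs (z (fst p)) (snd p)" using p(1) b unfolding base_solution_def by auto
    show "hs (z (fst p)) (snd p) \<le> hs (z t) x" if "t \<in> {0..T}" "x \<in> {0..l}" for t x using p(2) that by force
  qed
qed

text \<open>The right-hand side is as regular in time as the state, and the state has one time
  derivative more, so the order climbs by induction.\<close>

lemma base_solution_S:
  assumes b: "base_solution z w k"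
  shows "S z" "S w" "S k"
proof -
  have "SC n z \<and> SC n w \<and> SC n k" for n
  proof (induction n)
    case 0 then show ?case using b unfolding base_solution_def by simp
  next
    case (Suc n)
    note f = SC_field[OF conjunct1[OF Suc] conjunct1[OF conjunct2[OF Suc]] conjunct2[OF conjunct2[OF Suc]] base_solutionD(4-6)[OF b]]
    have "SC n (\<lambda>t x. - w t x)" using SC_mult[OF SC_const[of n "-1"], of w] Suc by simp
    then show ?case using b f(3,5) SC_SucI unfolding base_solution_def by blast
  qed
  then show "S z" "S w" "S k" unfolding S_def by auto
qed

lemma base_solution_slices:
  assumes b: "base_solution z w k" and t: "t \<in> {0..T}"
  shows "continuous_on {0..l} (hs (z t))" "continuous_on {0..l} (fs (z t) (k t))"
    "continuous_on {0..l} (w t)"  "continuous_on {0..l} (GX t (z t) (w t) (k t))"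
proof -
  note f = SC_field[OF base_solutionD[OF b]]
  show "continuous_on {0..l} (hs (z t))" "continuous_on {0..l} (fs (z t) (k t))" "continuous_on {0..l} (w t)"
    "continuous_on {0..l} (GX t (z t) (w t) (k t))"
    using f(1,2,5) base_solutionD(2)[OF b] jcont_slice[OF _ t] by simp_all
qed

text \<open>\<open>GX\<close> is the x-derivative of \<open>GU\<close>, so the difference between k
  and the primitive of w has zero time derivative and keeps its initial value.\<close>

lemma base_solution_primitive:
  assumes b: "base_solution z w k" and i: "primitive l (k 0) (w 0)" and t: "t \<in> {0..T}"
  shows "primitive l (k t) (w t)"
proof (rule primitiveI)
  have jw: "jcont w" using b unfolding base_solution_def by blast
  show "w t absolutely_integrable_on {0..l}" by (rule continuous_absolutely_integrable[OF jcont_slice[OF jw t]])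
  fix x assume x: "x \<in> {0..l}"
  have dw: "tderiv w (\<lambda>t. GX t (z t) (w t) (k t))" and dk: "tderiv k (\<lambda>t. GU t (z t) (w t) (k t))"
    using b unfolding base_solution_def by auto
  have jX: "jcont (\<lambda>t. GX t (z t) (w t) (k t))" using SC_field(5)[OF base_solutionD[OF b]] by simp
  have "tderiv (\<lambda>t x. integral {0..x} (\<lambda>y. w t y * 1)) (\<lambda>t x. integral {0..x} (\<lambda>y. GX t (z t) (w t) (k t) y * 1))"
    by (rule tderiv_weighted_integral[OF dw jw jX]) (rule continuous_absolutely_integrable, simp)
  then have dI: "tderiv (\<lambda>t x. integral {0..x} (w t)) (\<lambda>t x. integral {0..x} (GX t (z t) (w t) (k t)))" by simp
  have zero: "GU s (z s) (w s) (k s) x - (GU s (z s) (w s) (k s) 0 + integral {0..x} (GX s (z s) (w s) (k s))) = 0" if s: "s \<in> {0..T}" for s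
  proof -
    have "primitive l (GU s (z s) (w s) (k s)) (GX s (z s) (w s) (k s))"
      using Ue_deriv(1)[OF base_solution_slices(1,2)[OF b s]] base_solution_slices(4)[OF b s]
      unfolding GU_def GX_def by (rule primitive_C1)
    from primitive_eq[OF this x] show ?thesis by simp
  qed
  have "((\<lambda>s. k s x - (k s 0 + integral {0..x} (w s))) has_real_derivative 0) (at s within {0..T})" if s: "s \<in> {0..T}" for s
  proof -
    have "((\<lambda>s. k s x - (k s 0 + integral {0..x} (w s))) has_real_derivative
        GU s (z s) (w s) (k s) x - (GU s (z s) (w s) (k s) 0 + integral {0..x} (GX s (z s) (w s) (k s)))) (at s within {0..T})"
      using dk dI s x ends unfolding tderiv_def by (intro DERIV_diff DERIV_add) auto
    then show ?thesis unfolding zero[OF s] .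
  qed
  from constant_if_zero_derivative[OF this t]
  have "k t x - (k t 0 + integral {0..x} (w t)) = k 0 x - (k 0 0 + integral {0..x} (w 0))" .
  then show "k t x = k t 0 + integral {0..x} (w t)" using primitive_eq[OF i x] by simp
qed

end

section \<open>Local existence by truncation\<close>

context problem
begin

text \<open>The projection onto a ball, applied to the displacement from the initial state. It makes
  the right-hand side globally Lipschitz while the depth stays bounded below and the boundary values
  stay in compact subsets of U; being 1-Lipschitz, it does not spoil the estimates.\<close>

definition pr where "pr r v = closest_point (cball 0 r) v" for r :: real and v :: "real \<times> real \<times> real"

lemma pr_props:
  assumes "0 < r"
  shows "norm (pr r v) \<le> r" "norm (pr r v - pr r v') \<le> norm (v - v')" "norm v \<le> r \<Longrightarrow> pr r v = v" "continuous_on A (pr r)"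
proof -
  have ne: "cball (0::real\<times>real\<times>real) r \<noteq> {}" using assms by auto
  have "pr r v \<in> cball 0 r" unfolding pr_def by (rule closest_point_in_set[OF closed_cball ne])
  then show "norm (pr r v) \<le> r" by simp
  show "norm (pr r v - pr r v') \<le> norm (v - v')"
    using closest_point_lipschitz[OF convex_cball closed_cball ne, of v v'] unfolding pr_def dist_norm .
  show "pr r v = v" if "norm v \<le> r" using that unfolding pr_def by (intro closest_point_self) simp
  show "continuous_on A (pr r)" unfolding pr_def by (rule continuous_on_closest_point[OF convex_cball closed_cball ne])
qed

lemma norm3: "\<bar>fst v\<bar> \<le> norm v" "\<bar>fst (snd v)\<bar> \<le> norm v" "\<bar>snd (snd v)\<bar> \<le> norm v"
  "norm (fst v, snd (snd v)) \<le> norm v" "norm v \<le> \<bar>fst v\<bar> + \<bar>fst (snd v)\<bar> + \<bar>snd (snd v)\<bar>"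
  for v :: "real \<times> real \<times> real"
proof -
  obtain a c d where v: "v = (a, c, d)" by (cases v) auto
  have n: "norm v = sqrt (a\<^sup>2 + c\<^sup>2 + d\<^sup>2)" unfolding v norm_Pair by simp
  show "\<bar>fst v\<bar> \<le> norm v" "\<bar>fst (snd v)\<bar> \<le> norm v" "\<bar>snd (snd v)\<bar> \<le> norm v"
    unfolding n by (auto simp: v intro!: real_le_rsqrt)
  show "norm (fst v, snd (snd v)) \<le> norm v" unfolding n by (simp add: v norm_Pair)
  have "norm (a, c, d) \<le> norm a + norm (c, d)" using norm_Pair_le[of a "(c, d)"] .
  also have "norm (c, d) \<le> norm c + norm d" by (rule norm_Pair_le)
  finally show "norm v \<le> \<bar>fst v\<bar> + \<bar>fst (snd v)\<bar> + \<bar>snd (snd v)\<bar>" by (simp add: v)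
qed

text \<open>The equation with the right-hand side evaluated at the truncated state is solved on
  [0,1] by \<open>volterra\<close>. For a short time the truncation is inactive, and the solution is
  one of the original equation.\<close>

lemma base_local:
  assumes in_cont: "continuous_on {0..l} zin" "continuous_on {0..l} win" "continuous_on {0..l} kin"
    and \<delta>0: "0 < \<delta>0" "\<And>x. x \<in> {0..l} \<Longrightarrow> \<delta>0 \<le> hs zin x"
    and tr: "(zin 0, kin 0) \<in> U" "(zin l, kin l) \<in> U"
  obtains T z w k where "0 < T" "evolution.base_solution l h0 g b \<phi>1 \<pi>1 \<phi>2 \<pi>2 N0 Nl U \<xi>0 \<gamma>0 \<xi>l \<gamma>l T z w k"
    "\<And>x. x \<in> {0..l} \<Longrightarrow> z 0 x = zin x \<and> w 0 x = win x \<and> k 0 x = kin x"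
proof -
  define Y0 where "Y0 x = (zin x, win x, kin x)" for x
  have Y0c: "continuous_on {0..l} Y0" unfolding Y0_def by (intro continuous_intros in_cont)
  obtain e0 where e0: "0 < e0" "cball (zin 0, kin 0) e0 \<subseteq> U" using B0.U tr(1) open_contains_cball by blast
  obtain el where el: "0 < el" "cball (zin l, kin l) el \<subseteq> U" using B0.U tr(2) open_contains_cball by blast
  \<comment> \<open>Within distance \<delta>0 / 2 the depth stays above \<delta>0 / 2; within e0 and
    el the boundary values stay in closed balls contained in U.\<close>
  define r where "r = min (\<delta>0 / 2) (min e0 el)"
  have r: "0 < r" "r \<le> \<delta>0 / 2" "r \<le> e0" "r \<le> el" unfolding r_def using \<delta>0 e0 el by auto
  interpret E: evolution l h0 g b \<phi>1 \<pi>1 \<phi>2 \<pi>2 N0 Nl U \<xi>0 \<gamma>0 \<xi>l \<gamma>l 1 by unfold_locales (simp add: l_pos)+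
  define cY where "cY Y x = Y0 x + pr r (Y x - Y0 x)" for Y x
  define cz where "cz Y x = fst (cY Y x)" for Y x
  define cw where "cw Y x = fst (snd (cY Y x))" for Y x
  define ck where "ck Y x = snd (snd (cY Y x))" for Y x
  have near: "norm (cY Y x - Y0 x) \<le> r" for Y x unfolding cY_def using pr_props(1)[OF r(1)] by simp
  have hsc: "\<delta>0 / 2 \<le> hs (cz Y) x" if "x \<in> {0..l}" for Y x
  proof -
    have "\<bar>cz Y x - zin x\<bar> \<le> r" using norm3(1)[of "cY Y x - Y0 x"] near[of Y x] unfolding cz_def Y0_def by simp
    then show ?thesis using \<delta>0(2)[OF that] r(2) unfolding hs_def by linarith
  qed
  have trc: "(cz Y 0, ck Y 0) \<in> cball (zin 0, kin 0) e0" "(cz Y l, ck Y l) \<in> cball (zin l, kin l) el" for Y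
  proof -
    have "dist (zin x, kin x) (cz Y x, ck Y x) \<le> r" for x
    proof -
      have "dist (zin x, kin x) (cz Y x, ck Y x) = norm ((cz Y x, ck Y x) - (zin x, kin x))" unfolding dist_norm by (rule norm_minus_commute)
      then show ?thesis using norm3(4)[of "cY Y x - Y0 x"] near[of Y x] unfolding cz_def ck_def Y0_def by simp
    qed
    then show "(cz Y 0, ck Y 0) \<in> cball (zin 0, kin 0) e0" "(cz Y l, ck Y l) \<in> cball (zin l, kin l) el"
      using r(3,4) unfolding mem_cball by (meson order_trans)+
  qed
  have trU: "(cz Y 0, ck Y 0) \<in> U" "(cz Y l, ck Y l) \<in> U" for Y using trc e0 el by blast+
  have cYc: "continuous_on {0..l} (cY Y)" if "continuous_on {0..l} Y" for Y
    unfolding cY_def by (intro continuous_intros Y0c continuous_on_compose2[OF pr_props(4)[OF r(1), of UNIV]] that) auto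
  define G where "G t Y x = (- cw Y x, GX t (cz Y) (cw Y) (ck Y) x, GU t (cz Y) (cw Y) (ck Y) x)" for t Y x
  have "\<exists>L. 0 < L \<and> (\<forall>t (Y::real \<Rightarrow> real \<times> real \<times> real) Z d x. t \<in> {0..1} \<longrightarrow> continuous_on {0..l} Y \<longrightarrow> continuous_on {0..l} Z \<longrightarrow>
       (\<forall>y\<in>{0..l}. norm (Y y - Z y) \<le> d) \<longrightarrow> x \<in> {0..l} \<longrightarrow> norm (G t Y x - G t Z x) \<le> L * d)"
  proof -
    \<comment> \<open>A state of the Lipschitz class is a time together with a profile, and
      \<open>rel\<close> compares profiles at equal times: no Lipschitz dependence on t is
      claimed.\<close>
    define Gd :: "(real \<times> (real \<Rightarrow> real \<times> real \<times> real)) set" where "Gd = {0..1} \<times> {Y. continuous_on {0..l} Y}"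
    define rel where "rel i j d \<longleftrightarrow> fst i = fst j \<and> (\<forall>y\<in>{0..l}. norm (snd i y - snd j y) \<le> d)"
      for i j :: "real \<times> (real \<Rightarrow> real \<times> real \<times> real)" and d
    have relnn: "0 \<le> d" if "rel i j d" for i j d using that ends(1) norm_ge_zero order_trans unfolding rel_def by blast
    interpret L: lipschitz_class l h0 g b Gd rel by unfold_locales (rule relnn)
    obtain M where M: "0 \<le> M" "\<And>x. x \<in> {0..l} \<Longrightarrow> norm (Y0 x) \<le> M"
      using continuous_on_compact_bound_abs[of "{0..l}" "\<lambda>x. norm (Y0 x)"] Y0c by (auto intro: continuous_intros)
    have bnd: "norm (cY Y x) \<le> M + r" if "x \<in> {0..l}" for Y x
      using norm_triangle_ineq[of "Y0 x" "pr r (Y x - Y0 x)"] M(2)[OF that] pr_props(1)[OF r(1), of "Y x - Y0 x"] unfolding cY_def by linarith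
    have lip: "norm (cY (snd i) x - cY (snd j) x) \<le> 1 * d" if "rel i j d" "x \<in> {0..l}" for i j d x
    proof -
      have "norm (cY (snd i) x - cY (snd j) x) \<le> norm (snd i x - snd j x)"
        unfolding cY_def using pr_props(2)[OF r(1), of "snd i x - Y0 x" "snd j x - Y0 x"] by simp
      also have "\<dots> \<le> d" using that unfolding rel_def by blast
      finally show ?thesis by simp
    qed
    have Mr: "0 \<le> M + r" using M r by simp
    have cyc: "continuous_on {0..l} (cY (snd i))" if "i \<in> Gd" for i using that cYc unfolding Gd_def by auto
    have LBz: "L.LB (\<lambda>i. cz (snd i))"
      by (rule L.LBI[OF zero_le_one Mr])
         (use norm3(1) bnd lip cyc in \<open>auto simp: cz_def intro!: continuous_intros order_trans[OF norm3(1)] order_trans[OF norm3(1)[of "_ - _", simplified]]\<close>)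
    have LBw: "L.LB (\<lambda>i. cw (snd i))"
      by (rule L.LBI[OF zero_le_one Mr])
         (use norm3(2) bnd lip cyc in \<open>auto simp: cw_def intro!: continuous_intros order_trans[OF norm3(2)] order_trans[OF norm3(2)[of "_ - _", simplified]]\<close>)
    have LBk: "L.LB (\<lambda>i. ck (snd i))"
      by (rule L.LBI[OF zero_le_one Mr])
         (use norm3(3) bnd lip cyc in \<open>auto simp: ck_def intro!: continuous_intros order_trans[OF norm3(3)] order_trans[OF norm3(3)[of "_ - _", simplified]]\<close>)
    have \<delta>2: "0 < \<delta>0 / 2" using \<delta>0 by simp
    have F: "L.LB (\<lambda>i. GU (fst i) (cz (snd i)) (cw (snd i)) (ck (snd i)))" "L.LB (\<lambda>i. GX (fst i) (cz (snd i)) (cw (snd i)) (ck (snd i)))"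
      using LB_field[OF L.lipschitz_class_axioms, where \<tau>=fst and z="\<lambda>i. cz (snd i)" and Gd=Gd and w="\<lambda>i. cw (snd i)" and k="\<lambda>i. ck (snd i)"
        and \<delta>="\<delta>0/2" and ?K0.0="cball (zin 0, kin 0) e0" and Kl="cball (zin l, kin l) el" and T=1] LBz LBw LBk \<delta>2 hsc trc e0(2) el(2)
      by (auto simp: rel_def Gd_def)
    obtain L1 where L1: "0 \<le> L1" "\<And>i j d x. i \<in> Gd \<Longrightarrow> j \<in> Gd \<Longrightarrow> rel i j d \<Longrightarrow> x \<in> {0..l} \<Longrightarrow>
        \<bar>GU (fst i) (cz (snd i)) (cw (snd i)) (ck (snd i)) x - GU (fst j) (cz (snd j)) (cw (snd j)) (ck (snd j)) x\<bar> \<le> L1 * d"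
      by (rule L.LBE[OF F(1)]) blast
    obtain L2 where L2: "0 \<le> L2" "\<And>i j d x. i \<in> Gd \<Longrightarrow> j \<in> Gd \<Longrightarrow> rel i j d \<Longrightarrow> x \<in> {0..l} \<Longrightarrow>
        \<bar>GX (fst i) (cz (snd i)) (cw (snd i)) (ck (snd i)) x - GX (fst j) (cz (snd j)) (cw (snd j)) (ck (snd j)) x\<bar> \<le> L2 * d"
      by (rule L.LBE[OF F(2)]) blast
    show ?thesis
    proof (intro exI[of _ "1 + L2 + L1"] conjI allI impI)
      show "0 < 1 + L2 + L1" using L1 L2 by simp
      fix t d x :: real and Y Z :: "real \<Rightarrow> real \<times> real \<times> real" assume a: "t \<in> {0..1}" "continuous_on {0..l} Y" "continuous_on {0..l} Z" "\<forall>y\<in>{0..l}. norm (Y y - Z y) \<le> d" "x \<in> {0..l}"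
      have i: "(t, Y) \<in> Gd" "(t, Z) \<in> Gd" "rel (t, Y) (t, Z) d" using a unfolding Gd_def rel_def by auto
      have "\<bar>cw Y x - cw Z x\<bar> \<le> d" using norm3(2)[of "cY Y x - cY Z x"] lip[OF i(3) a(5)] unfolding cw_def by simp
      then show "norm (G t Y x - G t Z x) \<le> (1 + L2 + L1) * d"
        using L1(2)[OF i a(5)] L2(2)[OF i a(5)] norm3(5)[of "G t Y x - G t Z x"] unfolding G_def by (simp add: algebra_simps abs_minus_commute)
    qed
  qed
  then obtain L where L: "0 < L" "\<And>t Y Z d x. t \<in> {0..1} \<Longrightarrow> continuous_on {0..l} Y \<Longrightarrow> continuous_on {0..l} Z \<Longrightarrow>
       (\<And>y. y\<in>{0..l} \<Longrightarrow> norm (Y y - Z y) \<le> d) \<Longrightarrow> x \<in> {0..l} \<Longrightarrow> norm (G t Y x - G t Z x) \<le> L * d" by blast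
  have Gc: "continuous_on E.D (\<lambda>p. G (fst p) (Y (fst p)) (snd p))" if Y: "continuous_on E.D (\<lambda>p. Y (fst p) (snd p))" for Y
  proof -
    have "continuous_on E.D (\<lambda>p. Y0 (snd p))" by (rule continuous_on_compose2[OF Y0c]) (auto intro!: continuous_intros)
    then have c: "continuous_on E.D (\<lambda>p. cY (Y (fst p)) (snd p))"
      unfolding cY_def by (intro continuous_intros continuous_on_compose2[OF pr_props(4)[OF r(1), of UNIV]] Y) auto
    have j: "E.SC 0 (\<lambda>t. cz (Y t))" "E.SC 0 (\<lambda>t. cw (Y t))" "E.SC 0 (\<lambda>t. ck (Y t))"
      unfolding E.SC.simps E.jcont_def case_prod_unfold cz_def cw_def ck_def by (intro continuous_intros c)+
    have nz: "hs (cz (Y t)) x \<noteq> 0" if "t \<in> {0..1}" "x \<in> {0..l}" for t x using hsc[OF that(2), of "Y t"] \<delta>0(1) by auto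
    note f = E.SC_field[OF j nz trU]
    show ?thesis using f(3,5) j(2) unfolding G_def E.SC.simps E.jcont_def case_prod_unfold by (intro continuous_intros)
  qed
  obtain Y where Y: "continuous_on E.D (\<lambda>p. Y (fst p) (snd p))" "\<And>x. x\<in>{0..l} \<Longrightarrow> Y 0 x = Y0 x"
     "\<And>t x. t\<in>{0..1} \<Longrightarrow> x\<in>{0..l} \<Longrightarrow> ((\<lambda>t. Y t x) has_vector_derivative G t (Y t) x) (at t within {0..1})"
  proof -
    have "\<exists>Y. continuous_on E.D (\<lambda>p. Y (fst p) (snd p)) \<and> (\<forall>x\<in>{0..l}. Y 0 x = Y0 x) \<and>
       (\<forall>t\<in>{0..1}. \<forall>x\<in>{0..l}. ((\<lambda>t. Y t x) has_vector_derivative G t (Y t) x) (at t within {0..1}))"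
      by (rule E.volterra[where G=G and L=L, OF _ _ L(1) Y0c]) (rule Gc, assumption, rule L(2))
    then show ?thesis using that by blast
  qed
  have "uniformly_continuous_on E.D (\<lambda>p. Y (fst p) (snd p))"
    by (rule compact_uniformly_continuous[OF Y(1)]) (intro compact_Times compact_Icc)
  then obtain d where d: "0 < d" "\<And>p q. p \<in> E.D \<Longrightarrow> q \<in> E.D \<Longrightarrow> dist q p < d \<Longrightarrow> dist (Y (fst q) (snd q)) (Y (fst p) (snd p)) < r"
    unfolding uniformly_continuous_on_def using r(1) by blast
  \<comment> \<open>By uniform continuity the solution moves by less than r during [0,T], so the
    projection acts as the identity there.\<close>
  define T where "T = min 1 (d / 2)"
  have T: "0 < T" "T \<le> 1" "T < d" unfolding T_def using d by auto
  have Yr: "norm (Y t x - Y0 x) \<le> r" if "t \<in> {0..T}" "x \<in> {0..l}" for t x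
    using d(2)[of "(0, x)" "(t, x)"] that T Y(2) by (simp add: dist_norm norm_Pair)
  have cYY: "cY (Y t) x = Y t x" if "t \<in> {0..T}" "x \<in> {0..l}" for t x
    unfolding cY_def using pr_props(3)[OF r(1) Yr[OF that]] by simp
  interpret E': evolution l h0 g b \<phi>1 \<pi>1 \<phi>2 \<pi>2 N0 Nl U \<xi>0 \<gamma>0 \<xi>l \<gamma>l T by unfold_locales (simp_all add: l_pos T)
  let ?z = "\<lambda>t. cz (Y t)" and ?w = "\<lambda>t. cw (Y t)" and ?k = "\<lambda>t. ck (Y t)"
  have der: "((\<lambda>t. cY (Y t) x) has_vector_derivative G t (Y t) x) (at t within {0..T})" if t: "t \<in> {0..T}" and x: "x \<in> {0..l}" for t x
  proof -
    have "((\<lambda>t. Y t x) has_vector_derivative G t (Y t) x) (at t within {0..T})"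
      by (rule has_vector_derivative_within_subset[OF Y(3)]) (use t x T in auto)
    then show ?thesis by (rule has_vector_derivative_transform[OF t, rotated]) (use cYY x in auto)
  qed
  have c: "continuous_on E'.D (\<lambda>p. cY (Y (fst p)) (snd p))"
  proof -
    have "continuous_on E'.D (\<lambda>p. Y (fst p) (snd p))" by (rule continuous_on_subset[OF Y(1)]) (use T in auto)
    moreover have "cY (Y (fst p)) (snd p) = Y (fst p) (snd p)" if "p \<in> E'.D" for p using cYY that by auto
    ultimately show ?thesis by (simp cong: continuous_on_cong)
  qed
  have "E'.base_solution ?z ?w ?k" unfolding E'.base_solution_def
  proof (intro conjI ballI)
    show "E'.jcont ?z" "E'.jcont ?w" "E'.jcont ?k"
      unfolding E'.jcont_def case_prod_unfold cz_def cw_def ck_def by (intro continuous_intros c)+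
    show "E'.tderiv ?z (\<lambda>t x. - ?w t x)"
      unfolding E'.tderiv_def has_real_derivative_iff_has_vector_derivative cz_def
      using bounded_linear.has_vector_derivative[OF bounded_linear_fst der] unfolding G_def by simp
    show "E'.tderiv ?w (\<lambda>t. GX t (?z t) (?w t) (?k t))"
      unfolding E'.tderiv_def has_real_derivative_iff_has_vector_derivative cw_def[of _ , abs_def]
      using bounded_linear.has_vector_derivative[OF bounded_linear_fst bounded_linear.has_vector_derivative[OF bounded_linear_snd der]] unfolding G_def cw_def[abs_def] by simp
    show "E'.tderiv ?k (\<lambda>t. GU t (?z t) (?w t) (?k t))"
      unfolding E'.tderiv_def has_real_derivative_iff_has_vector_derivative ck_def[of _, abs_def]
      using bounded_linear.has_vector_derivative[OF bounded_linear_snd bounded_linear.has_vector_derivative[OF bounded_linear_snd der]] unfolding G_def ck_def[abs_def] by simp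
    show "0 < hs (?z t) x" if "x \<in> {0..l}" for t x using hsc[OF that, of "Y t"] \<delta>0(1) by simp
  qed (use trU in auto)
  moreover have "?z 0 x = zin x \<and> ?w 0 x = win x \<and> ?k 0 x = kin x" if "x \<in> {0..l}" for x
    using cYY[of 0 x] Y(2)[OF that] that T unfolding cz_def cw_def ck_def Y0_def by simp
  ultimately show ?thesis using that T(1) by blast
qed

end

section \<open>Propagation of the spatial regularity of the data\<close>

context lipschitz_class
begin

lemma LB_max:
  assumes u: "LB u"
  shows "LB (\<lambda>i x. max (u i x) k)"
proof -
  obtain L M where c: "0 \<le> L" "0 \<le> M" "\<And>i. i \<in> Gd \<Longrightarrow> continuous_on {0..l} (u i)"
    "\<And>i x. i \<in> Gd \<Longrightarrow> x \<in> {0..l} \<Longrightarrow> \<bar>u i x\<bar> \<le> M"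
    "\<And>i j d x. i \<in> Gd \<Longrightarrow> j \<in> Gd \<Longrightarrow> rel i j d \<Longrightarrow> x \<in> {0..l} \<Longrightarrow> \<bar>u i x - u j x\<bar> \<le> L * d"
    by (rule LBE[OF u]) blast
  show ?thesis
  proof (rule LBI[OF c(1), of "M + \<bar>k\<bar>"])
    show "continuous_on {0..l} (\<lambda>x. max (u i x) k)" if "i \<in> Gd" for i using c(3)[OF that] by (intro continuous_intros)
    show "\<bar>max (u i x) k\<bar> \<le> M + \<bar>k\<bar>" if "i \<in> Gd" "x \<in> {0..l}" for i x using c(4)[OF that] c(2) by linarith
    show "\<bar>max (u i x) k - max (u j x) k\<bar> \<le> L * d" if "i \<in> Gd" "j \<in> Gd" "rel i j d" "x \<in> {0..l}" for i j d x
      using c(5)[OF that] by linarith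
  qed (use c(2) in simp)
qed

end

text \<open>Expresses the extended reciprocal by sums, products, maxima and reciprocals of functions
  bounded below, operations under which the class \<open>LB\<close> is closed.\<close>

lemma ext_inverse_max:
  assumes "0 < d"
  shows "ext_inverse d z = 1 / max z d - (z - max z d) * (1 / max z d * (1 / max z d))"
  unfolding ext_inverse_def using assms by (auto simp: max_def field_simps power2_eq_square)

locale evolution_rho = evolution + rect_rho T l r1 r2 for r1 r2
begin

lemma RS_static: "St a \<Longrightarrow> RS m (\<lambda>t. a)"
proof (induction m arbitrary: a)
  case 0 then show ?case unfolding RS_0 by (rule S_intros(2)[OF St_continuous])
next
  case (Suc m)
  obtain a' where a': "St a'" "primitive l a a'" using St_primitive[OF Suc.prems] by blast
  have "R (Suc m) (\<lambda>t. a)"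
    by (rule R_SucI[OF S_intros(2)[OF St_continuous[OF Suc.prems]] conjunct1[OF Suc.IH[OF a'(1), unfolded RS_def]] a'(2)])
  then show ?case unfolding RS_Suc .
qed

lemma RS_opclass: "opclass l h0 b (RS m)"
  by unfold_locales (auto intro: RS_static RS_add RS_mult RS_integral RS_trace)

lemma base_solution_RS_fields:
  assumes b: "base_solution z w k" and RS: "RS m z" "RS m w" "RS m k"
  shows "RS m (\<lambda>t. hs (z t))" "RS m (\<lambda>t x. 1 / hs (z t) x)" "RS m (\<lambda>t. fs (z t) (k t))"
    "RS m (\<lambda>t. GU t (z t) (w t) (k t))" "RS m (\<lambda>t. GP t (z t) (w t) (k t))" "RS m (\<lambda>t. F2 (hs (z t)) (fs (z t) (k t)))"
proof -
  interpret c: opclass l h0 g b "RS m" by (rule RS_opclass)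
  note S = base_solution_S[OF b]
  have "S (\<lambda>t x. D0 t (z t) (w t) (k t))" "S (\<lambda>t x. Dl t (z t) (w t) (k t))"
    using SC_field(8,9)[where z=z and w=w and k=k, OF _ _ _ base_solutionD(4-6)[OF b]] S unfolding S_def by blast+
  then have d: "RS m (\<lambda>t x. D0 t (z t) (w t) (k t))" "RS m (\<lambda>t x. Dl t (z t) (w t) (k t))" by (auto intro: RS_time_only)
  show h: "RS m (\<lambda>t. hs (z t))" unfolding hs_def[abs_def] by (intro c.C_add c.C_diff c.C_const RS c.C_static St_b)
  obtain \<delta> where \<delta>: "0 < \<delta>" "\<And>t x. t \<in> {0..T} \<Longrightarrow> x \<in> {0..l} \<Longrightarrow> \<delta> \<le> hs (z t) x" using base_solution_lower[OF b] by blast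
  show ih: "RS m (\<lambda>t x. 1 / hs (z t) x)" by (rule RS_inverse[OF \<delta> h])
  note f = C_field[OF RS_opclass RS ih d]
  show "RS m (\<lambda>t. fs (z t) (k t))" "RS m (\<lambda>t. GU t (z t) (w t) (k t))" "RS m (\<lambda>t. GP t (z t) (w t) (k t))" "RS m (\<lambda>t. F2 (hs (z t)) (fs (z t) (k t)))"
    by (rule f)+
qed

text \<open>Here k, w and \<open>GP\<close> count as known functions, and \<partial>t w is regarded
  as a function \<open>Phi\<close> of (t, x) and of the value of z at x. \<open>linear_R\<close>
  solves the formally differentiated system for \<open>s1\<close>, \<open>s2\<close>, and
  \<open>persistence\<close> shows that these are densities of z and w. \<open>Phi\<close> uses the
  extended reciprocal, because the chain rule is required for every comparison function with density
  \<open>s1 t\<close>, whose depth need not stay above \<delta>.\<close>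

lemma base_solution_persistence:
  assumes b: "base_solution z w k" and i: "primitive l (k 0) (w 0)"
    and data: "R (Suc m) (\<lambda>t. z 0)" "R (Suc m) (\<lambda>t. w 0)" and RS: "RS m z" "RS m w"
  shows "RS (Suc m) z" "RS (Suc m) w"
proof -
  interpret c: opclass l h0 g b "RS m" by (rule RS_opclass)
  note S = base_solution_S[OF b]
  note kw = base_solution_primitive[OF b i]
  have Rk': "R (Suc m) k" by (rule R_SucI[OF S(3) conjunct1[OF RS(2)[unfolded RS_def]] kw])
  then have RSk: "RS m k" using RS_mono RS_Suc by blast
  note f = base_solution_RS_fields[OF b RS RSk]
  have R: "R m u" "S u" if "RS m u" for u using that unfolding RS_def by auto
  obtain \<delta> where \<delta>: "0 < \<delta>" and lb: "\<And>t x. t \<in> {0..T} \<Longrightarrow> x \<in> {0..l} \<Longrightarrow> \<delta> \<le> hs (z t) x" using base_solution_lower[OF b] by blast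
  have l0: "0 \<le> l" using l_pos by simp
  \<comment> \<open>The nonlocal part of \<open>GX\<close>. It has the density \<open>G'\<close>
    built from \<open>GU\<close>, \<open>GP\<close> and the flux itself, so it brings no
    x-derivative of z.\<close>
  define Gf where "Gf t x = ihb x * GP t (z t) (w t) (k t) x" for t x
  define P' where "P' t x = 3 * cc x * ihb x * GU t (z t) (w t) (k t) x + F2 (hs (z t)) (fs (z t) (k t)) x" for t x
  define G' where "G' t x = b1 x * (ihb x * ihb x) * GP t (z t) (w t) (k t) x + ihb x * P' t x" for t x
  have stat: "RS m (\<lambda>t. ihb)" "RS m (\<lambda>t. b1)" "RS m (\<lambda>t. cc)" by (intro RS_static St_ihb St_b St_cc)+
  have P'RS: "RS m P'" unfolding P'_def by (intro c.C_add c.C_mult c.C_const stat f)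
  have G'RS: "RS m G'" unfolding G'_def by (intro c.C_add c.C_mult c.C_const stat f P'RS)
  have Gp: "primitive l (Gf t) (G' t)" if t: "t \<in> {0..T}" for t
  proof -
    have "continuous_on {0..l} (P' t)" by (rule jcont_slice[OF _ t]) (rule S_jcont[OF R(2)[OF P'RS]])
    then have "primitive l (GP t (z t) (w t) (k t)) (P' t)"
      unfolding P'_def GP_def GU_def by (intro primitive_C1 Ue_deriv(2) base_solution_slices[OF b t])
    from primitive_mult[OF ihb_primitive this l0] show ?thesis unfolding Gf_def[abs_def] G'_def[abs_def] .
  qed
  \<comment> \<open>The flux as a function of the value a of z, with \<open>flz\<close> its
    a-derivative. \<open>Phiz\<close> and \<open>Phix\<close> below are the a-derivative and the
    explicit x-derivative of \<open>Phi\<close>, the latter with w for the x-derivative of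
    k.\<close>
  define fl where "fl t x a = 1/2 * g * ((h0 + a - b x) * (h0 + a - b x) - h0 * h0) + ext_inverse \<delta> (h0 + a - b x) * (k t x * k t x)" for t x a
  define flz where "flz t x a = g * (h0 + a - b x) - 1 / max (h0 + a - b x) \<delta> * (1 / max (h0 + a - b x) \<delta>) * (k t x * k t x)" for t x a
  define Phi where "Phi t x a = 3 * (ihb x * ihb x) * fl t x a + Gf t x" for t x a
  define Phiz where "Phiz t x a = 3 * (ihb x * ihb x) * flz t x a" for t x a
  define Phix where "Phix t x a = 6 * (ihb x * (b1 x * (ihb x * ihb x))) * fl t x a
     + 3 * (ihb x * ihb x) * (2 * (ext_inverse \<delta> (h0 + a - b x) * (k t x * w t x)) - flz t x a * b1 x) + G' t x" for t x a
  have on_sol: "fl t x (z t x) = fs (z t) (k t) x" "ext_inverse \<delta> (h0 + z t x - b x) = 1 / hs (z t) x"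
      "flz t x (z t x) = g * hs (z t) x - 1 / hs (z t) x * (1 / hs (z t) x) * (k t x * k t x)" if "t \<in> {0..T}" "x \<in> {0..l}" for t x
    using lb[OF that] unfolding fl_def flz_def fs_def hs_def by (auto simp: ext_inverse_eq max_def)
  define A where "A t x = 3 * (ihb x * ihb x) * (g * hs (z t) x - 1 / hs (z t) x * (1 / hs (z t) x) * (k t x * k t x))" for t x
  define Psi where "Psi t x = 6 * (ihb x * (b1 x * (ihb x * ihb x))) * fs (z t) (k t) x
     + 3 * (ihb x * ihb x) * (2 * (1 / hs (z t) x * (k t x * w t x)) - (g * hs (z t) x - 1 / hs (z t) x * (1 / hs (z t) x) * (k t x * k t x)) * b1 x) + G' t x" for t x
  have ARS: "RS m A" unfolding A_def by (intro c.C_add c.C_diff c.C_mult c.C_const stat f RSk)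
  have PRS: "RS m Psi" unfolding Psi_def by (intro c.C_add c.C_diff c.C_mult c.C_const stat f RSk RS G'RS)
  have eqA: "Phiz t x (z t x) = A t x" "Phix t x (z t x) = Psi t x" if "t \<in> {0..T}" "x \<in> {0..l}" for t x
    unfolding Phiz_def A_def Phix_def Psi_def on_sol[OF that] by simp_all
  obtain az aw where a: "R m (\<lambda>t. az)" "primitive l (z 0) az" "R m (\<lambda>t. aw)" "primitive l (w 0) aw"
    using R_static_SucE[OF data(1)] R_static_SucE[OF data(2)] by metis
  obtain s1 s2 where s: "R m s1" "R m s2" "tderiv s1 (\<lambda>t x. - s2 t x)" "tderiv s2 (\<lambda>t x. A t x * s1 t x + Psi t x)"
      "\<forall>x\<in>{0..l}. s1 0 x = az x \<and> s2 0 x = aw x"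
    using linear_R[OF ARS R(1)[OF PRS] a(1,3)] by blast
  have bs: "jcont z" "jcont w" "jcont k" "tderiv z (\<lambda>t x. - w t x)" "tderiv w (\<lambda>t. GX t (z t) (w t) (k t))" using b unfolding base_solution_def by auto
  have w_t: "tderiv w (\<lambda>t x. Phi t x (z t x))"
    by (rule tderiv_cong[OF refl _ bs(5)]) (simp add: GX_def Ux_def Phi_def on_sol F1_def Gf_def GP_def)
  have s2_t: "tderiv s2 (\<lambda>t x. Phiz t x (z t x) * s1 t x + Phix t x (z t x))"
    by (rule tderiv_cong[OF refl _ s(4)]) (simp add: eqA)
  have init: "primitive l (z 0) (s1 0)" "primitive l (w 0) (s2 0)"
    using a(2,4) s(5) l0 primitive_cong[of l "z 0" "z 0" "s1 0" az] primitive_cong[of l "w 0" "w 0" "s2 0" aw] by simp_all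
  have chain: "primitive l (\<lambda>x. Phi t x (Y x)) (\<lambda>x. Phiz t x (Y x) * s1 t x + Phix t x (Y x))"
    if t: "t \<in> {0..T}" and Y: "primitive l Y (s1 t)" for t Y
  proof -
    have pb: "primitive l b b1" by (rule primitive_C1[OF b_deriv St_cont(3)])
    have H: "primitive l (\<lambda>x. h0 + Y x - b x) (\<lambda>x. 0 + s1 t x - b1 x)" by (intro primitive_diff primitive_add primitive_const Y pb)
    note I = primitive_chain[OF H l0 ext_inverse_derivative[OF \<delta>] ext_inverse_deriv_continuous[OF \<delta>]]
    have FL: "primitive l (\<lambda>x. fl t x (Y x)) (\<lambda>x. 1/2 * g * (((0 + s1 t x - b1 x) * (h0 + Y x - b x) + (h0 + Y x - b x) * (0 + s1 t x - b1 x)) - 0) +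
       (- (1 / (max (h0 + Y x - b x) \<delta>)\<^sup>2) * (0 + s1 t x - b1 x) * (k t x * k t x) + ext_inverse \<delta> (h0 + Y x - b x) * (w t x * k t x + k t x * w t x)))"
      unfolding fl_def by (intro primitive_add primitive_mult primitive_diff primitive_cmult primitive_const H I kw[OF t] l0)
    have "primitive l (\<lambda>x. Phi t x (Y x)) (\<lambda>x. (3 * (b1 x * (ihb x * ihb x) * ihb x + ihb x * (b1 x * (ihb x * ihb x)))) * fl t x (Y x) +
        3 * (ihb x * ihb x) * (1/2 * g * (((0 + s1 t x - b1 x) * (h0 + Y x - b x) + (h0 + Y x - b x) * (0 + s1 t x - b1 x)) - 0) +
       (- (1 / (max (h0 + Y x - b x) \<delta>)\<^sup>2) * (0 + s1 t x - b1 x) * (k t x * k t x) + ext_inverse \<delta> (h0 + Y x - b x) * (w t x * k t x + k t x * w t x))) + G' t x)"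
      unfolding Phi_def by (intro primitive_add primitive_mult[OF _ FL] primitive_cmult primitive_mult[OF ihb_primitive ihb_primitive] Gp[OF t] l0)
    then show ?thesis
    proof (rule primitive_cong[THEN iffD1, rotated -1])
      show "(3 * (b1 x * (ihb x * ihb x) * ihb x + ihb x * (b1 x * (ihb x * ihb x)))) * fl t x (Y x) +
        3 * (ihb x * ihb x) * (1/2 * g * (((0 + s1 t x - b1 x) * (h0 + Y x - b x) + (h0 + Y x - b x) * (0 + s1 t x - b1 x)) - 0) +
       (- (1 / (max (h0 + Y x - b x) \<delta>)\<^sup>2) * (0 + s1 t x - b1 x) * (k t x * k t x) + ext_inverse \<delta> (h0 + Y x - b x) * (w t x * k t x + k t x * w t x))) + G' t x
        = Phiz t x (Y x) * s1 t x + Phix t x (Y x)" for x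
        unfolding Phiz_def Phix_def flz_def power2_eq_square by (simp add: algebra_simps add_divide_distrib diff_divide_distrib)
    qed (use l0 in auto)
  qed
  have rhs: "(\<lambda>x. Phiz t x (z t x) * s1 t x + Phix t x (z t x)) absolutely_integrable_on {0..l}" if t: "t \<in> {0..T}" for t
  proof -
    have "R m (\<lambda>t x. s1 t x * A t x + Psi t x)" by (intro R_add R_mult s(1) ARS R(1)[OF PRS])
    from R_ai[OF this t] show ?thesis
      by (rule absolutely_integrable_spike[of _ _ "{}"]) (use t in \<open>auto simp: eqA mult.commute\<close>)
  qed
  have lip: "\<exists>K\<ge>0. \<forall>t\<in>{0..T}. \<forall>x\<in>{0..l}. \<forall>a c. \<bar>a\<bar> \<le> M \<longrightarrow> \<bar>c\<bar> \<le> M \<longrightarrow>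
        \<bar>Phi t x a - Phi t x c\<bar> \<le> K * \<bar>a - c\<bar> \<and> \<bar>Phiz t x a - Phiz t x c\<bar> \<le> K * \<bar>a - c\<bar> \<and>
        \<bar>Phix t x a - Phix t x c\<bar> \<le> (K + \<bar>k t x\<bar>) * \<bar>a - c\<bar>" for M
  proof -
    define Gd where "Gd = {0..T} \<times> {- M..M}"
    define rel where "rel i j d \<longleftrightarrow> fst i = fst j \<and> \<bar>snd i - snd j\<bar> \<le> d" for i j :: "real \<times> real" and d
    interpret L: lipschitz_class l h0 g b Gd rel by unfold_locales (auto simp: rel_def)
    have jc: "L.LB (\<lambda>i. u (fst i))" if u: "jcont u" for u
    proof -
      obtain N where "0 \<le> N" "\<And>t x. t \<in> {0..T} \<Longrightarrow> x \<in> {0..l} \<Longrightarrow> \<bar>u t x\<bar> \<le> N" using jcont_bound[OF u] by blast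
      then show ?thesis using jcont_slice[OF u] by (intro L.LBI[of 0 N]) (auto simp: Gd_def rel_def)
    qed
    have jR: "jcont u" if "RS m u" for u using R(2)[OF that] SC.simps(1) unfolding S_def by blast
    have Gj: "jcont Gf" by (rule jR) (unfold Gf_def, intro c.C_mult stat f)
    have LBa: "L.LB (\<lambda>i x. snd i)" by (rule L.LBI[of 1 "\<bar>M\<bar>"]) (auto simp: Gd_def rel_def)
    have H: "L.LB (\<lambda>i x. h0 + snd i - b x)" by (intro L.C_add L.C_diff L.C_const LBa L.C_static St_b)
    have mx: "L.LB (\<lambda>i x. 1 / max (h0 + snd i - b x) \<delta>)" by (rule L.LB_inverse[OF L.LB_max[OF H] \<delta>]) simp
    have io: "L.LB (\<lambda>i x. ext_inverse \<delta> (h0 + snd i - b x))" unfolding ext_inverse_max[OF \<delta>]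
      by (intro L.C_diff L.C_mult H mx L.LB_max)
    have fl: "L.LB (\<lambda>i x. fl (fst i) x (snd i))" unfolding fl_def
      by (intro L.C_add L.C_diff L.C_mult L.C_const H io jc bs)
    have flz: "L.LB (\<lambda>i x. flz (fst i) x (snd i))" unfolding flz_def
      by (intro L.C_add L.C_diff L.C_mult L.C_const H mx jc bs)
    have LB1: "L.LB (\<lambda>i x. Phi (fst i) x (snd i))" unfolding Phi_def
      by (intro L.C_add L.C_mult L.C_const L.C_static St_ihb fl jc Gj)
    have LB2: "L.LB (\<lambda>i x. Phiz (fst i) x (snd i))" unfolding Phiz_def
      by (intro L.C_mult L.C_const L.C_static St_ihb flz)
    have LB3: "L.LB (\<lambda>i x. Phix (fst i) x (snd i))" unfolding Phix_def
      by (intro L.C_add L.C_diff L.C_mult L.C_const L.C_static St_ihb St_b fl flz io jc bs jR[OF G'RS])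
    have key: "\<exists>K\<ge>0. \<forall>t\<in>{0..T}. \<forall>x\<in>{0..l}. \<forall>a c. \<bar>a\<bar> \<le> M \<longrightarrow> \<bar>c\<bar> \<le> M \<longrightarrow> \<bar>Q t x a - Q t x c\<bar> \<le> K * \<bar>a - c\<bar>"
      if Q: "L.LB (\<lambda>i x. Q (fst i) x (snd i))" for Q
    proof -
      obtain K where K: "0 \<le> K" "\<And>i j d x. i \<in> Gd \<Longrightarrow> j \<in> Gd \<Longrightarrow> rel i j d \<Longrightarrow> x \<in> {0..l} \<Longrightarrow>
          \<bar>Q (fst i) x (snd i) - Q (fst j) x (snd j)\<bar> \<le> K * d"
        by (rule L.LBE[OF Q]) blast
      have "\<bar>Q t x a - Q t x c\<bar> \<le> K * \<bar>a - c\<bar>" if "t \<in> {0..T}" "x \<in> {0..l}" "\<bar>a\<bar> \<le> M" "\<bar>c\<bar> \<le> M" for t x a c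
        using K(2)[of "(t, a)" "(t, c)" "\<bar>a - c\<bar>" x] that unfolding Gd_def rel_def by (auto simp: abs_le_iff)
      then show ?thesis using K(1) by blast
    qed
    obtain K1 where K1: "0 \<le> K1" "\<forall>t\<in>{0..T}. \<forall>x\<in>{0..l}. \<forall>a c. \<bar>a\<bar> \<le> M \<longrightarrow> \<bar>c\<bar> \<le> M \<longrightarrow> \<bar>Phi t x a - Phi t x c\<bar> \<le> K1 * \<bar>a - c\<bar>"
      using key[OF LB1] by blast
    obtain K2 where K2: "0 \<le> K2" "\<forall>t\<in>{0..T}. \<forall>x\<in>{0..l}. \<forall>a c. \<bar>a\<bar> \<le> M \<longrightarrow> \<bar>c\<bar> \<le> M \<longrightarrow> \<bar>Phiz t x a - Phiz t x c\<bar> \<le> K2 * \<bar>a - c\<bar>"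
      using key[OF LB2] by blast
    obtain K3 where K3: "0 \<le> K3" "\<forall>t\<in>{0..T}. \<forall>x\<in>{0..l}. \<forall>a c. \<bar>a\<bar> \<le> M \<longrightarrow> \<bar>c\<bar> \<le> M \<longrightarrow> \<bar>Phix t x a - Phix t x c\<bar> \<le> K3 * \<bar>a - c\<bar>"
      using key[OF LB3] by blast
    note K = K1(1) K2(1) K3(1)
    have le: "K' * \<bar>a - c\<bar> \<le> (K1 + K2 + K3) * \<bar>a - c\<bar>" if "K' = K1 \<or> K' = K2 \<or> K' = K3" for K' a c :: real
      by (rule mult_right_mono) (use that K in auto)
    show ?thesis
    proof (intro exI[of _ "K1 + K2 + K3"] conjI ballI allI impI)
      show "0 \<le> K1 + K2 + K3" using K by simp
      fix t x a c assume *: "t \<in> {0..T}" "x \<in> {0..l}" "\<bar>a\<bar> \<le> M" "\<bar>c\<bar> \<le> M"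
      show "\<bar>Phi t x a - Phi t x c\<bar> \<le> (K1 + K2 + K3) * \<bar>a - c\<bar>" by (rule order_trans[OF K1(2)[rule_format, OF *] le]) simp
      show "\<bar>Phiz t x a - Phiz t x c\<bar> \<le> (K1 + K2 + K3) * \<bar>a - c\<bar>" by (rule order_trans[OF K2(2)[rule_format, OF *] le]) simp
      \<comment> \<open>\<open>persistence\<close> admits for \<Phi>x a Lipschitz constant that is
        merely integrable in x. The constant here is bounded; the absolute value of the field k,
        which belongs to \<open>R (Suc m)\<close>, fills the extra place and only enlarges
        it.\<close>
      have "K3 * \<bar>a - c\<bar> \<le> (K1 + K2 + K3 + \<bar>k t x\<bar>) * \<bar>a - c\<bar>" by (rule mult_right_mono) (use K in auto)
      then show "\<bar>Phix t x a - Phix t x c\<bar> \<le> (K1 + K2 + K3 + \<bar>k t x\<bar>) * \<bar>a - c\<bar>" using K3(2)[rule_format, OF *] by (rule order_trans[rotated])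
    qed
  qed
  note pers = persistence[where \<Phi>=Phi and \<Phi>z=Phiz and \<Phi>x=Phix, OF bs(1,2,4) w_t s(1-3) s2_t init chain rhs Rk' lip]
  have "R (Suc m) z" by (rule R_SucI[OF S(1) s(1) pers(1)])
  moreover have "R (Suc m) w" by (rule R_SucI[OF S(2) s(2) pers(2)])
  ultimately show "RS (Suc m) z" "RS (Suc m) w" unfolding RS_Suc by auto
qed

text \<open>At each level the fields \<open>GU\<close> and \<open>GP\<close> inherit the class of
  the state, which is all that the next level needs. So regularity climbs from \<open>RS 0\<close>,
  mere continuity in x, to the level n of the data; k stays one level ahead because w is its
  density.\<close>

lemma base_solution_R:
  assumes b: "base_solution z w k" and i: "primitive l (k 0) (w 0)"
    and data: "R n (\<lambda>t. z 0)" "R n (\<lambda>t. w 0)"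
  shows "R n z" "R n w" "R (Suc n) k" "R (Suc n) (\<lambda>t. GU t (z t) (w t) (k t))"
proof -
  have mono: "R m (\<lambda>t. u)" if "R n (\<lambda>t. u)" "m \<le> n" for m u
    using that(2,1) by (induction m rule: inc_induct) (blast intro: R_mono)+
  have "m \<le> n \<Longrightarrow> RS m z \<and> RS m w" for m
  proof (induction m)
    case 0 then show ?case using base_solution_S[OF b] unfolding RS_0 by blast
  next
    case (Suc m)
    then show ?case using base_solution_persistence[OF b i mono[OF data(1)] mono[OF data(2)]] by simp
  qed
  then have RS: "RS n z" "RS n w" by auto
  then show R: "R n z" "R n w" unfolding RS_def by auto
  show Rk: "R (Suc n) k" by (rule R_SucI[OF base_solution_S(3)[OF b] R(2) base_solution_primitive[OF b i]])
  have RSk: "RS n k" using Rk RS_mono RS_Suc by blast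
  note f = base_solution_RS_fields[OF b RS RSk]
  interpret c: opclass l h0 g b "RS n" by (rule RS_opclass)
  have X: "RS n (\<lambda>t. GX t (z t) (w t) (k t))"
    unfolding GX_def Ux_def[abs_def] GP_def[symmetric] F1_def by (intro c.C_add c.C_mult c.C_const RS_static St_ihb f)
  show "R (Suc n) (\<lambda>t. GU t (z t) (w t) (k t))"
  proof (rule R_SucI)
    show "R n (\<lambda>t. GX t (z t) (w t) (k t))" "S (\<lambda>t. GU t (z t) (w t) (k t))" using X f(4) unfolding RS_def by auto
    show "primitive l (GU t (z t) (w t) (k t)) (GX t (z t) (w t) (k t))" if t: "t \<in> {0..T}" for t
      using Ue_deriv(1)[OF base_solution_slices(1,2)[OF b t]] base_solution_slices(4)[OF b t]
      unfolding GU_def GX_def by (rule primitive_C1)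
  qed
qed

end

section \<open>Solutions of the Boussinesq-Abbott system\<close>

lemma AE_Ioo_iff: "(AE x in lebesgue_on {0<..<l::real}. P x) \<longleftrightarrow> negligible {x \<in> {0<..<l}. \<not> P x}"
proof -
  have "(AE x in lebesgue_on {0<..<l}. P x) \<longleftrightarrow> (AE x in lebesgue. x \<in> {0<..<l} \<longrightarrow> P x)"
    by (rule AE_restrict_space_iff) simp
  also have "\<dots> \<longleftrightarrow> negligible {x \<in> {0<..<l}. \<not> P x}"
  proof
    assume "AE x in lebesgue. x \<in> {0<..<l} \<longrightarrow> P x"
    then obtain N where "N \<in> null_sets lebesgue" "{x \<in> space lebesgue. \<not> (x \<in> {0<..<l} \<longrightarrow> P x)} \<subseteq> N"
      unfolding eventually_ae_filter by blast
    then show "negligible {x \<in> {0<..<l}. \<not> P x}" unfolding negligible_iff_null_sets[symmetric] by (elim negligible_subset) auto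
  next
    assume "negligible {x \<in> {0<..<l}. \<not> P x}"
    then show "AE x in lebesgue. x \<in> {0<..<l} \<longrightarrow> P x" unfolding negligible_iff_null_sets eventually_ae_filter by (rule bexI[rotated]) auto
  qed
  finally show ?thesis .
qed

lemma negligible_Icc_iff: "negligible {x \<in> {0..l::real}. P x} \<longleftrightarrow> negligible {x \<in> {0<..<l}. P x}"
proof
  assume "negligible {x \<in> {0<..<l}. P x}"
  then have "negligible ({x \<in> {0<..<l}. P x} \<union> {0, l})" by (simp add: negligible_Un)
  then show "negligible {x \<in> {0..l}. P x}" by (rule negligible_subset) auto
qed (auto elim: negligible_subset)

text \<open>\<open>T_op\<close> nests two weak derivatives, and the inner one is known only almost
  everywhere. So m is only required to agree almost everywhere with an absolutely continuous
  M.\<close>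

lemma weak_deriv_primitive:
  assumes M: "primitive l M V" and l: "0 < l" and m: "AE x in lebesgue_on {0<..<l}. m x = M x"
  shows "AE x in lebesgue_on {0<..<l}. weak_deriv l 1 m x = V x"
proof -
  have neg: "negligible {x \<in> {0<..<l}. m x \<noteq> M x}" using m unfolding AE_Ioo_iff .
  have negc: "negligible {x \<in> {0..l}. m x \<noteq> M x}" using neg unfolding negligible_Icc_iff .
  have Mi: "M absolutely_integrable_on {0..l}" by (rule continuous_absolutely_integrable[OF primitive_continuous[OF M]])
  have "m absolutely_integrable_on {0..l}" by (rule absolutely_integrable_spike[OF Mi negc]) auto
  then have lm: "locally_integrable l m" by (rule absolutely_integrable_imp_local)
  have lV: "locally_integrable l V" by (rule absolutely_integrable_imp_local[OF primitive_integrable[OF M]])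
  have "has_weak_deriv l 1 m V" unfolding has_weak_deriv_def
  proof (intro conjI lm lV allI impI)
    fix \<phi> assume t: "test_function l \<phi>"
    have "(LINT x:{0<..<l}|lebesgue. m x * (deriv ^^ 1) \<phi> x) = integral {0..l} (\<lambda>x. m x * deriv \<phi> x)"
      using locally_integrable_test(3)[OF lm test_function_deriv(1)[OF t]] by simp
    also have "\<dots> = integral {0..l} (\<lambda>x. M x * deriv \<phi> x)" by (rule integral_spike[OF negc]) auto
    also have "\<dots> = - integral {0..l} (\<lambda>x. V x * \<phi> x)" by (rule primitive_test_parts[OF M t l])
    finally show "(LINT x:{0<..<l}|lebesgue. m x * (deriv ^^ 1) \<phi> x) = (-1) ^ 1 * (LINT x:{0<..<l}|lebesgue. V x * \<phi> x)"
      using locally_integrable_test(3)[OF lV t] by simp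
  qed
  moreover from this have "has_weak_deriv l 1 m (weak_deriv l 1 m)" unfolding weak_deriv_def by (rule someI[of "has_weak_deriv l 1 m" V])
  ultimately show ?thesis unfolding AE_Ioo_iff using weak_deriv_unique l by blast
qed

lemma primitive_AE:
  assumes p: "primitive l p p'" and r: "r absolutely_integrable_on {0..l}" and eq: "AE x in lebesgue_on {0<..<l}. p' x = r x"
  shows "primitive l p r"
proof (rule primitiveI[OF r])
  fix x assume x: "x \<in> {0..l}"
  have "negligible {y \<in> {0..l}. p' y \<noteq> r y}" using eq unfolding AE_Ioo_iff negligible_Icc_iff .
  then have "integral {0..x} p' = integral {0..x} r" by (rule integral_spike) (use x in auto)
  then show "p x = p 0 + integral {0..x} r" using primitive_eq[OF p x] by simp
qed

lemma T_op_cong: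
  assumes "\<And>x. x \<in> {0..l} \<Longrightarrow> u x = v x" "x \<in> {0..l}"
  shows "T_op l h0 b u x = T_op l h0 b v x"
proof -
  have "weak_deriv l 1 (\<lambda>z. u z / (h0 - b z)) = weak_deriv l 1 (\<lambda>z. v z / (h0 - b z))" by (rule weak_deriv_cong) (simp add: assms)
  then show ?thesis unfolding T_op_def Let_def using assms by simp
qed

section \<open>The momentum equation as a first order system\<close>

context elliptic
begin

lemma AE_St: "AE x in lebesgue_on {0<..<l}. x \<in> {0<..<l} \<and> deriv b x = b1 x \<and> deriv (deriv b) x = b2 x"
  unfolding AE_Ioo_iff using deriv_b by (auto intro!: negligible_subset[OF negligible_empty])

text \<open>With h_b' = - b', h_b^3 (u / h_b)' is h_b^2 u' + h_b b' u, which is absolutely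
  continuous with density \<open>V\<close>. Inserting this, h_b times the residual of the equation
  for p' is -3 times the residual of the momentum equation, and h_b does not vanish.\<close>

lemma pde_iff:
  assumes u: "primitive l u u1" "primitive l u1 u2" and f: "primitive l f f1"
  shows "primitive l (\<lambda>x. hb x * u1 x - 3 * (ihb x * f x)) (\<lambda>x. hb x * u2 x - b1 x * u1 x - 3 * (b1 x * (ihb x * ihb x) * f x + ihb x * f1 x))" (is "primitive l ?p ?p'")
    and "(AE x in lebesgue_on {0<..<l}. u x + (h0 - b x) * T_op l h0 b u x + weak_deriv l 1 f x = - g * h x * deriv b x) \<longleftrightarrow>
      (AE x in lebesgue_on {0<..<l}. hb x * u2 x - b1 x * u1 x - 3 * (b1 x * (ihb x * ihb x) * f x + ihb x * f1 x) = 3 * cc x * ihb x * u x + F2 h f x)"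
proof -
  have l0: "0 \<le> l" using l_pos by simp
  have pb1: "primitive l b1 b2" by (rule primitive_C1[OF b1_deriv St_continuous[OF St_b(3)]])
  have phb: "primitive l hb (\<lambda>x. 0 - b1 x)" unfolding hb_def[abs_def] by (intro primitive_diff primitive_const primitive_C1[OF b_deriv St_cont(3)])
  have "primitive l ?p (\<lambda>x. ((0 - b1 x) * u1 x + hb x * u2 x) - 3 * (b1 x * (ihb x * ihb x) * f x + ihb x * f1 x))"
    by (intro primitive_diff primitive_cmult primitive_mult phb u f ihb_primitive l0)
  then show "primitive l ?p ?p'" by (rule primitive_cong[THEN iffD1, rotated -1]) (use l0 in auto)
  define v1 where "v1 x = u1 x * ihb x + u x * (b1 x * (ihb x * ihb x))" for x
  have "primitive l (\<lambda>x. u x * ihb x) v1" unfolding v1_def by (intro primitive_mult u ihb_primitive l0)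
  then have w1: "AE x in lebesgue_on {0<..<l}. weak_deriv l 1 (\<lambda>z. u z / (h0 - b z)) x = v1 x"
    by (rule weak_deriv_primitive[OF _ l_pos]) (simp add: ihb_def hb_def)
  define V where "V x = hb x * hb x * u2 x - hb x * b1 x * u1 x + (hb x * b2 x - b1 x * b1 x) * u x" for x
  have "primitive l (\<lambda>x. hb x * hb x * u1 x + hb x * b1 x * u x)
     (\<lambda>x. ((((0 - b1 x) * hb x + hb x * (0 - b1 x)) * u1 x) + hb x * hb x * u2 x) + (((0 - b1 x) * b1 x + hb x * b2 x) * u x + hb x * b1 x * u1 x))"
    by (intro primitive_add primitive_mult phb pb1 u l0)
  then have pV: "primitive l (\<lambda>x. hb x * hb x * u1 x + hb x * b1 x * u x) V"
    by (rule primitive_cong[THEN iffD1, rotated -1]) (use l0 in \<open>auto simp: V_def algebra_simps\<close>)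
  have nz: "hb x \<noteq> 0" if "x \<in> {0<..<l}" for x using hb_gt_0[of x] that by auto
  have w2: "AE x in lebesgue_on {0<..<l}. weak_deriv l 1 (\<lambda>y. (h0 - b y) ^ 3 * weak_deriv l 1 (\<lambda>z. u z / (h0 - b z)) y) x = V x"
  proof (rule weak_deriv_primitive[OF pV l_pos])
    show "AE x in lebesgue_on {0<..<l}. (h0 - b x) ^ 3 * weak_deriv l 1 (\<lambda>z. u z / (h0 - b z)) x = hb x * hb x * u1 x + hb x * b1 x * u x"
      using w1 AE_St
    proof eventually_elim
      case (elim x)
      then show ?case using nz[of x] unfolding elim v1_def hb_def[symmetric] ihb_def by (simp add: field_simps power3_eq_cube)
    qed
  qed
  have w3: "AE x in lebesgue_on {0<..<l}. weak_deriv l 1 f x = f1 x" by (rule weak_deriv_primitive[OF f l_pos]) simp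
  have eq: "AE x in lebesgue_on {0<..<l}. (u x + (h0 - b x) * T_op l h0 b u x + weak_deriv l 1 f x = - g * h x * deriv b x) \<longleftrightarrow>
     ?p' x = 3 * cc x * ihb x * u x + F2 h f x"
    using w2 w3 AE_St
  proof eventually_elim
    case (elim x)
    have n: "hb x \<noteq> 0" using elim nz by simp
    have T: "hb x * T_op l h0 b u x = - V x / 3 + hb x * b2 x / 2 * u x"
      unfolding T_op_def Let_def using elim n by (simp add: hb_def[symmetric] field_simps)
    have "hb x * (?p' x - (3 * cc x * ihb x * u x + F2 h f x)) = - 3 * (u x + hb x * T_op l h0 b u x + f1 x + g * h x * b1 x)"
      unfolding T V_def F2_def cc_def ihb_def using n by (simp add: field_simps power2_eq_square)
    moreover have "(hb x * (?p' x - (3 * cc x * ihb x * u x + F2 h f x)) = 0) \<longleftrightarrow> ?p' x = 3 * cc x * ihb x * u x + F2 h f x" using n by simp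
    moreover have "(- 3 * (u x + hb x * T_op l h0 b u x + f1 x + g * h x * b1 x) = 0) \<longleftrightarrow>
        u x + (h0 - b x) * T_op l h0 b u x + weak_deriv l 1 f x = - g * h x * deriv b x"
      using elim unfolding hb_def by auto
    ultimately show ?case by (simp only:)
  qed
  show "(AE x in lebesgue_on {0<..<l}. u x + (h0 - b x) * T_op l h0 b u x + weak_deriv l 1 f x = - g * h x * deriv b x) \<longleftrightarrow>
      (AE x in lebesgue_on {0<..<l}. ?p' x = 3 * cc x * ihb x * u x + F2 h f x)"
    by (rule eventually_subst[OF eq])
qed

end

section \<open>Solutions on arbitrary sets of times and their locality\<close>

context problem
begin

text \<open>\<open>BA_solution\<close> with an arbitrary set J of times, so that closed intervals
  are available, on which solutions are constructed.\<close>

definition BA_on where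
  "BA_on n zin kin J z q \<longleftrightarrow>
      smooth_in_time n l J z \<and> smooth_in_time (n + 1) l J q \<and>
      (\<forall>t\<in>J. \<forall>x\<in>{0..l}. h0 + z t x - b x \<noteq> 0) \<and>
      (\<forall>t\<in>J. (z t 0, q t 0) \<in> U \<and> (z t l, q t l) \<in> U) \<and>
      (\<forall>t\<in>J. AE x in lebesgue_on {0<..<l}. time_deriv n l J z t x + weak_deriv l 1 (q t) x = 0) \<and>
      (\<forall>t\<in>J. AE x in lebesgue_on {0<..<l}.
         time_deriv (n + 1) l J q t x + (h0 - b x) * T_op l h0 b (time_deriv (n + 1) l J q t) x
           + weak_deriv l 1 (f_NSW g h0 b (z t) (q t)) x = - g * (h0 + z t x - b x) * deriv b x) \<and>
      (\<forall>x\<in>{0..l}. z 0 x = zin x \<and> q 0 x = kin x) \<and>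
      (\<forall>t\<in>J. \<xi>0 (z t 0, q t 0) = \<gamma>0 t \<and> \<xi>l (z t l, q t l) = \<gamma>l t)"

lemma BA_solution_iff: "BA_solution n l h0 g b U \<xi>0 \<xi>l \<gamma>0 \<gamma>l zin kin T z q \<longleftrightarrow> BA_on n zin kin (time_interval T) z q"
  unfolding BA_solution_def BA_on_def Let_def ..

text \<open>Apart from the initial condition, every clause concerns a single time and time
  derivatives there, which are local. The lemma is used to open a closed interval at its right end
  and to glue solutions with different life spans.\<close>

lemma BA_on_local:
  assumes init: "\<And>x. x \<in> {0..l} \<Longrightarrow> z' 0 x = zin x \<and> q' 0 x = kin x"
    and ch: "\<And>t. t \<in> J' \<Longrightarrow> \<exists>J z q W. chart l J z J' z' W \<and> chart l J q J' q' W \<and> t \<in> W \<and> BA_on (Suc m) zin kin J z q"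
  shows "BA_on (Suc m) zin kin J' z' q'"
proof -
  have sz: "\<exists>J u W. chart l J u J' z' W \<and> t \<in> W \<and> smooth_in_time (Suc m) l J u"
    and sq: "\<exists>J u W. chart l J u J' q' W \<and> t \<in> W \<and> smooth_in_time (Suc (Suc m)) l J u" if "t \<in> J'" for t
    using ch[OF that] unfolding BA_on_def by auto
  have pt: "(\<forall>x\<in>{0..l}. h0 + z' t x - b x \<noteq> 0) \<and> ((z' t 0, q' t 0) \<in> U \<and> (z' t l, q' t l) \<in> U) \<and>
      (AE x in lebesgue_on {0<..<l}. time_deriv (Suc m) l J' z' t x + weak_deriv l 1 (q' t) x = 0) \<and>
      (AE x in lebesgue_on {0<..<l}.
         time_deriv (Suc m + 1) l J' q' t x + (h0 - b x) * T_op l h0 b (time_deriv (Suc m + 1) l J' q' t) x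
           + weak_deriv l 1 (f_NSW g h0 b (z' t) (q' t)) x = - g * (h0 + z' t x - b x) * deriv b x) \<and>
      (\<xi>0 (z' t 0, q' t 0) = \<gamma>0 t \<and> \<xi>l (z' t l, q' t l) = \<gamma>l t)" if t: "t \<in> J'" for t
  proof -
    obtain J z q W where c: "chart l J z J' z' W" "chart l J q J' q' W" "t \<in> W" and ba: "BA_on (Suc m) zin kin J z q" using ch[OF t] by blast
    have tJ: "t \<in> J" using c t unfolding chart_def by blast
    have "z t x = z' t x" "q t x = q' t x" if "x \<in> {0..l}" for x using c tJ that unfolding chart_def by blast+
    then have zq: "z' t x = z t x" "q' t x = q t x" if "x \<in> {0..l}" for x using that by auto
    have td: "time_deriv (Suc m) l J' z' t = time_deriv (Suc m) l J z t"
      by (rule smooth_in_time_local(2)[OF l_pos sz t c(1,3)]) (use ba in \<open>simp_all add: BA_on_def\<close>)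
    have td': "time_deriv (Suc m + 1) l J' q' t = time_deriv (Suc m + 1) l J q t"
      using smooth_in_time_local(2)[OF l_pos sq t c(2,3)] ba by (simp add: BA_on_def)
    have wq: "weak_deriv l 1 (q' t) = weak_deriv l 1 (q t)" by (rule weak_deriv_cong[OF zq(2)])
    have wf: "weak_deriv l 1 (f_NSW g h0 b (z' t) (q' t)) = weak_deriv l 1 (f_NSW g h0 b (z t) (q t))"
      by (rule weak_deriv_cong) (simp add: f_NSW_def zq)
    have pde: "AE x in lebesgue_on {0<..<l}.
         time_deriv (Suc m + 1) l J q t x + (h0 - b x) * T_op l h0 b (time_deriv (Suc m + 1) l J q t) x
           + weak_deriv l 1 (f_NSW g h0 b (z t) (q t)) x = - g * (h0 + z t x - b x) * deriv b x"
      using ba tJ unfolding BA_on_def by blast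
    have "AE x in lebesgue_on {0<..<l}.
         time_deriv (Suc m + 1) l J' q' t x + (h0 - b x) * T_op l h0 b (time_deriv (Suc m + 1) l J' q' t) x
           + weak_deriv l 1 (f_NSW g h0 b (z' t) (q' t)) x = - g * (h0 + z' t x - b x) * deriv b x"
      unfolding td' wf using pde AE_St by eventually_elim (simp add: zq)
    moreover have "AE x in lebesgue_on {0<..<l}. time_deriv (Suc m) l J' z' t x + weak_deriv l 1 (q' t) x = 0"
      unfolding td wq using ba tJ unfolding BA_on_def by blast
    moreover have "(\<forall>x\<in>{0..l}. h0 + z t x - b x \<noteq> 0)" "(z t 0, q t 0) \<in> U \<and> (z t l, q t l) \<in> U" "\<xi>0 (z t 0, q t 0) = \<gamma>0 t \<and> \<xi>l (z t l, q t l) = \<gamma>l t"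
      using ba tJ unfolding BA_on_def by blast+
    ultimately show ?thesis using zq ends by simp
  qed
  have "smooth_in_time (Suc m) l J' z'" by (rule smooth_in_time_local(1)[OF l_pos sz])
  moreover have "smooth_in_time (Suc m + 1) l J' q'" using smooth_in_time_local(1)[OF l_pos sq] by simp
  ultimately show ?thesis unfolding BA_on_def using pt init by blast
qed

end

text \<open>Unlike \<open>has_time_deriv_pointwise\<close>, this reaches the space derivatives of
  order j < k. With j = 1 it provides the time derivative of w, the x-derivative of q.\<close>

lemma has_time_deriv_chain:
  assumes h: "has_time_deriv k l J u v t" and l: "0 < l" and t: "t \<in> J"
    and c: "\<And>s. s \<in> J \<Longrightarrow> chain l k (c s)" "\<And>s. s \<in> J \<Longrightarrow> c s 0 = u s"
    and cv: "chain l k cv" "cv 0 = v" and j: "j < k"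
  shows "x \<in> {0..l} \<Longrightarrow> ((\<lambda>s. c s j x) has_real_derivative cv j x) (at t within J)"
    and "0 < e \<Longrightarrow> \<exists>d>0. \<forall>s\<in>J. \<bar>s - t\<bar> < d \<longrightarrow> (\<forall>x\<in>{0..l}. \<bar>c s j x - c t j x\<bar> < e)"
proof -
  have un: "\<exists>d>0. \<forall>s\<in>J. s \<noteq> t \<longrightarrow> \<bar>s - t\<bar> < d \<longrightarrow> (\<forall>x\<in>{0..l}. \<bar>(c s j x - c t j x) / (s - t) - cv j x\<bar> < e)" if e: "0 < e" for e
  proof -
    obtain d where "0 < d" "\<And>s x. s \<in> J \<Longrightarrow> s \<noteq> t \<Longrightarrow> \<bar>s - t\<bar> < d \<Longrightarrow> x \<in> {0..l} \<Longrightarrow> \<bar>(c s j x - c t j x) / (s - t) - cv j x\<bar> < e"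
      by (rule has_time_deriv_uniform[OF h l t c(1) _ cv(1) _ j e]) (use c(2) cv(2) in auto)
    then show ?thesis by blast
  qed
  show "((\<lambda>s. c s j x) has_real_derivative cv j x) (at t within J)" if x: "x \<in> {0..l}"
    unfolding has_field_derivative_iff Lim_within
  proof (intro allI impI)
    fix e :: real assume "0 < e"
    from un[OF this] obtain d where "0 < d" "\<forall>s\<in>J. s \<noteq> t \<longrightarrow> \<bar>s - t\<bar> < d \<longrightarrow> (\<forall>x\<in>{0..l}. \<bar>(c s j x - c t j x) / (s - t) - cv j x\<bar> < e)" by blast
    then show "\<exists>d>0. \<forall>s\<in>J. 0 < dist s t \<and> dist s t < d \<longrightarrow> dist ((c s j x - c t j x) / (s - t)) (cv j x) < e"
      using x by (intro exI[of _ d]) (auto simp: dist_real_def)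
  qed
  show "\<exists>d>0. \<forall>s\<in>J. \<bar>s - t\<bar> < d \<longrightarrow> (\<forall>x\<in>{0..l}. \<bar>c s j x - c t j x\<bar> < e)" if e: "0 < e"
  proof -
    have "continuous_on {0..l} (cv j)" using cv(1) j unfolding chain_def by (blast intro: primitive_continuous)
    then obtain M where M: "0 \<le> M" "\<And>x. x \<in> {0..l} \<Longrightarrow> \<bar>cv j x\<bar> \<le> M" using continuous_on_compact_bound_abs[OF _ compact_Icc] by metis
    obtain d where d: "0 < d" "\<forall>s\<in>J. s \<noteq> t \<longrightarrow> \<bar>s - t\<bar> < d \<longrightarrow> (\<forall>x\<in>{0..l}. \<bar>(c s j x - c t j x) / (s - t) - cv j x\<bar> < 1)" using un[of 1] by auto
    have "\<bar>c s j x - c t j x\<bar> < e" if s: "s \<in> J" "\<bar>s - t\<bar> < min d (e / (M + 1))" and x: "x \<in> {0..l}" for s x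
    proof (cases "s = t")
      case False
      have "\<bar>(c s j x - c t j x) / (s - t) - cv j x\<bar> < 1" using d(2) s x False by simp
      then have "\<bar>(c s j x - c t j x) / (s - t)\<bar> \<le> M + 1" using M(2)[OF x] by linarith
      then have "\<bar>c s j x - c t j x\<bar> \<le> (M + 1) * \<bar>s - t\<bar>" using False by (simp add: abs_divide field_simps)
      also have "\<dots> < e" using s(2) M(1) by (simp add: field_simps)
      finally show ?thesis .
    qed (use e in simp)
    then show ?thesis using d(1) e M(1) by (intro exI[of _ "min d (e / (M + 1))"]) auto
  qed
qed

section \<open>Uniqueness for the evolution equation\<close>

context evolution
begin

lemma base_solution_unique:
  assumes b: "base_solution z w k" and b': "base_solution z' w' k'"
    and init: "\<And>x. x \<in> {0..l} \<Longrightarrow> z 0 x = z' 0 x \<and> w 0 x = w' 0 x \<and> k 0 x = k' 0 x"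
    and t: "t \<in> {0..T}" and x: "x \<in> {0..l}"
  shows "z t x = z' t x" "w t x = w' t x" "k t x = k' t x"
proof -
  note B = b[unfolded base_solution_def] and B' = b'[unfolded base_solution_def]
  \<comment> \<open>A state is a time with a Boolean that selects one of the two solutions. The
    Lipschitz class then compares exactly these two, and their boundary values fill compact subsets
    of U.\<close>
  define Gd :: "(real \<times> bool) set" where "Gd = {0..T} \<times> UNIV"
  define Z where "Z i = (if snd i then z (fst i) else z' (fst i))" for i :: "real \<times> bool"
  define W where "W i = (if snd i then w (fst i) else w' (fst i))" for i :: "real \<times> bool"
  define K where "K i = (if snd i then k (fst i) else k' (fst i))" for i :: "real \<times> bool"
  define rel where "rel i j d \<longleftrightarrow> fst i = fst j \<and> (\<forall>y\<in>{0..l}. \<bar>Z i y - Z j y\<bar> \<le> d \<and> \<bar>W i y - W j y\<bar> \<le> d \<and> \<bar>K i y - K j y\<bar> \<le> d)" for i j d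
  have relnn: "0 \<le> d" if "rel i j d" for i j d using that ends(1) abs_ge_zero order_trans unfolding rel_def by blast
  interpret L: lipschitz_class l h0 g b Gd rel by unfold_locales (rule relnn)
  have lb: "L.LB Q" if Q: "\<And>i. Q i = (if snd i then u (fst i) else u' (fst i))" and j: "jcont u" "jcont u'"
    and r: "\<And>i j d x. rel i j d \<Longrightarrow> x \<in> {0..l} \<Longrightarrow> \<bar>Q i x - Q j x\<bar> \<le> d" for Q u u'
  proof -
    obtain M where M: "0 \<le> M" "\<And>t x. t \<in> {0..T} \<Longrightarrow> x \<in> {0..l} \<Longrightarrow> \<bar>u t x\<bar> \<le> M" using jcont_bound[OF j(1)] by blast
    obtain M' where M': "0 \<le> M'" "\<And>t x. t \<in> {0..T} \<Longrightarrow> x \<in> {0..l} \<Longrightarrow> \<bar>u' t x\<bar> \<le> M'" using jcont_bound[OF j(2)] by blast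
    show ?thesis
    proof (rule L.LBI[of 1 "M + M'"])
      fix i :: "real \<times> bool" assume i: "i \<in> Gd"
      then show "continuous_on {0..l} (Q i)" unfolding Q Gd_def using jcont_slice[OF j(1)] jcont_slice[OF j(2)] by auto
      show "\<bar>Q i x\<bar> \<le> M + M'" if "x \<in> {0..l}" for x
        using M(2)[of "fst i" x] M'(2)[of "fst i" x] M(1) M'(1) i that unfolding Q Gd_def by auto
    qed (use M M' r in auto)
  qed
  have LBs: "L.LB Z" "L.LB W" "L.LB K"
    by (rule lb[OF Z_def] lb[OF W_def] lb[OF K_def]; use B B' in \<open>auto simp: rel_def\<close>)+
  obtain \<delta>1 where d1: "0 < \<delta>1" "\<And>t x. t \<in> {0..T} \<Longrightarrow> x \<in> {0..l} \<Longrightarrow> \<delta>1 \<le> hs (z t) x" using base_solution_lower[OF b] by blast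
  obtain \<delta>2 where d2: "0 < \<delta>2" "\<And>t x. t \<in> {0..T} \<Longrightarrow> x \<in> {0..l} \<Longrightarrow> \<delta>2 \<le> hs (z' t) x" using base_solution_lower[OF b'] by blast
  define tr where "tr x = (\<lambda>t. (z t x, k t x)) ` {0..T} \<union> (\<lambda>t. (z' t x, k' t x)) ` {0..T}" for x
  have trc: "compact (tr x)" if "x \<in> {0..l}" for x
  proof -
    have "continuous_on {0..T} (\<lambda>t. u t x)" if "jcont u" for u using continuous_on_slice1[of T l u x] that \<open>x \<in> {0..l}\<close> unfolding jcont_def by simp
    then show ?thesis unfolding tr_def using B B' by (intro compact_Un compact_continuous_image continuous_on_Pair compact_Icc) auto
  qed
  have tr_in: "(Z i x, K i x) \<in> tr x" if "i \<in> Gd" for i x using that unfolding tr_def Z_def K_def Gd_def by auto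
  have trU: "tr 0 \<subseteq> U" "tr l \<subseteq> U" unfolding tr_def using B B' by auto
  have dl: "min \<delta>1 \<delta>2 \<le> hs (Z i) x" if "i \<in> Gd" "x \<in> {0..l}" for i x
    using that d1(2)[of "fst i" x] d2(2)[of "fst i" x] unfolding Z_def Gd_def by auto
  have dp: "0 < min \<delta>1 \<delta>2" using d1 d2 by simp
  note F = LB_field[OF L.lipschitz_class_axioms _ LBs dp dl trc[OF ends(1)] trU(1) tr_in trc[OF ends(2)] trU(2) tr_in, of fst T]
  have F: "L.LB (\<lambda>i. GU (fst i) (Z i) (W i) (K i))" "L.LB (\<lambda>i. GX (fst i) (Z i) (W i) (K i))"
    by (rule F; auto simp: rel_def Gd_def)+
  obtain L1 where L1: "0 \<le> L1" "\<And>i j d x. i \<in> Gd \<Longrightarrow> j \<in> Gd \<Longrightarrow> rel i j d \<Longrightarrow> x \<in> {0..l} \<Longrightarrow>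
      \<bar>GU (fst i) (Z i) (W i) (K i) x - GU (fst j) (Z j) (W j) (K j) x\<bar> \<le> L1 * d" by (rule L.LBE[OF F(1)]) blast
  obtain L2 where L2: "0 \<le> L2" "\<And>i j d x. i \<in> Gd \<Longrightarrow> j \<in> Gd \<Longrightarrow> rel i j d \<Longrightarrow> x \<in> {0..l} \<Longrightarrow>
      \<bar>GX (fst i) (Z i) (W i) (K i) x - GX (fst j) (Z j) (W j) (K j) x\<bar> \<le> L2 * d" by (rule L.LBE[OF F(2)]) blast
  define E where "E t x = (z t x - z' t x, w t x - w' t x, k t x - k' t x)" for t x
  define E' where "E' t x = (- (w t x - w' t x), GX t (z t) (w t) (k t) x - GX t (z' t) (w' t) (k' t) x,
     GU t (z t) (w t) (k t) x - GU t (z' t) (w' t) (k' t) x)" for t x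
  have "E t x = 0"
  proof (rule gronwall_zero[where L="1 + L2 + L1" and E=E and E'=E', OF _ _ _ _ _ t x])
    show "continuous_on ({0..T} \<times> {0..l}) (\<lambda>p. E (fst p) (snd p))"
      unfolding E_def using B B' unfolding jcont_def case_prod_unfold by (intro continuous_intros) auto
    show "0 < 1 + L2 + L1" using L1 L2 by simp
    show "((\<lambda>t. E t x) has_vector_derivative E' t x) (at t within {0..T})" if tx: "t \<in> {0..T}" "x \<in> {0..l}" for t x
      unfolding E_def E'_def
    proof (intro has_vector_derivative_Pair)
      show "((\<lambda>t. z t x - z' t x) has_vector_derivative - (w t x - w' t x)) (at t within {0..T})"
        using B B' tx DERIV_diff[of "\<lambda>t. z t x" "- w t x" t "{0..T}" "\<lambda>t. z' t x" "- w' t x"]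
        unfolding tderiv_def has_real_derivative_iff_has_vector_derivative by simp
      show "((\<lambda>t. w t x - w' t x) has_vector_derivative GX t (z t) (w t) (k t) x - GX t (z' t) (w' t) (k' t) x) (at t within {0..T})"
        "((\<lambda>t. k t x - k' t x) has_vector_derivative GU t (z t) (w t) (k t) x - GU t (z' t) (w' t) (k' t) x) (at t within {0..T})"
        using B B' tx unfolding tderiv_def has_real_derivative_iff_has_vector_derivative by (intro has_vector_derivative_diff; simp)+
    qed
    show "norm (E' t x) \<le> (1 + L2 + L1) * d" if tx: "t \<in> {0..T}" "x \<in> {0..l}" and d: "\<And>y. y \<in> {0..l} \<Longrightarrow> norm (E t y) \<le> d" for t x d
    proof -
      have le: "\<bar>z t y - z' t y\<bar> \<le> d" "\<bar>w t y - w' t y\<bar> \<le> d" "\<bar>k t y - k' t y\<bar> \<le> d" if "y \<in> {0..l}" for y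
        using norm3(1,2,3)[of "E t y"] d[OF that] unfolding E_def by simp_all
      have i: "(t, True) \<in> Gd" "(t, False) \<in> Gd" "rel (t, True) (t, False) d"
        using tx le unfolding Gd_def rel_def Z_def W_def K_def by auto
      have "norm (E' t x) \<le> \<bar>w t x - w' t x\<bar> + \<bar>GX t (z t) (w t) (k t) x - GX t (z' t) (w' t) (k' t) x\<bar> + \<bar>GU t (z t) (w t) (k t) x - GU t (z' t) (w' t) (k' t) x\<bar>"
        using norm3(5)[of "E' t x"] unfolding E'_def by simp
      also have "\<dots> \<le> d + L2 * d + L1 * d"
        using le(2)[OF tx(2)] L1(2)[OF i tx(2)] L2(2)[OF i tx(2)] unfolding Z_def W_def K_def by simp
      finally show ?thesis by (simp add: algebra_simps)
    qed
  qed (use init in \<open>simp add: E_def zero_prod_def\<close>)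
  then show "z t x = z' t x" "w t x = w' t x" "k t x = k' t x" unfolding E_def by (simp_all add: zero_prod_def)
qed

end

section \<open>From Sobolev solutions to the evolution equation\<close>

context problem
begin

lemma fs_primitive:
  assumes z: "primitive l z z1" and k: "primitive l k k1" and h: "\<And>x. x \<in> {0..l} \<Longrightarrow> 0 < hs z x"
  obtains f1 where "primitive l (fs z k) f1"
proof -
  have l0: "0 \<le> l" using l_pos by simp
  have H: "primitive l (hs z) (\<lambda>x. 0 + z1 x - b1 x)" unfolding hs_def[abs_def]
    by (intro primitive_diff primitive_add primitive_const z primitive_C1[OF b_deriv St_cont(3)])
  obtain x0 where x0: "x0 \<in> {0..l}" "\<forall>y\<in>{0..l}. hs z x0 \<le> hs z y"
    using continuous_attains_inf[OF compact_Icc _ primitive_continuous[OF H]] ends by blast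
  have "primitive l (\<lambda>x. 1 / hs z x) (\<lambda>x. - ((0 + z1 x - b1 x) * (1 / hs z x) * (1 / hs z x)))"
    by (rule primitive_inverse[OF H l0 h[OF x0(1)]]) (use x0 in auto)
  from that[unfolded fs_def[abs_def], OF primitive_add[OF primitive_cmult[OF primitive_diff[OF primitive_mult[OF H H l0] primitive_const]] primitive_mult[OF this primitive_mult[OF k k l0] l0]]]
  show ?thesis .
qed

text \<open>By the Sobolev embedding z, q and w are jointly continuous and differentiable in time,
  and the first equation holds pointwise. The momentum equation with the boundary rates is a
  two-point problem for \<partial>t q, and \<open>elliptic_unique\<close> identifies its solution
  with \<open>GU\<close>. Through this lemma uniqueness for the evolution equation becomes
  uniqueness for the original system.\<close>

lemma BA_on_base:
  assumes BA: "BA_on (Suc m) zin kin J z q" and \<tau>: "0 < \<tau>" "{0..\<tau>} \<subseteq> J"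
    and h0: "\<And>x. x \<in> {0..l} \<Longrightarrow> 0 < hs zin x"
  obtains w where "evolution.base_solution l h0 g b \<phi>1 \<pi>1 \<phi>2 \<pi>2 N0 Nl U \<xi>0 \<gamma>0 \<xi>l \<gamma>l \<tau> z w q"
    "\<And>t. t \<in> {0..\<tau>} \<Longrightarrow> primitive l (q t) (w t) \<and> continuous_on {0..l} (w t)"
proof -
  interpret E: evolution l h0 g b \<phi>1 \<pi>1 \<phi>2 \<pi>2 N0 Nl U \<xi>0 \<gamma>0 \<xi>l \<gamma>l \<tau> by unfold_locales (use \<tau> l_pos in auto)
  note B = BA[unfolded BA_on_def]
  have htd: "has_time_deriv k l J u (time_deriv k l J u t) t" if "smooth_in_time k l J u" "t \<in> J" for k u t
  proof -
    have "\<exists>v. has_time_deriv k l J ((time_deriv k l J ^^ 0) u) v t" using that unfolding smooth_in_time_def by blast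
    then show ?thesis unfolding time_deriv_def[of k l J u t] funpow_0 by (rule someI_ex)
  qed
  define zt where "zt = time_deriv (Suc m) l J z"
  define u where "u = time_deriv (Suc (Suc m)) l J q"
  have hz: "has_time_deriv (Suc m) l J z (zt t) t" and hq: "has_time_deriv (Suc (Suc m)) l J q (u t) t" if "t \<in> J" for t
    using htd[OF _ that] B unfolding zt_def u_def by auto
  have chz: "\<exists>c. chain l (Suc m) c \<and> c 0 = z t" and chzt: "\<exists>c. chain l (Suc m) c \<and> c 0 = zt t"
    and chq: "\<exists>c. chain l (Suc (Suc m)) c \<and> c 0 = q t" and chu: "\<exists>c. chain l (Suc (Suc m)) c \<and> c 0 = u t" if "t \<in> J" for t
    using hz[OF that] hq[OF that] that sobolev_cont_chain[OF _ l_pos] unfolding has_time_deriv_def by metis+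
  obtain cz where cz: "\<And>t. t \<in> J \<Longrightarrow> chain l (Suc m) (cz t)" "\<And>t. t \<in> J \<Longrightarrow> cz t 0 = z t" using chz by metis
  obtain czt where czt: "\<And>t. t \<in> J \<Longrightarrow> chain l (Suc m) (czt t)" "\<And>t. t \<in> J \<Longrightarrow> czt t 0 = zt t" using chzt by metis
  obtain cq where cq: "\<And>t. t \<in> J \<Longrightarrow> chain l (Suc (Suc m)) (cq t)" "\<And>t. t \<in> J \<Longrightarrow> cq t 0 = q t" using chq by metis
  obtain cu where cu: "\<And>t. t \<in> J \<Longrightarrow> chain l (Suc (Suc m)) (cu t)" "\<And>t. t \<in> J \<Longrightarrow> cu t 0 = u t" using chu by metis
  define w where "w t = cq t 1" for t
  define u1 where "u1 t = cu t 1" for t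
  define u2 where "u2 t = cu t 2" for t
  have pz: "primitive l (z t) (cz t 1)" and pzt: "primitive l (zt t) (czt t 1)" and pq: "primitive l (q t) (w t)" "primitive l (w t) (cq t 2)"
    and pu: "primitive l (u t) (u1 t)" "primitive l (u1 t) (u2 t)" if "t \<in> J" for t
    using cz[OF that] czt[OF that] cq[OF that] cu[OF that] unfolding chain_def w_def u1_def u2_def numeral_2_eq_2 by force+
  have J: "t \<in> J" if "t \<in> {0..\<tau>}" for t using that \<tau> by blast
  have uni: "\<exists>d>0. \<forall>s\<in>{0..\<tau>}. \<bar>s - t\<bar> < d \<longrightarrow> (\<forall>x\<in>{0..l}. \<bar>z s x - z t x\<bar> < e)"
    "\<exists>d>0. \<forall>s\<in>{0..\<tau>}. \<bar>s - t\<bar> < d \<longrightarrow> (\<forall>x\<in>{0..l}. \<bar>q s x - q t x\<bar> < e)"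
    "\<exists>d>0. \<forall>s\<in>{0..\<tau>}. \<bar>s - t\<bar> < d \<longrightarrow> (\<forall>x\<in>{0..l}. \<bar>w s x - w t x\<bar> < e)" if t: "t \<in> {0..\<tau>}" and e: "0 < e" for t e
  proof -
    note t' = J[OF t]
    have "\<exists>d>0. \<forall>s\<in>J. \<bar>s - t\<bar> < d \<longrightarrow> (\<forall>x\<in>{0..l}. \<bar>cz s 0 x - cz t 0 x\<bar> < e)"
      by (rule has_time_deriv_chain(2)[OF hz[OF t'] l_pos t' cz czt(1)[OF t'] czt(2)[OF t'] _ e]) auto
    then show "\<exists>d>0. \<forall>s\<in>{0..\<tau>}. \<bar>s - t\<bar> < d \<longrightarrow> (\<forall>x\<in>{0..l}. \<bar>z s x - z t x\<bar> < e)"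
      using cz(2) t' \<tau>(2) by (metis subsetD)
    have "\<exists>d>0. \<forall>s\<in>J. \<bar>s - t\<bar> < d \<longrightarrow> (\<forall>x\<in>{0..l}. \<bar>cq s 0 x - cq t 0 x\<bar> < e)"
      by (rule has_time_deriv_chain(2)[OF hq[OF t'] l_pos t' cq cu(1)[OF t'] cu(2)[OF t'] _ e]) auto
    then show "\<exists>d>0. \<forall>s\<in>{0..\<tau>}. \<bar>s - t\<bar> < d \<longrightarrow> (\<forall>x\<in>{0..l}. \<bar>q s x - q t x\<bar> < e)"
      using cq(2) t' \<tau>(2) by (metis subsetD)
    have "\<exists>d>0. \<forall>s\<in>J. \<bar>s - t\<bar> < d \<longrightarrow> (\<forall>x\<in>{0..l}. \<bar>cq s 1 x - cq t 1 x\<bar> < e)"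
      by (rule has_time_deriv_chain(2)[OF hq[OF t'] l_pos t' cq cu(1)[OF t'] cu(2)[OF t'] _ e]) auto
    then show "\<exists>d>0. \<forall>s\<in>{0..\<tau>}. \<bar>s - t\<bar> < d \<longrightarrow> (\<forall>x\<in>{0..l}. \<bar>w s x - w t x\<bar> < e)"
      using \<tau>(2) unfolding w_def by blast
  qed
  have jc: "E.jcont z" "E.jcont q" "E.jcont w"
    by (rule E.jcontI_uniform; use J pz pq uni in \<open>auto intro!: primitive_continuous\<close>)+
  have der: "((\<lambda>s. z s x) has_real_derivative zt t x) (at t within {0..\<tau>})" "((\<lambda>s. q s x) has_real_derivative u t x) (at t within {0..\<tau>})"
    "((\<lambda>s. w s x) has_real_derivative u1 t x) (at t within {0..\<tau>})" if t: "t \<in> {0..\<tau>}" and x: "x \<in> {0..l}" for t x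
  proof -
    note t' = J[OF t]
    show "((\<lambda>s. z s x) has_real_derivative zt t x) (at t within {0..\<tau>})" "((\<lambda>s. q s x) has_real_derivative u t x) (at t within {0..\<tau>})"
      by (rule DERIV_subset[OF has_time_deriv_pointwise[OF hz[OF t'] l_pos t' x] \<tau>(2)] DERIV_subset[OF has_time_deriv_pointwise[OF hq[OF t'] l_pos t' x] \<tau>(2)])+
    have "((\<lambda>s. cq s 1 x) has_real_derivative cu t 1 x) (at t within J)"
      by (rule has_time_deriv_chain(1)[OF hq[OF t'] l_pos t' cq cu(1)[OF t'] cu(2)[OF t'] _ x]) auto
    then show "((\<lambda>s. w s x) has_real_derivative u1 t x) (at t within {0..\<tau>})" unfolding w_def u1_def by (rule DERIV_subset[OF _ \<tau>(2)])
  qed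
  have zt: "zt t x = - w t x" if t: "t \<in> {0..\<tau>}" and x: "x \<in> {0..l}" for t x
  proof -
    note t' = J[OF t]
    have "AE x in lebesgue_on {0<..<l}. zt t x + weak_deriv l 1 (q t) x = 0" using B t' unfolding zt_def by blast
    moreover have "AE x in lebesgue_on {0<..<l}. weak_deriv l 1 (q t) x = w t x" by (rule weak_deriv_primitive[OF pq(1)[OF t'] l_pos]) simp
    ultimately have "AE x in lebesgue_on {0<..<l}. zt t x = - w t x" by eventually_elim linarith
    then have "negligible {x \<in> {0..l}. zt t x \<noteq> - w t x}" unfolding AE_Ioo_iff negligible_Icc_iff .
    from continuous_eq_if_AE_eq[OF primitive_continuous[OF pzt[OF t']] _ this l_pos x] show ?thesis
      using primitive_continuous[OF pq(2)[OF t']] by (auto intro: continuous_intros)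
  qed
  \<comment> \<open>A solution is only required to have nonzero depth. The depth is continuous in
    time and positive initially, so by the intermediate value theorem it stays positive.\<close>
  have hpos: "0 < hs (z t) x" if t: "t \<in> {0..\<tau>}" and x: "x \<in> {0..l}" for t x
  proof (rule ccontr)
    assume n: "\<not> 0 < hs (z t) x"
    have c: "continuous_on {0..t} (\<lambda>s. hs (z s) x)" unfolding hs_def
      by (intro continuous_intros DERIV_continuous_on[OF DERIV_subset[OF der(1)[OF _ x]]]) (use t in auto)
    have "0 < hs (z 0) x" using h0[OF x] B x unfolding hs_def by simp
    then obtain s where "s \<in> {0..t}" "hs (z s) x = 0" using IVT2'[of "\<lambda>s. hs (z s) x" t 0 0, OF _ _ _ c] n t by fastforce
    moreover from this have "s \<in> J" using J[of s] t by simp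
    ultimately show False using B x unfolding hs_def by auto
  qed
  have tr: "(z t 0, q t 0) \<in> U" "(z t l, q t l) \<in> U" if "t \<in> {0..\<tau>}" for t using B J[OF that] by blast+
  have bnd0: "if N0 then u1 t 0 = B0.dval t (z t 0) (q t 0) (w t 0) else u t 0 = B0.dval t (z t 0) (q t 0) (w t 0)"
    and bndl: "if Nl then u1 t l = Bl.dval t (z t l) (q t l) (w t l) else u t l = Bl.dval t (z t l) (q t l) (w t l)" if t: "t \<in> {0..\<tau>}" for t
  proof -
    have "\<forall>t\<in>{0..\<tau>}. if N0 then u1 t 0 = B0.dval t (z t 0) (q t 0) (w t 0) else u t 0 = B0.dval t (z t 0) (q t 0) (w t 0)"
      using B0.boundary_rate[of \<tau> "\<lambda>t. z t 0" "\<lambda>t. q t 0" "\<lambda>t. w t 0" "\<lambda>t. u t 0" "\<lambda>t. u1 t 0", OF \<tau>(1) tr(1)] der[OF _ ends(1)] zt[OF _ ends(1)] B J by simp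
    then show "if N0 then u1 t 0 = B0.dval t (z t 0) (q t 0) (w t 0) else u t 0 = B0.dval t (z t 0) (q t 0) (w t 0)" using t by blast
    have "\<forall>t\<in>{0..\<tau>}. if Nl then u1 t l = Bl.dval t (z t l) (q t l) (w t l) else u t l = Bl.dval t (z t l) (q t l) (w t l)"
      using Bl.boundary_rate[of \<tau> "\<lambda>t. z t l" "\<lambda>t. q t l" "\<lambda>t. w t l" "\<lambda>t. u t l" "\<lambda>t. u1 t l", OF \<tau>(1) tr(2)] der[OF _ ends(2)] zt[OF _ ends(2)] B J by simp
    then show "if Nl then u1 t l = Bl.dval t (z t l) (q t l) (w t l) else u t l = Bl.dval t (z t l) (q t l) (w t l)" using t by blast
  qed
  have UX: "u t x = GU t (z t) (w t) (q t) x \<and> u1 t x = GX t (z t) (w t) (q t) x" if t: "t \<in> {0..\<tau>}" and x: "x \<in> {0..l}" for t x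
  proof -
    note t' = J[OF t]
    obtain f1 where f1: "primitive l (fs (z t) (q t)) f1" by (rule fs_primitive[OF pz[OF t'] pq(1)[OF t'] hpos[OF t]])
    define p where "p x = hb x * u1 t x - 3 * (ihb x * fs (z t) (q t) x)" for x
    note pde = pde_iff(1)[OF pu[OF t'] f1] pde_iff(2)[OF pu[OF t'] f1, of "hs (z t)"]
    have ch: "continuous_on {0..l} (hs (z t))" unfolding hs_def[abs_def]
      by (intro continuous_intros primitive_continuous[OF pz[OF t']] St_continuous[OF St_b(1)])
    have cf: "continuous_on {0..l} (fs (z t) (q t))" by (rule primitive_continuous[OF f1])
    have fN: "f_NSW g h0 b (z t) (q t) = fs (z t) (q t)" by (rule ext) (rule fs_NSW[symmetric])
    have "AE x in lebesgue_on {0<..<l}. u t x + (h0 - b x) * T_op l h0 b (u t) x + weak_deriv l 1 (f_NSW g h0 b (z t) (q t)) x = - g * (h0 + z t x - b x) * deriv b x"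
      using B t' unfolding u_def by simp
    then have ae: "AE x in lebesgue_on {0<..<l}. hb x * u2 t x - b1 x * u1 t x - 3 * (b1 x * (ihb x * ihb x) * fs (z t) (q t) x + ihb x * f1 x) = 3 * cc x * ihb x * u t x + F2 (hs (z t)) (fs (z t) (q t)) x"
      unfolding pde(2)[symmetric] fN hs_def .
    have pp: "primitive l p (\<lambda>x. 3 * cc x * ihb x * u t x + F2 (hs (z t)) (fs (z t) (q t)) x)"
      unfolding p_def
      by (rule primitive_AE[OF pde(1) _ ae])
        (intro continuous_absolutely_integrable continuous_intros St_cont F_cont ch cf primitive_continuous[OF pu(1)[OF t']])
    have up: "ihb x * p x + F1 (fs (z t) (q t)) x = u1 t x" if "x \<in> {0..l}" for x
      using hb_gt_0[OF that] unfolding p_def F1_def ihb_def by (simp add: field_simps)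
    have pu': "primitive l (u t) (\<lambda>x. ihb x * p x + F1 (fs (z t) (q t)) x)"
      by (rule primitive_cong[THEN iffD1, OF _ _ _ pu(1)[OF t']]) (use up l_pos in auto)
    note el = elliptic_unique[OF ch cf pu' pp]
    have bc: "if N0 then ihb 0 * p 0 + F1 (fs (z t) (q t)) 0 = D0 t (z t) (w t) (q t) else u t 0 = D0 t (z t) (w t) (q t)"
      "if Nl then ihb l * p l + F1 (fs (z t) (q t)) l = Dl t (z t) (w t) (q t) else u t l = Dl t (z t) (w t) (q t)"
      unfolding up[OF ends(1)] up[OF ends(2)] D0_def Dl_def using bnd0[OF t] bndl[OF t] by (simp_all only:)
    have "u t x = GU t (z t) (w t) (q t) x" "p x = GP t (z t) (w t) (q t) x" unfolding GU_def GP_def by (rule el[OF bc x])+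
    moreover from this have "u1 t x = GX t (z t) (w t) (q t) x" unfolding GX_def Ux_def GP_def[symmetric] using up[OF x] by simp
    ultimately show ?thesis by blast
  qed
  have "E.base_solution z w q" unfolding E.base_solution_def E.tderiv_def
    using jc der zt UX hpos tr by simp
  then show ?thesis using pq J by (intro that) (auto intro!: primitive_continuous)
qed

end


lemma (in rect_rho) R_chain:
  assumes c: "chain l n c" and last: "c n = r1 \<or> c n = r2" and l: "0 < l"
  shows "j \<le> n \<Longrightarrow> R (n - j) (\<lambda>t. c j)"
proof (induction j rule: inc_induct)
  case base
  have "R 0 (\<lambda>t. r1)" by (rule R0I[of "\<lambda>t x. 0" "\<lambda>t x. 1" "\<lambda>t x. 0"]) (auto intro: S_intros(1))
  moreover have "R 0 (\<lambda>t. r2)" by (rule R0I[of "\<lambda>t x. 0" "\<lambda>t x. 0" "\<lambda>t x. 1"]) (auto intro: S_intros(1))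
  ultimately show ?case using last by auto
next
  case (step j)
  have p: "primitive l (c j) (c (Suc j))" using c step(2) unfolding chain_def by blast
  have "R (Suc (n - Suc j)) (\<lambda>t. c j)" by (rule R_SucI[OF S_intros(2)[OF primitive_continuous[OF p]] step.IH p])
  then show ?case using step(2) by (simp add: Suc_diff_Suc)
qed

section \<open>From the evolution equation to Sobolev solutions\<close>

context problem
begin

lemma BA_on_local_existence:
  assumes zin: "chain l (Suc m) cz" and kin: "chain l (Suc (Suc m)) ck"
    and \<delta>0: "0 < \<delta>0" "\<And>x. x \<in> {0..l} \<Longrightarrow> \<delta>0 \<le> hs (cz 0) x"
    and tr: "(cz 0 0, ck 0 0) \<in> U" "(cz 0 l, ck 0 l) \<in> U"
    and bc: "\<xi>0 (cz 0 0, ck 0 0) = \<gamma>0 0" "\<xi>l (cz 0 l, ck 0 l) = \<gamma>l 0"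
    and comp0: "N0 \<longrightarrow> ck 1 0 = - B0.g1 0 / B0.xz (cz 0 0, ck 0 0)"
    and compl: "Nl \<longrightarrow> ck 1 l = - Bl.g1 0 / Bl.xz (cz 0 l, ck 0 l)"
  obtains T z q where "0 < T" "BA_on (Suc m) (cz 0) (ck 0) {0..T} z q"
proof -
  have pz: "primitive l (cz 0) (cz 1)" and pk: "primitive l (ck 0) (ck 1)" "primitive l (ck 1) (ck 2)"
    using zin kin unfolding chain_def numeral_2_eq_2 by force+
  obtain T z w k where T: "0 < T" and bs: "evolution.base_solution l h0 g b \<phi>1 \<pi>1 \<phi>2 \<pi>2 N0 Nl U \<xi>0 \<gamma>0 \<xi>l \<gamma>l T z w k"
    and init: "\<And>x. x \<in> {0..l} \<Longrightarrow> z 0 x = cz 0 x \<and> w 0 x = ck 1 x \<and> k 0 x = ck 0 x"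
    using base_local[OF primitive_continuous[OF pz] primitive_continuous[OF pk(2)] primitive_continuous[OF pk(1)] \<delta>0 tr] by blast
  have SI: "SI l (cz (Suc m))" "SI l (ck (Suc (Suc m)))" using zin kin unfolding chain_def by auto
  \<comment> \<open>The highest derivatives of the two data become \<open>r1\<close> and
    \<open>r2\<close>. Everything below them is an iterated primitive, so by \<open>R_chain\<close>
    the data lie in the class \<open>R (Suc m)\<close>.\<close>
  interpret E: evolution_rho l h0 g b \<phi>1 \<pi>1 \<phi>2 \<pi>2 N0 Nl U \<xi>0 \<gamma>0 \<xi>l \<gamma>l T "cz (Suc m)" "ck (Suc (Suc m))"
    by unfold_locales (use T l_pos SI in auto)
  have ck1: "chain l (Suc m) (\<lambda>j. ck (Suc j))" using kin unfolding chain_def by auto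
  have data: "E.R (Suc m) (\<lambda>t. z 0)" "E.R (Suc m) (\<lambda>t. w 0)"
    using E.R_cong[OF _ E.R_chain[OF zin _ l_pos, of 0], of "\<lambda>t. z 0"] E.R_cong[OF _ E.R_chain[OF ck1 _ l_pos, of 0], of "\<lambda>t. w 0"] init by simp_all
  have i: "primitive l (k 0) (w 0)"
    by (rule primitive_cong[THEN iffD1, OF _ _ _ pk(1)]) (use init l_pos in auto)
  note R = E.base_solution_R[OF bs i data]
  note B = bs[unfolded E.base_solution_def]
  let ?u = "\<lambda>t. GU t (z t) (w t) (k t)"
  have sz: "smooth_in_time (Suc m) l {0..T} z" and tz: "\<And>t x. t \<in> {0..T} \<Longrightarrow> x \<in> {0..l} \<Longrightarrow> time_deriv (Suc m) l {0..T} z t x = - w t x"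
    using E.R_smooth_in_time[OF R(1)] B by auto
  have sk: "smooth_in_time (Suc (Suc m)) l {0..T} k" and tk: "\<And>t x. t \<in> {0..T} \<Longrightarrow> x \<in> {0..l} \<Longrightarrow> time_deriv (Suc (Suc m)) l {0..T} k t x = ?u t x"
    using E.R_smooth_in_time[OF R(3)] B by auto
  have kw: "primitive l (k t) (w t)" if "t \<in> {0..T}" for t by (rule E.base_solution_primitive[OF bs i that])
  have bcs: "\<xi>0 (z t 0, k t 0) = \<gamma>0 t" "\<xi>l (z t l, k t l) = \<gamma>l t" if t: "t \<in> {0..T}" for t
  proof -
    have trU: "(z t 0, k t 0) \<in> U" "(z t l, k t l) \<in> U" if "t \<in> {0..T}" for t using B that by auto
    have d: "((\<lambda>t. z t x) has_real_derivative - w t x) (at t within {0..T})" "((\<lambda>t. k t x) has_real_derivative ?u t x) (at t within {0..T})"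
      "((\<lambda>t. w t x) has_real_derivative GX t (z t) (w t) (k t) x) (at t within {0..T})" if "t \<in> {0..T}" "x \<in> {0..l}" for t x
      using B that unfolding E.tderiv_def by auto
    have r0: "if N0 then GX t (z t) (w t) (k t) 0 = B0.dval t (z t 0) (k t 0) (w t 0) else ?u t 0 = B0.dval t (z t 0) (k t 0) (w t 0)"
      and rl: "if Nl then GX t (z t) (w t) (k t) l = Bl.dval t (z t l) (k t l) (w t l) else ?u t l = Bl.dval t (z t l) (k t l) (w t l)" for t
      unfolding D0_def[symmetric] Dl_def[symmetric] GX_def GU_def by (rule Ue_bc)+
    have "\<forall>t\<in>{0..T}. \<xi>0 (z t 0, k t 0) = \<gamma>0 t"
    proof (rule B0.boundary_rate[of T "\<lambda>t. z t 0" "\<lambda>t. k t 0" "\<lambda>t. w t 0" "\<lambda>t. ?u t 0" "\<lambda>t. GX t (z t) (w t) (k t) 0", OF T trU(1) d[OF _ ends(1)], THEN iffD2], assumption+, intro conjI ballI)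
      show "\<xi>0 (z 0 0, k 0 0) = \<gamma>0 0" using bc(1) init[OF ends(1)] by simp
      show "N0 \<longrightarrow> w 0 0 = - B0.g1 0 / B0.xz (z 0 0, k 0 0)" using comp0 init[OF ends(1)] by simp
    qed (rule r0)
    then show "\<xi>0 (z t 0, k t 0) = \<gamma>0 t" using t by blast
    have "\<forall>t\<in>{0..T}. \<xi>l (z t l, k t l) = \<gamma>l t"
    proof (rule Bl.boundary_rate[of T "\<lambda>t. z t l" "\<lambda>t. k t l" "\<lambda>t. w t l" "\<lambda>t. ?u t l" "\<lambda>t. GX t (z t) (w t) (k t) l", OF T trU(2) d[OF _ ends(2)], THEN iffD2], assumption+, intro conjI ballI)
      show "\<xi>l (z 0 l, k 0 l) = \<gamma>l 0" using bc(2) init[OF ends(2)] by simp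
      show "Nl \<longrightarrow> w 0 l = - Bl.g1 0 / Bl.xz (z 0 l, k 0 l)" using compl init[OF ends(2)] by simp
    qed (rule rl)
    then show "\<xi>l (z t l, k t l) = \<gamma>l t" using t by blast
  qed
  have pde1: "AE x in lebesgue_on {0<..<l}. time_deriv (Suc m) l {0..T} z t x + weak_deriv l 1 (k t) x = 0" if t: "t \<in> {0..T}" for t
  proof -
    have "AE x in lebesgue_on {0<..<l}. weak_deriv l 1 (k t) x = w t x" by (rule weak_deriv_primitive[OF kw[OF t] l_pos]) simp
    then show ?thesis using AE_St by eventually_elim (simp add: tz[OF t])
  qed
  have pde2: "AE x in lebesgue_on {0<..<l}.
         time_deriv (Suc m + 1) l {0..T} k t x + (h0 - b x) * T_op l h0 b (time_deriv (Suc m + 1) l {0..T} k t) x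
           + weak_deriv l 1 (f_NSW g h0 b (z t) (k t)) x = - g * (h0 + z t x - b x) * deriv b x" if t: "t \<in> {0..T}" for t
  proof -
    have hs: "0 < hs (z t) x" if "x \<in> {0..l}" for x using B t that by blast
    obtain z1 where "primitive l (z t) z1" using R(1) t unfolding E.R.simps by blast
    then obtain f1 where f1: "primitive l (fs (z t) (k t)) f1" using fs_primitive[OF _ kw[OF t] hs] by blast
    note sl = E.base_solution_slices[OF bs t]
    have l0: "0 \<le> l" using l_pos by simp
    have P: "primitive l (GP t (z t) (w t) (k t)) (\<lambda>x. 3 * cc x * ihb x * ?u t x + F2 (hs (z t)) (fs (z t) (k t)) x)"
      unfolding GP_def GU_def
    proof (rule primitive_C1[OF Ue_deriv(2)[OF sl(1,2)]])
      have cU: "continuous_on {0..l} (Ue (hs (z t)) (fs (z t) (k t)) (D0 t (z t) (w t) (k t)) (Dl t (z t) (w t) (k t)))"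
        by (rule DERIV_continuous_on[OF Ue_deriv(1)[OF sl(1,2)]])
      show "continuous_on {0..l} (\<lambda>x. 3 * cc x * ihb x * Ue (hs (z t)) (fs (z t) (k t)) (D0 t (z t) (w t) (k t)) (Dl t (z t) (w t) (k t)) x + F2 (hs (z t)) (fs (z t) (k t)) x)"
        by (intro continuous_intros St_cont F_cont sl cU)
    qed
    have u: "primitive l (?u t) (GX t (z t) (w t) (k t))"
      unfolding GU_def GX_def by (rule primitive_C1[OF Ue_deriv(1)[OF sl(1,2)]]) (use sl(4) in \<open>simp_all add: GX_def\<close>)
    have "\<exists>u2. primitive l (GX t (z t) (w t) (k t)) u2"
      unfolding GX_def Ux_def[abs_def] F1_def GP_def[symmetric]
      by (rule exI, rule primitive_add[OF primitive_mult[OF ihb_primitive P l0] primitive_mult[OF primitive_cmult[OF primitive_mult[OF ihb_primitive ihb_primitive l0]] f1 l0]])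
    then obtain u2 where u2: "primitive l (GX t (z t) (w t) (k t)) u2" by blast
    note pde = pde_iff(1)[OF u u2 f1] pde_iff(2)[OF u u2 f1, of "hs (z t)"]
    have P': "primitive l (GP t (z t) (w t) (k t)) (\<lambda>x. hb x * u2 x - b1 x * GX t (z t) (w t) (k t) x - 3 * (b1 x * (ihb x * ihb x) * fs (z t) (k t) x + ihb x * f1 x))"
    proof (rule primitive_cong[THEN iffD1, OF _ refl _ pde(1)])
      show "hb x * GX t (z t) (w t) (k t) x - 3 * (ihb x * fs (z t) (k t) x) = GP t (z t) (w t) (k t) x" if "x \<in> {0..l}" for x
        using hb_gt_0[OF that] unfolding GX_def Ux_def GP_def[symmetric] F1_def ihb_def by (simp add: field_simps)
    qed (rule l0)
    \<comment> \<open>Both sides are densities of the same function \<open>GP\<close>, one from the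
      first order system and one from the definition of p, so they agree almost everywhere; by
      \<open>pde_iff\<close> this is the momentum equation.\<close>
    have "AE x in lebesgue_on {0<..<l}. hb x * u2 x - b1 x * GX t (z t) (w t) (k t) x - 3 * (b1 x * (ihb x * ihb x) * fs (z t) (k t) x + ihb x * f1 x)
        = 3 * cc x * ihb x * ?u t x + F2 (hs (z t)) (fs (z t) (k t)) x"
      using weak_deriv_primitive[OF P l_pos AE_I2[OF refl]] weak_deriv_primitive[OF P' l_pos AE_I2[OF refl]]
      by eventually_elim simp
    then have ae: "AE x in lebesgue_on {0<..<l}. ?u t x + (h0 - b x) * T_op l h0 b (?u t) x + weak_deriv l 1 (fs (z t) (k t)) x = - g * hs (z t) x * deriv b x"
      unfolding pde(2) .
    have fN: "f_NSW g h0 b (z t) (k t) = fs (z t) (k t)" by (rule ext) (rule fs_NSW[symmetric])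
    have To: "T_op l h0 b (time_deriv (Suc (Suc m)) l {0..T} k t) x = T_op l h0 b (?u t) x" if "x \<in> {0..l}" for x
      by (rule T_op_cong[OF tk[OF t] that])
    show ?thesis unfolding fN using ae AE_St by eventually_elim (simp add: tk[OF t] To hs_def)
  qed
  have "BA_on (Suc m) (cz 0) (ck 0) {0..T} z k"
    unfolding BA_on_def
  proof (intro conjI ballI)
    show "h0 + z t x - b x \<noteq> 0" if "t \<in> {0..T}" "x \<in> {0..l}" for t x using B that unfolding hs_def by force
  qed (use sz sk bcs pde1 pde2 init B in auto)
  then show ?thesis using that T by blast
qed

end

context problem
begin

lemma BA_on_unique:
  assumes BA: "BA_on (Suc m) zin kin J z q" "BA_on (Suc m) zin kin J' z' q'"
    and J: "{0..t} \<subseteq> J" "{0..t} \<subseteq> J'" "0 \<le> t" and h0: "\<And>x. x \<in> {0..l} \<Longrightarrow> 0 < hs zin x" and x: "x \<in> {0..l}"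
  shows "z' t x = z t x" "q' t x = q t x"
proof -
  note B = BA[unfolded BA_on_def]
  have init: "z 0 x = z' 0 x" "q 0 x = q' 0 x" if "x \<in> {0..l}" for x using B that by auto
  show "z' t x = z t x" "q' t x = q t x"
  proof (atomize (full), cases "t = 0")
    case True then show "z' t x = z t x \<and> q' t x = q t x" using init x by simp
  next
    case False
    then have t: "0 < t" using J(3) by simp
    interpret E: evolution l h0 g b \<phi>1 \<pi>1 \<phi>2 \<pi>2 N0 Nl U \<xi>0 \<gamma>0 \<xi>l \<gamma>l t by unfold_locales (use t l_pos in auto)
    obtain w where w: "E.base_solution z w q" "\<And>s. s \<in> {0..t} \<Longrightarrow> primitive l (q s) (w s) \<and> continuous_on {0..l} (w s)"
      using BA_on_base[OF BA(1) t J(1) h0] by blast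
    obtain w' where w': "E.base_solution z' w' q'" "\<And>s. s \<in> {0..t} \<Longrightarrow> primitive l (q' s) (w' s) \<and> continuous_on {0..l} (w' s)"
      using BA_on_base[OF BA(2) t J(2) h0] by blast
    have t0: "0 \<in> {0..t}" using t by simp
    \<comment> \<open>Initial data are prescribed for z and q only. The two values of w agree
      because both are the continuous x-derivative of the common initial discharge.\<close>
    have "w 0 y = w' 0 y" if y: "y \<in> {0..l}" for y
    proof (rule has_real_derivative_unique_within)
      show "(q 0 has_real_derivative w 0 y) (at y within {0..l})" using w(2)[OF t0] y by (blast intro: primitive_has_derivative)
      have "(q' 0 has_real_derivative w' 0 y) (at y within {0..l})" using w'(2)[OF t0] y by (blast intro: primitive_has_derivative)
      then show "(q 0 has_real_derivative w' 0 y) (at y within {0..l})"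
        by (rule has_field_derivative_transform_within[OF _ zero_less_one y]) (simp add: init)
      show "at y within {0..l} \<noteq> bot" using y l_pos by (simp add: trivial_limit_within islimpt_Icc)
    qed
    then show "z' t x = z t x \<and> q' t x = q t x"
      using E.base_solution_unique[OF w(1) w'(1) _ _ x, of t] init t by auto
  qed
qed

end

section \<open>Implicit differentiation of the reconstruction mappings\<close>

lemma implicit_deriv:
  fixes F :: "real \<times> real \<Rightarrow> real"
  assumes F: "(F has_derivative (\<lambda>v. fst v * c1 + snd v * c2)) (at (A s, m s))" and c2: "c2 \<noteq> 0"
    and A: "(A has_real_derivative A') (at s)" and m: "isCont m s"
    and FA: "((\<lambda>r. F (A r, m r)) has_real_derivative d) (at s)"
  shows "(m has_real_derivative (d - c1 * A') / c2) (at s)"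
proof -
  \<comment> \<open>m is not known to be differentiable, so the remainder e cannot be expanded along
    the curve. Measured against the sum norm \<open>N\<close> it splits into (\<eta> sgn) times each
    increment, which is absorbed into the coefficients. The result is an exact linear relation whose
    coefficients tend to c1 and c2, and it can be solved for the increment of m since c2 is
    nonzero.\<close>
  define e where "e p = F p - F (A s, m s) - ((fst p - A s) * c1 + (snd p - m s) * c2)" for p
  define N where "N p = \<bar>fst p - A s\<bar> + \<bar>snd p - m s\<bar>" for p :: "real \<times> real"
  define \<eta> where "\<eta> p = e p / N p" for p
  have eN: "e p = \<eta> p * N p" for p
  proof (cases "N p = 0")
    case True
    then have "p = (A s, m s)" unfolding N_def by (intro prod_eqI) auto
    then show ?thesis unfolding True by (simp add: e_def)
  qed (simp add: \<eta>_def)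
  have lim: "((\<lambda>p. \<eta> p) \<longlongrightarrow> 0) (at (A s, m s))"
  proof (rule Lim_null_comparison)
    have "((\<lambda>p. (F p - F (A s, m s) - (fst (p - (A s, m s)) * c1 + snd (p - (A s, m s)) * c2)) /\<^sub>R norm (p - (A s, m s))) \<longlongrightarrow> 0) (at (A s, m s))"
      using F unfolding has_derivative_at_within by blast
    from tendsto_norm_zero[OF this] show "((\<lambda>p. \<bar>e p\<bar> / norm (p - (A s, m s))) \<longlongrightarrow> 0) (at (A s, m s))"
      by (simp add: e_def divide_inverse mult.commute abs_mult)
    have "norm (\<eta> p) \<le> \<bar>e p\<bar> / norm (p - (A s, m s))" if "p \<noteq> (A s, m s)" for p
    proof -
      have "norm (p - (A s, m s)) \<le> N p" unfolding N_def by (cases p) (simp add: norm_Pair_le[THEN order_trans])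
      moreover have "0 < norm (p - (A s, m s))" using that by simp
      ultimately show ?thesis unfolding \<eta>_def real_norm_def abs_divide
        by (intro frac_le) auto
    qed
    then show "\<forall>\<^sub>F p in at (A s, m s). norm (\<eta> p) \<le> \<bar>e p\<bar> / norm (p - (A s, m s))" unfolding eventually_at_filter by (auto intro: always_eventually)
  qed
  have \<eta>0: "\<eta> (A s, m s) = 0" unfolding \<eta>_def e_def by simp
  have "isCont \<eta> (A s, m s)" using lim \<eta>0 unfolding isCont_def by simp
  moreover have "isCont (\<lambda>r. (A r, m r)) s" using DERIV_isCont[OF A] m by (intro continuous_intros)
  ultimately have "isCont (\<lambda>r. \<eta> (A r, m r)) s" by (rule isCont_o2[rotated])
  then have \<eta>s: "(\<lambda>r. \<eta> (A r, m r)) \<midarrow>s\<rightarrow> 0" using \<eta>0 unfolding isCont_def by simp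
  have sg: "(\<lambda>r. \<eta> (A r, m r) * sgn (f r)) \<midarrow>s\<rightarrow> 0" for f :: "real \<Rightarrow> real"
    by (rule Lim_null_comparison[OF _ tendsto_norm_zero[OF \<eta>s]]) (auto intro!: always_eventually simp: abs_mult sgn_if)
  define \<phi> where "\<phi> r = c1 + \<eta> (A r, m r) * sgn (A r - A s)" for r
  define \<psi> where "\<psi> r = c2 + \<eta> (A r, m r) * sgn (m r - m s)" for r
  have lims: "\<phi> \<midarrow>s\<rightarrow> c1" "\<psi> \<midarrow>s\<rightarrow> c2"
    using tendsto_add[OF tendsto_const sg, of c1] tendsto_add[OF tendsto_const sg, of c2] unfolding \<phi>_def \<psi>_def by simp_all
  have split: "F (A r, m r) - F (A s, m s) = \<phi> r * (A r - A s) + \<psi> r * (m r - m s)" for r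
  proof -
    have "\<eta> (A r, m r) * (sgn (A r - A s) * (A r - A s) + sgn (m r - m s) * (m r - m s)) = e (A r, m r)"
      unfolding eN N_def by (simp add: abs_sgn mult.commute)
    then show ?thesis unfolding \<phi>_def \<psi>_def e_def by (simp add: algebra_simps)
  qed
  have "(\<lambda>r. ((F (A r, m r) - F (A s, m s)) / (r - s) - \<phi> r * ((A r - A s) / (r - s))) / \<psi> r) \<midarrow>s\<rightarrow> (d - c1 * A') / c2"
    using FA A lims c2 unfolding has_field_derivative_iff by (intro tendsto_intros) auto
  moreover have "\<forall>\<^sub>F r in at s. ((F (A r, m r) - F (A s, m s)) / (r - s) - \<phi> r * ((A r - A s) / (r - s))) / \<psi> r = (m r - m s) / (r - s)"
    using tendsto_imp_eventually_ne[OF lims(2) c2] eventually_neq_at_within[of s s UNIV]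
  proof eventually_elim
    case (elim r)
    show ?case unfolding split using elim by (simp add: add_divide_distrib)
  qed
  ultimately show ?thesis unfolding has_field_derivative_iff by (rule Lim_transform_eventually)
qed

text \<open>Implicit differentiation: a nonzero coefficient of \<open>m\<close> in one of the two equations makes \<open>m\<close>,
  which is only known to be continuous, differentiable along lines.\<close>

lemma reconstruction_jacobian:
  fixes F1 F2 \<xi> m :: "real \<times> real \<Rightarrow> real"
  assumes U: "open U" "p \<in> U"
    and \<xi>: "(\<xi> has_derivative (\<lambda>v. fst v * X1 + snd v * X2)) (at p)" and m: "continuous_on U m"
    and F1: "(F1 has_derivative (\<lambda>v. fst v * a1 + snd v * a2)) (at (\<xi> p, m p))"
    and F2: "(F2 has_derivative (\<lambda>v. fst v * a3 + snd v * a4)) (at (\<xi> p, m p))"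
    and id: "\<And>p. p \<in> U \<Longrightarrow> F1 (\<xi> p, m p) = fst p \<and> F2 (\<xi> p, m p) = snd p"
  shows "a2 \<noteq> 0 \<Longrightarrow> X2 \<noteq> 0" "a2 = 0 \<Longrightarrow> a4 \<noteq> 0 \<Longrightarrow> X2 = 0 \<and> a1 * X1 = 1"
proof -
  have sys: "\<exists>m'. (e1 * X1 + e2 * X2) * a1 + m' * a2 = e1 \<and> (e1 * X1 + e2 * X2) * a3 + m' * a4 = e2" if nz: "a2 \<noteq> 0 \<or> a4 \<noteq> 0" for e1 e2
  proof -
    define c where "c = (\<lambda>r. (fst p + e1 * r, snd p + e2 * r))"
    have c0: "c 0 = p" unfolding c_def by simp
    have cd: "((\<lambda>r. fst (c r)) has_real_derivative e1) (at 0)" "((\<lambda>r. snd (c r)) has_real_derivative e2) (at 0)"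
      unfolding c_def fst_conv snd_conv by (auto intro!: derivative_eq_intros)
    have \<xi>d: "((\<lambda>r. \<xi> (c r)) has_real_derivative e1 * X1 + e2 * X2) (at 0)"
      using has_real_derivative_compose2[where U=UNIV and F=\<xi> and a="\<lambda>r. fst (c r)" and b="\<lambda>r. snd (c r)" and t=0, OF _ cd] \<xi> by (simp add: c0)
    have cc: "isCont c 0" unfolding c_def by (intro continuous_intros)
    have "isCont m (c 0)" using m U c0 by (simp add: continuous_on_eq_continuous_at)
    then have mc: "isCont (\<lambda>r. m (c r)) 0" by (rule isCont_o2[OF cc])
    have "open (c -` U)" unfolding c_def by (intro open_vimage[OF U(1)] continuous_intros)
    then have "\<forall>\<^sub>F r in nhds 0. c r \<in> U" using eventually_nhds_in_open[of "c -` U" 0] U(2) c0 by simp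
    then have "\<forall>\<^sub>F r in nhds 0. F1 (\<xi> (c r), m (c r)) = fst (c r)" "\<forall>\<^sub>F r in nhds 0. F2 (\<xi> (c r), m (c r)) = snd (c r)"
      by (auto elim!: eventually_mono simp: id simp del: split_paired_All)
    note Fd = DERIV_cong_ev[OF refl this(1) refl, THEN iffD2, OF cd(1)] DERIV_cong_ev[OF refl this(2) refl, THEN iffD2, OF cd(2)]
    note impl = implicit_deriv[where A="\<lambda>r. \<xi> (c r)" and m="\<lambda>r. m (c r)" and s=0, OF _ _ \<xi>d mc]
    obtain m' where md: "((\<lambda>r. m (c r)) has_real_derivative m') (at 0)"
      using nz impl[OF _ _ Fd(1)] impl[OF _ _ Fd(2)] F1 F2 c0 by metis
    have "((\<lambda>r. F1 (\<xi> (c r), m (c r))) has_real_derivative (e1 * X1 + e2 * X2) * a1 + m' * a2) (at 0)"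
        "((\<lambda>r. F2 (\<xi> (c r), m (c r))) has_real_derivative (e1 * X1 + e2 * X2) * a3 + m' * a4) (at 0)"
      by (rule has_real_derivative_compose2[where U=UNIV and a="\<lambda>r. \<xi> (c r)" and b="\<lambda>r. m (c r)" and t=0, OF _ \<xi>d md]; use F1 F2 in \<open>simp add: c0\<close>)+
    from DERIV_unique[OF this(1) Fd(1)] DERIV_unique[OF this(2) Fd(2)] show ?thesis by blast
  qed
  \<comment> \<open>In direction (0, 1), X2 = 0 would force m' = 0 by the first equation and
    contradict the second. If a2 = 0, the first equation alone gives a1 X2 = 0 in direction (0, 1)
    and a1 X1 = 1 in direction (1, 0).\<close>
  show "X2 \<noteq> 0" if "a2 \<noteq> 0" using sys[of 0 1] that by auto
  show "X2 = 0 \<and> a1 * X1 = 1" if "a2 = 0" "a4 \<noteq> 0"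
    using sys[of 0 1] sys[of 1 0] that by (auto simp: mult.commute)
qed

lemma smooth_partials:
  fixes F :: "real \<times> real \<Rightarrow> real"
  assumes F: "F differentiable (at p)"
  shows "(F has_derivative (\<lambda>v. fst v * partial1 F p + snd v * partial2 F p)) (at p)"
proof -
  note hd = has_derivative_partials[OF F]
  have "((\<lambda>s. F (s, snd p)) has_real_derivative (1 * frechet_derivative F (at p) (1, 0) + 0 * frechet_derivative F (at p) (0, 1))) (at (fst p))"
    by (rule has_real_derivative_compose2[where U=UNIV]) (use hd in auto)
  then have "partial1 F p = frechet_derivative F (at p) (1, 0)" unfolding partial1_def by (intro DERIV_imp_deriv) simp
  moreover have "((\<lambda>s. F (fst p, s)) has_real_derivative (0 * frechet_derivative F (at p) (1, 0) + 1 * frechet_derivative F (at p) (0, 1))) (at (snd p))"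
    by (rule has_real_derivative_compose2[where U=UNIV]) (use hd in auto)
  then have "partial2 F p = frechet_derivative F (at p) (0, 1)" unfolding partial2_def by (intro DERIV_imp_deriv) simp
  ultimately show ?thesis using hd by simp
qed

lemma smooth_components:
  fixes H :: "real \<times> real \<Rightarrow> real \<times> real"
  assumes V: "open V" "smooth_on H V" and p: "p \<in> V"
  shows "(fst \<circ> H) differentiable (at p)" "(snd \<circ> H) differentiable (at p)"
proof -
  have "H differentiable (at p)" using smooth_on_differentiable[OF V(2) p] at_within_open[OF p V(1)] by simp
  then show "(fst \<circ> H) differentiable (at p)" "(snd \<circ> H) differentiable (at p)"
    using differentiable_chain_at bounded_linear_imp_differentiable bounded_linear_fst bounded_linear_snd by blast+
qed

text \<open>At the right end the input is the second argument of the reconstruction mapping.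
  Exchanging the arguments lets \<open>reconstruction_jacobian\<close>, where the input comes first,
  serve for both ends.\<close>

lemma swap_partials:
  fixes F :: "real \<times> real \<Rightarrow> real"
  assumes "F differentiable (at (y, x))"
  shows "((\<lambda>v. F (snd v, fst v)) has_derivative (\<lambda>v. fst v * partial2 F (y, x) + snd v * partial1 F (y, x))) (at (x, y))"
proof -
  have s: "((\<lambda>v. (snd v, fst v)) has_derivative (\<lambda>v. (snd v, fst v))) (at (x, y :: real))" by (auto intro!: derivative_eq_intros)
  have "((\<lambda>v. F (snd v, fst v)) has_derivative (\<lambda>v. fst (snd v, fst v) * partial1 F (y, x) + snd (snd v, fst v) * partial2 F (y, x))) (at (x, y))"
    by (rule has_derivative_compose[OF s, of F]) (use smooth_partials[OF assms] in simp)
  then show ?thesis by (simp add: add.commute)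
qed

lemma INF_pos_continuous:
  fixes f :: "real \<Rightarrow> real"
  assumes "continuous_on {0..l} f" "\<And>x. x \<in> {0..l} \<Longrightarrow> 0 < f x" "0 \<le> l"
  shows "0 < (INF x\<in>{0..l}. f x)"
proof -
  obtain x0 where x0: "x0 \<in> {0..l}" "\<forall>y\<in>{0..l}. f x0 \<le> f y" using continuous_attains_inf[OF compact_Icc _ assms(1)] assms(3) by auto
  have "f x0 \<le> (INF x\<in>{0..l}. f x)" by (rule cINF_greatest) (use x0 in auto)
  then show ?thesis using assms(2)[OF x0(1)] by linarith
qed

section \<open>The maximal solution\<close>

context problem
begin

text \<open>Solutions with different life spans agree where they overlap. So the value at time t may
  be taken from any solution that lives beyond t, and the supremum of the existence times is itself
  one.\<close>

lemma BA_exists_maximal: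
  assumes zin: "chain l (Suc m) cz" and kin: "chain l (Suc (Suc m)) ck"
    and \<delta>0: "0 < \<delta>0" "\<And>x. x \<in> {0..l} \<Longrightarrow> \<delta>0 \<le> hs (cz 0) x"
    and tr: "(cz 0 0, ck 0 0) \<in> U" "(cz 0 l, ck 0 l) \<in> U"
    and bc: "\<xi>0 (cz 0 0, ck 0 0) = \<gamma>0 0" "\<xi>l (cz 0 l, ck 0 l) = \<gamma>l 0"
    and comp0: "N0 \<longrightarrow> ck 1 0 = - B0.g1 0 / B0.xz (cz 0 0, ck 0 0)"
    and compl: "Nl \<longrightarrow> ck 1 l = - Bl.g1 0 / Bl.xz (cz 0 l, ck 0 l)"
  shows "\<exists>Tstar::ereal. 0 < Tstar \<and>
    (\<exists>z q. BA_on (Suc m) (cz 0) (ck 0) (time_interval Tstar) z q \<and>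
       (\<forall>T' z' q'. 0 < T' \<and> BA_on (Suc m) (cz 0) (ck 0) (time_interval T') z' q' \<longrightarrow>
          T' \<le> Tstar \<and> (\<forall>t\<in>time_interval T'. \<forall>x\<in>{0..l}. z' t x = z t x \<and> q' t x = q t x)) \<and>
       (\<forall>t. 0 < t \<and> ereal t < Tstar \<longrightarrow> (INF x\<in>{0..l}. h0 - b x + z t x) > 0))"
proof -
  let ?BA = "\<lambda>T. BA_on (Suc m) (cz 0) (ck 0) (time_interval T)"
  have h0: "0 < hs (cz 0) x" if "x \<in> {0..l}" for x using \<delta>0(1) \<delta>0(2)[OF that] by linarith
  have sub: "{0..t} \<subseteq> time_interval T" if "t \<in> time_interval T" for t T
    using that unfolding time_interval_def by (auto intro: le_less_trans[of "ereal _" "ereal t"])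
  have uniq: "z' t x = z t x \<and> q' t x = q t x"
    if "?BA T z q" "?BA T' z' q'" "t \<in> time_interval T" "t \<in> time_interval T'" "x \<in> {0..l}" for T T' z q z' q' t x
    using BA_on_unique[OF that(1,2) sub[OF that(3)] sub[OF that(4)] _ h0 that(5)] that(3) unfolding time_interval_def by simp
  obtain T0 z0 q0 where T0: "0 < T0" and BA0: "BA_on (Suc m) (cz 0) (ck 0) {0..T0} z0 q0"
    by (rule BA_on_local_existence[OF zin kin \<delta>0 tr bc comp0 compl])
  have chart0: "chart l {0..T0} u (time_interval (ereal T0)) u {..<T0}" for u
    unfolding chart_def time_interval_def by auto
  \<comment> \<open>Local existence gives a closed interval, whereas solutions are defined on
    half-open ones; locality of the notion of solution bridges the two.\<close>
  have BA0': "?BA (ereal T0) z0 q0"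
  proof (rule BA_on_local)
    show "z0 0 x = cz 0 x \<and> q0 0 x = ck 0 x" if "x \<in> {0..l}" for x using BA0 that unfolding BA_on_def by blast
    show "\<exists>J z q W. chart l J z (time_interval (ereal T0)) z0 W \<and> chart l J q (time_interval (ereal T0)) q0 W \<and> t \<in> W \<and> BA_on (Suc m) (cz 0) (ck 0) J z q"
      if "t \<in> time_interval (ereal T0)" for t
      using chart0 BA0 that unfolding time_interval_def by (intro exI[of _ "{0..T0}"] exI[of _ "{..<T0}"]) auto
  qed
  define Ts where "Ts = Sup {T. 0 < T \<and> (\<exists>z q. ?BA T z q)}"
  have upper: "T \<le> Ts" if "0 < T" "?BA T z q" for T z q unfolding Ts_def by (rule Sup_upper) (use that in blast)
  have "0 < ereal T0" using T0 by simp
  then have Ts0: "0 < Ts" using upper[OF _ BA0'] by (meson less_le_trans)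
  have "\<forall>t\<in>time_interval Ts. \<exists>T z q. ereal t < T \<and> 0 < T \<and> ?BA T z q"
    unfolding Ts_def time_interval_def by (auto simp: less_Sup_iff)
  then obtain Tf zf qf where f: "\<And>t. t \<in> time_interval Ts \<Longrightarrow> ereal t < Tf t \<and> 0 < Tf t \<and> ?BA (Tf t) (zf t) (qf t)" by metis
  \<comment> \<open>The diagonal: at each t the solution \<open>zf t\<close> chosen for this t is
    evaluated at t itself. \<open>agree\<close> shows that the result does not depend on the
    choice.\<close>
  define z where "z t = zf t t" for t
  define q where "q t = qf t t" for t
  have in_Tf: "t \<in> time_interval (Tf t)" if "t \<in> time_interval Ts" for t using f[OF that] that unfolding time_interval_def by auto
  have agree: "z' t x = z t x \<and> q' t x = q t x" if "?BA T' z' q'" "t \<in> time_interval T'" "t \<in> time_interval Ts" "x \<in> {0..l}" for T' z' q' t x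
    unfolding z_def q_def using uniq[OF _ that(1) in_Tf[OF that(3)] that(2,4)] f[OF that(3)] by blast
  have BAs: "?BA Ts z q"
  proof (rule BA_on_local)
    have "0 \<in> time_interval Ts" using Ts0 unfolding time_interval_def by (simp add: zero_ereal_def)
    then show "z 0 x = cz 0 x \<and> q 0 x = ck 0 x" if "x \<in> {0..l}" for x
      using f[of 0] that unfolding z_def q_def BA_on_def by blast
    fix t assume t: "t \<in> time_interval Ts"
    note ft = f[OF t]
    \<comment> \<open>A time beyond t within the life span of the solution chosen for t. On the open
      set of times below r the glued pair coincides with that solution.\<close>
    obtain r where r: "ereal t < ereal r" "ereal r < Tf t" using ft ereal_dense2 by blast
    have le: "Tf t \<le> Ts" using ft upper by blast
    have tiW: "s \<in> time_interval (Tf t)" "s \<in> time_interval Ts" if "0 \<le> s" "s < r" for s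
    proof -
      have "ereal s < Tf t" using that r(2) by (meson ereal_less(3) less_ereal.simps(1) less_trans)
      then show "s \<in> time_interval (Tf t)" "s \<in> time_interval Ts" using that le unfolding time_interval_def by auto
    qed
    have W: "time_interval (Tf t) \<inter> {..<r} = time_interval Ts \<inter> {..<r}" using tiW unfolding time_interval_def by auto
    have nn: "0 \<le> s" if "s \<in> time_interval T" for s T using that unfolding time_interval_def by simp
    have "chart l (time_interval (Tf t)) (zf t) (time_interval Ts) z {..<r}" "chart l (time_interval (Tf t)) (qf t) (time_interval Ts) q {..<r}"
      unfolding chart_def using W agree[of "Tf t" "zf t" "qf t"] ft tiW nn by (auto simp del: atLeastAtMost_iff)
    then show "\<exists>J z' q' W. chart l J z' (time_interval Ts) z W \<and> chart l J q' (time_interval Ts) q W \<and> t \<in> W \<and> BA_on (Suc m) (cz 0) (ck 0) J z' q'"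
      using ft r(1) by (metis lessThan_iff less_ereal.simps(1))
  qed
  have pos: "0 < (INF x\<in>{0..l}. h0 - b x + z t x)" if t: "0 < t" "ereal t < Ts" for t
  proof -
    interpret E: evolution l h0 g b \<phi>1 \<pi>1 \<phi>2 \<pi>2 N0 Nl U \<xi>0 \<gamma>0 \<xi>l \<gamma>l t by unfold_locales (use t l_pos in auto)
    have "t \<in> time_interval Ts" using t unfolding time_interval_def by simp
    from sub[OF this] obtain w where w: "E.base_solution z w q" using BA_on_base[OF BAs t(1) _ h0] by blast
    have tt: "t \<in> {0..t}" using t by simp
    have eq: "h0 - b x + z t x = hs (z t) x" for x unfolding hs_def by simp
    show ?thesis unfolding eq
      by (rule INF_pos_continuous[OF E.base_solution_slices(1)[OF w tt]]) (use w t l_pos in \<open>auto simp: E.base_solution_def\<close>)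
  qed
  show ?thesis
  proof (rule exI[of _ Ts], intro conjI Ts0, rule exI[of _ z], rule exI[of _ q], intro conjI BAs allI impI)
    fix T' z' q' assume a: "0 < T' \<and> ?BA T' z' q'"
    then show "T' \<le> Ts" using upper by blast
    then have "time_interval T' \<subseteq> time_interval Ts" unfolding time_interval_def by auto
    then show "\<forall>t\<in>time_interval T'. \<forall>x\<in>{0..l}. z' t x = z t x \<and> q' t x = q t x" using agree a by blast
  qed (use pos in blast)
qed

end

theorem theorem3p8:
  fixes l h0 g :: real
    and b :: "real \<Rightarrow> real"
    and U V0 Vl :: "(real \<times> real) set"
    and \<xi>0p \<xi>0m \<xi>lp \<xi>lm :: "real \<times> real \<Rightarrow> real"
    and H0 Hl :: "real \<times> real \<Rightarrow> real \<times> real"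
    and g0 gl :: "real \<Rightarrow> real"
    and n :: nat
    and \<zeta>in qin :: "real \<Rightarrow> real"
  assumes "l > 0" and "h0 > 0" and "g > 0"
    and "smooth_on b {0..l}"
    and "(INF x\<in>{0<..<l}. h0 - b x) > 0"
    and "(INF x\<in>{0<..<l}. 1 + 1/4 * (deriv b x)\<^sup>2 + 1/6 * (h0 - b x) * deriv (deriv b) x) > 0"
    and "open U" and "connected U" and "(0, 0) \<in> U"
    and "smooth_on \<xi>0p U" and "smooth_on \<xi>lm U"
    and "continuous_on U \<xi>0m" and "continuous_on U \<xi>lp"
    and "open V0" and "(\<lambda>p. (\<xi>0p p, \<xi>0m p)) ` U \<subseteq> V0"
    and "open Vl" and "(\<lambda>p. (\<xi>lp p, \<xi>lm p)) ` U \<subseteq> Vl"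
    and "smooth_on H0 V0" and "smooth_on Hl Vl"
    and "\<forall>p\<in>U. H0 (\<xi>0p p, \<xi>0m p) = p"
    and "\<forall>p\<in>U. Hl (\<xi>lp p, \<xi>lm p) = p"
    and A1: "((\<forall>p\<in>V0. partial2 (fst \<circ> H0) p = 0) \<and> (\<forall>p\<in>V0. partial2 (snd \<circ> H0) p \<noteq> 0))
             \<or> (\<forall>p\<in>V0. partial2 (fst \<circ> H0) p \<noteq> 0)"
    and A2: "((\<forall>p\<in>Vl. partial1 (fst \<circ> Hl) p = 0) \<and> (\<forall>p\<in>Vl. partial1 (snd \<circ> Hl) p \<noteq> 0))
             \<or> (\<forall>p\<in>Vl. partial1 (fst \<circ> Hl) p \<noteq> 0)"
    and A3: "(\<exists>p\<in>V0. partial1 (fst \<circ> H0) p = 0) \<longrightarrow> (\<exists>\<phi>. \<forall>(z, q)\<in>U. \<xi>0p (z, q) = \<phi> q)"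
    and A4: "(\<exists>p\<in>Vl. partial2 (fst \<circ> Hl) p = 0) \<longrightarrow> (\<exists>\<phi>. \<forall>(z, q)\<in>U. \<xi>lm (z, q) = \<phi> q)"
    and "smooth_on g0 {0..}" and "smooth_on gl {0..}"
    and "n \<noteq> 0"
    and "\<zeta>in \<in> sobolev_cont n l" and "qin \<in> sobolev_cont (n + 1) l"
    and "(INF x\<in>{0..l}. h0 - b x + \<zeta>in x) > 0"
    and "(\<zeta>in 0, qin 0) \<in> U" and "(\<zeta>in l, qin l) \<in> U"
    and "\<xi>0p (\<zeta>in 0, qin 0) = g0 0" and "\<xi>lm (\<zeta>in l, qin l) = gl 0"
    and "(\<forall>p\<in>V0. partial2 (fst \<circ> H0) p = 0) \<longrightarrow>
         0 = - vector_derivative qin (at 0 within {0..l})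
             - partial1 (fst \<circ> H0) (g0 0, \<xi>0m (\<zeta>in 0, qin 0))
               * vector_derivative g0 (at 0 within {0..})"
    and "(\<forall>p\<in>Vl. partial1 (fst \<circ> Hl) p = 0) \<longrightarrow>
         0 = - vector_derivative qin (at l within {0..l})
             - partial2 (fst \<circ> Hl) (\<xi>lp (\<zeta>in l, qin l), gl 0)
               * vector_derivative gl (at 0 within {0..})"
  shows "\<exists>Tstar::ereal. 0 < Tstar \<and>
    (\<exists>\<zeta> q. BA_solution n l h0 g b U \<xi>0p \<xi>lm g0 gl \<zeta>in qin Tstar \<zeta> q \<and>
       (\<forall>T' \<zeta>' q'. 0 < T' \<and> BA_solution n l h0 g b U \<xi>0p \<xi>lm g0 gl \<zeta>in qin T' \<zeta>' q' \<longrightarrow>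
          T' \<le> Tstar \<and>
          (\<forall>t\<in>time_interval T'. \<forall>x\<in>{0..l}. \<zeta>' t x = \<zeta> t x \<and> q' t x = q t x)) \<and>
       (\<forall>t. 0 < t \<and> ereal t < Tstar \<longrightarrow> (INF x\<in>{0..l}. h0 - b x + \<zeta> t x) > 0))"
proof -
  \<comment> \<open>By (A1) and (A2), if a flag fails, the partial derivative in question vanishes
    nowhere. The flags decide which quantity each boundary condition prescribes, and they are also
    the premises of the two additional compatibility conditions.\<close>
  define Nf where "Nf \<longleftrightarrow> (\<forall>p\<in>V0. partial2 (fst \<circ> H0) p = 0)"
  define Nr where "Nr \<longleftrightarrow> (\<forall>p\<in>Vl. partial1 (fst \<circ> Hl) p = 0)"
  note A = assms
  have V0: "(\<xi>0p p, \<xi>0m p) \<in> V0" and Vl: "(\<xi>lp p, \<xi>lm p) \<in> Vl" if "p \<in> U" for p using A(15,17) that by auto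
  have k0: "if Nf then partial2 (fst \<circ> H0) P = 0 \<and> partial2 (snd \<circ> H0) P \<noteq> 0 else partial2 (fst \<circ> H0) P \<noteq> 0" if "P \<in> V0" for P
    using A1 that unfolding Nf_def by auto
  have kl: "if Nr then partial1 (fst \<circ> Hl) P = 0 \<and> partial1 (snd \<circ> Hl) P \<noteq> 0 else partial1 (fst \<circ> Hl) P \<noteq> 0" if "P \<in> Vl" for P
    using A2 that unfolding Nr_def by auto
  have \<xi>d: "(\<xi> has_derivative (\<lambda>v. fst v * frechet_derivative \<xi> (at p within U) (1, 0) + snd v * frechet_derivative \<xi> (at p within U) (0, 1))) (at p)"
    if "smooth_on \<xi> U" "p \<in> U" for \<xi> :: "real \<times> real \<Rightarrow> real" and p
    using has_derivative_partials[OF smooth_on_differentiable[OF that]] unfolding at_within_open[OF that(2) A(7)] .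
  have J0: "if Nf then frechet_derivative \<xi>0p (at p within U) (0, 1) = 0 \<and>
        partial1 (fst \<circ> H0) (\<xi>0p p, \<xi>0m p) * frechet_derivative \<xi>0p (at p within U) (1, 0) = 1
      else frechet_derivative \<xi>0p (at p within U) (0, 1) \<noteq> 0" if p: "p \<in> U" for p
  proof -
    note c = smooth_components[OF A(14,18) V0[OF p]]
    have id: "(fst \<circ> H0) (\<xi>0p p, \<xi>0m p) = fst p \<and> (snd \<circ> H0) (\<xi>0p p, \<xi>0m p) = snd p" if "p \<in> U" for p using A(20) that by simp
    note J = reconstruction_jacobian[OF A(7) p \<xi>d[OF A(10) p] A(12) smooth_partials[OF c(1)] smooth_partials[OF c(2)] id]
    show ?thesis using k0[OF V0[OF p]] J by (simp split: if_splits)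
  qed
  have Jl: "if Nr then frechet_derivative \<xi>lm (at p within U) (0, 1) = 0 \<and>
        partial2 (fst \<circ> Hl) (\<xi>lp p, \<xi>lm p) * frechet_derivative \<xi>lm (at p within U) (1, 0) = 1
      else frechet_derivative \<xi>lm (at p within U) (0, 1) \<noteq> 0" if p: "p \<in> U" for p
  proof -
    note c = smooth_components[OF A(16,19) Vl[OF p]]
    \<comment> \<open>The arguments are exchanged twice so that the input \<open>\<xi>lm\<close>
      comes first, in the form that \<open>swap_partials\<close> provides.\<close>
    have id: "(fst \<circ> Hl) (snd (\<xi>lm p, \<xi>lp p), fst (\<xi>lm p, \<xi>lp p)) = fst p \<and> (snd \<circ> Hl) (snd (\<xi>lm p, \<xi>lp p), fst (\<xi>lm p, \<xi>lp p)) = snd p" if "p \<in> U" for p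
      using A(21) that by simp
    note J = reconstruction_jacobian[OF A(7) p \<xi>d[OF A(11) p] A(13) swap_partials[OF c(1)] swap_partials[OF c(2)] id]
    show ?thesis using kl[OF Vl[OF p]] J by (simp split: if_splits)
  qed
  interpret B0: boundary U \<xi>0p g0 Nf
  proof unfold_locales
    show "if Nf then frechet_derivative \<xi>0p (at p within U) (0, 1) = 0 \<and> frechet_derivative \<xi>0p (at p within U) (1, 0) \<noteq> 0
      else frechet_derivative \<xi>0p (at p within U) (0, 1) \<noteq> 0" if "p \<in> U" for p using J0[OF that] by (auto split: if_splits)
  qed (rule A)+
  interpret Bl: boundary U \<xi>lm gl Nr
  proof unfold_locales
    show "if Nr then frechet_derivative \<xi>lm (at p within U) (0, 1) = 0 \<and> frechet_derivative \<xi>lm (at p within U) (1, 0) \<noteq> 0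
      else frechet_derivative \<xi>lm (at p within U) (0, 1) \<noteq> 0" if "p \<in> U" for p using Jl[OF that] by (auto split: if_splits)
  qed (rule A)+
  interpret bt: bathymetry l h0 g b by unfold_locales (rule A)+
  obtain \<phi>1 \<pi>1 where f1: "bt.fundamental \<phi>1 \<pi>1" "\<phi>1 0 = 1" "\<pi>1 0 = 0" using bt.fundamental_exists by blast
  obtain \<phi>2 \<pi>2 where f2: "bt.fundamental \<phi>2 \<pi>2" "\<phi>2 0 = 0" "\<pi>2 0 = 1" using bt.fundamental_exists by blast
  interpret P: problem l h0 g b \<phi>1 \<pi>1 \<phi>2 \<pi>2 Nf Nr U \<xi>0p g0 \<xi>lm gl
    by unfold_locales (rule f1 f2)+
  obtain m where n: "n = Suc m" using \<open>n \<noteq> 0\<close> not0_implies_Suc by blast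
  obtain cz where cz: "chain l (Suc m) cz" "cz 0 = \<zeta>in" using sobolev_cont_chain[OF _ A(1)] \<open>\<zeta>in \<in> sobolev_cont n l\<close> n by metis
  obtain ck where ck: "chain l (Suc (Suc m)) ck" "ck 0 = qin" using sobolev_cont_chain[OF _ A(1)] \<open>qin \<in> sobolev_cont (n + 1) l\<close> n by (metis Suc_eq_plus1)
  have pz: "primitive l \<zeta>in (cz 1)" and pk: "primitive l qin (ck 1)" "primitive l (ck 1) (ck 2)"
    using cz ck unfolding chain_def numeral_2_eq_2 by force+
  define \<delta>0 where "\<delta>0 = (INF x\<in>{0..l}. h0 - b x + \<zeta>in x)"
  have d0: "0 < \<delta>0" unfolding \<delta>0_def by (rule A(31))
  have d1: "\<delta>0 \<le> P.hs (cz 0) x" if x: "x \<in> {0..l}" for x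
  proof -
    have "continuous_on {0..l} (\<lambda>x. h0 - b x + \<zeta>in x)"
      by (intro continuous_intros primitive_continuous[OF pz] bt.St_continuous[OF bt.St_b(1)])
    then have "bdd_below ((\<lambda>x. h0 - b x + \<zeta>in x) ` {0..l})"
      by (intro bounded_imp_bdd_below compact_imp_bounded compact_continuous_image compact_Icc)
    from cINF_lower[OF this x] show ?thesis unfolding \<delta>0_def P.hs_def cz(2) by simp
  qed
  have nb: "at x within {0..l} \<noteq> bot" if "x \<in> {0..l}" for x using that A(1) by (simp add: trivial_limit_within islimpt_Icc)
  have vq: "vector_derivative qin (at x within {0..l}) = ck 1 x" if x: "x \<in> {0..l}" for x
    using primitive_has_derivative[OF pk(1) primitive_continuous[OF pk(2)] x]
    unfolding has_real_derivative_iff_has_vector_derivative by (rule vector_derivative_within[OF nb[OF x]])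
  have vg: "vector_derivative \<gamma> (at 0 within {0..}) = frechet_derivative \<gamma> (at 0 within {0..}) 1" if "smooth_on \<gamma> {0..}" for \<gamma> :: "real \<Rightarrow> real"
  proof (rule vector_derivative_within)
    have "(0::real) islimpt {0..}" using islimpt_subset[of "0::real" "{0..1}" "{0..}"] islimpt_Icc[of 0 1 "0::real"] by auto
    then show "at (0::real) within {0..} \<noteq> bot" by (simp add: trivial_limit_within)
    show "(\<gamma> has_vector_derivative frechet_derivative \<gamma> (at 0 within {0..}) 1) (at 0 within {0..})"
      using has_real_derivative_frechet[OF smooth_on_differentiable[OF that]] unfolding has_real_derivative_iff_has_vector_derivative by simp
  qed
  have inv: "- G / X = - (a * G)" if "a * X = 1" for a X G :: real
  proof -
    have "X \<noteq> 0" using that by auto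
    then have "a = 1 / X" using that by (simp add: field_simps)
    then show ?thesis by simp
  qed
  \<comment> \<open>As \<partial>1 of the first component of \<open>H0\<close> times the
    \<zeta>-derivative of the input is 1, the compatibility condition on the derivative of
    \<open>qin\<close> is the constant of integration that \<open>boundary_rate\<close> asks for at
    time 0.\<close>
  have c0: "Nf \<longrightarrow> ck 1 0 = - B0.g1 0 / B0.xz (cz 0 0, ck 0 0)"
  proof
    assume N: Nf
    have "0 = - ck 1 0 - partial1 (fst \<circ> H0) (g0 0, \<xi>0m (\<zeta>in 0, qin 0)) * B0.g1 0"
      using A(36) N vq[OF P.ends(1)] vg[OF A(26)] unfolding Nf_def B0.g1_def by simp
    moreover have "partial1 (fst \<circ> H0) (g0 0, \<xi>0m (\<zeta>in 0, qin 0)) * B0.xz (\<zeta>in 0, qin 0) = 1"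
      using J0[OF A(32)] N A(34) unfolding B0.xz_def by simp
    ultimately show "ck 1 0 = - B0.g1 0 / B0.xz (cz 0 0, ck 0 0)" unfolding cz(2) ck(2) using inv by simp
  qed
  have cl: "Nr \<longrightarrow> ck 1 l = - Bl.g1 0 / Bl.xz (cz 0 l, ck 0 l)"
  proof
    assume N: Nr
    have "0 = - ck 1 l - partial2 (fst \<circ> Hl) (\<xi>lp (\<zeta>in l, qin l), gl 0) * Bl.g1 0"
      using A(37) N vq[OF P.ends(2)] vg[OF A(27)] unfolding Nr_def Bl.g1_def by simp
    moreover have "partial2 (fst \<circ> Hl) (\<xi>lp (\<zeta>in l, qin l), gl 0) * Bl.xz (\<zeta>in l, qin l) = 1"
      using Jl[OF A(33)] N A(35) unfolding Bl.xz_def by simp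
    ultimately show "ck 1 l = - Bl.g1 0 / Bl.xz (cz 0 l, ck 0 l)" unfolding cz(2) ck(2) using inv by simp
  qed
  have tr: "(cz 0 0, ck 0 0) \<in> U" "(cz 0 l, ck 0 l) \<in> U" and bc: "\<xi>0p (cz 0 0, ck 0 0) = g0 0" "\<xi>lm (cz 0 l, ck 0 l) = gl 0"
    unfolding cz(2) ck(2) by (rule A)+
  show ?thesis
    using P.BA_exists_maximal[OF cz(1) ck(1) d0 d1 tr bc c0 cl] unfolding P.BA_solution_iff n cz(2) ck(2) .
qed

end
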